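(* Let $a(h)=(h-\lambda_1)(h-\lambda_2)(h-\lambda_3)$ and $b(h)=(h-\mu_1)(h-\mu_2)(h-\mu_3)$ be polynomials of degree $3$ in $\mathbb{C}[h]$ such that $\lambda_i-\lambda_j\notin\mathbb{Z}$ and $\mu_i-\mu_j\notin\mathbb{Z}$ for all $i\neq j$. If the generalized Weyl algebras $A(a)$ and $A(b)$ are Morita equivalent, then their associated quantum tori $T_{Q(a)}$ and $T_{Q(b)}$ are isomorphic.
   Context: For $a\in\mathbb{C}[h]$, $A(a)$ denotes the (classical) generalized Weyl algebra: the $\mathbb{C}$-algebra generated over $\mathbb{C}[h]$ by two generators $x,y$ subject to $xh=(h-1)x$, $yh=(h+1)y$, $yx=a(h)$, $xy=a(h-1)$. Morita equivalence is understood as $\mathbb{C}$-linear. For a multiplicatively antisymmetric matrix $Q=(q_{ij})\in M_n(\mathbb{C}^* )$ (that is, $q_{ij}q_{ji}=q_{ii}=1$ for all $i,j$), the quantum torus $T_Q$ is the $\mathbb{C}$-algebra generated by $X_1,\ldots,X_n$ and their inverses $X_1^{-1},\ldots,X_n^{-1}$, with relations $X_iX_j=q_{ij}X_jX_i$. For $a(h)=\prod_{i=1}^n(h-\lambda_i)$, given with an indexing of its roots, $Q(a)=(q_{ij})\in M_n(\mathbb{C}^* )$ is the matrix with $q_{ij}=e^{2i\pi(\lambda_i-\lambda_j)}$. Isomorphisms are isomorphisms of $\mathbb{C}$-algebras. *)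

theory Defs
  imports
    "HOL-Analysis.Finite_Cartesian_Product"
    "HOL-Algebra.QuotRing"
    "HOL-Algebra.Module"
    "HOL-Computational_Algebra.Polynomial"
    "HOL-Library.Poly_Mapping"
    "HOL-Library.Equipollence"
    "HOL-Library.Numeral_Type"
begin

section \<open>Algebras over the complex numbers\<close>

text \<open>
  Associative, unital, not necessarily commutative algebras over the complex numbers, carried by the
  records of \<^theory>\<open>HOL-Algebra.Module\<close>. (The locale \<^locale>\<open>algebra\<close> there is
  restricted to commutative algebras.)
\<close>

locale complex_algebra = ring A for A :: "(complex, 'a) module" (structure) +
  assumes smult_closed: "x \<in> carrier A \<Longrightarrow> c \<odot> x \<in> carrier A"
    and smult_l_distr: "x \<in> carrier A \<Longrightarrow> (c + d) \<odot> x = c \<odot> x \<oplus> d \<odot> x"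
    and smult_r_distr: "x \<in> carrier A \<Longrightarrow> y \<in> carrier A \<Longrightarrow> c \<odot> (x \<oplus> y) = c \<odot> x \<oplus> c \<odot> y"
    and smult_assoc: "x \<in> carrier A \<Longrightarrow> (c * d) \<odot> x = c \<odot> (d \<odot> x)"
    and smult_one: "x \<in> carrier A \<Longrightarrow> 1 \<odot> x = x"
    and smult_mult_left: "x \<in> carrier A \<Longrightarrow> y \<in> carrier A \<Longrightarrow> (c \<odot> x) \<otimes> y = c \<odot> (x \<otimes> y)"
    and smult_mult_right: "x \<in> carrier A \<Longrightarrow> y \<in> carrier A \<Longrightarrow> x \<otimes> (c \<odot> y) = c \<odot> (x \<otimes> y)"

definition algebra_iso :: "(complex, 'a) module \<Rightarrow> (complex, 'b) module \<Rightarrow> ('a \<Rightarrow> 'b) set" where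
  "algebra_iso A B =
     {f \<in> ring_iso A B. \<forall>c. \<forall>x \<in> carrier A. f (c \<odot>\<^bsub>A\<^esub> x) = c \<odot>\<^bsub>B\<^esub> f x}"

definition algebra_isomorphic :: "(complex, 'a) module \<Rightarrow> (complex, 'b) module \<Rightarrow> bool" where
  "algebra_isomorphic A B \<longleftrightarrow> algebra_iso A B \<noteq> {}"


section \<open>Free algebras and presentations\<close>

text \<open>
  Words form a free monoid, written additively because \<^typ>\<open>'w \<Rightarrow>\<^sub>0 complex\<close> carries the
  convolution product when \<^typ>\<open>'w\<close> is an additive monoid. Hence
  \<open>'g word \<Rightarrow>\<^sub>0 complex\<close> is the free (noncommutative) algebra on the generators \<open>'g\<close>.
\<close>

datatype 'g word = Word (letters: "'g list")

instantiation word :: (type) monoid_add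
begin

definition zero_word :: "'a word" where "0 = Word []"
definition plus_word :: "'a word \<Rightarrow> 'a word \<Rightarrow> 'a word"
  where "u + v = Word (letters u @ letters v)"

instance by standard (simp_all add: zero_word_def plus_word_def)

end

type_synonym 'g free_alg = "'g word \<Rightarrow>\<^sub>0 complex"

definition gen :: "'g \<Rightarrow> 'g free_alg" where
  "gen g = Poly_Mapping.single (Word [g]) 1"

definition scalar :: "complex \<Rightarrow> 'g free_alg" where
  "scalar c = Poly_Mapping.single 0 c"

definition eval_poly :: "complex poly \<Rightarrow> 'g free_alg \<Rightarrow> 'g free_alg" where
  "eval_poly p u = (\<Sum>i\<le>degree p. scalar (coeff p i) * u ^ i)"

definition free_algebra :: "(complex, 'g free_alg) module" where
  "free_algebra = \<lparr>carrier = UNIV, monoid.mult = (*), one = 1, zero = 0, add = (+),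
     module.smult = (\<lambda>c f. scalar c * f)\<rparr>"

text \<open>
  The quotient of the free algebra by the two-sided ideal generated by \<open>S\<close>. As in
  \<^const>\<open>rcoset_mult\<close>, the scalar multiple of a coset is the union of the cosets of the
  scalar multiples of its representatives.
\<close>

definition presented_algebra :: "'g free_alg set \<Rightarrow> (complex, 'g free_alg set) module" where
  "presented_algebra S =
     (let I = genideal free_algebra S in
      ring.extend (free_algebra Quot I)
        \<lparr>module.smult = (\<lambda>c X. \<Union>f\<in>X. I +>\<^bsub>free_algebra\<^esub> (c \<odot>\<^bsub>free_algebra\<^esub> f))\<rparr>)"

lemma ring_free_algebra: "ring (free_algebra :: (complex, 'g free_alg) module)"
proof (rule ringI)
  show "abelian_group (free_algebra :: (complex, 'g free_alg) module)"
  proof (rule abelian_groupI)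
    fix x :: "'g free_alg"
    show "\<exists>y\<in>carrier free_algebra. y \<oplus>\<^bsub>free_algebra\<^esub> x = \<zero>\<^bsub>free_algebra\<^esub>"
      by (rule bexI[of _ "- x"]) (simp_all add: free_algebra_def)
  qed (simp_all add: free_algebra_def ac_simps)
  show "Group.monoid (free_algebra :: (complex, 'g free_alg) module)"
    by (rule Group.monoidI) (simp_all add: free_algebra_def mult.assoc)
qed (simp_all add: free_algebra_def algebra_simps)

lemma scalar_commute: "scalar c * f = f * scalar c"
proof (induction f rule: update_induct)
  case const
  then show ?case by simp
next
  case (update f a b)
  have "Poly_Mapping.update a b f = Poly_Mapping.single a b + f"
    using update.hyps
    by (intro poly_mapping_eqI) (auto simp: lookup_update lookup_add lookup_single in_keys_iff when_def)
  moreover have "scalar c * Poly_Mapping.single a b = Poly_Mapping.single a b * scalar c"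
    by (simp add: scalar_def mult_single mult.commute)
  ultimately show ?case using update.IH by (simp add: distrib_left distrib_right)
qed

lemma scalar_mult: "scalar (c * d) = scalar c * scalar d"
  by (simp add: scalar_def mult_single)

lemma scalar_one: "scalar 1 = 1"
  by (simp add: scalar_def)

lemma complex_algebra_presented_algebra: "complex_algebra (presented_algebra S)"
proof -
  define I where "I = genideal free_algebra S"
  interpret F: ring "free_algebra :: (complex, 'a free_alg) module" by (rule ring_free_algebra)
  interpret I: ideal I free_algebra
    unfolding I_def by (rule F.genideal_ideal) (simp add: free_algebra_def)
  interpret Q: ring "free_algebra Quot I" by (rule I.quotient_is_ring)
  let ?P = "presented_algebra S"
  let ?c = "\<lambda>f. I +>\<^bsub>free_algebra\<^esub> f"
  have carr: "x \<in> carrier free_algebra" for x :: "'a free_alg" by (simp add: free_algebra_def)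
  have P: "?P = ring.extend (free_algebra Quot I)
        \<lparr>module.smult = (\<lambda>c X. \<Union>f\<in>X. ?c (c \<odot>\<^bsub>free_algebra\<^esub> f))\<rparr>"
    by (simp add: presented_algebra_def I_def Let_def)
  have fields: "carrier ?P = carrier (free_algebra Quot I)" "monoid.mult ?P = monoid.mult (free_algebra Quot I)"
    "monoid.one ?P = monoid.one (free_algebra Quot I)" "ring.zero ?P = ring.zero (free_algebra Quot I)"
    "ring.add ?P = ring.add (free_algebra Quot I)"
    "\<And>c X. c \<odot>\<^bsub>?P\<^esub> X = (\<Union>f\<in>X. ?c (c \<odot>\<^bsub>free_algebra\<^esub> f))"
    by (simp_all add: P ring.extend_def)
  have c_carr: "?c f \<in> carrier ?P" for f
    unfolding fields by (auto simp: FactRing_def A_RCOSETS_def' free_algebra_def)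
  have c_ex: "\<exists>f. X = ?c f" if "X \<in> carrier ?P" for X
    using that unfolding fields by (auto simp: FactRing_def A_RCOSETS_def')
  have c_add: "?c f \<oplus>\<^bsub>?P\<^esub> ?c g = ?c (f + g)" for f g
    unfolding fields using I.a_rcos_sum[OF carr carr] by (simp add: FactRing_def free_algebra_def)
  have c_mult: "?c f \<otimes>\<^bsub>?P\<^esub> ?c g = ?c (f * g)" for f g
    unfolding fields using I.rcoset_mult_add[OF carr carr] by (simp add: FactRing_def free_algebra_def)
  have c_smult: "c \<odot>\<^bsub>?P\<^esub> ?c f = ?c (scalar c * f)" for c f
  proof -
    have coset: "?c (c \<odot>\<^bsub>free_algebra\<^esub> g) = ?c (scalar c * f)" if "g \<in> ?c f" for g
    proof -
      from that obtain h where h: "h \<in> I" "g = h + f"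
        by (auto simp: a_r_coset_def' free_algebra_def)
      have "scalar c * h \<in> I"
        using I.I_l_closed[OF h(1) carr, of "scalar c"] by (simp add: free_algebra_def)
      hence "scalar c * g \<in> ?c (scalar c * f)"
        by (auto simp: a_r_coset_def' free_algebra_def h(2) distrib_left)
      hence "?c (scalar c * f) = ?c (scalar c * g)"
        using F.a_repr_independence[OF _ carr I.a_subgroup] by blast
      thus ?thesis by (simp add: free_algebra_def)
    qed
    have "c \<odot>\<^bsub>?P\<^esub> ?c f = (\<Union>g\<in>?c f. ?c (scalar c * f))"
      unfolding fields using coset by (rule SUP_cong[OF refl])
    also have "\<dots> = ?c (scalar c * f)"
      using I.a_rcos_self[OF carr] by blast
    finally show ?thesis .
  qed
  have "ring ?P"
  proof (rule ringI)
    show "abelian_group ?P"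
    proof (rule abelian_groupI)
      fix X assume "X \<in> carrier ?P"
      then show "\<exists>Y\<in>carrier ?P. Y \<oplus>\<^bsub>?P\<^esub> X = \<zero>\<^bsub>?P\<^esub>"
        unfolding fields using Q.l_neg Q.a_inv_closed by blast
    qed (simp_all only: fields Q.zero_closed Q.a_closed Q.a_ac Q.l_zero Q.r_zero)
    show "Group.monoid ?P"
      by (rule Group.monoidI)
        (simp_all only: fields Q.m_closed Q.one_closed Q.m_assoc Q.l_one Q.r_one)
  qed (simp_all only: fields Q.l_distr Q.r_distr)
  show ?thesis
  proof (rule complex_algebra.intro[OF \<open>ring ?P\<close>], unfold_locales)
    fix X Y c d
    assume "X \<in> carrier ?P"
    then obtain f where X: "X = ?c f" using c_ex by blast
    show "c \<odot>\<^bsub>?P\<^esub> X \<in> carrier ?P" by (simp only: X c_smult c_carr)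
    show "(c + d) \<odot>\<^bsub>?P\<^esub> X = c \<odot>\<^bsub>?P\<^esub> X \<oplus>\<^bsub>?P\<^esub> d \<odot>\<^bsub>?P\<^esub> X"
      by (simp only: X c_smult c_add scalar_def single_add distrib_right)
    show "(c * d) \<odot>\<^bsub>?P\<^esub> X = c \<odot>\<^bsub>?P\<^esub> (d \<odot>\<^bsub>?P\<^esub> X)"
      by (simp only: X c_smult scalar_mult mult.assoc)
    show "1 \<odot>\<^bsub>?P\<^esub> X = X"
      by (simp only: X c_smult scalar_one mult_1_left)
    assume "Y \<in> carrier ?P"
    then obtain g where Y: "Y = ?c g" using c_ex by blast
    show "c \<odot>\<^bsub>?P\<^esub> (X \<oplus>\<^bsub>?P\<^esub> Y) = c \<odot>\<^bsub>?P\<^esub> X \<oplus>\<^bsub>?P\<^esub> c \<odot>\<^bsub>?P\<^esub> Y"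
      by (simp only: X Y c_smult c_add distrib_left)
    show "(c \<odot>\<^bsub>?P\<^esub> X) \<otimes>\<^bsub>?P\<^esub> Y = c \<odot>\<^bsub>?P\<^esub> (X \<otimes>\<^bsub>?P\<^esub> Y)"
      by (simp only: X Y c_smult c_mult mult.assoc)
    have "f * (scalar c * g) = scalar c * (f * g)"
      by (metis mult.assoc scalar_commute)
    then show "X \<otimes>\<^bsub>?P\<^esub> (c \<odot>\<^bsub>?P\<^esub> Y) = c \<odot>\<^bsub>?P\<^esub> (X \<otimes>\<^bsub>?P\<^esub> Y)"
      by (simp only: X Y c_smult c_mult)
  qed
qed


section \<open>Generalized Weyl algebras and quantum tori\<close>

datatype gwa_gen = gen_h | gen_x | gen_y

definition gwa :: "complex poly \<Rightarrow> (complex, gwa_gen free_alg set) module" where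
  "gwa a =
     (let h = gen gen_h; x = gen gen_x; y = gen gen_y in
      presented_algebra
        {x * h - (h - 1) * x,
         y * h - (h + 1) * y,
         y * x - eval_poly a h,
         x * y - eval_poly a (h - 1)})"

datatype 'n torus_gen = TX 'n | TX_inv 'n  \<comment> \<open>the generators \<open>X\<^sub>i\<close> and their inverses\<close>

definition quantum_torus ::
    "complex ^ 'n ^ 'n \<Rightarrow> (complex, 'n::finite torus_gen free_alg set) module" where
  "quantum_torus Q = presented_algebra
     ((\<Union>i. {gen (TX i) * gen (TX_inv i) - 1, gen (TX_inv i) * gen (TX i) - 1}) \<union>
      (\<Union>i. \<Union>j. {gen (TX i) * gen (TX j) - scalar (Q $ i $ j) * gen (TX j) * gen (TX i)}))"

definition root_matrix :: "complex ^ 'n \<Rightarrow> complex ^ 'n ^ 'n" where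
  "root_matrix l = (\<chi> i j. exp (2 * \<i> * of_real pi * (l $ i - l $ j)))"

lemma root_matrix_antisymmetric:
  "root_matrix l $ i $ i = 1" "root_matrix l $ i $ j * root_matrix l $ j $ i = 1"
  by (simp_all add: root_matrix_def flip: exp_add distrib_left)


section \<open>Linear Morita equivalence\<close>

text \<open>
  Left modules over a not necessarily commutative ring. (The locale \<^locale>\<open>module\<close> requires a
  commutative one.) The fields \<^const>\<open>monoid.mult\<close> and \<^const>\<open>monoid.one\<close> of the module record are unused.
\<close>

locale left_module = A?: ring A + M?: abelian_group M
  for A :: "(complex, 'a) module" (structure) and M :: "('a, 'u) module" (structure) +
  assumes smult_closed: "a \<in> carrier A \<Longrightarrow> x \<in> carrier M \<Longrightarrow> a \<odot>\<^bsub>M\<^esub> x \<in> carrier M"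
    and smult_l_distr: "a \<in> carrier A \<Longrightarrow> b \<in> carrier A \<Longrightarrow> x \<in> carrier M \<Longrightarrow>
      (a \<oplus>\<^bsub>A\<^esub> b) \<odot>\<^bsub>M\<^esub> x = a \<odot>\<^bsub>M\<^esub> x \<oplus>\<^bsub>M\<^esub> b \<odot>\<^bsub>M\<^esub> x"
    and smult_r_distr: "a \<in> carrier A \<Longrightarrow> x \<in> carrier M \<Longrightarrow> y \<in> carrier M \<Longrightarrow>
      a \<odot>\<^bsub>M\<^esub> (x \<oplus>\<^bsub>M\<^esub> y) = a \<odot>\<^bsub>M\<^esub> x \<oplus>\<^bsub>M\<^esub> a \<odot>\<^bsub>M\<^esub> y"
    and smult_assoc: "a \<in> carrier A \<Longrightarrow> b \<in> carrier A \<Longrightarrow> x \<in> carrier M \<Longrightarrow>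
      (a \<otimes>\<^bsub>A\<^esub> b) \<odot>\<^bsub>M\<^esub> x = a \<odot>\<^bsub>M\<^esub> (b \<odot>\<^bsub>M\<^esub> x)"
    and smult_one: "x \<in> carrier M \<Longrightarrow> \<one>\<^bsub>A\<^esub> \<odot>\<^bsub>M\<^esub> x = x"

text \<open>
  Homomorphisms are extensional functions, so that equality of functions is equality of
  homomorphisms; identities and composites are accordingly restricted to the carrier.
\<close>

definition lmod_hom ::
    "(complex, 'a) module \<Rightarrow> ('a, 'u) module \<Rightarrow> ('a, 'u) module \<Rightarrow> ('u \<Rightarrow> 'u) set" where
  "lmod_hom A M N = {f \<in> carrier M \<rightarrow>\<^sub>E carrier N.
     (\<forall>x \<in> carrier M. \<forall>y \<in> carrier M. f (x \<oplus>\<^bsub>M\<^esub> y) = f x \<oplus>\<^bsub>N\<^esub> f y) \<and>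
     (\<forall>a \<in> carrier A. \<forall>x \<in> carrier M. f (a \<odot>\<^bsub>M\<^esub> x) = a \<odot>\<^bsub>N\<^esub> f x)}"

definition lmod_iso ::
    "(complex, 'a) module \<Rightarrow> ('a, 'u) module \<Rightarrow> ('a, 'u) module \<Rightarrow> ('u \<Rightarrow> 'u) set" where
  "lmod_iso A M N = {f \<in> lmod_hom A M N. bij_betw f (carrier M) (carrier N)}"

definition hom_id :: "('a, 'u) module \<Rightarrow> 'u \<Rightarrow> 'u" where
  "hom_id M = (\<lambda>x \<in> carrier M. x)"

definition hom_add ::
    "('a, 'u) module \<Rightarrow> ('a, 'u) module \<Rightarrow> ('u \<Rightarrow> 'u) \<Rightarrow> ('u \<Rightarrow> 'u) \<Rightarrow> 'u \<Rightarrow> 'u" where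
  "hom_add M N f g = (\<lambda>x \<in> carrier M. f x \<oplus>\<^bsub>N\<^esub> g x)"

text \<open>The complex numbers act on a module through the scalars \<open>c \<odot> \<one>\<close> of the algebra.\<close>

definition hom_smult ::
    "(complex, 'a) module \<Rightarrow> ('a, 'u) module \<Rightarrow> ('a, 'u) module \<Rightarrow> complex \<Rightarrow> ('u \<Rightarrow> 'u) \<Rightarrow> 'u \<Rightarrow> 'u"
  where
  "hom_smult A M N c f = (\<lambda>x \<in> carrier M. (c \<odot>\<^bsub>A\<^esub> \<one>\<^bsub>A\<^esub>) \<odot>\<^bsub>N\<^esub> f x)"

text \<open>
  A functor consists of its object map \<open>Fo\<close> and its morphism map \<open>Fm\<close>; the latter also takes the
  domain and the codomain of the morphism, which a HOL function does not determine.
\<close>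

locale linear_functor =
  fixes A :: "(complex, 'a) module" and B :: "(complex, 'b) module"
    and Fo :: "('a, 'u) module \<Rightarrow> ('b, 'u) module"
    and Fm :: "('a, 'u) module \<Rightarrow> ('a, 'u) module \<Rightarrow> ('u \<Rightarrow> 'u) \<Rightarrow> 'u \<Rightarrow> 'u"
  assumes obj: "left_module A M \<Longrightarrow> left_module B (Fo M)"
    and hom: "left_module A M \<Longrightarrow> left_module A N \<Longrightarrow> f \<in> lmod_hom A M N \<Longrightarrow>
      Fm M N f \<in> lmod_hom B (Fo M) (Fo N)"
    and id: "left_module A M \<Longrightarrow> Fm M M (hom_id M) = hom_id (Fo M)"
    and comp: "left_module A L \<Longrightarrow> left_module A M \<Longrightarrow> left_module A N \<Longrightarrow>
      f \<in> lmod_hom A L M \<Longrightarrow> g \<in> lmod_hom A M N \<Longrightarrow>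
      Fm L N (compose (carrier L) g f) = compose (carrier (Fo L)) (Fm M N g) (Fm L M f)"
    and add: "left_module A M \<Longrightarrow> left_module A N \<Longrightarrow>
      f \<in> lmod_hom A M N \<Longrightarrow> g \<in> lmod_hom A M N \<Longrightarrow>
      Fm M N (hom_add M N f g) = hom_add (Fo M) (Fo N) (Fm M N f) (Fm M N g)"
    and smult: "left_module A M \<Longrightarrow> left_module A N \<Longrightarrow> f \<in> lmod_hom A M N \<Longrightarrow>
      Fm M N (hom_smult A M N c f) = hom_smult B (Fo M) (Fo N) c (Fm M N f)"

text \<open>
  A natural isomorphism from an endofunctor \<open>(Eo, Em)\<close> of the category of left \<open>A\<close>-modules to the
  identity functor.
\<close>

definition nat_iso_id ::
    "(complex, 'a) module \<Rightarrow> (('a, 'u) module \<Rightarrow> ('a, 'u) module) \<Rightarrow>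
     (('a, 'u) module \<Rightarrow> ('a, 'u) module \<Rightarrow> ('u \<Rightarrow> 'u) \<Rightarrow> 'u \<Rightarrow> 'u) \<Rightarrow>
     (('a, 'u) module \<Rightarrow> 'u \<Rightarrow> 'u) \<Rightarrow> bool" where
  "nat_iso_id A Eo Em \<eta> \<longleftrightarrow>
     (\<forall>M. left_module A M \<longrightarrow> \<eta> M \<in> lmod_iso A (Eo M) M) \<and>
     (\<forall>M N f. left_module A M \<longrightarrow> left_module A N \<longrightarrow> f \<in> lmod_hom A M N \<longrightarrow>
        compose (carrier (Eo M)) (\<eta> N) (Em M N f) = compose (carrier (Eo M)) f (\<eta> M))"

text \<open>
  \<open>A\<close> and \<open>B\<close> are Morita equivalent: there are complex linear functors between their categories of
  left modules which are inverse to each other up to natural isomorphism. HOL has no category of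
  all modules, so the modules are those with elements in a type \<open>'u\<close>, which plays the role of the
  universe and has to be large enough for the regular modules. Since \<open>'u\<close> is otherwise arbitrary,
  a theorem assuming \<open>morita_equivalent TYPE('u) A B\<close> holds for every such universe.
\<close>

definition morita_equivalent ::
    "'u itself \<Rightarrow> (complex, 'a) module \<Rightarrow> (complex, 'b) module \<Rightarrow> bool" where
  "morita_equivalent _ A B \<longleftrightarrow>
     carrier A \<lesssim> (UNIV :: 'u set) \<and> carrier B \<lesssim> (UNIV :: 'u set) \<and>
     (\<exists>(Fo :: ('a, 'u) module \<Rightarrow> ('b, 'u) module) Fm Go Gm \<eta> \<epsilon>.
        linear_functor A B Fo Fm \<and> linear_functor B A Go Gm \<and>
        nat_iso_id A (\<lambda>M. Go (Fo M)) (\<lambda>M N f. Gm (Fo M) (Fo N) (Fm M N f)) \<eta> \<and>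
        nat_iso_id B (\<lambda>M. Fo (Go M)) (\<lambda>M N f. Fm (Go M) (Go N) (Gm M N f)) \<epsilon>)"

lemma morita_equivalent_refl:
  fixes A :: "(complex, 'a) module"
  assumes "carrier A \<lesssim> (UNIV :: 'u set)"
  shows "morita_equivalent TYPE('u) A A"
proof -
  have "linear_functor A A (\<lambda>M :: ('a, 'u) module. M) (\<lambda>_ _ f. f)"
    by (rule linear_functor.intro) (assumption | rule refl)+
  moreover have "nat_iso_id A (\<lambda>M :: ('a, 'u) module. M) (\<lambda>_ _ f. f) hom_id"
  proof -
    have "bij_betw (\<lambda>x. if x \<in> S then x else undefined) S S" for S :: "'u set"
      by (rule bij_betwI[of _ _ _ "\<lambda>x. x"]) auto
    then have "hom_id M \<in> lmod_iso A M M" if "left_module A M" for M :: "('a, 'u) module"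
    proof -
      interpret left_module A M by (rule that)
      show ?thesis
        using \<open>\<And>S. bij_betw _ S S\<close>
        by (auto simp: hom_id_def lmod_iso_def lmod_hom_def restrict_def smult_closed)
    qed
    then show ?thesis
      by (auto simp: nat_iso_id_def hom_id_def lmod_hom_def compose_def restrict_def fun_eq_iff
          PiE_iff extensional_def)
  qed
  ultimately show ?thesis
    using assms unfolding morita_equivalent_def by blast
qed

end

theory Submission
  imports
    Defs
    "HOL-Analysis.Cartesian_Space"
    "HOL-Computational_Algebra.Fraction_Field"
begin

text \<open>
  Let \<open>L\<close> be the algebra of skew Laurent polynomials over \<open>\<complex>(h)\<close>; \<open>A(a)\<close> embeds into \<open>L\<close> by \<open>y \<mapsto> a x\<^sup>-\<^sup>1\<close>.
  If \<open>P - P(h - 1)\<close> is the component of degree zero of \<open>u \<in> A(a)\<close>, then for \<open>c\<close> with \<open>\<Sum> c\<^sub>i = 0\<close> the number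
  \<open>\<tau>\<^sub>c(u) = \<Sum> c\<^sub>i P(\<lambda>\<^sub>i)\<close> is well defined, \<open>\<tau>\<^sub>c\<close> is a trace on \<open>A(a)\<close>, and every trace is of this form.

  The arithmetic input is that for integral \<open>c\<close> and every idempotent matrix \<open>f\<close> over \<open>A(a)\<close> of rank one,
  \<open>\<tau>\<^sub>c(f) - \<tau>\<^sub>c(1)\<close> is an integer. As \<open>L\<close> is left Euclidean, \<open>f = w d\<close> with a column \<open>w\<close> and a row \<open>d\<close> over \<open>L\<close> such that
  \<open>d w = 1\<close>. In the representation of \<open>L\<close> by banded matrices indexed by \<open>\<int>\<close>, let \<open>\<Pi>\<close> and \<open>\<Pi>\<^sub>N\<close> be the projections to the
  indices \<open>\<ge> 1\<close> and \<open>> N\<close>. For large \<open>N\<close> the finite matrix \<open>\<Pi> f \<Pi> - w \<Pi>\<^sub>N d\<close> is regular at each root and becomes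
  idempotent there, because \<open>A(a)\<close> then preserves the indices \<open>\<ge> 1\<close>; so its trace is an integer, whereas by
  telescoping this trace is \<open>h - P + const\<close>, where \<open>P - P(h - 1)\<close> is the degree zero component of the trace of \<open>f\<close>.

  A Morita equivalence identifies \<open>A(b)\<close> with a full corner of a matrix algebra over \<open>A(a)\<close>. Pulling traces back along it
  gives a linear map between the coefficient spaces \<open>{c. \<Sum> c\<^sub>i = 0}\<close>. Evaluating on the rank one idempotents
  attached to the simple modules \<open>A/(Ax + A(h - \<lambda>\<^sub>i))\<close> one sees that it maps the integral vectors bijectively to the integral
  vectors, and that \<open>\<Sum> c\<^sub>i \<lambda>\<^sub>i\<close> is preserved modulo \<open>\<int>\<close>. Extending it by the identity on one
  coordinate vector gives a matrix in \<open>GL\<^sub>3(\<int>)\<close> that matches the commutation rules of the two quantum tori.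
\<close>

section \<open>Rational functions and their translates\<close>

text \<open>The obstacle is that \<open>w\<close> and \<open>d\<close> may have poles at the roots,
  so that a compression of w d cannot be evaluated factor by factor, although f = w d is polynomial.
  Far out in the index set the translates of \<open>w\<close> and \<open>d\<close> have no poles
  left; this is why a tail beyond N is subtracted. The difference is a finite matrix, and it is
  regular at the roots because both terms are. As h moves by one, its trace changes by the boundary
  terms of a box of indices, and one of these is an entry of d w = 1. That entry is the origin of
  the summand h, and thereby of the comparison with \<tau>_c(1) = \<Sum> c_i \<lambda>_i.

  In exponents, the commutation form of a torus is (u, v) \<mapsto> (u.\<lambda>)(\<Sum> v) -
  (\<Sum> u)(v.\<lambda>). It is zero on vectors of coordinate sum zero, so the lattice on which the
  traces live does not see it. The added coordinate vector has sum one and turns the form into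
  pairings with \<lambda>, which the traces do control modulo \<int>.\<close>

definition pshift :: "int \<Rightarrow> complex poly \<Rightarrow> complex poly" where
  "pshift n p = pcompose p [:of_int n, 1:]"

lemma pshift_add [simp]: "pshift n (p + q) = pshift n p + pshift n q"
  by (simp add: pshift_def pcompose_add)
lemma pshift_diff [simp]: "pshift n (p - q) = pshift n p - pshift n q"
  by (simp add: pshift_def pcompose_diff)
lemma pshift_uminus [simp]: "pshift n (- p) = - pshift n p"
  by (simp add: pshift_def pcompose_uminus)
lemma pshift_mult [simp]: "pshift n (p * q) = pshift n p * pshift n q"
  by (simp add: pshift_def pcompose_mult)
lemma pshift_smult [simp]: "pshift n (smult c p) = smult c (pshift n p)"
  by (simp add: pshift_def pcompose_smult)
lemma pshift_0 [simp]: "pshift n 0 = 0" and pshift_1 [simp]: "pshift n 1 = 1" and pshift_const [simp]: "pshift n [:c:] = [:c:]"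
  by (simp_all add: pshift_def pcompose_1 pcompose_pCons)
lemma poly_pshift [simp]: "poly (pshift n p) z = poly p (z + of_int n)"
  by (simp add: pshift_def poly_pcompose add.commute)
lemma pshift_zero [simp]: "pshift 0 p = p"
  by (simp add: pshift_def)
lemma pshift_pshift [simp]: "pshift m (pshift n p) = pshift (m + n) p"
  by (rule poly_ext) (simp add: algebra_simps)
lemma pshift_eq_0_iff [simp]: "pshift n p = 0 \<longleftrightarrow> p = 0"
  by (metis pshift_pshift pshift_0 pshift_zero add.right_inverse add.left_inverse)
lemma pshift_prod: "pshift n (prod f S) = (\<Prod>i\<in>S. pshift n (f i))"
  by (induction S rule: infinite_finite_induct) auto
lemma pshift_sum: "pshift n (sum f S) = (\<Sum>i\<in>S. pshift n (f i))"
  by (induction S rule: infinite_finite_induct) auto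
lemma pshift_dvd: "p dvd q \<Longrightarrow> pshift n p dvd pshift n q"
  by (auto elim!: dvdE)

text \<open>The rising factorials h (h+1) ... (h+k-1): the backward difference lowers them as
  differentiation lowers powers.\<close>

definition rising :: "nat \<Rightarrow> complex poly" where
  "rising k = (\<Prod>i<k. [:of_nat i, 1:])"

lemma rising_diff: "rising (Suc k) - pshift (-1) (rising (Suc k)) = smult (of_nat (Suc k)) (rising k)"
proof (rule poly_ext)
  fix z :: complex
  have "(\<Prod>i<Suc k. z - 1 + of_nat i) = (z - 1) * (\<Prod>i<k. z + of_nat i)"
    by (subst prod.lessThan_Suc_shift) (simp add: algebra_simps)
  then have "poly (pshift (-1) (rising (Suc k))) z = (z - 1) * (\<Prod>i<k. z + of_nat i)"
    by (simp add: rising_def poly_prod algebra_simps)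
  moreover have "poly (rising (Suc k)) z = (z + of_nat k) * (\<Prod>i<k. z + of_nat i)"
    by (simp add: rising_def poly_prod algebra_simps)
  ultimately show "poly (rising (Suc k) - pshift (-1) (rising (Suc k))) z = poly (smult (of_nat (Suc k)) (rising k)) z"
    by (simp add: rising_def poly_prod algebra_simps)
qed

text \<open>The span is an inductive predicate so that antidifferences can be built by rule
  induction, one summand at a time.\<close>

inductive rising_span :: "complex poly \<Rightarrow> bool" where
  zero: "rising_span 0"
| add: "rising_span p \<Longrightarrow> rising_span (smult c (rising k) + p)"

text \<open>Writing h = (h + k) - k shows that multiplication by h preserves the span; the rest is
  induction over the coefficients.\<close>

lemma rising_span_all: "rising_span p"
proof (induction p)
  case 0 show ?case by (rule rising_span.zero)
next
  case (pCons c p)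
  have 1: "rising_span (pCons 0 q)" if "rising_span q" for q
    using that
  proof induction
    case zero show ?case by (simp add: rising_span.zero)
  next
    case (add p c k)
    have "pCons 0 (rising k) = rising (Suc k) - smult (of_nat k) (rising k)"
      by (simp add: rising_def)
    moreover have "pCons 0 (smult c (rising k) + p) = smult c (pCons 0 (rising k)) + pCons 0 p"
      by simp
    ultimately have "pCons 0 (smult c (rising k) + p) = smult c (rising (Suc k)) + (smult (- c * of_nat k) (rising k) + pCons 0 p)"
      by (simp add: smult_diff_right)
    then show ?case using add.IH by (metis rising_span.add)
  qed
  have "pCons c p = smult c (rising 0) + pCons 0 p"
    by (simp add: rising_def)
  then show ?case using 1[OF pCons.IH] by (auto intro: rising_span.intros)
qed

lemma antidifference_exists: "\<exists>P. P - pshift (-1) P = p"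
  using rising_span_all[of p]
proof induction
  case zero show ?case by (rule exI[of _ 0]) simp
next
  case (add p c k)
  then obtain P where "P - pshift (-1) P = p" by blast
  have "smult (c / of_nat (Suc k)) (rising (Suc k)) - pshift (-1) (smult (c / of_nat (Suc k)) (rising (Suc k)))
      = smult (c / of_nat (Suc k)) (smult (of_nat (Suc k)) (rising k))"
    by (simp only: pshift_smult flip: smult_diff_right rising_diff)
  also have "\<dots> = smult c (rising k)" by (simp del: of_nat_Suc)
  finally show ?case using \<open>P - pshift (-1) P = p\<close>
    by (intro exI[of _ "smult (c / of_nat (Suc k)) (rising (Suc k)) + P"])
       (simp only: pshift_add add_diff_add)
qed

text \<open>The difference of two antidifferences has period one, so it takes a single value at all
  natural numbers and is constant.\<close>

lemma antidifference_unique: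
  assumes "P - pshift (-1) P = Q - pshift (-1) Q"
  shows "\<exists>c. P = Q + [:c:]"
proof -
  define R where "R = P - Q"
  have R: "pshift (-1) R = R" using assms by (simp add: R_def algebra_simps)
  have "poly R (of_nat n) = poly R 0" for n
  proof (induction n)
    case (Suc n)
    have "poly R (of_nat (Suc n)) = poly (pshift (-1) R) (of_nat (Suc n))" using R by simp
    then show ?case using Suc by simp
  qed simp
  then have "of_nat ` UNIV \<subseteq> {z. poly (R - [:poly R 0:]) z = 0}" by auto
  moreover have "infinite (of_nat ` UNIV :: complex set)"
    by (simp add: finite_image_iff inj_of_nat)
  ultimately have "R - [:poly R 0:] = 0"
    using poly_roots_finite finite_subset by blast
  then show ?thesis by (intro exI[of _ "poly R 0"]) (simp add: R_def algebra_simps)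
qed

section \<open>Rational functions: translation, regularity and values\<close>

type_synonym ratfun = "complex poly fract"

definition rshift :: "int \<Rightarrow> ratfun \<Rightarrow> ratfun" where
  "rshift n r = (THE s. \<exists>p q. q \<noteq> 0 \<and> r = Fract p q \<and> s = Fract (pshift n p) (pshift n q))"

lemma rshift_Fract: assumes "q \<noteq> 0" shows "rshift n (Fract p q) = Fract (pshift n p) (pshift n q)"
  unfolding rshift_def
proof (rule the_equality)
  show "\<exists>p' q'. q' \<noteq> 0 \<and> Fract p q = Fract p' q' \<and> Fract (pshift n p) (pshift n q) = Fract (pshift n p') (pshift n q')"
    using assms by blast
  fix s assume "\<exists>p' q'. q' \<noteq> 0 \<and> Fract p q = Fract p' q' \<and> s = Fract (pshift n p') (pshift n q')"
  then obtain p' q' where *: "q' \<noteq> 0" "Fract p q = Fract p' q'" "s = Fract (pshift n p') (pshift n q')" by blast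
  then have "p * q' = p' * q" using assms by (simp add: eq_fract)
  then have "pshift n p * pshift n q' = pshift n p' * pshift n q" by (metis pshift_mult)
  then show "s = Fract (pshift n p) (pshift n q)" using * assms by (simp add: eq_fract)
qed

lemma rshift_add [simp]: "rshift n (r + s) = rshift n r + rshift n s"
  by (cases r; cases s) (simp add: rshift_Fract)
lemma rshift_mult [simp]: "rshift n (r * s) = rshift n r * rshift n s"
  by (cases r; cases s) (simp add: rshift_Fract)
lemma rshift_uminus [simp]: "rshift n (- r) = - rshift n r"
  by (cases r) (simp add: rshift_Fract)
lemma rshift_diff [simp]: "rshift n (r - s) = rshift n r - rshift n s"
  using rshift_add[of n r "- s"] by simp
lemma rshift_0 [simp]: "rshift n 0 = 0" and rshift_1 [simp]: "rshift n 1 = 1"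
  by (simp_all add: rshift_Fract Zero_fract_def One_fract_def)
lemma rshift_rshift [simp]: "rshift m (rshift n r) = rshift (m + n) r"
  by (cases r) (simp add: rshift_Fract)
lemma rshift_zero [simp]: "rshift 0 r = r"
  by (cases r) (simp add: rshift_Fract)
lemma rshift_eq_0_iff [simp]: "rshift n r = 0 \<longleftrightarrow> r = 0"
  by (metis rshift_rshift rshift_0 rshift_zero add.right_inverse add.left_inverse)
lemma rshift_sum: "rshift n (sum f S) = (\<Sum>i\<in>S. rshift n (f i))"
  by (induction S rule: infinite_finite_induct) auto

definition rat_of :: "complex poly \<Rightarrow> ratfun" where "rat_of p = Fract p 1"

lemma rat_of_add [simp]: "rat_of (p + q) = rat_of p + rat_of q"
  and rat_of_diff [simp]: "rat_of (p - q) = rat_of p - rat_of q"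
  and rat_of_uminus [simp]: "rat_of (- p) = - rat_of p"
  and rat_of_mult [simp]: "rat_of (p * q) = rat_of p * rat_of q"
  and rat_of_0 [simp]: "rat_of 0 = 0" and rat_of_1 [simp]: "rat_of 1 = 1"
  and rat_of_eq_iff [simp]: "rat_of p = rat_of q \<longleftrightarrow> p = q"
  and rshift_rat_of [simp]: "rshift n (rat_of p) = rat_of (pshift n p)"
  by (simp_all add: rat_of_def Zero_fract_def One_fract_def eq_fract rshift_Fract)
lemma rat_of_eq_0_iff [simp]: "rat_of p = 0 \<longleftrightarrow> p = 0"
  using rat_of_eq_iff[of p 0] by (simp del: rat_of_eq_iff)
lemma rat_of_sum: "rat_of (sum f S) = (\<Sum>i\<in>S. rat_of (f i))"
  by (induction S rule: infinite_finite_induct) auto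
lemma ratfun_denominator: "\<exists>q. q \<noteq> 0 \<and> (\<exists>p. rat_of q * r = rat_of p)"
proof (cases r)
  case (Fract a b)
  then show ?thesis by (intro exI[of _ b]) (auto simp: rat_of_def eq_fract mult.commute intro!: exI[of _ a])
qed

text \<open>Regularity means that some representation has a denominator that is nonzero at
  \<open>z\<close>. As a relation it needs no default value at a pole.\<close>

definition has_value :: "ratfun \<Rightarrow> complex \<Rightarrow> complex \<Rightarrow> bool" where
  "has_value r z v \<longleftrightarrow> (\<exists>p q. poly q z \<noteq> 0 \<and> r = Fract p q \<and> v = poly p z / poly q z)"

lemma has_value_unique: "has_value r z v \<Longrightarrow> has_value r z w \<Longrightarrow> v = w"
proof -
  assume "has_value r z v" "has_value r z w"
  then obtain p q p' q' where *: "poly q z \<noteq> 0" "poly q' z \<noteq> 0" "Fract p q = Fract p' q'"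
    "v = poly p z / poly q z" "w = poly p' z / poly q' z"
    unfolding has_value_def by metis
  then have "q \<noteq> 0" "q' \<noteq> 0" by auto
  with * have "p * q' = p' * q" by (simp add: eq_fract)
  then have "poly p z * poly q' z = poly p' z * poly q z" by (metis poly_mult)
  then show ?thesis using * by (simp add: frac_eq_eq)
qed

lemma has_value_add: "has_value r z v \<Longrightarrow> has_value s z w \<Longrightarrow> has_value (r + s) z (v + w)"
proof -
  assume "has_value r z v" "has_value s z w"
  then obtain p q p' q' where *: "poly q z \<noteq> 0" "poly q' z \<noteq> 0" "r = Fract p q" "s = Fract p' q'"
    "v = poly p z / poly q z" "w = poly p' z / poly q' z"
    unfolding has_value_def by metis
  then have "q \<noteq> 0" "q' \<noteq> 0" by auto
  with * show ?thesis unfolding has_value_def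
    by (intro exI[of _ "p * q' + p' * q"] exI[of _ "q * q'"]) (simp add: add_frac_eq)
qed

lemma has_value_mult: "has_value r z v \<Longrightarrow> has_value s z w \<Longrightarrow> has_value (r * s) z (v * w)"
proof -
  assume "has_value r z v" "has_value s z w"
  then obtain p q p' q' where *: "poly q z \<noteq> 0" "poly q' z \<noteq> 0" "r = Fract p q" "s = Fract p' q'"
    "v = poly p z / poly q z" "w = poly p' z / poly q' z"
    unfolding has_value_def by metis
  then show ?thesis unfolding has_value_def
    by (intro exI[of _ "p * p'"] exI[of _ "q * q'"]) simp
qed

lemma has_value_rat_of [intro]: "has_value (rat_of p) z (poly p z)"
  unfolding has_value_def rat_of_def by (intro exI[of _ p] exI[of _ 1]) simp

lemma has_value_uminus: "has_value r z v \<Longrightarrow> has_value (- r) z (- v)"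
  using has_value_mult[OF has_value_rat_of[of "-1"], where s = r and w = v and z = z] by simp
lemma has_value_diff: "has_value r z v \<Longrightarrow> has_value s z w \<Longrightarrow> has_value (r - s) z (v - w)"
  using has_value_add[of r z v "- s" "- w"] has_value_uminus[of s z w] by simp
lemma has_value_sum: "(\<And>i. i \<in> S \<Longrightarrow> has_value (f i) z (g i)) \<Longrightarrow> has_value (sum f S) z (sum g S)"
proof (induction S rule: infinite_finite_induct)
  case (infinite A) then show ?case using has_value_rat_of[of 0 z] by simp
next
  case empty show ?case using has_value_rat_of[of 0 z] by simp
next
  case (insert x F) then show ?case by (auto intro: has_value_add)
qed

lemma has_value_rshift: "has_value r (z + of_int n) v \<Longrightarrow> has_value (rshift n r) z v"
proof -
  assume "has_value r (z + of_int n) v"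
  then obtain p q where *: "poly q (z + of_int n) \<noteq> 0" "r = Fract p q" "v = poly p (z + of_int n) / poly q (z + of_int n)"
    unfolding has_value_def by metis
  then have "q \<noteq> 0" by auto
  with * show ?thesis unfolding has_value_def
    by (intro exI[of _ "pshift n p"] exI[of _ "pshift n q"]) (simp add: rshift_Fract)
qed

text \<open>Only finitely many translates of \<open>z\<close> can hit one of the finitely many
  poles. This makes the tails of banded matrices evaluable.\<close>

lemma eventually_has_value: "\<exists>N. \<forall>n\<ge>N. \<exists>v. has_value r (z + of_int n) v"
proof (cases r)
  case (Fract p q)
  have "finite {x. poly q x = 0}" using Fract by (simp add: poly_roots_finite)
  moreover have "inj (\<lambda>n::int. z + of_int n)" by (auto intro!: injI)
  ultimately have "finite {n. poly q (z + of_int n) = 0}"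
    using finite_vimageI[of "{x. poly q x = 0}" "\<lambda>n::int. z + of_int n"] by (simp add: vimage_def)
  then obtain N where "\<forall>n\<in>{n. poly q (z + of_int n) = 0}. n < N"
    by (meson bdd_above_finite bdd_above.unfold gt_ex order_le_less_trans)
  then have "\<forall>n\<ge>N. poly q (z + of_int n) \<noteq> 0" by force
  then show ?thesis unfolding has_value_def using Fract by blast
qed

text \<open>Beyond the poles the value \<open>k\<close> at one integer propagates to the next, so
  numerator minus \<open>k\<close> times denominator has infinitely many zeros.\<close>

lemma rshift_invariant_const: assumes "rshift 1 r = r" shows "\<exists>k. r = rat_of [:k:]"
proof -
  obtain N where N: "\<forall>n\<ge>N. \<exists>v. has_value r (0 + of_int n) v"
    using eventually_has_value by blast
  obtain k where k: "has_value r (of_int N) k" using N by auto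
  have const: "has_value r (of_int N + of_nat n) k" for n
  proof (induction n)
    case 0 show ?case using k by simp
  next
    case (Suc n)
    obtain v where v: "has_value r (of_int N + of_nat (Suc n)) v"
      using N[rule_format, of "N + int (Suc n)"] by auto
    then have "has_value (rshift 1 r) (of_int N + of_nat n) v"
      by (intro has_value_rshift) (simp add: algebra_simps)
    with Suc assms have "v = k" using has_value_unique by metis
    then show ?case using v by simp
  qed
  obtain p q where r: "r = Fract p q" "q \<noteq> 0" by (cases r)
  have "poly p (of_int N + of_nat n) = k * poly q (of_int N + of_nat n)" for n
  proof -
    obtain p' q' where *: "poly q' (of_int N + of_nat n) \<noteq> 0" "r = Fract p' q'"
      "k = poly p' (of_int N + of_nat n) / poly q' (of_int N + of_nat n)"
      using const[of n] unfolding has_value_def by metis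
    then have "q' \<noteq> 0" by auto
    then have "p * q' = p' * q" using r * by (simp add: eq_fract)
    then have "poly p (of_int N + of_nat n) * poly q' (of_int N + of_nat n) = poly p' (of_int N + of_nat n) * poly q (of_int N + of_nat n)"
      by (metis poly_mult)
    moreover have "poly p' (of_int N + of_nat n) = k * poly q' (of_int N + of_nat n)"
      using * by (simp add: eq_divide_eq)
    ultimately have "poly p (of_int N + of_nat n) * poly q' (of_int N + of_nat n) =
        k * poly q (of_int N + of_nat n) * poly q' (of_int N + of_nat n)" by (simp add: ac_simps)
    then show ?thesis using * by (simp only: mult_cancel_right) simp
  qed
  then have "range (\<lambda>n::nat. of_int N + of_nat n) \<subseteq> {x. poly (p - smult k q) x = 0}" by auto
  moreover have "infinite (range (\<lambda>n::nat. of_int N + of_nat n :: complex))"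
    by (subst finite_image_iff) (auto intro!: injI)
  ultimately have "p - smult k q = 0" using poly_roots_finite finite_subset by blast
  then have "r = rat_of [:k:]" using r by (simp add: rat_of_def eq_fract)
  then show ?thesis by blast
qed

section \<open>Skew Laurent polynomials\<close>

text \<open>An element stands for the sum of \<open>coef f n\<close> times x^n with coefficients on
  the left, where x r(h) = r(h - 1) x.\<close>

typedef skl = "{f :: int \<Rightarrow> ratfun. finite {n. f n \<noteq> 0}}" morphisms coef Skl
  by (rule exI[of _ "\<lambda>_. 0"]) simp

abbreviation supp :: "skl \<Rightarrow> int set" where "supp f \<equiv> {n. coef f n \<noteq> 0}"

lemma finite_supp [simp, intro]: "finite (supp f)"
  using coef[of f] by simp

lemma skl_eqI: "(\<And>n. coef f n = coef g n) \<Longrightarrow> f = g"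
  by (simp add: coef_inject[symmetric] fun_eq_iff)

lemma coef_Skl: "finite {n. f n \<noteq> 0} \<Longrightarrow> coef (Skl f) = f"
  by (simp add: Skl_inverse)

instantiation skl :: ab_group_add
begin
definition zero_skl :: skl where "0 = Skl (\<lambda>_. 0)"
definition plus_skl :: "skl \<Rightarrow> skl \<Rightarrow> skl" where "f + g = Skl (\<lambda>n. coef f n + coef g n)"
definition uminus_skl :: "skl \<Rightarrow> skl" where "- f = Skl (\<lambda>n. - coef f n)"
definition minus_skl :: "skl \<Rightarrow> skl \<Rightarrow> skl" where "f - g = Skl (\<lambda>n. coef f n - coef g n)"

lemma coef_0 [simp]: "coef 0 n = 0"
  by (simp add: zero_skl_def coef_Skl)
lemma coef_uminus [simp]: "coef (- f) n = - coef f n"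
  by (simp add: uminus_skl_def coef_Skl)
lemma coef_add [simp]: "coef (f + g) n = coef f n + coef g n"
proof -
  have "finite {n. coef f n + coef g n \<noteq> 0}"
    by (rule finite_subset[of _ "supp f \<union> supp g"]) auto
  then show ?thesis by (simp add: plus_skl_def coef_Skl)
qed
lemma coef_diff [simp]: "coef (f - g) n = coef f n - coef g n"
proof -
  have "finite {n. coef f n - coef g n \<noteq> 0}"
    by (rule finite_subset[of _ "supp f \<union> supp g"]) auto
  then show ?thesis by (simp add: minus_skl_def coef_Skl)
qed

instance by standard (rule skl_eqI; simp add: algebra_simps)+
end

lemma coef_sum [simp]: "coef (sum f S) n = (\<Sum>i\<in>S. coef (f i) n)"
  by (induction S rule: infinite_finite_induct) auto

definition monomial :: "ratfun \<Rightarrow> int \<Rightarrow> skl" where "monomial r m = Skl (\<lambda>n. if n = m then r else 0)"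
lemma coef_monomial [simp]: "coef (monomial r m) n = (if n = m then r else 0)"
proof -
  have "finite {n. (if n = m then r else 0) \<noteq> 0}"
    by (rule finite_subset[of _ "{m}"]) auto
  then show ?thesis by (simp add: monomial_def coef_Skl)
qed

lemma skl_eq_sum_monomial: "f = (\<Sum>n\<in>supp f. monomial (coef f n) n)"
  by (rule skl_eqI) (simp add: sum.delta')

instantiation skl :: ring_1
begin
definition one_skl :: skl where "1 = monomial 1 0"
definition times_skl :: "skl \<Rightarrow> skl \<Rightarrow> skl"
  where "f * g = Skl (\<lambda>n. \<Sum>i\<in>supp f. coef f i * rshift (- i) (coef g (n - i)))"

lemma coef_times: "coef (f * g) n = (\<Sum>i\<in>supp f. coef f i * rshift (- i) (coef g (n - i)))"
proof -
  have "{n. (\<Sum>i\<in>supp f. coef f i * rshift (- i) (coef g (n - i))) \<noteq> 0}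
      \<subseteq> (\<lambda>(i, j). i + j) ` (supp f \<times> supp g)"
  proof
    fix n assume "n \<in> {n. (\<Sum>i\<in>supp f. coef f i * rshift (- i) (coef g (n - i))) \<noteq> 0}"
    then obtain i where "coef f i \<noteq> 0" "coef g (n - i) \<noteq> 0"
      by (auto elim!: sum.not_neutral_contains_not_neutral)
    then show "n \<in> (\<lambda>(i, j). i + j) ` (supp f \<times> supp g)"
      by (intro image_eqI[of _ _ "(i, n - i)"]) auto
  qed
  then have "finite {n. (\<Sum>i\<in>supp f. coef f i * rshift (- i) (coef g (n - i))) \<noteq> 0}"
    using finite_subset by blast
  then show ?thesis by (simp add: times_skl_def coef_Skl)
qed

lemma coef_mult: "finite S \<Longrightarrow> supp f \<subseteq> S \<Longrightarrow> coef (f * g) n = (\<Sum>i\<in>S. coef f i * rshift (- i) (coef g (n - i)))"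
  by (simp add: coef_times) (rule sum.mono_neutral_left, auto)

lemma mult_assoc_skl: "f * g * h = f * (g * (h :: skl))"
proof (rule skl_eqI)
  fix n
  define S where "S = (\<lambda>(i, j). i + j) ` (supp f \<times> supp g)"
  have fin: "finite S" by (simp add: S_def)
  have "supp (f * g) \<subseteq> S"
  proof
    fix m assume "m \<in> supp (f * g)"
    then obtain i where "coef f i \<noteq> 0" "coef g (m - i) \<noteq> 0"
      by (auto simp: coef_times elim!: sum.not_neutral_contains_not_neutral)
    then show "m \<in> S" unfolding S_def by (intro image_eqI[of _ _ "(i, m - i)"]) auto
  qed
  then have "coef (f * g * h) n = (\<Sum>k\<in>S. coef (f * g) k * rshift (- k) (coef h (n - k)))"
    by (rule coef_mult[OF fin])
  also have "\<dots> = (\<Sum>k\<in>S. \<Sum>i\<in>supp f. coef f i * rshift (- i) (coef g (k - i)) * rshift (- k) (coef h (n - k)))"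
    by (simp add: coef_times sum_distrib_right)
  also have "\<dots> = (\<Sum>i\<in>supp f. \<Sum>k\<in>S. coef f i * rshift (- i) (coef g (k - i)) * rshift (- k) (coef h (n - k)))"
    by (rule sum.swap)
  also have "\<dots> = (\<Sum>i\<in>supp f. coef f i * rshift (- i) (coef (g * h) (n - i)))"
  proof (rule sum.cong[OF refl])
    fix i assume i: "i \<in> supp f"
    have "(\<Sum>k\<in>S. coef f i * rshift (- i) (coef g (k - i)) * rshift (- k) (coef h (n - k)))
        = (\<Sum>k\<in>(+) i ` supp g. coef f i * rshift (- i) (coef g (k - i)) * rshift (- k) (coef h (n - k)))"
    proof (rule sum.mono_neutral_right[OF fin])
      show "(+) i ` supp g \<subseteq> S" using i by (force simp: S_def)
      show "\<forall>k\<in>S - (+) i ` supp g. coef f i * rshift (- i) (coef g (k - i)) * rshift (- k) (coef h (n - k)) = 0"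
      proof
        fix k assume "k \<in> S - (+) i ` supp g"
        then have "k - i \<notin> supp g" by (auto simp: image_iff)
        then show "coef f i * rshift (- i) (coef g (k - i)) * rshift (- k) (coef h (n - k)) = 0" by simp
      qed
    qed
    also have "\<dots> = (\<Sum>j\<in>supp g. coef f i * rshift (- i) (coef g j) * rshift (- (i + j)) (coef h (n - (i + j))))"
      by (subst sum.reindex) (auto simp: algebra_simps)
    also have "\<dots> = coef f i * rshift (- i) (coef (g * h) (n - i))"
      by (simp add: coef_times rshift_sum sum_distrib_left algebra_simps)
    finally show "(\<Sum>k\<in>S. coef f i * rshift (- i) (coef g (k - i)) * rshift (- k) (coef h (n - k)))
        = coef f i * rshift (- i) (coef (g * h) (n - i))" .
  qed
  also have "\<dots> = coef (f * (g * h)) n" by (simp add: coef_times)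
  finally show "coef (f * g * h) n = coef (f * (g * h)) n" .
qed

lemma coef_monomial_mult [simp]: "coef (monomial r m * g) n = r * rshift (- m) (coef g (n - m))"
  by (subst coef_mult[of "{m}"]) auto

lemma coef_mult_monomial [simp]: "coef (f * monomial r m) n = coef f (n - m) * rshift (m - n) r"
proof -
  have "coef (f * monomial r m) n = (\<Sum>i\<in>insert (n - m) (supp f). coef f i * rshift (- i) (coef (monomial r m) (n - i)))"
    by (rule coef_mult) auto
  also have "\<dots> = (\<Sum>i\<in>insert (n - m) (supp f). if i = n - m then coef f (n - m) * rshift (m - n) r else 0)"
    by (intro sum.cong refl) auto
  also have "\<dots> = coef f (n - m) * rshift (m - n) r" by (subst sum.delta) auto
  finally show ?thesis .
qed

instance
proof
  fix a b c :: skl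
  show "a * b * c = a * (b * c)" by (rule mult_assoc_skl)
  show "1 * a = a" by (rule skl_eqI) (simp add: one_skl_def)
  show "a * 1 = a" by (rule skl_eqI) (simp add: one_skl_def)
  show "(0::skl) \<noteq> 1"
    by (metis coef_monomial one_skl_def coef_0 zero_neq_one)
  show "a * (b + c) = a * b + a * c"
    by (rule skl_eqI) (simp add: coef_times sum.distrib algebra_simps)
  show "(a + b) * c = a * c + b * c"
  proof (rule skl_eqI)
    fix n
    have *: "finite (supp a \<union> supp b)" "supp a \<subseteq> supp a \<union> supp b" "supp b \<subseteq> supp a \<union> supp b"
      "supp (a + b) \<subseteq> supp a \<union> supp b" by auto
    show "coef ((a + b) * c) n = coef (a * c + b * c) n"
      by (simp add: coef_mult[OF *(1,4)] coef_mult[OF *(1,2)] coef_mult[OF *(1,3)] sum.distrib algebra_simps)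
  qed
qed
end

lemma coef_1 [simp]: "coef 1 n = (if n = 0 then 1 else 0)"
  by (simp add: one_skl_def)

lemma monomial_mult_monomial: "monomial r m * monomial s n = monomial (r * rshift (- m) s) (m + n)"
  by (rule skl_eqI) auto
lemma monomial_0 [simp]: "monomial 0 n = 0" by (rule skl_eqI) simp
lemma monomial_1_0: "monomial 1 0 = 1" by (simp add: one_skl_def)
lemma monomial_add: "monomial (r + s) n = monomial r n + monomial s n" by (rule skl_eqI) simp
lemma monomial_diff: "monomial (r - s) n = monomial r n - monomial s n" by (rule skl_eqI) simp
text \<open>Degree n occupies the diagonal l - k = n, and row l carries the coefficient translated
  by l. With this translation the skew product becomes the matrix product, and translating h by n
  moves both indices by n.\<close>

definition mat :: "skl \<Rightarrow> int \<Rightarrow> int \<Rightarrow> ratfun" where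
  "mat u l k = rshift l (coef u (l - k))"

lemma mat_mult:
  assumes "finite J" "\<And>j. coef u (l - j) \<noteq> 0 \<Longrightarrow> j \<in> J"
  shows "mat (u * v) l k = (\<Sum>j\<in>J. mat u l j * mat v j k)"
proof -
  have "supp u \<subseteq> (-) l ` J"
  proof
    fix i assume "i \<in> supp u"
    then have "l - i \<in> J" using assms(2)[of "l - i"] by simp
    then show "i \<in> (-) l ` J" by (intro image_eqI[of _ _ "l - i"]) auto
  qed
  then have "coef (u * v) (l - k) = (\<Sum>i\<in>(-) l ` J. coef u i * rshift (- i) (coef v (l - k - i)))"
    by (intro coef_mult) (use assms in auto)
  also have "\<dots> = (\<Sum>j\<in>J. coef u (l - j) * rshift (j - l) (coef v (j - k)))"
    by (subst sum.reindex) (auto intro!: inj_onI simp: algebra_simps)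
  finally show ?thesis by (simp add: mat_def rshift_sum)
qed

lemma mat_1: "mat 1 l k = (if l = k then 1 else 0)"
  by (simp add: mat_def)
lemma mat_sum: "mat (sum f S) l k = (\<Sum>i\<in>S. mat (f i) l k)"
  by (simp add: mat_def rshift_sum)
lemma rshift_mat: "rshift n (mat u l k) = mat u (n + l) (n + k)"
  by (simp add: mat_def)

section \<open>Degree bounds and left Euclidean division\<close>

definition supported :: "int \<Rightarrow> int \<Rightarrow> skl \<Rightarrow> bool" where
  "supported lo hi f \<longleftrightarrow> (\<forall>n. coef f n \<noteq> 0 \<longrightarrow> lo \<le> n \<and> n \<le> hi)"

lemma supported_exists: "\<exists>b. supported (- b) b f"
proof -
  have "finite (abs ` supp f)" by simp
  then obtain b where "\<And>x. x \<in> abs ` supp f \<Longrightarrow> x \<le> b"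
    by (meson bdd_above.E bdd_above_finite)
  then have "\<And>n. coef f n \<noteq> 0 \<Longrightarrow> \<bar>n\<bar> \<le> b" by auto
  then have "supported (- b) b f" unfolding supported_def by (metis abs_le_D1 abs_le_D2 minus_le_iff)
  then show ?thesis by blast
qed
lemma supported_mono: "supported lo hi f \<Longrightarrow> lo' \<le> lo \<Longrightarrow> hi \<le> hi' \<Longrightarrow> supported lo' hi' f"
  unfolding supported_def by force

lemma uniform_supported:
  assumes "finite I"
  shows "\<exists>b. \<forall>p\<in>I. supported (- b) b (f p)"
proof -
  obtain g where g: "\<And>p. supported (- g p) (g p) (f p)" using supported_exists[of "f _"] by metis
  obtain b where "\<forall>p\<in>I. g p \<le> b"
    using assms by (metis bdd_above.E bdd_above_finite finite_imageI imageI)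
  then have "\<forall>p\<in>I. supported (- b) b (f p)" using g supported_mono by (metis neg_le_iff_le)
  then show ?thesis by blast
qed

text \<open>The product of the top coefficients, one of them translated, is nonzero because
  translation is injective on the field of rational functions.\<close>

instance skl :: ring_1_no_zero_divisors
proof
  fix f g :: skl assume "f \<noteq> 0" "g \<noteq> 0"
  then have ne: "supp f \<noteq> {}" "supp g \<noteq> {}"
    by (metis (mono_tags, lifting) empty_iff mem_Collect_eq skl_eqI coef_0)+
  define m n where "m = Max (supp f)" and "n = Max (supp g)"
  have m: "m \<in> supp f" "\<And>i. i \<in> supp f \<Longrightarrow> i \<le> m" and n: "n \<in> supp g" "\<And>i. i \<in> supp g \<Longrightarrow> i \<le> n"
    using ne by (simp_all add: m_def n_def del: mem_Collect_eq)
  have "coef (f * g) (m + n) = (\<Sum>i\<in>supp f. if i = m then coef f m * rshift (- m) (coef g n) else 0)"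
    unfolding coef_mult[OF finite_supp subset_refl]
  proof (intro sum.cong refl)
    fix i assume i: "i \<in> supp f"
    show "coef f i * rshift (- i) (coef g (m + n - i)) = (if i = m then coef f m * rshift (- m) (coef g n) else 0)"
    proof (cases "i = m")
      case False
      then have "i < m" using m(2)[OF i] by simp
      then have "coef g (m + n - i) = 0" using n(2)[of "m + n - i"] by force
      then show ?thesis using False by simp
    qed simp
  qed
  also have "\<dots> = coef f m * rshift (- m) (coef g n)"
    using m by (subst sum.delta) auto
  also have "\<dots> \<noteq> 0" using m n by simp
  finally show "f * g \<noteq> 0" by (metis coef_0)
qed

text \<open>Long division: the top term of \<open>g\<close> is cancelled by a left monomial multiple
  of \<open>z\<close>. The leading coefficient of \<open>z\<close> has to be translated first, since
  the monomial moves past it.\<close>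

lemma skew_division:
  assumes z: "supported 0 (int d) z" "coef z (int d) \<noteq> 0"
  shows "supported 0 (int m) g \<Longrightarrow> \<exists>q. supported 0 (int d - 1) (g - q * z)"
proof (induction m arbitrary: g)
  case (0 g)
  show ?case
  proof (cases "d = 0")
    case True
    have "z = monomial (coef z 0) 0"
      by (rule skl_eqI) (use z True in \<open>auto simp: supported_def\<close>)
    then have "monomial (coef g 0 / coef z 0) 0 * z = monomial (coef g 0) 0"
      using z(2) True by (metis monomial_mult_monomial add_0 minus_zero nonzero_eq_divide_eq of_nat_0 rshift_zero)
    moreover have "g = monomial (coef g 0) 0" by (rule skl_eqI) (use 0 in \<open>auto simp: supported_def\<close>)
    ultimately have "g - monomial (coef g 0 / coef z 0) 0 * z = 0" by simp
    then show ?thesis by (intro exI[of _ "monomial (coef g 0 / coef z 0) 0"]) (simp add: supported_def)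
  next
    case False
    then show ?thesis using 0 by (intro exI[of _ 0]) (auto simp: supported_def)
  qed
next
  case (Suc m g)
  show ?case
  proof (cases "Suc m < d")
    case True
    then show ?thesis using Suc.prems by (intro exI[of _ 0]) (auto simp: supported_def)
  next
    case False
    define k where "k = int (Suc m) - int d"
    have k: "k \<ge> 0" using False by (simp add: k_def)
    define q where "q = monomial (coef g (int (Suc m)) / rshift (- k) (coef z (int d))) k"
    have "supported 0 (int m) (g - q * z)"
      unfolding supported_def
    proof (intro allI impI)
      fix n assume n: "coef (g - q * z) n \<noteq> 0"
      have c: "coef (g - q * z) n = coef g n - coef g (int (Suc m)) / rshift (- k) (coef z (int d)) * rshift (- k) (coef z (n - k))"
        by (simp add: q_def)
      have "n \<noteq> int (Suc m)"
      proof
        assume "n = int (Suc m)"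
        then have "n - k = int d" by (simp add: k_def)
        then show False using n z(2) unfolding c by (simp add: \<open>n = int (Suc m)\<close>)
      qed
      moreover have "coef g n \<noteq> 0 \<or> coef z (n - k) \<noteq> 0" using n unfolding c by auto
      then have "0 \<le> n \<and> n \<le> int (Suc m)"
        using Suc.prems z(1) k unfolding supported_def k_def by fastforce
      ultimately show "0 \<le> n \<and> n \<le> int m" by auto
    qed
    then obtain q' where "supported 0 (int d - 1) (g - q * z - q' * z)" using Suc.IH by blast
    then show ?thesis by (intro exI[of _ "q + q'"]) (simp add: algebra_simps)
  qed
qed

text \<open>Monomials are units, so elements of the left ideal can be moved into nonnegative
  degrees; one of least degree there is a generator \<open>z\<close>, by division with remainder.
  Cancelling \<open>z\<close> on the right in its own expression through the \<open>w p\<close>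
  yields the relation of the \<open>r p\<close> and \<open>w' p\<close>.\<close>

lemma left_ideal_principal:
  fixes w :: "'i \<Rightarrow> skl"
  assumes I: "finite I" and nz: "\<exists>p\<in>I. w p \<noteq> 0"
  shows "\<exists>z w' r. z \<noteq> 0 \<and> (\<forall>p\<in>I. w p = w' p * z) \<and> (\<Sum>p\<in>I. r p * w' p) = 1"
proof -
  define J where "J = {g. \<exists>r. g = (\<Sum>p\<in>I. r p * w p)}"
  have J_diff: "g - q * h \<in> J" if gh: "g \<in> J" "h \<in> J" for g h q
  proof -
    obtain r s where "g = (\<Sum>p\<in>I. r p * w p)" "h = (\<Sum>p\<in>I. s p * w p)" using gh by (auto simp: J_def)
    then have "g - q * h = (\<Sum>p\<in>I. (r p - q * s p) * w p)"
      by (simp add: sum_subtractf sum_distrib_left algebra_simps)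
    then show ?thesis unfolding J_def by (intro CollectI exI)
  qed
  have J0: "0 \<in> J" unfolding J_def by (intro CollectI exI[of _ "\<lambda>_. 0"]) simp
  have J_mult: "q * h \<in> J" if h: "h \<in> J" for q h using J_diff[OF J0 h, of "- q"] by simp
  have J_w: "w p \<in> J" if p: "p \<in> I" for p
  proof -
    have "w p = (\<Sum>i\<in>I. (if i = p then 1 else 0) * w i)"
      using I p by (simp add: if_distrib[of "\<lambda>x. x * _"] cong: if_cong)
    then show ?thesis unfolding J_def by (intro CollectI exI)
  qed
  have shift: "\<exists>t m. supported 0 (int m) (monomial 1 t * g)" for g
  proof -
    obtain b where b: "supported (- b) b g" using supported_exists by blast
    have "supported 0 (int (nat (2 * b))) (monomial 1 b * g)"
      unfolding supported_def
    proof (intro allI impI)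
      fix n assume "coef (monomial 1 b * g) n \<noteq> 0"
      then have "coef g (n - b) \<noteq> 0" by simp
      then have "- b \<le> n - b \<and> n - b \<le> b" using b unfolding supported_def by blast
      then show "0 \<le> n \<and> n \<le> int (nat (2 * b))" by auto
    qed
    then show ?thesis by blast
  qed
  have monomial_cancel: "monomial 1 (- t) * (monomial 1 t * g) = g" for t and g :: skl
    by (simp add: monomial_mult_monomial monomial_1_0 flip: mult.assoc)
  define P where "P d \<longleftrightarrow> (\<exists>z\<in>J. z \<noteq> 0 \<and> supported 0 (int d) z)" for d
  obtain p where p: "p \<in> I" "w p \<noteq> 0" using nz by blast
  obtain t m where tm: "supported 0 (int m) (monomial 1 t * w p)" using shift by blast
  have "monomial 1 t * w p \<noteq> 0" using p monomial_cancel[of t "w p"] by auto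
  then have Pm: "P m" unfolding P_def using J_mult[OF J_w[OF p(1)]] tm by blast
  define d where "d = (LEAST d. P d)"
  have Pd: "P d" unfolding d_def using Pm by (rule LeastI)
  then obtain z where z: "z \<in> J" "z \<noteq> 0" "supported 0 (int d) z" unfolding P_def by blast
  have small: "h = 0" if h: "h \<in> J" "supported 0 (int d - 1) h" for h
  proof (rule ccontr)
    assume "h \<noteq> 0"
    then obtain n where n: "coef h n \<noteq> 0" by (metis skl_eqI coef_0)
    then have "0 \<le> n \<and> n \<le> int d - 1" using h(2) unfolding supported_def by blast
    then have "d > 0" by linarith
    then have "P (d - 1)" unfolding P_def using h \<open>h \<noteq> 0\<close> by (intro bexI[of _ h]) (auto simp: of_nat_diff)
    then have "d \<le> d - 1" unfolding d_def by (rule Least_le)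
    then show False using \<open>d > 0\<close> by simp
  qed
  have top: "coef z (int d) \<noteq> 0"
  proof
    assume zd: "coef z (int d) = 0"
    have "supported 0 (int d - 1) z" unfolding supported_def
    proof (intro allI impI)
      fix n assume n: "coef z n \<noteq> 0"
      then have "0 \<le> n \<and> n \<le> int d" using z(3) unfolding supported_def by blast
      moreover have "n \<noteq> int d" using n zd by auto
      ultimately show "0 \<le> n \<and> n \<le> int d - 1" by auto
    qed
    then show False using small z by blast
  qed
  have ex: "\<exists>q. g = q * z" if g: "g \<in> J" for g
  proof -
    obtain t m where tm: "supported 0 (int m) (monomial 1 t * g)" using shift by blast
    then obtain q where q: "supported 0 (int d - 1) (monomial 1 t * g - q * z)"
      using skew_division[OF z(3) top] by blast
    have "monomial 1 t * g - q * z = 0"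
      by (rule small[OF J_diff[OF J_mult[OF g] z(1)] q])
    then have "g = monomial 1 (- t) * q * z"
      using monomial_cancel[of t g] by (simp add: mult.assoc)
    then show ?thesis by blast
  qed
  have "\<forall>p\<in>I. \<exists>q. w p = q * z" using ex J_w by blast
  then obtain w' where w': "\<forall>p\<in>I. w p = w' p * z" by metis
  obtain r where r: "z = (\<Sum>p\<in>I. r p * w p)" using z(1) unfolding J_def by blast
  also have "\<dots> = (\<Sum>p\<in>I. r p * w' p) * z" using w' by (simp add: sum_distrib_right mult.assoc)
  finally have "(1 - (\<Sum>p\<in>I. r p * w' p)) * z = 0" by (simp add: algebra_simps)
  then have "(\<Sum>p\<in>I. r p * w' p) = 1" using z(2) by simp
  then show ?thesis using w' z(2) by blast
qed


text \<open>Induction on the number of nonzero columns. For an entry E i j \<noteq> 0, subtract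
  column j times row i divided by that entry: idempotency survives, column j becomes zero, and the
  trace drops by (E E) i j / E i j = 1.\<close>

lemma idempotent_trace_Nats:
  fixes E :: "'j \<Rightarrow> 'j \<Rightarrow> complex"
  assumes J: "finite J"
  shows "\<lbrakk>\<And>i k. i \<in> J \<Longrightarrow> k \<in> J \<Longrightarrow> (\<Sum>j\<in>J. E i j * E j k) = E i k\<rbrakk> \<Longrightarrow> (\<Sum>j\<in>J. E j j) \<in> \<nat>"
proof (induction "card {j\<in>J. \<exists>i\<in>J. E i j \<noteq> 0}" arbitrary: E rule: less_induct)
  case less
  note idem = less.prems
  show ?case
  proof (cases "\<forall>i\<in>J. \<forall>j\<in>J. E i j = 0")
    case True
    then show ?thesis by simp
  next
    case False
    then obtain i j where ij: "i \<in> J" "j \<in> J" "E i j \<noteq> 0" by blast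
    define E' where "E' k l = E k l - E k j * E i l / E i j" for k l
    have "{l\<in>J. \<exists>k\<in>J. E' k l \<noteq> 0} \<subset> {l\<in>J. \<exists>k\<in>J. E k l \<noteq> 0}"
    proof
      show "{l\<in>J. \<exists>k\<in>J. E' k l \<noteq> 0} \<subseteq> {l\<in>J. \<exists>k\<in>J. E k l \<noteq> 0}"
      proof safe
        fix l k assume l: "l \<in> J" and k: "k \<in> J" "E' k l \<noteq> 0"
        then have "E k l \<noteq> 0 \<or> E i l \<noteq> 0" by (auto simp: E'_def)
        then show "\<exists>k\<in>J. E k l \<noteq> 0" using k ij by blast
      qed
      have "j \<notin> {l\<in>J. \<exists>k\<in>J. E' k l \<noteq> 0}" using ij by (simp add: E'_def)
      moreover have "j \<in> {l\<in>J. \<exists>k\<in>J. E k l \<noteq> 0}" using ij by blast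
      ultimately show "{l\<in>J. \<exists>k\<in>J. E' k l \<noteq> 0} \<noteq> {l\<in>J. \<exists>k\<in>J. E k l \<noteq> 0}" by blast
    qed
    then have less': "card {l\<in>J. \<exists>k\<in>J. E' k l \<noteq> 0} < card {l\<in>J. \<exists>k\<in>J. E k l \<noteq> 0}"
      using J by (intro psubset_card_mono) auto
    have idem': "(\<Sum>m\<in>J. E' k m * E' m l) = E' k l" if kl: "k \<in> J" "l \<in> J" for k l
    proof -
      have "(\<Sum>m\<in>J. E' k m * E' m l) = (\<Sum>m\<in>J. E k m * E m l)
          - (\<Sum>m\<in>J. E k m * E m j) * (E i l / E i j) - (E k j / E i j) * (\<Sum>m\<in>J. E i m * E m l)
          + (E k j / E i j) * (\<Sum>m\<in>J. E i m * E m j) * (E i l / E i j)"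
        unfolding E'_def sum_distrib_left sum_distrib_right sum_subtractf[symmetric] sum.distrib[symmetric]
        by (intro sum.cong refl) (simp add: algebra_simps)
      also have "\<dots> = E' k l"
        using ij kl by (simp add: idem E'_def)
      finally show ?thesis .
    qed
    have "(\<Sum>l\<in>J. E l l) = (\<Sum>l\<in>J. E' l l) + (\<Sum>l\<in>J. E i l * E l j) / E i j"
      unfolding E'_def sum_subtractf sum_divide_distrib by (simp add: mult.commute)
    also have "\<dots> = (\<Sum>l\<in>J. E' l l) + 1" using ij by (simp add: idem)
    finally show ?thesis using less.hyps[OF less' idem'] by simp
  qed
qed

section \<open>Degree components and matrix entries of the image of A(a)\<close>

definition shifted_prod :: "complex poly \<Rightarrow> int \<Rightarrow> int \<Rightarrow> complex poly" where
  "shifted_prod a l k = (\<Prod>m\<in>{l..<k}. pshift m a)"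

lemma pshift_shifted_prod: "pshift n (shifted_prod a l k) = shifted_prod a (n + l) (n + k)"
proof -
  have *: "{n + l..<n + k} = (+) n ` {l..<k}" by (simp add: add.commute)
  show ?thesis unfolding shifted_prod_def pshift_prod * by (subst prod.reindex) auto
qed

text \<open>The split point \<open>j\<close> may lie outside the interval from \<open>l\<close> to
  \<open>k\<close>, and then the right-hand side has additional factors; hence divisibility only.
  This covers all combinations of signs of degrees in a product.\<close>

lemma shifted_prod_dvd: "shifted_prod a l k dvd shifted_prod a l j * shifted_prod a j k"
proof -
  have "shifted_prod a l k dvd (\<Prod>m\<in>{l..<j} \<union> {j..<k}. pshift m a)"
    unfolding shifted_prod_def by (intro prod_dvd_prod_subset) auto
  also have "\<dots> = shifted_prod a l j * shifted_prod a j k"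
    unfolding shifted_prod_def by (intro prod.union_disjoint) auto
  finally show ?thesis .
qed

lemma pshift_dvd_shifted_prod: "l \<le> m \<Longrightarrow> m < k \<Longrightarrow> pshift m a dvd shifted_prod a l k"
  unfolding shifted_prod_def by (intro dvd_prodI) auto

lemma shifted_prod_empty [simp]: "k \<le> l \<Longrightarrow> shifted_prod a l k = 1"
  by (simp add: shifted_prod_def)
lemma shifted_prod_nonzero: "a \<noteq> 0 \<Longrightarrow> shifted_prod a l k \<noteq> 0"
  by (simp add: shifted_prod_def)

definition multiples :: "complex poly \<Rightarrow> ratfun set" where
  "multiples d = {r. \<exists>p. r = rat_of p \<and> d dvd p}"

lemma multiples_0 [simp]: "0 \<in> multiples d"
  unfolding multiples_def by (intro CollectI exI[of _ 0]) simp
lemma multiples_add: "r \<in> multiples d \<Longrightarrow> s \<in> multiples d \<Longrightarrow> r + s \<in> multiples d"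
  unfolding multiples_def by clarify (metis rat_of_add dvd_add)
lemma multiples_uminus: "r \<in> multiples d \<Longrightarrow> - r \<in> multiples d"
  unfolding multiples_def by clarify (metis rat_of_uminus dvd_minus_iff)
lemma multiples_sum: "(\<And>i. i \<in> S \<Longrightarrow> f i \<in> multiples d) \<Longrightarrow> sum f S \<in> multiples d"
  by (induction S rule: infinite_finite_induct) (auto intro: multiples_add)
lemma multiples_mult: "r \<in> multiples d \<Longrightarrow> s \<in> multiples e \<Longrightarrow> r * s \<in> multiples (d * e)"
  unfolding multiples_def by clarify (metis rat_of_mult mult_dvd_mono)
lemma multiples_dvd: "r \<in> multiples d \<Longrightarrow> e dvd d \<Longrightarrow> r \<in> multiples e"
  unfolding multiples_def using dvd_trans by blast
lemma multiples_rshift: "r \<in> multiples d \<Longrightarrow> rshift n r \<in> multiples (pshift n d)"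
  unfolding multiples_def using pshift_dvd by auto
lemma rat_of_multiples: "rat_of p \<in> multiples d \<longleftrightarrow> d dvd p"
  unfolding multiples_def by simp

text \<open>The image of A(a) under x \<mapsto> x and y \<mapsto> a x^-1, degree by degree: y^n has
  the coefficient \<open>shifted_prod a 0 n\<close> in degree -n, and in degrees \<ge> 0 every
  polynomial occurs.\<close>

definition gwa_sub :: "complex poly \<Rightarrow> skl set" where
  "gwa_sub a = {u. \<forall>n. coef u n \<in> multiples (shifted_prod a 0 (- n))}"

lemma gwD: "u \<in> gwa_sub a \<Longrightarrow> coef u n \<in> multiples (shifted_prod a 0 (- n))"
  by (simp add: gwa_sub_def)

lemma gwa_sub_0 [simp]: "0 \<in> gwa_sub a" by (simp add: gwa_sub_def)
lemma gwa_sub_add: "u \<in> gwa_sub a \<Longrightarrow> v \<in> gwa_sub a \<Longrightarrow> u + v \<in> gwa_sub a"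
  by (simp add: gwa_sub_def multiples_add)
lemma gwa_sub_uminus: "u \<in> gwa_sub a \<Longrightarrow> - u \<in> gwa_sub a"
  by (simp add: gwa_sub_def multiples_uminus)
lemma gwa_sub_diff: "u \<in> gwa_sub a \<Longrightarrow> v \<in> gwa_sub a \<Longrightarrow> u - v \<in> gwa_sub a"
  using gwa_sub_add[of u a "- v"] gwa_sub_uminus by simp
lemma gwa_sub_sum: "(\<And>i. i \<in> S \<Longrightarrow> f i \<in> gwa_sub a) \<Longrightarrow> sum f S \<in> gwa_sub a"
  by (simp add: gwa_sub_def multiples_sum)
lemma gwa_sub_monomial: "shifted_prod a 0 (- n) dvd p \<Longrightarrow> monomial (rat_of p) n \<in> gwa_sub a"
  by (simp add: gwa_sub_def rat_of_multiples)
lemma gwa_sub_mon0 [simp]: "monomial (rat_of p) 0 \<in> gwa_sub a"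
  by (rule gwa_sub_monomial) simp
lemma gwa_sub_1 [simp]: "1 \<in> gwa_sub a"
  using gwa_sub_mon0[of 1] by (simp add: monomial_1_0)
lemma gwa_sub_mult: assumes u: "u \<in> gwa_sub a" and v: "v \<in> gwa_sub a" shows "u * v \<in> gwa_sub a"
proof -
  have "coef u i * rshift (- i) (coef v (n - i)) \<in> multiples (shifted_prod a 0 (- n))" for n i
  proof -
  have "rshift (- i) (coef v (n - i)) \<in> multiples (shifted_prod a (- i) (- n))"
    using multiples_rshift[OF gwD[OF v, of "n - i"], of "- i"] by (simp add: pshift_shifted_prod)
  then show ?thesis
    using multiples_dvd[OF multiples_mult[OF gwD[OF u]] shifted_prod_dvd] by blast
  qed
  then show ?thesis unfolding gwa_sub_def by (auto simp: coef_times intro: multiples_sum)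
qed

text \<open>An entry above the diagonal picks up a(h + m) for each index l \<le> m < k that it
  passes. For l \<le> 0 < k the factor a(h) is among these, so the entry is zero at the
  roots.\<close>

lemma mat_gwa_sub: "u \<in> gwa_sub a \<Longrightarrow> mat u l k \<in> multiples (shifted_prod a l k)"
  using multiples_rshift[OF gwD[of u a "l - k"], of l] by (simp add: mat_def pshift_shifted_prod)

section \<open>Clearing denominators\<close>

definition denom :: "ratfun \<Rightarrow> complex poly" where
  "denom r = (SOME q. q \<noteq> 0 \<and> (\<exists>p. rat_of q * r = rat_of p))"

lemma denom_nonzero: "denom r \<noteq> 0" and denom_mult: "\<exists>p. rat_of (denom r) * r = rat_of p"
  using someI_ex[OF ratfun_denominator[of r]] unfolding denom_def by auto

text \<open>The polynomial is multiplied from the left, where it multiplies every coefficient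
  without translation. It supplies the denominators and also the products that negative degrees
  demand.\<close>

lemma clear_denominators_single:
  assumes a: "a \<noteq> 0"
  shows "\<exists>Q. Q \<noteq> 0 \<and> monomial (rat_of Q) 0 * u \<in> gwa_sub a"
proof -
  define Q where "Q = (\<Prod>n\<in>supp u. denom (coef u n) * shifted_prod a 0 (- n))"
  have "Q \<noteq> 0" using a by (simp add: Q_def shifted_prod_nonzero denom_nonzero)
  moreover have "coef (monomial (rat_of Q) 0 * u) n \<in> multiples (shifted_prod a 0 (- n))" for n
  proof (cases "n \<in> supp u")
    case True
    have "denom (coef u n) * shifted_prod a 0 (- n) dvd Q"
      unfolding Q_def by (rule dvd_prodI) (use True in auto)
    then obtain R where R: "Q = denom (coef u n) * shifted_prod a 0 (- n) * R" by (rule dvdE)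
    obtain p where p: "rat_of (denom (coef u n)) * coef u n = rat_of p" using denom_mult by blast
    have "coef (monomial (rat_of Q) 0 * u) n = rat_of Q * coef u n" by simp
    also have "\<dots> = rat_of (shifted_prod a 0 (- n)) * rat_of R * (rat_of (denom (coef u n)) * coef u n)"
      unfolding R rat_of_mult by (simp only: ac_simps)
    also have "\<dots> = rat_of (shifted_prod a 0 (- n) * (R * p))"
      unfolding p rat_of_mult by (simp only: ac_simps)
    finally show ?thesis by (simp only: rat_of_multiples dvd_triv_left)
  next
    case False
    then have "coef (monomial (rat_of Q) 0 * u) n = 0" by simp
    then show ?thesis by (simp only: multiples_0)
  qed
  ultimately show ?thesis unfolding gwa_sub_def by blast
qed

lemma clear_denominators:
  assumes a: "a \<noteq> 0" and "finite I"
  shows "\<exists>P. P \<noteq> 0 \<and> (\<forall>i\<in>I. monomial (rat_of P) 0 * y i \<in> gwa_sub a)"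
  using assms(2)
proof (induction I)
  case empty
  have "1 \<noteq> (0 :: complex poly)" by simp
  then show ?case by blast
next
  case (insert i I)
  from insert.IH obtain P where P: "P \<noteq> 0" "\<And>j. j \<in> I \<Longrightarrow> monomial (rat_of P) 0 * y j \<in> gwa_sub a" by blast
  from clear_denominators_single[OF a, of "y i"]
  obtain Q where Q: "Q \<noteq> 0" "monomial (rat_of Q) 0 * y i \<in> gwa_sub a" by blast
  have "monomial (rat_of (P * Q)) 0 * y j \<in> gwa_sub a" if j: "j \<in> insert i I" for j
  proof (cases "j = i")
    case True
    have "monomial (rat_of (P * Q)) 0 = monomial (rat_of P) 0 * monomial (rat_of Q) 0" by (simp add: monomial_mult_monomial)
    then show ?thesis using gwa_sub_mult[OF gwa_sub_mon0[of P a] Q(2)] True by (simp only: mult.assoc)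
  next
    case False
    have "monomial (rat_of (P * Q)) 0 = monomial (rat_of Q) 0 * monomial (rat_of P) 0" by (simp add: monomial_mult_monomial mult.commute)
    then show ?thesis using gwa_sub_mult[OF gwa_sub_mon0[of Q a] P(2)] False j by (simp add: mult.assoc)
  qed
  moreover have "P * Q \<noteq> 0" using P Q by simp
  ultimately show ?case by blast
qed

section \<open>Traces\<close>

definition antidiff :: "complex poly \<Rightarrow> complex poly" where
  "antidiff p = (SOME P. P - pshift (-1) P = p)"

lemma antidiff: "antidiff p - pshift (-1) (antidiff p) = p"
  unfolding antidiff_def using antidifference_exists by (rule someI_ex)

text \<open>
  An antidifference is only determined up to a constant; this does no harm as the coefficients \<open>c\<close> always sum to zero.
\<close>

definition tau :: "('i::finite \<Rightarrow> complex) \<Rightarrow> ('i \<Rightarrow> complex) \<Rightarrow> skl \<Rightarrow> complex" where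
  "tau lam c u = (\<Sum>i\<in>UNIV. c i * poly (antidiff (SOME p. coef u 0 = rat_of p)) (lam i))"

lemma tau_eq:
  assumes "coef u 0 = rat_of (P - pshift (-1) P)" and c: "(\<Sum>i\<in>UNIV. c i) = 0"
  shows "tau lam c u = (\<Sum>i\<in>UNIV. c i * poly P (lam i))"
proof -
  have "(SOME p. coef u 0 = rat_of p) = P - pshift (-1) P"
    unfolding assms(1) by (rule some_equality) (auto simp only: rat_of_eq_iff)
  moreover obtain k where "antidiff (P - pshift (-1) P) = P + [:k:]"
    using antidifference_unique antidiff by blast
  ultimately have *: "antidiff (SOME p. coef u 0 = rat_of p) = P + [:k:]" by simp
  have "tau lam c u = (\<Sum>i\<in>UNIV. c i * poly P (lam i)) + (\<Sum>i\<in>UNIV. c i) * k"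
    unfolding tau_def * by (simp add: algebra_simps sum.distrib sum_distrib_left)
  then show ?thesis using c by simp
qed

lemma gwa_sub_primitive: "u \<in> gwa_sub a \<Longrightarrow> \<exists>P. coef u 0 = rat_of (P - pshift (-1) P)"
proof -
  assume "u \<in> gwa_sub a"
  then obtain p where p: "coef u 0 = rat_of p" using gwD[of u a 0] by (auto simp: multiples_def)
  obtain P where "P - pshift (-1) P = p" using antidifference_exists by blast
  then show ?thesis using p by blast
qed

lemma tau_add:
  assumes "u \<in> gwa_sub a" "v \<in> gwa_sub a" "(\<Sum>i\<in>UNIV. c i) = 0"
  shows "tau lam c (u + v) = tau lam c u + tau lam c v"
proof -
  obtain P Q where *: "coef u 0 = rat_of (P - pshift (-1) P)" "coef v 0 = rat_of (Q - pshift (-1) Q)"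
    using gwa_sub_primitive assms by metis
  then have "coef (u + v) 0 = rat_of ((P + Q) - pshift (-1) (P + Q))"
    by (simp add: algebra_simps)
  from tau_eq[OF this assms(3), of lam] show ?thesis
    unfolding tau_eq[OF *(1) assms(3), of lam] tau_eq[OF *(2) assms(3), of lam]
    by (simp add: algebra_simps sum.distrib)
qed

lemma tau_smult:
  assumes "u \<in> gwa_sub a" "(\<Sum>i\<in>UNIV. c i) = 0"
  shows "tau lam c (monomial (rat_of [:k:]) 0 * u) = k * tau lam c u"
proof -
  obtain P where *: "coef u 0 = rat_of (P - pshift (-1) P)" using gwa_sub_primitive assms by metis
  have "coef (monomial (rat_of [:k:]) 0 * u) 0 = rat_of ([:k:] * (P - pshift (-1) P))"
    by (simp only: coef_monomial_mult * rat_of_mult minus_zero rshift_zero diff_0_right)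
  also have "[:k:] * (P - pshift (-1) P) = smult k P - pshift (-1) (smult k P)"
    by (simp add: smult_diff_right)
  finally have "coef (monomial (rat_of [:k:]) 0 * u) 0 = rat_of (smult k P - pshift (-1) (smult k P))" .
  from tau_eq[OF this assms(2), of lam] show ?thesis
    unfolding tau_eq[OF * assms(2), of lam] by (simp add: sum_distrib_left ac_simps)
qed

lemma tau_0: "(\<Sum>i\<in>UNIV. c i) = 0 \<Longrightarrow> tau lam c 0 = 0"
  using tau_smult[OF gwa_sub_0, of c lam 0] by simp

lemma tau_sum:
  assumes "(\<Sum>i\<in>UNIV. c i) = 0" "\<And>j. j \<in> S \<Longrightarrow> f j \<in> gwa_sub a"
  shows "tau lam c (sum f S) = (\<Sum>j\<in>S. tau lam c (f j))"
  using assms(2)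
proof (induction S rule: infinite_finite_induct)
  case (insert x F)
  have "sum f F \<in> gwa_sub a" using insert.prems by (intro gwa_sub_sum) auto
  then have "tau lam c (f x + sum f F) = tau lam c (f x) + tau lam c (sum f F)"
    using tau_add[OF _ _ assms(1)] insert.prems by blast
  then show ?case using insert by simp
qed (simp_all add: tau_0[OF assms(1)])

lemma tau_1: "(\<Sum>i\<in>UNIV. c i) = 0 \<Longrightarrow> tau lam c 1 = (\<Sum>i\<in>UNIV. c i * lam i)"
proof -
  assume c: "(\<Sum>i\<in>UNIV. c i) = 0"
  have "[:0,1:] - pshift (-1) [:0,1:] = 1" by (rule poly_ext) simp
  then have "coef 1 0 = rat_of ([:0,1:] - pshift (-1) [:0,1:])" by simp
  from tau_eq[OF this c, of lam] show ?thesis by simp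
qed

text \<open>The sum \<open>P\<close> of the p(h - k) for 0 \<le> k < m telescopes, and p(h - k) is
  divisible by a(h) because p is divisible by a(h + k).\<close>

lemma telescope:
  assumes "shifted_prod a 0 (int m) dvd p"
  shows "\<exists>P. a dvd P \<and> p - pshift (- int m) p = P - pshift (-1) P"
proof -
  define P where "P = (\<Sum>k<m. pshift (- int k) p)"
  have "a dvd P" unfolding P_def
  proof (rule dvd_sum)
    fix k assume "k \<in> {..<m}"
    then have "pshift (int k) a dvd shifted_prod a 0 (int m)" by (intro pshift_dvd_shifted_prod) auto
    then have "pshift (- int k) (pshift (int k) a) dvd pshift (- int k) p" using assms by (intro pshift_dvd) (rule dvd_trans)
    then show "a dvd pshift (- int k) p" by simp
  qed
  moreover have "p - pshift (- int m) p = P - pshift (-1) P"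
    unfolding P_def by (induction m) (auto simp: algebra_simps)
  ultimately show ?thesis by blast
qed

text \<open>Only opposite degrees meet in degree zero, and each pair contributes, up to sign, p -
  p(h - n) with p divisible by n consecutive translates of a. By \<open>telescope\<close> its
  antidifference is a multiple of a, hence zero at the roots.\<close>

lemma tau_commute:
  fixes c :: "'i::finite \<Rightarrow> complex"
  assumes root: "\<And>i. poly a (lam i) = 0" and c: "(\<Sum>i\<in>UNIV. c i) = 0"
    and u: "u \<in> gwa_sub a" and v: "v \<in> gwa_sub a"
  shows "tau lam c (u * v) = tau lam c (v * u)"
proof -
  \<comment> \<open>One index set for both products: n is the degree taken from \<open>u\<close> and
    -n the degree taken from \<open>v\<close>.\<close>
  define S where "S = supp u \<union> uminus ` supp v"
  have S: "finite S" "supp u \<subseteq> S" by (auto simp: S_def)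
  have S': "supp v \<subseteq> uminus ` S" by (force simp: S_def)
  have uv: "coef (u * v) 0 = (\<Sum>n\<in>S. coef u n * rshift (- n) (coef v (- n)))"
    using coef_mult[OF S] by simp
  have "coef (v * u) 0 = (\<Sum>n\<in>uminus ` S. coef v n * rshift (- n) (coef u (- n)))"
    using coef_mult[OF _ S'] S by simp
  then have vu: "coef (v * u) 0 = (\<Sum>n\<in>S. coef v (- n) * rshift n (coef u n))"
    by (simp add: sum.reindex)
  have "\<exists>P. a dvd P \<and> coef u n * rshift (- n) (coef v (- n)) - coef v (- n) * rshift n (coef u n) = rat_of (P - pshift (-1) P)" for n
  proof (cases "n \<ge> 0")
    case True
    have "coef v (- n) * rshift n (coef u n) \<in> multiples (shifted_prod a 0 n)"
      using multiples_dvd[OF multiples_mult[OF gwD[OF v, of "- n"] multiples_rshift[OF gwD[OF u, of n], of n]], of "shifted_prod a 0 n"]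
      by simp
    then obtain p where p: "coef v (- n) * rshift n (coef u n) = rat_of p" "shifted_prod a 0 n dvd p" by (auto simp: multiples_def)
    obtain P where P: "a dvd P" "p - pshift (- n) p = P - pshift (-1) P" using telescope[of a "nat n" p] p(2) True by auto
    have "rshift (- n) (coef v (- n) * rshift n (coef u n)) = rat_of (pshift (- n) p)" by (simp only: p(1) rshift_rat_of)
    then have "coef u n * rshift (- n) (coef v (- n)) = rat_of (pshift (- n) p)" by (simp add: mult.commute)
    then have "coef u n * rshift (- n) (coef v (- n)) - coef v (- n) * rshift n (coef u n) = rat_of (- (p - pshift (- n) p))"
      by (simp add: p(1))
    also have "- (p - pshift (- n) p) = (- P) - pshift (-1) (- P)" by (simp add: P(2))
    finally show ?thesis using P(1) by (intro exI[of _ "- P"]) simp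
  next
    case False
    have "coef u n * rshift (- n) (coef v (- n)) \<in> multiples (shifted_prod a 0 (- n))"
      using multiples_dvd[OF multiples_mult[OF gwD[OF u, of n] multiples_rshift[OF gwD[OF v, of "- n"], of "- n"]], of "shifted_prod a 0 (- n)"]
      by simp
    then obtain p where p: "coef u n * rshift (- n) (coef v (- n)) = rat_of p" "shifted_prod a 0 (- n) dvd p" by (auto simp: multiples_def)
    obtain P where P: "a dvd P" "p - pshift n p = P - pshift (-1) P" using telescope[of a "nat (- n)" p] p(2) False by auto
    have "rshift n (coef u n * rshift (- n) (coef v (- n))) = rat_of (pshift n p)" by (simp only: p(1) rshift_rat_of)
    then have "coef v (- n) * rshift n (coef u n) = rat_of (pshift n p)" by (simp add: mult.commute)
    then have "coef u n * rshift (- n) (coef v (- n)) - coef v (- n) * rshift n (coef u n) = rat_of (p - pshift n p)"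
      by (simp add: p(1))
    then show ?thesis using P by metis
  qed
  then obtain P where P: "\<And>n. a dvd P n"
    "\<And>n. coef u n * rshift (- n) (coef v (- n)) - coef v (- n) * rshift n (coef u n) = rat_of (P n - pshift (-1) (P n))" by metis
  define R where "R = (\<Sum>n\<in>S. P n)"
  have "coef (u * v - v * u) 0 = rat_of (R - pshift (-1) R)"
  proof -
    have "coef (u * v - v * u) 0 = (\<Sum>n\<in>S. coef u n * rshift (- n) (coef v (- n)) - coef v (- n) * rshift n (coef u n))"
      by (simp only: coef_diff uv vu sum_subtractf)
    also have "\<dots> = rat_of (\<Sum>n\<in>S. P n - pshift (-1) (P n))"
      by (simp only: P(2) rat_of_sum)
    also have "(\<Sum>n\<in>S. P n - pshift (-1) (P n)) = R - pshift (-1) R"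
      by (simp only: R_def sum_subtractf pshift_sum)
    finally show ?thesis .
  qed
  from tau_eq[OF this c, of lam]
  have "tau lam c (u * v - v * u) = (\<Sum>i\<in>UNIV. c i * poly R (lam i))" .
  also have "\<dots> = 0"
  proof -
    have "a dvd R" unfolding R_def by (rule dvd_sum) (rule P)
    then show ?thesis using root by (auto elim!: dvdE)
  qed
  finally show ?thesis
    using tau_add[OF gwa_sub_mult[OF v u] gwa_sub_diff[OF gwa_sub_mult[OF u v] gwa_sub_mult[OF v u]] c, of lam] by simp
qed

section \<open>Idempotents of rank one\<close>

text \<open>
  The last condition says that the corner \<open>f M f\<close> has no nonzero element of square zero. It is the form of ``rank one''
  that visibly passes to and from full corners.
\<close>

definition uniform_idem :: "skl set \<Rightarrow> 'i set \<Rightarrow> ('i \<Rightarrow> 'i \<Rightarrow> skl) \<Rightarrow> bool" where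
  "uniform_idem S I f \<longleftrightarrow> finite I \<and> (\<forall>p\<in>I. \<forall>q\<in>I. f p q \<in> S) \<and>
     (\<forall>p\<in>I. \<forall>q\<in>I. (\<Sum>r\<in>I. f p r * f r q) = f p q) \<and> (\<exists>p\<in>I. \<exists>q\<in>I. f p q \<noteq> 0) \<and>
     (\<forall>m. (\<forall>p\<in>I. \<forall>q\<in>I. m p q \<in> S) \<longrightarrow>
          (\<forall>p\<in>I. \<forall>q\<in>I. (\<Sum>r\<in>I. f p r * m r q) = m p q) \<longrightarrow>
          (\<forall>p\<in>I. \<forall>q\<in>I. (\<Sum>r\<in>I. m p r * f r q) = m p q) \<longrightarrow>
          (\<forall>p\<in>I. \<forall>q\<in>I. (\<Sum>r\<in>I. m p r * m r q) = 0) \<longrightarrow> (\<forall>p\<in>I. \<forall>q\<in>I. m p q = 0))"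

text \<open>A nonzero column \<open>q0\<close> of \<open>f\<close> generates a principal left ideal,
  which gives w with f w = w and a left inverse of w. For a row y of f - w d one has y w = 0, so
  column \<open>q0\<close> times y, cleared of denominators, is an element of square zero in the
  corner of \<open>f\<close>. Hence y = 0.\<close>

lemma uniform_idem_factor:
  fixes f :: "'i \<Rightarrow> 'i \<Rightarrow> skl"
  assumes f: "uniform_idem (gwa_sub a) I f" and a: "a \<noteq> 0"
  shows "\<exists>w d. (\<forall>p\<in>I. \<forall>q\<in>I. f p q = w p * d q) \<and> (\<Sum>q\<in>I. d q * w q) = 1"
proof -
  have I: "finite I" and fgw: "\<And>p q. p \<in> I \<Longrightarrow> q \<in> I \<Longrightarrow> f p q \<in> gwa_sub a"
    and idem: "\<And>p q. p \<in> I \<Longrightarrow> q \<in> I \<Longrightarrow> (\<Sum>r\<in>I. f p r * f r q) = f p q"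
    using f unfolding uniform_idem_def by blast+
  obtain p0 q0 where pq0: "p0 \<in> I" "q0 \<in> I" "f p0 q0 \<noteq> 0"
    using f unfolding uniform_idem_def by blast
  have "\<exists>p\<in>I. f p q0 \<noteq> 0" using pq0 by blast
  from left_ideal_principal[OF I this]
  obtain z w r where z: "z \<noteq> 0" "\<And>p. p \<in> I \<Longrightarrow> f p q0 = w p * z" and rw: "(\<Sum>p\<in>I. r p * w p) = 1" by blast
  have fw: "(\<Sum>q\<in>I. f p q * w q) = w p" if p: "p \<in> I" for p
  proof -
    have "(\<Sum>q\<in>I. f p q * w q) * z = (\<Sum>q\<in>I. f p q * f q q0)"
      unfolding sum_distrib_right by (intro sum.cong refl) (simp add: z(2) mult.assoc)
    also have "\<dots> = w p * z" using idem[OF p pq0(2)] z(2)[OF p] by simp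
    finally show ?thesis using z(1) by simp
  qed
  \<comment> \<open>Passing from \<open>r\<close> to r f keeps the property of being a left inverse
    of \<open>w\<close> and adds d f = d.\<close>
  define d where "d q = (\<Sum>p\<in>I. r p * f p q)" for q
  have dw: "(\<Sum>q\<in>I. d q * w q) = 1"
  proof -
    have "(\<Sum>q\<in>I. d q * w q) = (\<Sum>p\<in>I. r p * (\<Sum>q\<in>I. f p q * w q))"
      unfolding d_def sum_distrib_right sum_distrib_left by (subst sum.swap) (simp add: mult.assoc)
    also have "\<dots> = 1" using fw rw by simp
    finally show ?thesis .
  qed
  have df: "(\<Sum>q\<in>I. d q * f q s) = d s" if s: "s \<in> I" for s
  proof -
    have "(\<Sum>q\<in>I. d q * f q s) = (\<Sum>p\<in>I. r p * (\<Sum>q\<in>I. f p q * f q s))"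
      unfolding d_def sum_distrib_right sum_distrib_left by (subst sum.swap) (simp add: mult.assoc)
    also have "\<dots> = d s" unfolding d_def using idem s by (intro sum.cong refl) simp
    finally show ?thesis .
  qed
  have "f p q = w p * d q" if p: "p \<in> I" and q: "q \<in> I" for p q
  proof -
    define y where "y q = f p q - w p * d q" for q
    have yf: "(\<Sum>q\<in>I. y q * f q s) = y s" if s: "s \<in> I" for s
    proof -
      have "(\<Sum>q\<in>I. y q * f q s) = (\<Sum>q\<in>I. f p q * f q s) - w p * (\<Sum>q\<in>I. d q * f q s)"
        by (simp add: y_def left_diff_distrib sum_subtractf sum_distrib_left mult.assoc)
      then show ?thesis by (simp add: idem[OF p s] df[OF s] y_def)
    qed
    have yw: "(\<Sum>q\<in>I. y q * w q) = 0"
    proof -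
      have "(\<Sum>q\<in>I. y q * w q) = (\<Sum>q\<in>I. f p q * w q) - w p * (\<Sum>q\<in>I. d q * w q)"
        by (simp add: y_def left_diff_distrib sum_subtractf sum_distrib_left mult.assoc)
      then show ?thesis by (simp add: fw[OF p] dw)
    qed
    obtain P where P: "P \<noteq> 0" "\<And>i. i \<in> I \<Longrightarrow> monomial (rat_of P) 0 * y i \<in> gwa_sub a"
      using clear_denominators[OF a I, of y] by blast
    define c where "c = monomial (rat_of P) 0"
    have "c \<noteq> 0" using P(1) by (metis c_def coef_0 coef_monomial rat_of_eq_0_iff)
    define m where "m s t = f s q0 * (c * y t)" for s t
    have "\<forall>s\<in>I. \<forall>t\<in>I. m s t \<in> gwa_sub a"
      using fgw pq0 P(2) by (auto simp: m_def c_def intro: gwa_sub_mult)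
    moreover have "\<forall>s\<in>I. \<forall>t\<in>I. (\<Sum>k\<in>I. f s k * m k t) = m s t"
      using idem[OF _ pq0(2)] by (simp add: m_def flip: mult.assoc sum_distrib_right)
    moreover have "\<forall>s\<in>I. \<forall>t\<in>I. (\<Sum>k\<in>I. m s k * f k t) = m s t"
      using yf by (simp add: m_def mult.assoc flip: sum_distrib_left)
    moreover have "\<forall>s\<in>I. \<forall>t\<in>I. (\<Sum>k\<in>I. m s k * m k t) = 0"
    proof (intro ballI)
      fix s t assume "s \<in> I" "t \<in> I"
      have "(\<Sum>k\<in>I. m s k * m k t) = (\<Sum>k\<in>I. f s q0 * c * (y k * w k) * (z * c * y t))"
        by (intro sum.cong refl) (simp add: m_def z(2) mult.assoc)
      also have "\<dots> = f s q0 * c * (\<Sum>k\<in>I. y k * w k) * (z * c * y t)"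
        by (simp add: sum_distrib_left sum_distrib_right)
      finally show "(\<Sum>k\<in>I. m s k * m k t) = 0" using yw by simp
    qed
    ultimately have "\<forall>s\<in>I. \<forall>t\<in>I. m s t = 0"
      using f unfolding uniform_idem_def by blast
    then have "m p0 q = 0" using pq0 q by blast
    then have "y q = 0" using pq0 \<open>c \<noteq> 0\<close> by (simp add: m_def)
    then show ?thesis by (simp add: y_def)
  qed
  then show ?thesis using dw by blast
qed

section \<open>Truncated banded matrices\<close>

lemma mat_supported: "supported (- b) b u \<Longrightarrow> \<bar>l - k\<bar> > b \<Longrightarrow> mat u l k = 0"
  unfolding supported_def mat_def by (metis abs_le_iff minus_le_iff not_le rshift_0)

lemma mat_mult_supported:
  assumes "supported (- b) b u" "{l - b..l + b} \<subseteq> J" "finite J"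
  shows "mat (u * v) l k = (\<Sum>j\<in>J. mat u l j * mat v j k)"
proof (rule mat_mult[OF assms(3)])
  fix j assume "coef u (l - j) \<noteq> 0"
  then have "- b \<le> l - j \<and> l - j \<le> b" using assms(1) unfolding supported_def by blast
  then show "j \<in> J" using assms(2) by auto
qed

text \<open>In row l the coefficients are evaluated at \<open>lam i\<close> + l, and there are
  finitely many coefficients and roots.\<close>

lemma uniform_regular:
  fixes w :: "'p \<Rightarrow> skl" and lam :: "'i::finite \<Rightarrow> complex"
  assumes "finite I"
  shows "\<exists>N. \<forall>p\<in>I. \<forall>i. \<forall>l k. l \<ge> N \<longrightarrow> (\<exists>v. has_value (mat (w p) l k) (lam i) v)"
proof -
  have "\<exists>N. \<forall>n\<ge>N. \<exists>v. has_value r (lam i + of_int n) v" for r i by (rule eventually_has_value)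
  then obtain M where M: "\<And>r i n. n \<ge> M r i \<Longrightarrow> \<exists>v. has_value r (lam i + of_int n) v" by metis
  define A where "A = (\<Union>p\<in>I. \<Union>i\<in>UNIV. \<Union>n\<in>supp (w p). {M (coef (w p) n) i})"
  have "finite A" using assms by (auto simp: A_def)
  then obtain N where N: "\<And>x. x \<in> A \<Longrightarrow> x \<le> N" by (meson bdd_above.E bdd_above_finite)
  have "\<exists>v. has_value (mat (w p) l k) (lam i) v" if "p \<in> I" "l \<ge> N" for p i l k
  proof (cases "coef (w p) (l - k) = 0")
    case True
    then show ?thesis using has_value_rat_of[of 0] by (auto simp: mat_def intro!: exI)
  next
    case False
    then have "M (coef (w p) (l - k)) i \<le> N" using that by (intro N) (auto simp: A_def)
    then show ?thesis using M[of "coef (w p) (l - k)" i l] that by (auto simp: mat_def intro: has_value_rshift)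
  qed
  then show ?thesis by blast
qed

lemma sum_rotate: "(\<Sum>i\<in>A. \<Sum>j\<in>B. \<Sum>k\<in>C. f i j k) = (\<Sum>k\<in>C. \<Sum>i\<in>A. \<Sum>j\<in>B. f i j k)"
proof -
  have "(\<Sum>i\<in>A. \<Sum>j\<in>B. \<Sum>k\<in>C. f i j k) = (\<Sum>i\<in>A. \<Sum>k\<in>C. \<Sum>j\<in>B. f i j k)"
    by (intro sum.cong refl sum.swap)
  also have "\<dots> = (\<Sum>k\<in>C. \<Sum>i\<in>A. \<Sum>j\<in>B. f i j k)" by (rule sum.swap)
  finally show ?thesis .
qed

text \<open>\<open>H\<close> is the compression of w (1 - \<Pi>_N) d to the indices 1, ..., N + b.
  It differs from the polynomial matrix \<open>F\<close> of w d by a tail that is regular at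
  \<open>z\<close>. Its square differs from it by products in \<open>F\<close> passing through
  indices \<le> 0, and these vanish at \<open>z\<close>. So the values of \<open>H\<close> at
  \<open>z\<close> form an idempotent matrix.\<close>

lemma band_trace_integer:
  fixes lam :: "'i::finite \<Rightarrow> complex" and w d :: "'p \<Rightarrow> skl"
  assumes I: "finite I" and b: "b \<ge> 0" "\<And>p. p \<in> I \<Longrightarrow> supported (- b) b (w p)" "\<And>p. p \<in> I \<Longrightarrow> supported (- b) b (d p)"
    and dw: "(\<Sum>p\<in>I. d p * w p) = 1"
    and gwa_sub: "\<And>p q. p \<in> I \<Longrightarrow> q \<in> I \<Longrightarrow> w p * d q \<in> gwa_sub a"
    and root: "poly a z = 0"
    and N: "N \<ge> b + 1"
    and reg: "\<And>p l k. p \<in> I \<Longrightarrow> l \<ge> N + 1 - b \<Longrightarrow> \<exists>v. has_value (mat (w p) l k) z v"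
             "\<And>p l k. p \<in> I \<Longrightarrow> l \<ge> N + 1 - b \<Longrightarrow> \<exists>v. has_value (mat (d p) l k) z v"
  shows "\<exists>t\<in>\<int>. has_value (\<Sum>p\<in>I. \<Sum>l\<in>{1..N+b}. \<Sum>j\<in>{1-b..N}. mat (w p) l j * mat (d p) j l) z t"
proof -
  define W where "W p l j = mat (w p) l j" for p l j
  define D where "D p l j = mat (d p) l j" for p l j
  define F where "F p q l k = mat (w p * d q) l k" for p q l k
  \<comment> \<open>By the band width, rows l > N + b of \<open>W\<close> have no entries in columns
    j \<le> N, and rows l \<ge> 1 have none in columns j < 1 - b. This explains both the size of the
    box and the range of j.\<close>
  define X where "X = N + b"
  define H where "H = (\<lambda>(p, l) (q, k). \<Sum>j\<in>{1-b..N}. W p l j * D q j k)"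
  have W0: "W p l j = 0" if "p \<in> I" "\<bar>l - j\<bar> > b" for p l j
    using mat_supported[OF b(2)[OF that(1)] that(2)] by (simp add: W_def)
  have D0: "D p l j = 0" if "p \<in> I" "\<bar>l - j\<bar> > b" for p l j
    using mat_supported[OF b(3)[OF that(1)] that(2)] by (simp add: D_def)
  have F_eq: "F p q l k = (\<Sum>j\<in>J. W p l j * D q j k)"
    if "p \<in> I" "q \<in> I" "finite J" "\<And>j. \<bar>l - j\<bar> \<le> b \<Longrightarrow> \<bar>j - k\<bar> \<le> b \<Longrightarrow> j \<in> J" for p q l k J
  proof -
    have "F p q l k = (\<Sum>j\<in>J \<union> {l - b..l + b}. W p l j * D q j k)"
      unfolding F_def W_def D_def using that b(2) by (intro mat_mult_supported[of b]) auto
    also have "\<dots> = (\<Sum>j\<in>J. W p l j * D q j k)"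
    proof (rule sum.mono_neutral_right)
      show "\<forall>j\<in>J \<union> {l - b..l + b} - J. W p l j * D q j k = 0"
      proof
        fix j assume "j \<in> J \<union> {l - b..l + b} - J"
        then have "\<bar>l - j\<bar> > b \<or> \<bar>j - k\<bar> > b" using that(4)[of j] by force
        then show "W p l j * D q j k = 0" using W0[OF that(1)] D0[OF that(2)] by auto
      qed
    qed (use that in auto)
    finally show ?thesis .
  qed
  have reg_F: "\<exists>v. has_value (F p q l k) z v" if "p \<in> I" "q \<in> I" for p q l k
    using mat_gwa_sub[OF gwa_sub[OF that], of l k] has_value_rat_of unfolding F_def multiples_def by fastforce
  have F_zero: "has_value (F p q l k) z 0" if pq: "p \<in> I" "q \<in> I" "l \<le> 0" "0 < k" for p q l k
  proof -
    obtain P where P: "F p q l k = rat_of P" "shifted_prod a l k dvd P"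
      using mat_gwa_sub[OF gwa_sub[OF pq(1,2)], of l k] by (auto simp: F_def multiples_def)
    have "pshift 0 a dvd P" using pshift_dvd_shifted_prod[of l 0 k a] pq P(2) dvd_trans by blast
    then have "poly P z = 0" using root by (auto elim!: dvdE)
    then show ?thesis using P has_value_rat_of[of P z] by simp
  qed
  \<comment> \<open>If one outer index is \<le> 0 and the other \<ge> 1, the middle index is within
    \<open>b\<close> of both, hence between 1 - b and b \<le> N: the truncation at \<open>N\<close>
    removes nothing.\<close>
  have H_F: "(\<Sum>j\<in>{1-b..N}. W p l j * D q j k) = F p q l k"
    if "p \<in> I" "q \<in> I" "l \<le> 0 \<and> k \<ge> 1 \<or> l \<ge> 1 \<and> k \<le> 0" for p q l k
    using that N b(1) by (intro F_eq[symmetric]) auto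
  define J where "J = I \<times> {1..X}"
  have J: "finite J" using I by (simp add: J_def)
  \<comment> \<open>At small indices \<open>W\<close> and \<open>D\<close> may have poles, so
    regularity is read off from the complementary sum over j > N, where nonzero entries lie in rows
    free of poles.\<close>
  have reg_H: "\<exists>v. has_value (H x y) z v" if "x \<in> J" "y \<in> J" for x y
  proof -
    obtain p l q k where x: "x = (p, l)" "y = (q, k)" by fastforce
    have pq: "p \<in> I" "q \<in> I" "1 \<le> l" "l \<le> X" using that by (auto simp: J_def x)
    have "F p q l k = (\<Sum>j\<in>{1-b..N} \<union> {N+1..X+b}. W p l j * D q j k)"
      using pq by (intro F_eq) auto
    also have "\<dots> = H x y + (\<Sum>j\<in>{N+1..X+b}. W p l j * D q j k)"
      unfolding H_def x by (subst sum.union_disjoint) auto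
    finally have H: "H x y = F p q l k - (\<Sum>j\<in>{N+1..X+b}. W p l j * D q j k)" by simp
    have "\<exists>v. has_value (W p l j * D q j k) z v" if j: "j \<in> {N+1..X+b}" for j
    proof (cases "l \<ge> N + 1 - b")
      case True
      have jN: "j \<ge> N + 1 - b" using j b(1) by auto
      obtain v v' where "has_value (W p l j) z v" "has_value (D q j k) z v'"
        using reg(1)[OF pq(1) True] reg(2)[OF pq(2) jN] unfolding W_def D_def by blast
      then show ?thesis using has_value_mult by blast
    next
      case False
      then have "W p l j = 0" using j by (intro W0[OF pq(1)]) auto
      then show ?thesis using has_value_rat_of[of 0 z] by auto
    qed
    then obtain v where "\<And>j. j \<in> {N+1..X+b} \<Longrightarrow> has_value (W p l j * D q j k) z (v j)" by metis
    then have "has_value (\<Sum>j\<in>{N+1..X+b}. W p l j * D q j k) z (\<Sum>j\<in>{N+1..X+b}. v j)"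
      by (rule has_value_sum)
    then show ?thesis unfolding H using reg_F[OF pq(1,2), of l k] has_value_diff by blast
  qed
  define h where "h x y = (SOME v. has_value (H x y) z v)" for x y
  have h: "has_value (H x y) z (h x y)" if "x \<in> J" "y \<in> J" for x y
    unfolding h_def using reg_H[OF that] by (rule someI_ex)
  \<comment> \<open>This is d w = 1 with the middle index split into the box and the part \<le> 0;
    the bound 1 - 2b is the least j, namely 1 - b, minus the band width.\<close>
  have DW: "(\<Sum>q\<in>I. \<Sum>k\<in>{1..X}. D q j k * W q k j')
      = (if j = j' then 1 else 0) - (\<Sum>q\<in>I. \<Sum>k\<in>{1-2*b..0}. D q j k * W q k j')"
    if j: "j \<in> {1-b..N}" for j j'
  proof -
    have "mat (d q * w q) j j' = (\<Sum>k\<in>{1-2*b..0} \<union> {1..X}. D q j k * W q k j')" if "q \<in> I" for q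
      unfolding D_def W_def using j b(1) N by (intro mat_mult_supported[OF b(3)[OF that]]) (auto simp: X_def)
    moreover have "(\<Sum>q\<in>I. mat (d q * w q) j j') = (if j = j' then 1 else 0)"
      by (simp add: dw mat_1 flip: mat_sum)
    ultimately have "(if j = j' then 1 else 0) = (\<Sum>q\<in>I. \<Sum>k\<in>{1-2*b..0} \<union> {1..X}. D q j k * W q k j')"
      by simp
    also have "\<dots> = (\<Sum>q\<in>I. \<Sum>k\<in>{1-2*b..0}. D q j k * W q k j') + (\<Sum>q\<in>I. \<Sum>k\<in>{1..X}. D q j k * W q k j')"
      by (subst sum.union_disjoint) (auto simp: sum.distrib)
    finally show ?thesis by simp
  qed
  have square: "(\<Sum>y\<in>J. H (p, l) y * H y (s, r))
      = H (p, l) (s, r) - (\<Sum>q\<in>I. \<Sum>k\<in>{1-2*b..0}. F p q l k * F q s k r)"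
    if ps: "p \<in> I" "s \<in> I" "l \<in> {1..X}" "r \<in> {1..X}" for p l s r
  proof -
    let ?S = "{1-b..N}"
    have pull: "(\<Sum>q\<in>I. \<Sum>k\<in>K. (\<Sum>j\<in>?S. W p l j * D q j k) * (\<Sum>j'\<in>?S. W q k j' * D s j' r))
        = (\<Sum>j\<in>?S. \<Sum>j'\<in>?S. W p l j * (\<Sum>q\<in>I. \<Sum>k\<in>K. D q j k * W q k j') * D s j' r)" for K :: "int set"
    proof -
      have "(\<Sum>q\<in>I. \<Sum>k\<in>K. (\<Sum>j\<in>?S. W p l j * D q j k) * (\<Sum>j'\<in>?S. W q k j' * D s j' r))
          = (\<Sum>q\<in>I. \<Sum>k\<in>K. \<Sum>j\<in>?S. \<Sum>j'\<in>?S. W p l j * (D q j k * W q k j') * D s j' r)"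
        unfolding sum_product by (intro sum.cong refl) (simp add: ac_simps)
      also have "\<dots> = (\<Sum>j\<in>?S. \<Sum>j'\<in>?S. \<Sum>q\<in>I. \<Sum>k\<in>K. W p l j * (D q j k * W q k j') * D s j' r)"
        unfolding sum_rotate[where A = I] ..
      also have "\<dots> = (\<Sum>j\<in>?S. \<Sum>j'\<in>?S. W p l j * (\<Sum>q\<in>I. \<Sum>k\<in>K. D q j k * W q k j') * D s j' r)"
        unfolding sum_distrib_left sum_distrib_right ..
      finally show ?thesis .
    qed
    have "(\<Sum>y\<in>J. H (p, l) y * H y (s, r))
        = (\<Sum>q\<in>I. \<Sum>k\<in>{1..X}. (\<Sum>j\<in>?S. W p l j * D q j k) * (\<Sum>j'\<in>?S. W q k j' * D s j' r))"
      unfolding J_def H_def sum.cartesian_product by (intro sum.cong refl) auto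
    also have "\<dots> = (\<Sum>j\<in>?S. \<Sum>j'\<in>?S. W p l j * (\<Sum>q\<in>I. \<Sum>k\<in>{1..X}. D q j k * W q k j') * D s j' r)"
      by (rule pull)
    also have "\<dots> = (\<Sum>j\<in>?S. \<Sum>j'\<in>?S. (if j = j' then W p l j * D s j' r else 0)
        - W p l j * (\<Sum>q\<in>I. \<Sum>k\<in>{1-2*b..0}. D q j k * W q k j') * D s j' r)"
      by (intro sum.cong refl) (simp add: DW algebra_simps)
    also have "\<dots> = H (p, l) (s, r) - (\<Sum>j\<in>?S. \<Sum>j'\<in>?S. W p l j * (\<Sum>q\<in>I. \<Sum>k\<in>{1-2*b..0}. D q j k * W q k j') * D s j' r)"
      unfolding sum_subtractf H_def by simp
    also have "(\<Sum>j\<in>?S. \<Sum>j'\<in>?S. W p l j * (\<Sum>q\<in>I. \<Sum>k\<in>{1-2*b..0}. D q j k * W q k j') * D s j' r)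
        = (\<Sum>q\<in>I. \<Sum>k\<in>{1-2*b..0}. (\<Sum>j\<in>?S. W p l j * D q j k) * (\<Sum>j'\<in>?S. W q k j' * D s j' r))"
      by (rule pull[symmetric])
    also have "\<dots> = (\<Sum>q\<in>I. \<Sum>k\<in>{1-2*b..0}. F p q l k * F q s k r)"
      using ps by (intro sum.cong refl) (auto simp: H_F)
    finally show ?thesis .
  qed
  have "(\<Sum>y\<in>J. h x y * h y u) = h x u" if xu: "x \<in> J" "u \<in> J" for x u
  proof -
    obtain p l s r where x: "x = (p, l)" "u = (s, r)" by fastforce
    have ps: "p \<in> I" "s \<in> I" "l \<in> {1..X}" "r \<in> {1..X}" using xu by (auto simp: J_def x)
    have 1: "has_value (\<Sum>y\<in>J. H x y * H y u) z (\<Sum>y\<in>J. h x y * h y u)"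
      by (intro has_value_sum has_value_mult h xu)
    have "has_value (F p q l k * F q s k r) z 0" if kq: "q \<in> I" "k \<in> {1-2*b..0}" for q k
    proof -
      obtain v where "has_value (F p q l k) z v" using reg_F[OF ps(1) kq(1)] by blast
      moreover have "has_value (F q s k r) z 0" using ps kq by (intro F_zero) auto
      ultimately show ?thesis using has_value_mult by fastforce
    qed
    then have "has_value (\<Sum>q\<in>I. \<Sum>k\<in>{1-2*b..0}. F p q l k * F q s k r) z (\<Sum>q\<in>I. \<Sum>k\<in>{1-2*b..0}. 0)"
      by (intro has_value_sum) auto
    then have "has_value (\<Sum>y\<in>J. H x y * H y u) z (h x u - 0)"
      unfolding x square[OF ps] using h[OF xu] by (intro has_value_diff) (auto simp: x)
    then show ?thesis using has_value_unique[OF 1] by simp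
  qed
  then have "(\<Sum>x\<in>J. h x x) \<in> \<nat>"
    by (rule idempotent_trace_Nats[OF J])
  moreover have "has_value (\<Sum>x\<in>J. H x x) z (\<Sum>x\<in>J. h x x)"
    by (intro has_value_sum h)
  moreover have "(\<Sum>x\<in>J. H x x) = (\<Sum>p\<in>I. \<Sum>l\<in>{1..N+b}. \<Sum>j\<in>{1-b..N}. mat (w p) l j * mat (d p) j l)"
  proof -
    have "(\<Sum>x\<in>J. H x x) = (\<Sum>p\<in>I. \<Sum>l\<in>{1..X}. H (p, l) (p, l))"
      unfolding J_def sum.cartesian_product by (intro sum.cong refl) auto
    then show ?thesis by (simp add: H_def X_def W_def D_def)
  qed
  ultimately show ?thesis using Nats_subset_Ints by auto
qed

text \<open>Translating h by one moves the box of indices one step along the diagonal. What is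
  gained is column j = N + 1, a diagonal entry of d w = 1; what is lost is row l = 1, a diagonal
  entry of w d.\<close>

lemma band_trace_shift:
  fixes w d :: "'p \<Rightarrow> skl"
  assumes I: "finite I" and b: "b \<ge> 0" "\<And>p. p \<in> I \<Longrightarrow> supported (- b) b (w p)" "\<And>p. p \<in> I \<Longrightarrow> supported (- b) b (d p)"
    and dw: "(\<Sum>p\<in>I. d p * w p) = 1" and N: "N \<ge> b + 1"
  defines "T \<equiv> (\<Sum>p\<in>I. \<Sum>l\<in>{1..N+b}. \<Sum>j\<in>{1-b..N}. mat (w p) l j * mat (d p) j l)"
  shows "rshift 1 T - T = 1 - mat (\<Sum>p\<in>I. w p * d p) 1 1"
proof -
  define g where "g l j = (\<Sum>p\<in>I. mat (w p) l j * mat (d p) j l)" for l j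
  have g0: "g l j = 0" if "\<bar>l - j\<bar> > b" for l j
    unfolding g_def using mat_supported[OF b(2) that] by (intro sum.neutral) auto
  define X where "X = N + b"
  have T1: "T = (\<Sum>l\<in>{1..X}. \<Sum>j\<in>{1-b..N}. g l j)"
    unfolding T_def g_def X_def by (subst sum.swap) (rule sum.cong[OF refl], rule sum.swap)
  have "rshift 1 T = (\<Sum>l\<in>{1..X}. \<Sum>j\<in>{1-b..N}. g (1 + l) (1 + j))"
    unfolding T1 g_def by (simp add: rshift_sum rshift_mat)
  also have "\<dots> = (\<Sum>l\<in>(+) 1 ` {1..X}. \<Sum>j\<in>(+) 1 ` {1-b..N}. g l j)"
    by (simp add: sum.reindex del: image_add_atLeastAtMost)
  also have "\<dots> = (\<Sum>l\<in>{2..X+1}. \<Sum>j\<in>{2-b..N+1}. g l j)"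
    by (simp add: add.commute)
  \<comment> \<open>For l \<ge> 2 column 1 - b lies outside the band, so it can be added; likewise
    row X + 1 below. Both boxes then differ by one row and one column of a common box.\<close>
  also have "\<dots> = (\<Sum>l\<in>{2..X+1}. \<Sum>j\<in>{1-b..N+1}. g l j)"
    by (intro sum.cong refl sum.mono_neutral_left) (auto intro!: g0)
  finally have t: "rshift 1 T = (\<Sum>l\<in>{2..X+1}. \<Sum>j\<in>{1-b..N+1}. g l j)" .
  have "T = (\<Sum>l\<in>{1..X+1}. \<Sum>j\<in>{1-b..N}. g l j)"
    unfolding T1 by (rule sum.mono_neutral_left) (auto intro!: sum.neutral g0 simp: X_def)
  moreover have "(\<Sum>l\<in>{1..X+1}. \<Sum>j\<in>{1-b..N+1}. g l j) = (\<Sum>l\<in>{1..X+1}. \<Sum>j\<in>{1-b..N}. g l j) + (\<Sum>l\<in>{1..X+1}. g l (N+1))"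
  proof -
    have *: "{1-b..N+1} = insert (N+1) {1-b..N}" using N b by auto
    show ?thesis unfolding * by (simp add: sum.distrib add.commute)
  qed
  moreover have "(\<Sum>l\<in>{1..X+1}. \<Sum>j\<in>{1-b..N+1}. g l j) = (\<Sum>l\<in>{2..X+1}. \<Sum>j\<in>{1-b..N+1}. g l j) + (\<Sum>j\<in>{1-b..N+1}. g 1 j)"
  proof -
    have *: "{1..X+1} = insert 1 {2..X+1}" using N b by (auto simp: X_def)
    show ?thesis unfolding * by (simp add: add.commute)
  qed
  ultimately have "rshift 1 T + (\<Sum>j\<in>{1-b..N+1}. g 1 j) = T + (\<Sum>l\<in>{1..X+1}. g l (N+1))"
    unfolding t by metis
  then have "rshift 1 T - T = (\<Sum>l\<in>{1..X+1}. g l (N+1)) - (\<Sum>j\<in>{1-b..N+1}. g 1 j)"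
  proof -
    assume "rshift 1 T + (\<Sum>j\<in>{1-b..N+1}. g 1 j) = T + (\<Sum>l\<in>{1..X+1}. g l (N+1))"
    then have "rshift 1 T = T + (\<Sum>l\<in>{1..X+1}. g l (N+1)) - (\<Sum>j\<in>{1-b..N+1}. g 1 j)"
      by (simp only: eq_diff_eq)
    then show ?thesis by simp
  qed
  also have "(\<Sum>l\<in>{1..X+1}. g l (N+1)) = mat (\<Sum>p\<in>I. d p * w p) (N+1) (N+1)"
    unfolding g_def mat_sum
  proof (subst sum.swap, rule sum.cong[OF refl])
    fix p assume p: "p \<in> I"
    have "mat (d p * w p) (N+1) (N+1) = (\<Sum>l\<in>{1..X+1}. mat (d p) (N+1) l * mat (w p) l (N+1))"
      using N b(1) by (intro mat_mult_supported[OF b(3)[OF p]]) (auto simp: X_def)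
    then show "(\<Sum>l\<in>{1..X+1}. mat (w p) l (N+1) * mat (d p) (N+1) l) = mat (d p * w p) (N+1) (N+1)"
      by (simp add: mult.commute)
  qed
  also have "\<dots> = 1" by (simp add: dw mat_1)
  also have "(\<Sum>j\<in>{1-b..N+1}. g 1 j) = mat (\<Sum>p\<in>I. w p * d p) 1 1"
    unfolding g_def mat_sum
  proof (subst sum.swap, rule sum.cong[OF refl])
    fix p assume p: "p \<in> I"
    show "(\<Sum>j\<in>{1-b..N+1}. mat (w p) 1 j * mat (d p) j 1) = mat (w p * d p) 1 1"
      using N b(1) by (intro mat_mult_supported[OF b(2)[OF p], symmetric]) auto
  qed
  finally show ?thesis .
qed

text \<open>By the two preceding lemmas T + S - h is a constant k and T has an integer value t_i at
  \<lambda>_i, so S(\<lambda>_i) = k + \<lambda>_i - t_i. Paired with \<open>c\<close>, the constant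
  drops out, the \<lambda>_i give \<tau>_c(1) and the t_i give an integer.\<close>

theorem uniform_idem_trace:
  fixes lam c :: "'i::finite \<Rightarrow> complex"
  assumes f: "uniform_idem (gwa_sub a) I f" and a: "a \<noteq> 0" and root: "\<And>i. poly a (lam i) = 0"
    and c: "(\<Sum>i\<in>UNIV. c i) = 0" "\<And>i. c i \<in> \<int>"
  shows "tau lam c (\<Sum>p\<in>I. f p p) - tau lam c 1 \<in> \<int>"
proof -
  have I: "finite I" and fgw: "\<And>p q. p \<in> I \<Longrightarrow> q \<in> I \<Longrightarrow> f p q \<in> gwa_sub a"
    using f unfolding uniform_idem_def by blast+
  obtain w d where fwd: "\<And>p q. p \<in> I \<Longrightarrow> q \<in> I \<Longrightarrow> f p q = w p * d q" and dw: "(\<Sum>q\<in>I. d q * w q) = 1"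
    using uniform_idem_factor[OF f a] by blast
  obtain b1 b2 where b12: "\<forall>p\<in>I. supported (- b1) b1 (w p)" "\<forall>p\<in>I. supported (- b2) b2 (d p)"
    using uniform_supported[OF I] by metis
  define b where "b = max 0 (max b1 b2)"
  have b: "b \<ge> 0" "\<And>p. p \<in> I \<Longrightarrow> supported (- b) b (w p)" "\<And>p. p \<in> I \<Longrightarrow> supported (- b) b (d p)"
  proof -
    show "b \<ge> 0" by (simp add: b_def)
    have le: "b1 \<le> b" "b2 \<le> b" by (simp_all add: b_def)
    show "supported (- b) b (w p)" if "p \<in> I" for p
      by (rule supported_mono[OF b12(1)[rule_format, OF that]]) (use le in auto)
    show "supported (- b) b (d p)" if "p \<in> I" for p
      by (rule supported_mono[OF b12(2)[rule_format, OF that]]) (use le in auto)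
  qed
  obtain N1 where N1: "\<forall>p\<in>I. \<forall>i. \<forall>l k. l \<ge> N1 \<longrightarrow> (\<exists>v. has_value (mat (w p) l k) (lam i) v)"
    using uniform_regular[OF I] by blast
  obtain N2 where N2: "\<forall>p\<in>I. \<forall>i. \<forall>l k. l \<ge> N2 \<longrightarrow> (\<exists>v. has_value (mat (d p) l k) (lam i) v)"
    using uniform_regular[OF I] by blast
  \<comment> \<open>The slack \<open>b\<close> is needed because rows from N + 1 - b on must be free
    of poles.\<close>
  define N where "N = max (b + 1) (max (N1 + b) (N2 + b))"
  have N: "N \<ge> b + 1" "N + 1 - b \<ge> N1" "N + 1 - b \<ge> N2" by (auto simp: N_def)
  define T where "T = (\<Sum>p\<in>I. \<Sum>l\<in>{1..N+b}. \<Sum>j\<in>{1-b..N}. mat (w p) l j * mat (d p) j l)"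
  have "\<exists>t\<in>\<int>. has_value T (lam i) t" for i
    unfolding T_def
  proof (rule band_trace_integer[OF I b dw _ root N(1)])
    show "w p * d q \<in> gwa_sub a" if "p \<in> I" "q \<in> I" for p q using fgw[OF that] fwd[OF that] by simp
    show "\<exists>v. has_value (mat (w p) l k) (lam i) v" if "p \<in> I" "N + 1 - b \<le> l" for p l k
      using N1 N that by auto
    show "\<exists>v. has_value (mat (d p) l k) (lam i) v" if "p \<in> I" "N + 1 - b \<le> l" for p l k
      using N2 N that by auto
  qed
  then obtain t where t: "\<And>i. t i \<in> \<int>" "\<And>i. has_value T (lam i) (t i)" by metis
  define u where "u = (\<Sum>p\<in>I. f p p)"
  have ugw: "u \<in> gwa_sub a" unfolding u_def using fgw by (intro gwa_sub_sum) auto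
  obtain S where S: "coef u 0 = rat_of (S - pshift (-1) S)" using gwa_sub_primitive[OF ugw] by blast
  have "(\<Sum>p\<in>I. w p * d p) = u" unfolding u_def using fwd by (intro sum.cong refl) auto
  then have "rshift 1 T - T = 1 - mat u 1 1"
    using band_trace_shift[OF I b dw N(1)] unfolding T_def by simp
  also have "mat u 1 1 = rat_of (pshift 1 S) - rat_of S" by (simp add: mat_def S)
  finally have "rshift 1 (T + rat_of S - rat_of [:0, 1:]) = T + rat_of S + (1 - rat_of (pshift 1 [:0, 1:]))"
    by (simp add: algebra_simps)
  also have "pshift 1 [:0, 1:] = [:0, 1:] + 1" by (rule poly_ext) simp
  finally have "rshift 1 (T + rat_of S - rat_of [:0, 1:]) = T + rat_of S - rat_of [:0, 1:]" by simp
  then obtain k where k: "T + rat_of S - rat_of [:0, 1:] = rat_of [:k:]" using rshift_invariant_const by blast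
  have S_lam: "poly S (lam i) = k + lam i - t i" for i
  proof -
    have "T = rat_of ([:k:] + [:0, 1:] - S)" using k by (simp only: rat_of_add rat_of_diff diff_eq_eq eq_diff_eq)
    then have "has_value T (lam i) (poly ([:k:] + [:0, 1:] - S) (lam i))" using has_value_rat_of by metis
    then have "t i = poly ([:k:] + [:0, 1:] - S) (lam i)" using t(2) has_value_unique by blast
    then show ?thesis by simp
  qed
  have "tau lam c u = (\<Sum>i\<in>UNIV. c i * (k + lam i - t i))"
    unfolding tau_eq[OF S c(1)] by (simp add: S_lam)
  also have "\<dots> = (\<Sum>i\<in>UNIV. c i) * k + (\<Sum>i\<in>UNIV. c i * lam i) - (\<Sum>i\<in>UNIV. c i * t i)"
    by (simp add: algebra_simps sum.distrib sum_subtractf sum_distrib_left)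
  finally have "tau lam c u - tau lam c 1 = - (\<Sum>i\<in>UNIV. c i * t i)"
    by (simp add: c tau_1)
  also have "\<dots> \<in> \<int>" using c t by (intro Ints_minus Ints_sum Ints_mult)
  finally show ?thesis unfolding u_def .
qed

section \<open>Classification of traces\<close>

definition root_poly :: "('i::finite \<Rightarrow> complex) \<Rightarrow> complex poly" where
  "root_poly lam = (\<Prod>i\<in>UNIV. [:- lam i, 1:])"

definition cofactor :: "('i::finite \<Rightarrow> complex) \<Rightarrow> 'i \<Rightarrow> complex poly" where
  "cofactor lam i = (\<Prod>j\<in>UNIV - {i}. [:- lam j, 1:])"

lemma root_poly_cofactor: "root_poly lam = [:- lam i, 1:] * cofactor lam i"
  unfolding root_poly_def cofactor_def by (rule prod.remove) auto

lemma root_poly_nonzero: "root_poly lam \<noteq> 0"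
  by (simp add: root_poly_def)

lemma poly_root_poly [simp]: "poly (root_poly lam) (lam i) = 0"
  by (simp add: root_poly_cofactor[of lam i])

lemma poly_cofactor_other: "i \<noteq> j \<Longrightarrow> poly (cofactor lam i) (lam j) = 0"
  by (auto simp: cofactor_def poly_prod)

lemma poly_cofactor_self: "inj lam \<Longrightarrow> poly (cofactor lam i) (lam i) \<noteq> 0"
  by (auto simp: cofactor_def poly_prod dest: injD)

lemma prod_linear_dvd:
  assumes "finite S" "inj_on lam S" "\<And>i. i \<in> S \<Longrightarrow> poly p (lam i) = 0"
  shows "(\<Prod>i\<in>S. [:- lam i, 1:]) dvd (p :: complex poly)"
  using assms
proof (induction S rule: finite_induct)
  case (insert x F)
  then obtain q where q: "p = (\<Prod>i\<in>F. [:- lam i, 1:]) * q" by (auto elim!: dvdE)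
  have "poly (\<Prod>i\<in>F. [:- lam i, 1:]) (lam x) \<noteq> 0"
    using insert by (auto simp: poly_prod)
  moreover have "poly p (lam x) = 0" using insert by simp
  ultimately have "[:- lam x, 1:] dvd q" unfolding q by (simp add: poly_eq_0_iff_dvd)
  then obtain r where "q = [:- lam x, 1:] * r" by (rule dvdE)
  then have "p = (\<Prod>i\<in>insert x F. [:- lam i, 1:]) * r"
    using insert by (simp only: q prod.insert mult.assoc mult.left_commute not_False_eq_True)
  then show ?case by (rule dvdI)
qed simp

lemma root_poly_dvd: "inj lam \<Longrightarrow> (\<And>i. poly p (lam i) = 0) \<Longrightarrow> root_poly lam dvd p"
  unfolding root_poly_def by (rule prod_linear_dvd) auto

lemma shifted_prod_0_1 [simp]: "shifted_prod a 0 1 = a"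
proof -
  have "{0..<1} = {0 :: int}" by auto
  then show ?thesis by (simp add: shifted_prod_def)
qed

text \<open>The commutator with h multiplies the part of degree n by n, so a trace sees degree zero
  only. There it is a functional of the antidifference P which kills the multiples of a, since
  [P x^-1, x] = P - P(h - 1). By Lagrange interpolation it depends linearly on the values of P at
  the roots.\<close>

lemma trace_classification:
  fixes lam :: "'i::finite \<Rightarrow> complex" and s :: "skl \<Rightarrow> complex"
  assumes lam: "inj lam"
    and add: "\<And>u v. u \<in> gwa_sub (root_poly lam) \<Longrightarrow> v \<in> gwa_sub (root_poly lam) \<Longrightarrow> s (u + v) = s u + s v"
    and smult: "\<And>k u. u \<in> gwa_sub (root_poly lam) \<Longrightarrow> s (monomial (rat_of [:k:]) 0 * u) = k * s u"
    and comm: "\<And>u v. u \<in> gwa_sub (root_poly lam) \<Longrightarrow> v \<in> gwa_sub (root_poly lam) \<Longrightarrow> s (u * v) = s (v * u)"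
  shows "\<exists>c. (\<Sum>i\<in>UNIV. c i) = 0 \<and> (\<forall>u\<in>gwa_sub (root_poly lam). s u = tau lam c u)"
proof -
  let ?a = "root_poly lam"
  have s0: "s 0 = 0" using smult[OF gwa_sub_0, of 0] by simp
  have diff: "s (u - v) = s u - s v" if "u \<in> gwa_sub ?a" "v \<in> gwa_sub ?a" for u v
    using add[OF gwa_sub_diff[OF that] that(2)] by simp
  have sum: "s (sum f S) = (\<Sum>j\<in>S. s (f j))" if "\<And>j. j \<in> S \<Longrightarrow> f j \<in> gwa_sub ?a" for f :: "'x \<Rightarrow> skl" and S
    using that
  proof (induction S rule: infinite_finite_induct)
    case (insert x F)
    then have "sum f F \<in> gwa_sub ?a" by (intro gwa_sub_sum) auto
    then show ?case using insert add by simp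
  qed (simp_all add: s0)
  have monomial_gwa_sub: "monomial (coef u n) n \<in> gwa_sub ?a" if "u \<in> gwa_sub ?a" for u n
    using gwD[OF that, of n] by (auto simp: gwa_sub_def)
  have off: "s (monomial (coef u n) n) = 0" if u: "u \<in> gwa_sub ?a" and n: "n \<noteq> 0" for u n
  proof -
    define m where "m = monomial (coef u n) n"
    define h where "h = monomial (rat_of [:0, 1:]) 0"
    have m: "m \<in> gwa_sub ?a" and h: "h \<in> gwa_sub ?a" using monomial_gwa_sub[OF u] by (simp_all add: m_def h_def)
    have p: "[:of_int n:] = [:0, 1:] - pshift (- n) [:0, 1:]" by (rule poly_ext) simp
    have "h * m - m * h = monomial (rat_of [:of_int n:]) 0 * m"
      unfolding h_def m_def p by (simp add: monomial_mult_monomial monomial_diff algebra_simps flip: monomial_diff)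
    then have "of_int n * s m = s (h * m - m * h)" using smult[OF m, of "of_int n"] by simp
    also have "\<dots> = 0" using diff gwa_sub_mult[OF h m] gwa_sub_mult[OF m h] comm[OF h m] by simp
    finally show ?thesis using n by (simp add: m_def)
  qed
  define x where "x P = s (monomial (rat_of (P - pshift (-1) P)) 0)" for P
  have x_add: "x (P + Q) = x P + x Q" for P Q
  proof -
    have "monomial (rat_of ((P + Q) - pshift (-1) (P + Q))) 0 = monomial (rat_of (P - pshift (-1) P)) 0 + monomial (rat_of (Q - pshift (-1) Q)) 0"
      by (simp add: algebra_simps flip: monomial_add)
    then show ?thesis unfolding x_def by (simp only: add[OF gwa_sub_mon0 gwa_sub_mon0])
  qed
  have x_smult: "x (smult k P) = k * x P" for k P
  proof -
    have "smult k P - pshift (-1) (smult k P) = [:k:] * (P - pshift (-1) P)" by (simp add: smult_diff_right)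
    then have "monomial (rat_of (smult k P - pshift (-1) (smult k P))) 0 = monomial (rat_of [:k:]) 0 * monomial (rat_of (P - pshift (-1) P)) 0"
      by (simp only: monomial_mult_monomial minus_zero rshift_zero add_0 rat_of_mult)
    then show ?thesis unfolding x_def by (simp only: smult[OF gwa_sub_mon0])
  qed
  have x_sum: "x (sum f S) = (\<Sum>j\<in>S. x (f j))" for f :: "'i \<Rightarrow> _" and S
    by (induction S rule: infinite_finite_induct) (auto simp: x_add x_smult[of 0, simplified])
  have x_a: "x P = 0" if "?a dvd P" for P
  proof -
    have y: "monomial (rat_of P) (-1) \<in> gwa_sub ?a" using that by (intro gwa_sub_monomial) simp
    have t: "monomial 1 1 \<in> gwa_sub ?a" using gwa_sub_monomial[of ?a 1 1] by simp
    have "monomial (rat_of P) (-1) * monomial 1 1 - monomial 1 1 * monomial (rat_of P) (-1) = monomial (rat_of (P - pshift (-1) P)) 0"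
      by (simp add: monomial_mult_monomial flip: monomial_diff)
    then show ?thesis unfolding x_def using diff[OF gwa_sub_mult[OF y t] gwa_sub_mult[OF t y]] comm[OF y t] by simp
  qed
  define L where "L i = smult (1 / poly (cofactor lam i) (lam i)) (cofactor lam i)" for i
  define c where "c i = x (L i)" for i
  have L: "poly (L i) (lam j) = (if i = j then 1 else 0)" for i j
    using poly_cofactor_self[OF lam, of i] poly_cofactor_other[of i j lam] by (cases "i = j") (simp_all add: L_def)
  have x_c: "x P = (\<Sum>i\<in>UNIV. c i * poly P (lam i))" for P
  proof -
    define R where "R = P + smult (-1) (\<Sum>i\<in>UNIV. smult (poly P (lam i)) (L i))"
    have "poly R (lam j) = 0" for j
      by (simp add: R_def poly_sum L if_distrib[of "\<lambda>x. _ * x"] cong: if_cong)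
    then have "x R = 0" by (intro x_a root_poly_dvd[OF lam])
    then show ?thesis unfolding R_def x_add x_smult x_sum c_def by (simp add: mult.commute)
  qed
  \<comment> \<open>The constant 1 has difference zero; this forces the coefficients to sum to
    zero.\<close>
  have "(\<Sum>i\<in>UNIV. c i) = x 1" by (simp add: x_c)
  also have "\<dots> = 0" by (simp add: x_def s0)
  finally have c0: "(\<Sum>i\<in>UNIV. c i) = 0" .
  have "s u = tau lam c u" if u: "u \<in> gwa_sub ?a" for u
  proof -
    obtain P where P: "coef u 0 = rat_of (P - pshift (-1) P)" using gwa_sub_primitive[OF u] by blast
    have "s u = s (\<Sum>n\<in>supp u. monomial (coef u n) n)" using skl_eq_sum_monomial[of u] by simp
    also have "\<dots> = (\<Sum>n\<in>supp u. s (monomial (coef u n) n))" using monomial_gwa_sub[OF u] by (rule sum)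
    also have "\<dots> = (\<Sum>n\<in>{0}. s (monomial (coef u n) n))"
      using off[OF u] by (intro sum.mono_neutral_cong) (auto simp: s0)
    also have "\<dots> = x P" by (simp add: P x_def)
    finally show ?thesis using tau_eq[OF P c0, of lam] x_c by simp
  qed
  then show ?thesis using c0 by blast
qed

text \<open>Converse of \<open>uniform_idem_factor\<close>: an element m of the corner equals w k d
  with the scalar k = d m w, and m m = 0 gives k k = 0, hence k = 0 in a domain.\<close>

lemma uniform_idem_of_factor:
  fixes w d :: "'p \<Rightarrow> skl"
  assumes I: "finite I" and S: "\<And>p q. p \<in> I \<Longrightarrow> q \<in> I \<Longrightarrow> w p * d q \<in> S" and dw: "(\<Sum>q\<in>I. d q * w q) = 1"
  shows "uniform_idem S I (\<lambda>p q. w p * d q)"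
  unfolding uniform_idem_def
proof (intro conjI ballI allI impI)
  have dw': "x * (\<Sum>q\<in>I. d q * w q) * y = x * y" for x y using dw by simp
  show "finite I" by (rule I)
  show "w p * d q \<in> S" if "p \<in> I" "q \<in> I" for p q using S that .
  show "(\<Sum>r\<in>I. w p * d r * (w r * d q)) = w p * d q" for p q
    using dw'[of "w p" "d q"] by (simp add: sum_distrib_left sum_distrib_right mult.assoc)
  show "\<exists>p\<in>I. \<exists>q\<in>I. w p * d q \<noteq> 0"
  proof (rule ccontr)
    assume *: "\<not> (\<exists>p\<in>I. \<exists>q\<in>I. w p * d q \<noteq> 0)"
    have "1 = (\<Sum>p\<in>I. d p * w p) * (\<Sum>q\<in>I. d q * w q)" using dw by simp
    also have "\<dots> = (\<Sum>p\<in>I. \<Sum>q\<in>I. d p * (w p * d q) * w q)"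
      unfolding sum_product by (simp add: mult.assoc)
    also have "\<dots> = 0"
    proof (intro sum.neutral ballI)
      fix p q assume "p \<in> I" "q \<in> I"
      then have "w p * d q = 0" using * by blast
      then show "d p * (w p * d q) * w q = 0" by (simp only: mult_zero_right mult_zero_left)
    qed
    finally show False by simp
  qed
  fix m p q
  assume m: "\<forall>p\<in>I. \<forall>q\<in>I. m p q \<in> S" "\<forall>p\<in>I. \<forall>q\<in>I. (\<Sum>r\<in>I. w p * d r * m r q) = m p q"
    "\<forall>p\<in>I. \<forall>q\<in>I. (\<Sum>r\<in>I. m p r * (w r * d q)) = m p q"
    "\<forall>p\<in>I. \<forall>q\<in>I. (\<Sum>r\<in>I. m p r * m r q) = 0" and pq: "p \<in> I" "q \<in> I"
  define y where "y q = (\<Sum>r\<in>I. d r * m r q)" for q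
  define k where "k = (\<Sum>q\<in>I. y q * w q)"
  have m1: "m p q = w p * y q" if "p \<in> I" "q \<in> I" for p q
    using m(2) that unfolding y_def by (simp add: sum_distrib_left mult.assoc)
  have yk: "y q = k * d q" if "q \<in> I" for q
  proof -
    have "y q = (\<Sum>r\<in>I. \<Sum>s\<in>I. d r * (m r s * (w s * d q)))"
      unfolding y_def using m(3) that by (intro sum.cong refl) (simp flip: sum_distrib_left)
    also have "\<dots> = k * d q"
      unfolding k_def y_def sum_distrib_right by (subst sum.swap) (simp add: mult.assoc)
    finally show ?thesis .
  qed
  have "k * k = 0"
  proof -
    have "(\<Sum>p\<in>I. \<Sum>q\<in>I. d p * (\<Sum>r\<in>I. m p r * m r q) * w q) = 0"
      using m(4) by (intro sum.neutral ballI) simp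
    moreover have "(\<Sum>p\<in>I. \<Sum>q\<in>I. d p * (\<Sum>r\<in>I. m p r * m r q) * w q) = k * k"
    proof -
      have "(\<Sum>r\<in>I. m p r * m r q) = w p * k * (k * d q)" if "p \<in> I" "q \<in> I" for p q
      proof -
        have "(\<Sum>r\<in>I. m p r * m r q) = (\<Sum>r\<in>I. w p * (y r * w r) * (k * d q))"
          using that by (intro sum.cong refl) (simp add: m1 yk mult.assoc)
        also have "\<dots> = w p * (\<Sum>r\<in>I. y r * w r) * (k * d q)"
          by (simp only: sum_distrib_left[symmetric] sum_distrib_right[symmetric])
        finally show ?thesis by (simp only: k_def[symmetric])
      qed
      then have "(\<Sum>p\<in>I. \<Sum>q\<in>I. d p * (\<Sum>r\<in>I. m p r * m r q) * w q) = (\<Sum>p\<in>I. \<Sum>q\<in>I. (d p * w p) * (k * k * (d q * w q)))"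
        by (intro sum.cong refl) (simp add: mult.assoc)
      also have "\<dots> = (\<Sum>p\<in>I. d p * w p) * (k * k * (\<Sum>q\<in>I. d q * w q))"
        by (simp only: sum_distrib_left[symmetric] sum_distrib_right[symmetric])
      finally show ?thesis using dw by simp
    qed
    ultimately show ?thesis by simp
  qed
  then have "k = 0" by simp
  then show "m p q = 0" using m1[OF pq] yk[OF pq(2)] by simp
qed

lemma uniform_idem_unit: "1 \<in> S \<Longrightarrow> uniform_idem S {()} (\<lambda>_ _. 1)"
  using uniform_idem_of_factor[of "{()}" "\<lambda>_. 1" "\<lambda>_. 1" S] by simp

text \<open>
  The idempotent belongs to the left ideal \<open>A x + A (h - \<lambda>\<^sub>i)\<close>: the column \<open>w\<close> lists its generators and the row \<open>d\<close> is a dual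
  basis.
\<close>

lemma rank_one_idem_exists:
  fixes lam :: "'i::finite \<Rightarrow> complex"
  assumes lam: "inj lam"
  shows "\<exists>f :: bool \<Rightarrow> bool \<Rightarrow> skl. uniform_idem (gwa_sub (root_poly lam)) UNIV f \<and>
     (\<forall>c. (\<Sum>i\<in>UNIV. c i) = 0 \<longrightarrow> tau lam c (\<Sum>p\<in>UNIV. f p p) = tau lam c 1 - c i)"
proof -
  let ?a = "root_poly lam"
  \<comment> \<open>The Lagrange polynomial of the root \<open>lam i\<close>. As R - 1 vanishes
    there, R + (h - \<lambda>_i) B = 1 for some \<open>B\<close>, and this identity is d w =
    1.\<close>
  define R where "R = smult (1 / poly (cofactor lam i) (lam i)) (cofactor lam i)"
  have R: "poly R (lam j) = (if i = j then 1 else 0)" for j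
    using poly_cofactor_self[OF lam, of i] poly_cofactor_other[of i j lam] by (cases "i = j") (simp_all add: R_def)
  have "[:- lam i, 1:] dvd 1 - R" using R[of i] by (simp flip: poly_eq_0_iff_dvd)
  then obtain B where B: "1 - R = [:- lam i, 1:] * B" by (rule dvdE)
  \<comment> \<open>This is the entry of w d in degree -1, where membership in A(a) requires the
    factor a.\<close>
  have aR: "?a dvd [:- lam i, 1:] * R"
    unfolding root_poly_cofactor[of lam i] R_def by (intro mult_dvd_mono dvd_refl dvd_smult)
  define w where "w p = (if p then monomial 1 1 else monomial (rat_of [:- lam i, 1:]) 0)" for p :: bool
  define d where "d p = (if p then monomial (rat_of R) (-1) else monomial (rat_of B) 0)" for p :: bool
  have dw: "(\<Sum>q\<in>UNIV. d q * w q) = 1"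
  proof -
    have "(\<Sum>q\<in>UNIV. d q * w q) = monomial (rat_of (R + [:- lam i, 1:] * B)) 0"
      by (simp add: UNIV_bool w_def d_def monomial_mult_monomial monomial_add mult.commute add.commute del: mult_pCons_left mult_pCons_right)
    also have "R + [:- lam i, 1:] * B = 1" unfolding B[symmetric] by simp
    finally show ?thesis by (simp add: monomial_1_0)
  qed
  have word_elem: "w p * d q \<in> gwa_sub ?a" for p q
  proof (cases p; cases q)
    assume "p" "q"
    then show ?thesis by (simp add: w_def d_def monomial_mult_monomial)
  next
    assume "p" "\<not> q"
    then have "w p * d q = monomial (rat_of (pshift (-1) B)) 1" by (simp add: w_def d_def monomial_mult_monomial)
    then show ?thesis by (simp add: gwa_sub_monomial)
  next
    assume "\<not> p" "q"
    then have "w p * d q = monomial (rat_of ([:- lam i, 1:] * R)) (-1)"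
      by (simp only: w_def d_def monomial_mult_monomial if_True if_False minus_zero rshift_zero add_0 rat_of_mult)
    then show ?thesis using aR by (simp only:) (rule gwa_sub_monomial, simp only: minus_minus shifted_prod_0_1)
  next
    assume "\<not> p" "\<not> q"
    then show ?thesis by (simp add: w_def d_def gwa_sub_mult)
  qed
  have "tau lam c (\<Sum>p\<in>UNIV. w p * d p) = tau lam c 1 - c i" if c: "(\<Sum>i\<in>UNIV. c i) = 0" for c
  proof -
    have one: "1 = [:0, 1:] - pshift (-1) [:0, 1:]" by (rule poly_ext) simp
    have "(\<Sum>p\<in>UNIV. w p * d p) = monomial (rat_of (pshift (-1) R + [:- lam i, 1:] * B)) 0"
      by (simp add: UNIV_bool w_def d_def monomial_mult_monomial add.commute del: mult_pCons_left mult_pCons_right flip: monomial_add)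
    also have "pshift (-1) R + [:- lam i, 1:] * B = ([:0, 1:] - R) - pshift (-1) ([:0, 1:] - R)"
      unfolding B[symmetric] by (subst one) (simp add: algebra_simps)
    finally have "coef (\<Sum>p\<in>UNIV. w p * d p) 0 = rat_of (([:0, 1:] - R) - pshift (-1) ([:0, 1:] - R))"
      by simp
    from tau_eq[OF this c, of lam] show ?thesis
      by (simp add: tau_1[OF c] R algebra_simps sum_subtractf if_distrib[of "\<lambda>x. c _ * x"] cong: if_cong)
  qed
  moreover have "uniform_idem (gwa_sub ?a) UNIV (\<lambda>p q. w p * d q)"
    by (rule uniform_idem_of_factor[OF _ word_elem dw]) auto
  ultimately show ?thesis by blast
qed

section \<open>Full corners of matrix algebras\<close>

definition matmul :: "'r set \<Rightarrow> ('p \<Rightarrow> 'r \<Rightarrow> skl) \<Rightarrow> ('r \<Rightarrow> 'q \<Rightarrow> skl) \<Rightarrow> 'p \<Rightarrow> 'q \<Rightarrow> skl" where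
  "matmul I A B = (\<lambda>p q. \<Sum>r\<in>I. A p r * B r q)"

text \<open>Matrices are total functions that are zero off I \<times> J, so that matrix identities
  are equations between functions.\<close>

definition Mat :: "skl set \<Rightarrow> 'p set \<Rightarrow> 'q set \<Rightarrow> ('p \<Rightarrow> 'q \<Rightarrow> skl) set" where
  "Mat S I J = {A. (\<forall>p q. p \<notin> I \<or> q \<notin> J \<longrightarrow> A p q = 0) \<and> (\<forall>p q. A p q \<in> S)}"

definition one_on :: "'p set \<Rightarrow> 'p \<Rightarrow> 'p \<Rightarrow> skl" where
  "one_on I p q = (if p = q \<and> p \<in> I then 1 else 0)"

definition mtrace :: "'p set \<Rightarrow> ('p \<Rightarrow> 'p \<Rightarrow> skl) \<Rightarrow> skl" where
  "mtrace I A = (\<Sum>p\<in>I. A p p)"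

abbreviation mzero :: "'p \<Rightarrow> 'q \<Rightarrow> skl" where "mzero \<equiv> \<lambda>_ _. 0"

lemma matmul_assoc: "matmul J (matmul I A B) C = matmul I A (matmul J B C)"
  unfolding matmul_def sum_distrib_left sum_distrib_right
  by (intro ext, subst sum.swap) (simp add: mult.assoc)

lemma matmul_zero [simp]: "matmul I mzero B = mzero" "matmul I A mzero = mzero"
  by (simp_all add: matmul_def)

lemma matmul_one_left: "finite I \<Longrightarrow> A \<in> Mat S I J \<Longrightarrow> matmul I (one_on I) A = A"
proof (rule ext)+
  fix p q assume I: "finite I" "A \<in> Mat S I J"
  have "matmul I (one_on I) A p q = (\<Sum>r\<in>I. if r = p then A p q else 0)"
    unfolding matmul_def one_on_def by (intro sum.cong refl) auto
  also have "\<dots> = A p q" using I by (auto simp: Mat_def)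
  finally show "matmul I (one_on I) A p q = A p q" .
qed

lemma matmul_one_right: "finite J \<Longrightarrow> A \<in> Mat S I J \<Longrightarrow> matmul J A (one_on J) = A"
proof (rule ext)+
  fix p q assume J: "finite J" "A \<in> Mat S I J"
  have "matmul J A (one_on J) p q = (\<Sum>r\<in>J. if r = q then A p q else 0)"
    unfolding matmul_def one_on_def by (intro sum.cong refl) auto
  also have "\<dots> = A p q" using J by (auto simp: Mat_def)
  finally show "matmul J A (one_on J) p q = A p q" .
qed

lemma Mat_mult: "A \<in> Mat (gwa_sub a) I J \<Longrightarrow> B \<in> Mat (gwa_sub a) J K \<Longrightarrow> matmul J A B \<in> Mat (gwa_sub a) I K"
  by (auto simp: Mat_def matmul_def intro!: gwa_sub_sum gwa_sub_mult)

lemma Mat_one: "one_on I \<in> Mat (gwa_sub a) I I"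
  by (auto simp: Mat_def one_on_def)

lemma tau_mtrace_commute:
  fixes lam c :: "'i::finite \<Rightarrow> complex"
  assumes root: "\<And>i. poly a (lam i) = 0" and c: "(\<Sum>i\<in>UNIV. c i) = 0"
    and A: "A \<in> Mat (gwa_sub a) I J" and B: "B \<in> Mat (gwa_sub a) J I"
  shows "tau lam c (mtrace I (matmul J A B)) = tau lam c (mtrace J (matmul I B A))"
proof -
  have AB: "A p q \<in> gwa_sub a" "B q p \<in> gwa_sub a" for p q using A B by (auto simp: Mat_def)
  have two: "tau lam c (\<Sum>p\<in>I'. \<Sum>q\<in>J'. g p q) = (\<Sum>p\<in>I'. \<Sum>q\<in>J'. tau lam c (g p q))"
    if "\<And>p q. g p q \<in> gwa_sub a" for g :: "'x \<Rightarrow> 'y \<Rightarrow> skl" and I' J'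
    using tau_sum[OF c, of I' "\<lambda>p. \<Sum>q\<in>J'. g p q" a lam] tau_sum[OF c, of J' "g _" a lam] that
    by (simp add: gwa_sub_sum)
  have "tau lam c (mtrace I (matmul J A B)) = (\<Sum>p\<in>I. \<Sum>q\<in>J. tau lam c (A p q * B q p))"
    unfolding mtrace_def matmul_def by (rule two) (intro gwa_sub_mult AB)
  also have "\<dots> = (\<Sum>q\<in>J. \<Sum>p\<in>I. tau lam c (B q p * A p q))"
    by (subst sum.swap) (intro sum.cong refl tau_commute[OF root c] AB)
  also have "\<dots> = tau lam c (mtrace J (matmul I B A))"
    unfolding mtrace_def matmul_def by (rule two[symmetric]) (intro gwa_sub_mult AB)
  finally show ?thesis .
qed

text \<open>The notion \<open>uniform_idem\<close> for matrices extended by zero, in a form in which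
  \<open>matmul\<close> identities can be used for rewriting.\<close>

definition ext_idem :: "skl set \<Rightarrow> 'p set \<Rightarrow> ('p \<Rightarrow> 'p \<Rightarrow> skl) \<Rightarrow> bool" where
  "ext_idem S I f \<longleftrightarrow> finite I \<and> f \<in> Mat S I I \<and> matmul I f f = f \<and> f \<noteq> mzero \<and>
     (\<forall>m\<in>Mat S I I. matmul I f m = m \<longrightarrow> matmul I m f = m \<longrightarrow> matmul I m m = mzero \<longrightarrow> m = mzero)"

lemma uniform_idem_of_ext:
  assumes f: "ext_idem S I f" and S: "0 \<in> S"
  shows "uniform_idem S I f"
  unfolding uniform_idem_def
proof (intro conjI allI impI)
  have f': "finite I" "f \<in> Mat S I I" "matmul I f f = f" "f \<noteq> mzero" using f by (auto simp: ext_idem_def)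
  show "finite I" by fact
  show "\<forall>p\<in>I. \<forall>q\<in>I. f p q \<in> S" using f'(2) by (auto simp: Mat_def)
  show "\<forall>p\<in>I. \<forall>q\<in>I. (\<Sum>r\<in>I. f p r * f r q) = f p q" using f'(3) by (metis matmul_def)
  show "\<exists>p\<in>I. \<exists>q\<in>I. f p q \<noteq> 0" using f'(2,4) unfolding Mat_def by blast
  fix m
  assume m: "\<forall>p\<in>I. \<forall>q\<in>I. m p q \<in> S" "\<forall>p\<in>I. \<forall>q\<in>I. (\<Sum>r\<in>I. f p r * m r q) = m p q"
    "\<forall>p\<in>I. \<forall>q\<in>I. (\<Sum>r\<in>I. m p r * f r q) = m p q"
    "\<forall>p\<in>I. \<forall>q\<in>I. (\<Sum>r\<in>I. m p r * m r q) = 0"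
  define m' where "m' p q = (if p \<in> I \<and> q \<in> I then m p q else 0)" for p q
  have fz: "p \<notin> I \<or> q \<notin> I \<Longrightarrow> f p q = 0" for p q using f'(2) by (auto simp: Mat_def)
  have "m' \<in> Mat S I I" using m(1) S by (auto simp: Mat_def m'_def)
  moreover have "matmul I f m' = m'"
    by (intro ext) (use m(2) fz in \<open>auto simp: matmul_def m'_def cong: sum.cong\<close>)
  moreover have "matmul I m' f = m'"
    by (intro ext) (use m(3) fz in \<open>auto simp: matmul_def m'_def cong: sum.cong\<close>)
  moreover have "matmul I m' m' = mzero"
  proof (intro ext)
    fix p q show "matmul I m' m' p q = 0"
      by (cases "p \<in> I \<and> q \<in> I") (use m(4) in \<open>auto simp: matmul_def m'_def\<close>)
  qed
  ultimately have "m' = mzero" using f by (auto simp: ext_idem_def)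
  then show "\<forall>p\<in>I. \<forall>q\<in>I. m p q = 0" by (metis m'_def)
qed

lemma ext_of_uniform_idem:
  assumes f: "uniform_idem S I f" and S: "0 \<in> S"
  shows "\<exists>f'. ext_idem S I f' \<and> (\<forall>p\<in>I. \<forall>q\<in>I. f' p q = f p q)"
proof -
  have f1: "finite I" "\<And>p q. p \<in> I \<Longrightarrow> q \<in> I \<Longrightarrow> f p q \<in> S"
    "\<And>p q. p \<in> I \<Longrightarrow> q \<in> I \<Longrightarrow> (\<Sum>r\<in>I. f p r * f r q) = f p q" "\<exists>p\<in>I. \<exists>q\<in>I. f p q \<noteq> 0"
    using f unfolding uniform_idem_def by blast+
  define f' where "f' p q = (if p \<in> I \<and> q \<in> I then f p q else 0)" for p q
  have "f' \<in> Mat S I I" using f1(2) S by (auto simp: Mat_def f'_def)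
  moreover have "matmul I f' f' = f'"
    by (intro ext) (use f1(3) in \<open>auto simp: matmul_def f'_def cong: sum.cong\<close>)
  moreover have "f' \<noteq> mzero" using f1(4) by (metis f'_def)
  moreover have "m = mzero" if m: "m \<in> Mat S I I" "matmul I f' m = m" "matmul I m f' = m" "matmul I m m = mzero" for m
  proof -
    have "\<forall>p\<in>I. \<forall>q\<in>I. m p q \<in> S" using m(1) by (auto simp: Mat_def)
    moreover have "\<forall>p\<in>I. \<forall>q\<in>I. (\<Sum>r\<in>I. f p r * m r q) = m p q"
    proof (intro ballI)
      fix p q assume "p \<in> I" "q \<in> I"
      then have "(\<Sum>r\<in>I. f p r * m r q) = matmul I f' m p q" by (simp add: matmul_def f'_def)
      then show "(\<Sum>r\<in>I. f p r * m r q) = m p q" using m(2) by simp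
    qed
    moreover have "\<forall>p\<in>I. \<forall>q\<in>I. (\<Sum>r\<in>I. m p r * f r q) = m p q"
    proof (intro ballI)
      fix p q assume "p \<in> I" "q \<in> I"
      then have "(\<Sum>r\<in>I. m p r * f r q) = matmul I m f' p q" by (simp add: matmul_def f'_def)
      then show "(\<Sum>r\<in>I. m p r * f r q) = m p q" using m(3) by simp
    qed
    moreover have "\<forall>p\<in>I. \<forall>q\<in>I. (\<Sum>r\<in>I. m p r * m r q) = 0"
      using m(4) by (metis matmul_def)
    ultimately have "\<forall>p\<in>I. \<forall>q\<in>I. m p q = 0" using f unfolding uniform_idem_def by blast
    then show "m = mzero" using m(1) by (intro ext) (auto simp: Mat_def)
  qed
  ultimately have "ext_idem S I f'" unfolding ext_idem_def using f1(1) by blast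
  then show ?thesis by (auto simp: f'_def)
qed

text \<open>A Morita equivalence in matrix form: with e = \<open>corner 1\<close>, the map
  \<open>corner\<close> is an isomorphism of A(b) onto e M_n(A(a)) e. The rows \<open>u s\<close>
  and columns \<open>v s\<close> witness that e is full, since the sum of all u_s e v_s is
  1.\<close>

locale morita_matrices =
  fixes a b :: "complex poly" and n k :: nat and u v :: "nat \<Rightarrow> nat \<Rightarrow> skl"
    and corner :: "skl \<Rightarrow> nat \<Rightarrow> nat \<Rightarrow> skl"
  assumes corner_closed: "x \<in> gwa_sub b \<Longrightarrow> corner x \<in> Mat (gwa_sub a) {..<n} {..<n}"
    and corner_add: "x \<in> gwa_sub b \<Longrightarrow> y \<in> gwa_sub b \<Longrightarrow> corner (x + y) i j = corner x i j + corner y i j"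
    and corner_mult: "x \<in> gwa_sub b \<Longrightarrow> y \<in> gwa_sub b \<Longrightarrow> corner (x * y) = matmul {..<n} (corner x) (corner y)"
    and corner_smult: "x \<in> gwa_sub b \<Longrightarrow> corner (monomial (rat_of [:c:]) 0 * x) i j = monomial (rat_of [:c:]) 0 * corner x i j"
    and corner_inj: "x \<in> gwa_sub b \<Longrightarrow> corner x = mzero \<Longrightarrow> x = 0"
    and corner_surj: "m \<in> Mat (gwa_sub a) {..<n} {..<n} \<Longrightarrow> matmul {..<n} (corner 1) m = m \<Longrightarrow> matmul {..<n} m (corner 1) = m \<Longrightarrow>
      \<exists>x\<in>gwa_sub b. corner x = m"
    and u_gwa_sub: "s < k \<Longrightarrow> i < n \<Longrightarrow> u s i \<in> gwa_sub a" and v_gwa_sub: "s < k \<Longrightarrow> i < n \<Longrightarrow> v s i \<in> gwa_sub a"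
    and ue: "s < k \<Longrightarrow> j < n \<Longrightarrow> (\<Sum>i<n. u s i * corner 1 i j) = u s j"
    and ev: "s < k \<Longrightarrow> i < n \<Longrightarrow> (\<Sum>j<n. corner 1 i j * v s j) = v s i"
    and uv: "(\<Sum>s<k. \<Sum>i<n. u s i * v s i) = 1"
begin

lemma corner_0: "corner 0 i j = 0"
  using corner_smult[OF gwa_sub_0, of 0] by simp

lemma corner_sum:
  assumes "\<And>r. r \<in> R \<Longrightarrow> f r \<in> gwa_sub b"
  shows "corner (sum f R) i j = (\<Sum>r\<in>R. corner (f r) i j)"
  using assms
proof (induction R rule: infinite_finite_induct)
  case (insert x F)
  then have "sum f F \<in> gwa_sub b" by (intro gwa_sub_sum) auto
  then show ?case using insert corner_add by simp
qed (simp_all add: corner_0)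

lemma corner_eqD: "x \<in> gwa_sub b \<Longrightarrow> y \<in> gwa_sub b \<Longrightarrow> corner x = corner y \<Longrightarrow> x = y"
proof -
  assume xy: "x \<in> gwa_sub b" "y \<in> gwa_sub b" "corner x = corner y"
  have "corner (x - y) i j + corner y i j = corner x i j" for i j
    using corner_add[OF gwa_sub_diff[OF xy(1,2)] xy(2), of i j] by simp
  then have "corner (x - y) = mzero" using xy(3) by (intro ext) simp
  then have "x - y = 0" using gwa_sub_diff[OF xy(1,2)] corner_inj by blast
  then show ?thesis by simp
qed

section \<open>Transport of idempotents in both directions along the corner\<close>

definition hat :: "('p \<Rightarrow> 'q \<Rightarrow> skl) \<Rightarrow> 'p \<times> nat \<Rightarrow> 'q \<times> nat \<Rightarrow> skl" where
  "hat f = (\<lambda>(p, i) (q, j). corner (f p q) i j)"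

abbreviation blk :: "'p set \<Rightarrow> ('p \<times> nat) set" where "blk I \<equiv> I \<times> {..<n}"

lemma hat_closed: "f \<in> Mat (gwa_sub b) I J \<Longrightarrow> hat f \<in> Mat (gwa_sub a) (blk I) (blk J)"
proof -
  assume f: "f \<in> Mat (gwa_sub b) I J"
  have Tf: "corner (f p q) \<in> Mat (gwa_sub a) {..<n} {..<n}" for p q using f by (intro corner_closed) (simp add: Mat_def)
  have "hat f (p, i) (q, j) = 0" if "(p, i) \<notin> blk I \<or> (q, j) \<notin> blk J" for p i q j
  proof (cases "p \<notin> I \<or> q \<notin> J")
    case True
    then have "f p q = 0" using f unfolding Mat_def by blast
    then show ?thesis by (simp add: hat_def corner_0)
  next
    case False
    then have "i \<notin> {..<n} \<or> j \<notin> {..<n}" using that by auto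
    then show ?thesis using Tf[of p q] by (simp add: hat_def Mat_def)
  qed
  moreover have "hat f x y \<in> gwa_sub a" for x y using Tf by (auto simp: hat_def Mat_def split: prod.split)
  ultimately show ?thesis unfolding Mat_def by auto
qed

lemma hat_mult:
  fixes f :: "'p \<Rightarrow> 'r \<Rightarrow> skl" and g :: "'r \<Rightarrow> 'q \<Rightarrow> skl"
  assumes "f \<in> Mat (gwa_sub b) I J" "g \<in> Mat (gwa_sub b) J K"
  shows "hat (matmul J f g) = matmul (blk J) (hat f) (hat g)"
proof (intro ext)
  fix x :: "'p \<times> nat" and y :: "'q \<times> nat"
  obtain p i q j where xy: "x = (p, i)" "y = (q, j)" by (metis surj_pair)
  have fg: "f p q \<in> gwa_sub b" "g q' r \<in> gwa_sub b" for p q q' r using assms by (auto simp: Mat_def)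
  have "hat (matmul J f g) x y = (\<Sum>r\<in>J. \<Sum>l<n. corner (f p r) i l * corner (g r q) l j)"
    unfolding hat_def matmul_def xy using corner_mult[OF fg]
    by (simp add: corner_sum gwa_sub_mult fg matmul_def)
  also have "\<dots> = matmul (blk J) (hat f) (hat g) x y"
    unfolding matmul_def hat_def xy sum.cartesian_product by (intro sum.cong refl) auto
  finally show "hat (matmul J f g) x y = matmul (blk J) (hat f) (hat g) x y" .
qed

lemma hat_inj:
  assumes "f \<in> Mat (gwa_sub b) I J" "g \<in> Mat (gwa_sub b) I J" "hat f = hat g"
  shows "f = g"
proof (intro ext)
  fix p q
  have "corner (f p q) i j = corner (g p q) i j" for i j
    using fun_cong[OF fun_cong[OF assms(3), of "(p, i)"], of "(q, j)"] by (simp add: hat_def)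
  then have "corner (f p q) = corner (g p q)" by (intro ext)
  then show "f p q = g p q" using corner_eqD assms(1,2) by (auto simp: Mat_def)
qed

lemma hat_zero: "hat mzero = mzero"
  by (auto simp: hat_def corner_0 fun_eq_iff)

text \<open>The two equations put \<open>m\<close> into the corner of a block diagonal matrix with
  blocks \<open>corner 1\<close>, so every block of \<open>m\<close> satisfies the hypotheses of
  \<open>corner_surj\<close>.\<close>

lemma hat_surj:
  assumes I: "finite I" and m: "m \<in> Mat (gwa_sub a) (blk I) (blk I)"
    and e: "matmul (blk I) (hat (one_on I)) m = m" "matmul (blk I) m (hat (one_on I)) = m"
  shows "\<exists>f\<in>Mat (gwa_sub b) I I. hat f = m"
proof -
  define B where "B p q = (\<lambda>i j. m (p, i) (q, j))" for p q
  have one: "hat (one_on I) (p, i) (r, l) = (if p = r \<and> p \<in> I then corner 1 i l else 0)" for p r i l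
    by (auto simp: hat_def one_on_def corner_0)
  have B: "B p q \<in> Mat (gwa_sub a) {..<n} {..<n}" for p q using m by (auto simp: Mat_def B_def)
  have out: "B p q = mzero" if "p \<notin> I \<or> q \<notin> I" for p q
    by (intro ext) (use m that in \<open>auto simp: Mat_def B_def\<close>)
  have left: "matmul {..<n} (corner 1) (B p q) = B p q" if p: "p \<in> I" for p q
  proof (intro ext)
    fix i j
    have "B p q i j = matmul (blk I) (hat (one_on I)) m (p, i) (q, j)" by (simp add: e B_def)
    also have "\<dots> = (\<Sum>r\<in>I. \<Sum>l<n. (if p = r \<and> p \<in> I then corner 1 i l else 0) * m (r, l) (q, j))"
      unfolding matmul_def sum.cartesian_product one[symmetric] by (intro sum.cong refl) auto
    also have "\<dots> = (\<Sum>r\<in>I. if p = r then matmul {..<n} (corner 1) (B p q) i j else 0)"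
      using p by (intro sum.cong refl) (auto simp: matmul_def B_def)
    also have "\<dots> = matmul {..<n} (corner 1) (B p q) i j" using p I by simp
    finally show "matmul {..<n} (corner 1) (B p q) i j = B p q i j" by simp
  qed
  have right: "matmul {..<n} (B p q) (corner 1) = B p q" if q: "q \<in> I" for p q
  proof (intro ext)
    fix i j
    have "B p q i j = matmul (blk I) m (hat (one_on I)) (p, i) (q, j)" by (simp add: e B_def)
    also have "\<dots> = (\<Sum>r\<in>I. \<Sum>l<n. m (p, i) (r, l) * (if r = q \<and> r \<in> I then corner 1 l j else 0))"
      unfolding matmul_def sum.cartesian_product one[symmetric] by (intro sum.cong refl) auto
    also have "\<dots> = (\<Sum>r\<in>I. if r = q then matmul {..<n} (B p q) (corner 1) i j else 0)"
      using q by (intro sum.cong refl) (auto simp: matmul_def B_def)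
    also have "\<dots> = matmul {..<n} (B p q) (corner 1) i j" using q I by simp
    finally show "matmul {..<n} (B p q) (corner 1) i j = B p q i j" by simp
  qed
  have "\<exists>x. x \<in> gwa_sub b \<and> corner x = B p q \<and> (p \<notin> I \<or> q \<notin> I \<longrightarrow> x = 0)" for p q
  proof (cases "p \<in> I \<and> q \<in> I")
    case True
    then show ?thesis using corner_surj[OF B left right] by blast
  next
    case False
    then show ?thesis using out by (intro exI[of _ 0]) (auto simp: corner_0 fun_eq_iff)
  qed
  then obtain f where f: "\<And>p q. f p q \<in> gwa_sub b" "\<And>p q. corner (f p q) = B p q"
    "\<And>p q. p \<notin> I \<or> q \<notin> I \<Longrightarrow> f p q = 0" by metis
  have "hat f = m" by (auto simp: hat_def f B_def fun_eq_iff)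
  moreover have "f \<in> Mat (gwa_sub b) I I" using f by (auto simp: Mat_def)
  ultimately show ?thesis by blast
qed

text \<open>A matrix in the corner of \<open>hat f\<close> also lies in the corner of
  \<open>hat (one_on I)\<close>, hence comes from a matrix over A(b). An element of square zero
  would therefore already exist in the corner of \<open>f\<close>.\<close>

lemma hat_ext_idem:
  assumes f: "ext_idem (gwa_sub b) I f"
  shows "ext_idem (gwa_sub a) (blk I) (hat f)"
proof -
  have f1: "finite I" "f \<in> Mat (gwa_sub b) I I" "matmul I f f = f" "f \<noteq> mzero"
    and f2: "\<And>m. m \<in> Mat (gwa_sub b) I I \<Longrightarrow> matmul I f m = m \<Longrightarrow> matmul I m f = m \<Longrightarrow> matmul I m m = mzero \<Longrightarrow> m = mzero"
    using f by (auto simp: ext_idem_def)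
  have z: "mzero \<in> Mat (gwa_sub b) I I" by (simp add: Mat_def)
  have "hat f \<noteq> mzero"
  proof
    assume "hat f = mzero"
    then have "hat f = hat mzero" by (simp add: hat_zero)
    then show False using hat_inj[OF f1(2) z] f1(4) by blast
  qed
  moreover have "m = mzero" if m: "m \<in> Mat (gwa_sub a) (blk I) (blk I)" "matmul (blk I) (hat f) m = m"
    "matmul (blk I) m (hat f) = m" "matmul (blk I) m m = mzero" for m
  proof -
    have "matmul (blk I) (hat (one_on I)) m = m"
      by (metis f1(1,2) hat_mult Mat_one m(2) matmul_assoc matmul_one_left)
    moreover have "matmul (blk I) m (hat (one_on I)) = m"
      by (metis f1(1,2) hat_mult Mat_one m(3) matmul_assoc matmul_one_right)
    ultimately obtain g where g: "g \<in> Mat (gwa_sub b) I I" "hat g = m"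
      using hat_surj[OF f1(1) m(1)] by blast
    have "matmul I f g = g" by (rule hat_inj[OF Mat_mult[OF f1(2) g(1)] g(1)]) (simp add: hat_mult[OF f1(2) g(1)] g m)
    moreover have "matmul I g f = g" by (rule hat_inj[OF Mat_mult[OF g(1) f1(2)] g(1)]) (simp add: hat_mult[OF g(1) f1(2)] g m)
    moreover have "matmul I g g = mzero" by (rule hat_inj[OF Mat_mult[OF g(1) g(1)] z]) (simp add: hat_mult[OF g(1) g(1)] g m hat_zero)
    ultimately have "g = mzero" using f2 g(1) by blast
    then show ?thesis using g(2) hat_zero by metis
  qed
  ultimately show ?thesis unfolding ext_idem_def
    using f1 hat_closed hat_mult by (metis finite_SigmaI finite_lessThan)
qed

text \<open>Block diagonal, each block being the single row of all \<open>u s i\<close>. With the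
  matching columns in \<open>Vmat\<close>, U V = 1, and both are fixed by the idempotent
  \<open>hat (one_on (blk2 I))\<close>.\<close>

definition Umat :: "'p set \<Rightarrow> 'p \<Rightarrow> ('p \<times> nat) \<times> nat \<Rightarrow> skl" where
  "Umat I = (\<lambda>p ((q, s), i). if p = q \<and> p \<in> I \<and> s < k \<and> i < n then u s i else 0)"

definition Vmat :: "'p set \<Rightarrow> ('p \<times> nat) \<times> nat \<Rightarrow> 'p \<Rightarrow> skl" where
  "Vmat I = (\<lambda>((q, s), i) p. if p = q \<and> p \<in> I \<and> s < k \<and> i < n then v s i else 0)"

abbreviation blk2 :: "'p set \<Rightarrow> ('p \<times> nat) set" where "blk2 I \<equiv> I \<times> {..<k}"

lemma Umat_closed: "Umat I \<in> Mat (gwa_sub a) I (blk (blk2 I))"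
  using u_gwa_sub by (auto simp: Mat_def Umat_def)

lemma Vmat_closed: "Vmat I \<in> Mat (gwa_sub a) (blk (blk2 I)) I"
  using v_gwa_sub by (auto simp: Mat_def Vmat_def)

lemma sum_block: "(\<Sum>x\<in>blk (blk2 I). g x) = (\<Sum>q\<in>I. \<Sum>s<k. \<Sum>i<n. g ((q, s), i))"
  by (simp add: sum.cartesian_product')

lemma U_V: assumes I: "finite I" shows "matmul (blk (blk2 I)) (Umat I) (Vmat I) = one_on I"
proof (intro ext)
  fix p q
  have "matmul (blk (blk2 I)) (Umat I) (Vmat I) p q
      = (\<Sum>r\<in>I. if r = p then (if p = q \<and> p \<in> I then \<Sum>s<k. \<Sum>i<n. u s i * v s i else 0) else 0)"
    unfolding matmul_def sum_block by (intro sum.cong refl) (auto simp: Umat_def Vmat_def)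
  then show "matmul (blk (blk2 I)) (Umat I) (Vmat I) p q = one_on I p q"
    using I by (auto simp: uv one_on_def)
qed

lemma U_hat: assumes I: "finite I" shows "matmul (blk (blk2 I)) (Umat I) (hat (one_on (blk2 I))) = Umat I"
proof (intro ext)
  fix p and y :: "('a \<times> nat) \<times> nat"
  obtain q t j where y: "y = ((q, t), j)" by (metis surj_pair)
  have Tj: "corner 1 i j = 0" if "\<not> j < n" for i using corner_closed[OF gwa_sub_1] that by (auto simp: Mat_def)
  have "matmul (blk (blk2 I)) (Umat I) (hat (one_on (blk2 I))) p y
      = (\<Sum>r\<in>I. if r = p then \<Sum>s<k. if s = t then (if p = q \<and> p \<in> I then \<Sum>i<n. u t i * corner 1 i j else 0) else 0 else 0)"
  proof -
    have *: "(\<Sum>i<n. Umat I p ((r, s), i) * hat (one_on (blk2 I)) ((r, s), i) y)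
        = (if r = p then if s = t then (if p = q \<and> p \<in> I then \<Sum>i<n. u t i * corner 1 i j else 0) else 0 else 0)"
      if "r \<in> I" "s < k" for r s
    proof (cases "r = p \<and> s = t \<and> p = q")
      case True
      then show ?thesis using that by (auto simp: y Umat_def hat_def one_on_def intro!: sum.cong)
    next
      case False
      then have "Umat I p ((r, s), i) * hat (one_on (blk2 I)) ((r, s), i) y = 0" for i
        by (auto simp: y Umat_def hat_def one_on_def corner_0)
      then have "(\<Sum>i<n. Umat I p ((r, s), i) * hat (one_on (blk2 I)) ((r, s), i) y) = 0"
        by (intro sum.neutral ballI)
      then show ?thesis using False by auto
    qed
    show ?thesis unfolding matmul_def sum_block using * by (auto intro!: sum.cong)
  qed
  also have "\<dots> = Umat I p y"
    using I Tj ue[of t j] by (auto simp: y Umat_def)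
  finally show "matmul (blk (blk2 I)) (Umat I) (hat (one_on (blk2 I))) p y = Umat I p y" .
qed

lemma hat_V: assumes I: "finite I" shows "matmul (blk (blk2 I)) (hat (one_on (blk2 I))) (Vmat I) = Vmat I"
proof (intro ext)
  fix p and y :: "('a \<times> nat) \<times> nat"
  obtain q t j where y: "y = ((q, t), j)" by (metis surj_pair)
  have Tj: "corner 1 j i = 0" if "\<not> j < n" for i using corner_closed[OF gwa_sub_1] that by (auto simp: Mat_def)
  have "matmul (blk (blk2 I)) (hat (one_on (blk2 I))) (Vmat I) y p
      = (\<Sum>r\<in>I. if r = p then \<Sum>s<k. if s = t then (if p = q \<and> p \<in> I then \<Sum>i<n. corner 1 j i * v t i else 0) else 0 else 0)"
  proof -
    have *: "(\<Sum>i<n. hat (one_on (blk2 I)) y ((r, s), i) * Vmat I ((r, s), i) p)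
        = (if r = p then if s = t then (if p = q \<and> p \<in> I then \<Sum>i<n. corner 1 j i * v t i else 0) else 0 else 0)"
      if "r \<in> I" "s < k" for r s
    proof (cases "r = p \<and> s = t \<and> p = q")
      case True
      then show ?thesis using that by (auto simp: y Vmat_def hat_def one_on_def intro!: sum.cong)
    next
      case False
      then have "hat (one_on (blk2 I)) y ((r, s), i) * Vmat I ((r, s), i) p = 0" for i
        by (auto simp: y Vmat_def hat_def one_on_def corner_0)
      then have "(\<Sum>i<n. hat (one_on (blk2 I)) y ((r, s), i) * Vmat I ((r, s), i) p) = 0"
        by (intro sum.neutral ballI)
      then show ?thesis using False by auto
    qed
    show ?thesis unfolding matmul_def sum_block using * by (auto intro!: sum.cong)
  qed
  also have "\<dots> = Vmat I y p"
    using I Tj ev[of t j] by (auto simp: y Vmat_def)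
  finally show "matmul (blk (blk2 I)) (hat (one_on (blk2 I))) (Vmat I) y p = Vmat I y p" .
qed

text \<open>Fullness at work: V f U lies in the corner of \<open>hat (one_on (blk2 I))\<close>,
  hence is the image of a matrix \<open>g\<close> over A(b). As U V = 1, a square-zero element M of
  its corner yields the square-zero element x = U M V of the corner of \<open>f\<close>, and M is
  recovered as V f x f U.\<close>

lemma ext_idem_descend:
  fixes f :: "'p \<Rightarrow> 'p \<Rightarrow> skl"
  assumes f: "ext_idem (gwa_sub a) I f"
  shows "\<exists>g. ext_idem (gwa_sub b) (blk2 I) g \<and> hat g = matmul I (Vmat I) (matmul I f (Umat I))"
proof -
  let ?K = "blk2 I" and ?L = "blk (blk2 I)" and ?U = "Umat I" and ?V = "Vmat I"
  have I: "finite I" and f1: "f \<in> Mat (gwa_sub a) I I" "matmul I f f = f" "f \<noteq> mzero"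
    and f2: "\<And>m. m \<in> Mat (gwa_sub a) I I \<Longrightarrow> matmul I f m = m \<Longrightarrow> matmul I m f = m \<Longrightarrow> matmul I m m = mzero \<Longrightarrow> m = mzero"
    using f by (auto simp: ext_idem_def)
  have K: "finite ?K" using I by simp
  define F where "F = matmul I ?V (matmul I f ?U)"
  have UVx: "matmul ?L ?U (matmul I ?V x) = x" if "x \<in> Mat (gwa_sub a) I J" for x :: "'p \<Rightarrow> 'j \<Rightarrow> skl" and J
    using matmul_one_left[OF I that] U_V[OF I] by (metis matmul_assoc)
  have F_closed: "F \<in> Mat (gwa_sub a) ?L ?L"
    unfolding F_def by (intro Mat_mult Vmat_closed Umat_closed f1)
  have UF: "matmul ?L ?U F = matmul I f ?U"
    unfolding F_def by (rule UVx[OF Mat_mult[OF f1(1) Umat_closed]])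
  have FF: "matmul ?L F F = F"
  proof -
    have "matmul ?L F F = matmul I ?V (matmul I f (matmul ?L ?U F))" by (simp add: F_def matmul_assoc)
    also have "\<dots> = F" unfolding UF by (metis F_def f1(2) matmul_assoc)
    finally show ?thesis .
  qed
  have "matmul ?L (hat (one_on ?K)) F = F"
    using hat_V[OF I] by (metis F_def matmul_assoc)
  moreover have "matmul ?L F (hat (one_on ?K)) = F"
    using U_hat[OF I] by (simp add: F_def matmul_assoc)
  ultimately obtain g where g: "g \<in> Mat (gwa_sub b) ?K ?K" "hat g = F"
    using hat_surj[OF K F_closed] by blast
  have gg: "matmul ?K g g = g"
    by (rule hat_inj[OF Mat_mult[OF g(1) g(1)] g(1)]) (simp add: hat_mult[OF g(1) g(1)] g FF)
  have UFV: "matmul ?L (matmul ?L ?U F) ?V = f"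
    unfolding UF using U_V[OF I] matmul_one_right[OF I f1(1)] by (simp add: matmul_assoc)
  have g0: "g \<noteq> mzero"
  proof
    assume "g = mzero"
    then have "F = mzero" using g(2) hat_zero by metis
    then show False using UFV f1(3) by simp
  qed
  have "m = mzero" if m: "m \<in> Mat (gwa_sub b) ?K ?K" "matmul ?K g m = m" "matmul ?K m g = m" "matmul ?K m m = mzero" for m
  proof -
    define M where "M = hat m"
    have M: "M \<in> Mat (gwa_sub a) ?L ?L" using hat_closed[OF m(1)] by (simp add: M_def)
    have FM: "matmul ?L F M = M" using hat_mult[OF g(1) m(1)] m(2) g(2) by (simp add: M_def)
    have MF: "matmul ?L M F = M" using hat_mult[OF m(1) g(1)] m(3) g(2) by (simp add: M_def)
    have MM0: "matmul ?L M M = mzero" using hat_mult[OF m(1) m(1)] m(4) by (simp add: M_def hat_zero)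
    define x where "x = matmul ?L ?U (matmul ?L M ?V)"
    have x: "x \<in> Mat (gwa_sub a) I I" unfolding x_def by (intro Mat_mult[OF Umat_closed] Mat_mult[OF M] Vmat_closed)
    have fUM: "matmul I f (matmul ?L ?U M) = matmul ?L ?U M"
    proof -
      have "matmul I f (matmul ?L ?U M) = matmul ?L (matmul ?L ?U F) M" unfolding UF by (simp add: matmul_assoc)
      also have "\<dots> = matmul ?L ?U M" by (simp add: matmul_assoc FM)
      finally show ?thesis .
    qed
    have MVf: "matmul I (matmul ?L M ?V) f = matmul ?L M ?V"
    proof -
      have FV: "matmul ?L F ?V = matmul I ?V f"
        unfolding F_def using U_V[OF I] matmul_one_right[OF I f1(1)] by (simp add: matmul_assoc)
      then have "matmul I (matmul ?L M ?V) f = matmul ?L M (matmul ?L F ?V)" by (simp add: matmul_assoc)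
      also have "\<dots> = matmul ?L M ?V" by (metis MF matmul_assoc)
      finally show ?thesis .
    qed
    have fx: "matmul I f x = x" unfolding x_def by (metis fUM matmul_assoc)
    have xf: "matmul I x f = x" unfolding x_def by (metis MVf matmul_assoc)
    \<comment> \<open>V U need not be the identity. Inserting \<open>f\<close>, which fixes U M,
      produces V f U = \<open>F\<close>, and M F M = M M = 0.\<close>
    have MVUM: "matmul I (matmul ?L M ?V) (matmul ?L ?U M) = mzero"
    proof -
      have "matmul I (matmul ?L M ?V) (matmul ?L ?U M) = matmul I (matmul ?L M ?V) (matmul I f (matmul ?L ?U M))" by (simp only: fUM)
      also have "\<dots> = matmul ?L M (matmul ?L F M)" by (simp add: F_def matmul_assoc)
      also have "\<dots> = mzero" by (simp add: FM MM0)
      finally show ?thesis .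
    qed
    have "matmul I x x = matmul ?L ?U (matmul ?L (matmul I (matmul ?L M ?V) (matmul ?L ?U M)) ?V)"
      by (simp add: x_def matmul_assoc)
    then have "matmul I x x = mzero" by (simp add: MVUM)
    then have "x = mzero" using f2 x fx xf by blast
    have "M = matmul ?L F (matmul ?L M F)" by (simp add: FM MF)
    also have "\<dots> = matmul I ?V (matmul I f (matmul I x (matmul I f ?U)))"
      by (simp add: F_def x_def matmul_assoc)
    also have "\<dots> = mzero" by (simp add: \<open>x = mzero\<close>)
    finally have "hat m = hat mzero" by (simp add: M_def hat_zero)
    then show ?thesis by (intro hat_inj[OF m(1)]) (auto simp: Mat_def)
  qed
  then have "ext_idem (gwa_sub b) ?K g" unfolding ext_idem_def using K g gg g0 by blast
  then show ?thesis using g(2) F_def by blast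
qed

end

section \<open>The lattice of integral traces\<close>

lemma mtrace_gwa_sub: "A \<in> Mat (gwa_sub a) I J \<Longrightarrow> mtrace K A \<in> gwa_sub a"
  unfolding mtrace_def by (intro gwa_sub_sum) (simp add: Mat_def)

lemma ext_idem_trace:
  fixes lam c :: "'i::finite \<Rightarrow> complex"
  assumes "ext_idem (gwa_sub a) I f" "a \<noteq> 0" "\<And>i. poly a (lam i) = 0" "(\<Sum>i\<in>UNIV. c i) = 0" "\<And>i. c i \<in> \<int>"
  shows "tau lam c (mtrace I f) - tau lam c 1 \<in> \<int>"
  unfolding mtrace_def using uniform_idem_trace[OF uniform_idem_of_ext[OF assms(1) gwa_sub_0] assms(2-5)] .

lemma ext_rank_one_idem:
  fixes lam :: "'i::finite \<Rightarrow> complex"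
  assumes "inj lam"
  shows "\<exists>f :: bool \<Rightarrow> bool \<Rightarrow> skl. ext_idem (gwa_sub (root_poly lam)) UNIV f \<and>
     (\<forall>c. (\<Sum>i\<in>UNIV. c i) = 0 \<longrightarrow> tau lam c (mtrace UNIV f) = tau lam c 1 - c i)"
proof -
  obtain f :: "bool \<Rightarrow> bool \<Rightarrow> skl" where f: "uniform_idem (gwa_sub (root_poly lam)) UNIV f"
     "\<And>c. (\<Sum>i\<in>UNIV. c i) = 0 \<Longrightarrow> tau lam c (\<Sum>p\<in>UNIV. f p p) = tau lam c 1 - c i"
    using rank_one_idem_exists[OF assms, of i] by blast
  obtain f' where f': "ext_idem (gwa_sub (root_poly lam)) UNIV f'" "\<forall>p\<in>UNIV. \<forall>q\<in>UNIV. f' p q = f p q"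
    using ext_of_uniform_idem[OF f(1) gwa_sub_0] by blast
  then have "f' = f" by (intro ext) simp
  then show ?thesis using f f' unfolding mtrace_def by blast
qed

lemma ext_unit_idem: "ext_idem (gwa_sub a) {()} (\<lambda>_ _. 1)"
proof -
  obtain f' where f': "ext_idem (gwa_sub a) {()} f'" "\<forall>p\<in>{()}. \<forall>q\<in>{()}. f' p q = 1"
    using ext_of_uniform_idem[OF uniform_idem_unit[OF gwa_sub_1] gwa_sub_0] by blast
  then have "f' = (\<lambda>_ _. 1)" by (intro ext) simp
  then show ?thesis using f' by simp
qed

context morita_matrices
begin

definition pull :: "('i::finite \<Rightarrow> complex) \<Rightarrow> ('i \<Rightarrow> complex) \<Rightarrow> skl \<Rightarrow> complex" where
  "pull lam c x = tau lam c (mtrace {..<n} (corner x))"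

context
  fixes lam mu c :: "'i::finite \<Rightarrow> complex"
  assumes a: "a = root_poly lam" and b: "b = root_poly mu" and mu: "inj mu" and c: "(\<Sum>i\<in>UNIV. c i) = 0"
begin

lemma corner_gwa_sub: "x \<in> gwa_sub b \<Longrightarrow> corner x i j \<in> gwa_sub a"
  using corner_closed[of x] by (auto simp: Mat_def)

lemma root_a: "poly a (lam i) = 0"
  by (simp add: a)

lemma pull_add: "x \<in> gwa_sub b \<Longrightarrow> y \<in> gwa_sub b \<Longrightarrow> pull lam c (x + y) = pull lam c x + pull lam c y"
proof -
  assume xy: "x \<in> gwa_sub b" "y \<in> gwa_sub b"
  have "mtrace {..<n} (corner (x + y)) = mtrace {..<n} (corner x) + mtrace {..<n} (corner y)"
    using xy by (simp add: mtrace_def corner_add sum.distrib)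
  then show ?thesis unfolding pull_def
    using tau_add[OF mtrace_gwa_sub[OF corner_closed] mtrace_gwa_sub[OF corner_closed] c] xy by simp
qed

lemma pull_sum:
  assumes "\<And>j. j \<in> S \<Longrightarrow> f j \<in> gwa_sub b"
  shows "pull lam c (sum f S) = (\<Sum>j\<in>S. pull lam c (f j))"
  using assms
proof (induction S rule: infinite_finite_induct)
  case (insert x F)
  then have "sum f F \<in> gwa_sub b" by (intro gwa_sub_sum) auto
  then show ?case using insert pull_add by simp
qed (simp_all add: pull_def mtrace_def corner_0 tau_0[OF c])

lemma pull_mtrace: "f \<in> Mat (gwa_sub b) I I \<Longrightarrow> pull lam c (mtrace I f) = tau lam c (mtrace (blk I) (hat f))"
proof -
  assume f: "f \<in> Mat (gwa_sub b) I I"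
  then have fg: "f p q \<in> gwa_sub b" for p q by (auto simp: Mat_def)
  have "pull lam c (mtrace I f) = (\<Sum>p\<in>I. tau lam c (\<Sum>i<n. corner (f p p) i i))"
    unfolding mtrace_def by (simp add: pull_sum fg) (simp add: pull_def mtrace_def)
  also have "\<dots> = tau lam c (\<Sum>p\<in>I. \<Sum>i<n. corner (f p p) i i)"
    by (rule tau_sum[OF c, symmetric, where a = a]) (intro gwa_sub_sum corner_gwa_sub fg)
  also have "\<dots> = tau lam c (mtrace (blk I) (hat f))"
    by (simp add: mtrace_def hat_def sum.cartesian_product')
  finally show ?thesis .
qed

text \<open>The pulled back functional is again a trace, as \<open>corner\<close> is multiplicative
  and matrix traces commute; the classification applies.\<close>

lemma pull_exists: "\<exists>c'. (\<Sum>i\<in>UNIV. c' i) = 0 \<and> (\<forall>x\<in>gwa_sub b. pull lam c x = tau mu c' x)"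
  unfolding b
proof (rule trace_classification[OF mu], unfold b[symmetric])
  fix x y assume xy: "x \<in> gwa_sub b" "y \<in> gwa_sub b"
  show "pull lam c (x + y) = pull lam c x + pull lam c y" by (rule pull_add[OF xy])
  show "pull lam c (monomial (rat_of [:k:]) 0 * x) = k * pull lam c x" for k
  proof -
    have "mtrace {..<n} (corner (monomial (rat_of [:k:]) 0 * x)) = monomial (rat_of [:k:]) 0 * mtrace {..<n} (corner x)"
      using xy by (simp add: mtrace_def corner_smult sum_distrib_left)
    then show ?thesis unfolding pull_def
      using tau_smult[OF mtrace_gwa_sub[OF corner_closed[OF xy(1)]] c] by simp
  qed
  show "pull lam c (x * y) = pull lam c (y * x)"
    unfolding pull_def using xy by (simp add: corner_mult tau_mtrace_commute[OF root_a c corner_closed corner_closed])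
qed

context
  fixes c' :: "'i \<Rightarrow> complex"
  assumes c': "(\<Sum>i\<in>UNIV. c' i) = 0" and pull: "\<And>x. x \<in> gwa_sub b \<Longrightarrow> pull lam c x = tau mu c' x"
begin

lemma tau_mtrace_hat: "f \<in> Mat (gwa_sub b) I I \<Longrightarrow> tau lam c (mtrace (blk I) (hat f)) = tau mu c' (mtrace I f)"
  using pull_mtrace[of f I] pull[OF mtrace_gwa_sub, of f I I I] by simp

text \<open>Rank one idempotents over A(b) stay such over A(a), so their traces all agree with
  \<tau>_c(1) modulo \<int>. The unit gives the congruence; comparing it with the idempotent of
  trace \<tau>(1) - c'_i isolates c'_i.\<close>

lemma pull_integral:
  assumes int: "\<And>i. c i \<in> \<int>"
  shows "c' i \<in> \<int>" and "(\<Sum>i\<in>UNIV. c' i * mu i) - (\<Sum>i\<in>UNIV. c i * lam i) \<in> \<int>"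
proof -
  have val: "tau mu c' (mtrace I f) - tau lam c 1 \<in> \<int>" if f: "ext_idem (gwa_sub b) I f" for I and f :: "'p \<Rightarrow> 'p \<Rightarrow> skl"
    using ext_idem_trace[OF hat_ext_idem[OF f] _ root_a c int, of "\<lambda>i. i"] tau_mtrace_hat[of f I] f
    by (simp add: ext_idem_def a root_poly_nonzero)
  have one: "tau mu c' 1 - tau lam c 1 \<in> \<int>"
    using val[OF ext_unit_idem] by (simp add: mtrace_def)
  obtain f :: "bool \<Rightarrow> bool \<Rightarrow> skl" where f: "ext_idem (gwa_sub b) UNIV f" "tau mu c' (mtrace UNIV f) = tau mu c' 1 - c' i"
    using ext_rank_one_idem[OF mu] c' unfolding b by blast
  have "c' i = (tau mu c' 1 - tau lam c 1) - (tau mu c' (mtrace UNIV f) - tau lam c 1)"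
    by (simp add: f(2))
  then show "c' i \<in> \<int>" using Ints_diff[OF one val[OF f(1)]] by simp
  show "(\<Sum>i\<in>UNIV. c' i * mu i) - (\<Sum>i\<in>UNIV. c i * lam i) \<in> \<int>"
    using one by (simp add: tau_1 c c')
qed

text \<open>The same argument along \<open>ext_idem_descend\<close>: the trace of the descended
  idempotent is that of V f U, hence that of f U V = f.\<close>

lemma pull_integral_rev:
  assumes lam: "inj lam" and int: "\<And>i. c' i \<in> \<int>"
  shows "c i \<in> \<int>"
proof -
  have val: "tau lam c (mtrace I f) - tau mu c' 1 \<in> \<int>" if f: "ext_idem (gwa_sub a) I f" for I and f :: "'p \<Rightarrow> 'p \<Rightarrow> skl"
  proof -
    have I: "finite I" and f1: "f \<in> Mat (gwa_sub a) I I" using f by (auto simp: ext_idem_def)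
    obtain g where g: "ext_idem (gwa_sub b) (blk2 I) g" "hat g = matmul I (Vmat I) (matmul I f (Umat I))"
      using ext_idem_descend[OF f] by blast
    have "tau mu c' (mtrace (blk2 I) g) = tau lam c (mtrace (blk (blk2 I)) (matmul I (Vmat I) (matmul I f (Umat I))))"
      using tau_mtrace_hat[of g "blk2 I"] g by (simp add: ext_idem_def)
    also have "\<dots> = tau lam c (mtrace I (matmul (blk (blk2 I)) (matmul I f (Umat I)) (Vmat I)))"
      by (rule tau_mtrace_commute[OF root_a c Vmat_closed Mat_mult[OF f1 Umat_closed]])
    also have "matmul (blk (blk2 I)) (matmul I f (Umat I)) (Vmat I) = f"
      using U_V[OF I] matmul_one_right[OF I f1] by (simp add: matmul_assoc)
    finally have "tau lam c (mtrace I f) = tau mu c' (mtrace (blk2 I) g)" by simp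
    then show ?thesis
      using ext_idem_trace[OF g(1) _ _ c' int, of mu] by (simp add: b root_poly_nonzero)
  qed
  have one: "tau lam c 1 - tau mu c' 1 \<in> \<int>"
    using val[OF ext_unit_idem] by (simp add: mtrace_def)
  obtain f :: "bool \<Rightarrow> bool \<Rightarrow> skl" where f: "ext_idem (gwa_sub a) UNIV f" "tau lam c (mtrace UNIV f) = tau lam c 1 - c i"
    using ext_rank_one_idem[OF lam] c unfolding a by blast
  have "c i = (tau lam c 1 - tau mu c' 1) - (tau lam c (mtrace UNIV f) - tau mu c' 1)"
    by (simp add: f(2))
  then show "c i \<in> \<int>" using Ints_diff[OF one val[OF f(1)]] by simp
qed

end

end

lemma pull_linear:
  fixes lam c d :: "'i::finite \<Rightarrow> complex"
  assumes a: "a = root_poly lam" and c: "(\<Sum>i\<in>UNIV. c i) = 0" and d: "(\<Sum>i\<in>UNIV. d i) = 0" and x: "x \<in> gwa_sub b"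
  shows "pull lam (\<lambda>i. s * c i + t * d i) x = s * pull lam c x + t * pull lam d x"
proof -
  have "mtrace {..<n} (corner x) \<in> gwa_sub a" by (rule mtrace_gwa_sub[OF corner_closed[OF x]])
  then obtain P where P: "coef (mtrace {..<n} (corner x)) 0 = rat_of (P - pshift (-1) P)" using gwa_sub_primitive by blast
  have "(\<Sum>i\<in>UNIV. s * c i + t * d i) = 0" using c d by (simp add: sum.distrib flip: sum_distrib_left)
  then show ?thesis unfolding pull_def
    by (simp add: tau_eq[OF P] c d algebra_simps sum.distrib sum_distrib_left)
qed

text \<open>The unit and the idempotent attached to the i-th root have traces that differ by exactly
  the i-th coefficient.\<close>

lemma coefficients_unique:
  fixes mu c d :: "'i::finite \<Rightarrow> complex"
  assumes mu: "inj mu" and b: "b = root_poly mu" and c: "(\<Sum>i\<in>UNIV. c i) = 0" and d: "(\<Sum>i\<in>UNIV. d i) = 0"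
    and eq: "\<And>x. x \<in> gwa_sub b \<Longrightarrow> tau mu c x = tau mu d x"
  shows "c = d"
proof
  fix i
  obtain f :: "bool \<Rightarrow> bool \<Rightarrow> skl" where f: "ext_idem (gwa_sub b) UNIV f"
    "\<And>c. (\<Sum>i\<in>UNIV. c i) = 0 \<Longrightarrow> tau mu c (mtrace UNIV f) = tau mu c 1 - c i"
    using ext_rank_one_idem[OF mu, of i] unfolding b by blast
  have "mtrace UNIV f \<in> gwa_sub b" using f(1) mtrace_gwa_sub unfolding ext_idem_def by blast
  then show "c i = d i" using f(2)[OF c] f(2)[OF d] eq[of 1] eq[of "mtrace UNIV f"] by simp
qed

text \<open>The map sends the coefficients of a trace on A(a) to those of its pull-back. It is
  chosen separately for each \<open>c\<close>, so linearity rests on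
  \<open>coefficients_unique\<close>. The last clause is what later makes the inverse
  integral.\<close>

theorem lattice_map:
  fixes lam mu :: "'i::finite \<Rightarrow> complex"
  assumes a: "a = root_poly lam" and b: "b = root_poly mu" and lam: "inj lam" and mu: "inj mu"
  obtains g :: "('i \<Rightarrow> complex) \<Rightarrow> ('i \<Rightarrow> complex)" where
    "\<And>c. (\<Sum>i\<in>UNIV. c i) = 0 \<Longrightarrow> (\<Sum>i\<in>UNIV. g c i) = 0"
    "\<And>c d s t. (\<Sum>i\<in>UNIV. c i) = 0 \<Longrightarrow> (\<Sum>i\<in>UNIV. d i) = 0 \<Longrightarrow>
       g (\<lambda>i. s * c i + t * d i) = (\<lambda>i. s * g c i + t * g d i)"
    "\<And>c i. (\<Sum>i\<in>UNIV. c i) = 0 \<Longrightarrow> (\<And>i. c i \<in> \<int>) \<Longrightarrow> g c i \<in> \<int>"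
    "\<And>c. (\<Sum>i\<in>UNIV. c i) = 0 \<Longrightarrow> (\<And>i. c i \<in> \<int>) \<Longrightarrow>
       (\<Sum>i\<in>UNIV. g c i * mu i) - (\<Sum>i\<in>UNIV. c i * lam i) \<in> \<int>"
    "\<And>c i. (\<Sum>i\<in>UNIV. c i) = 0 \<Longrightarrow> (\<And>i. g c i \<in> \<int>) \<Longrightarrow> c i \<in> \<int>"
proof -
  have "\<forall>c. \<exists>c'. (\<Sum>i\<in>UNIV. c i) = 0 \<longrightarrow> (\<Sum>i\<in>UNIV. c' i) = 0 \<and> (\<forall>x\<in>gwa_sub b. pull lam c x = tau mu c' x)"
    using pull_exists[OF a b mu] by metis
  then obtain g where g: "\<And>c. (\<Sum>i\<in>UNIV. c i) = 0 \<Longrightarrow> (\<Sum>i\<in>UNIV. g c i) = 0"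
    "\<And>c x. (\<Sum>i\<in>UNIV. c i) = 0 \<Longrightarrow> x \<in> gwa_sub b \<Longrightarrow> pull lam c x = tau mu (g c) x" by metis
  show ?thesis
  proof (rule that[of g])
    fix c :: "'i \<Rightarrow> complex" assume c: "(\<Sum>i\<in>UNIV. c i) = 0"
    show "(\<Sum>i\<in>UNIV. g c i) = 0" by (rule g(1)[OF c])
    show "g c i \<in> \<int>" if "\<And>i. c i \<in> \<int>" for i
      by (rule pull_integral(1)[OF a b mu c g(1)[OF c] g(2)[OF c] that])
    show "(\<Sum>i\<in>UNIV. g c i * mu i) - (\<Sum>i\<in>UNIV. c i * lam i) \<in> \<int>" if "\<And>i. c i \<in> \<int>"
      by (rule pull_integral(2)[OF a b mu c g(1)[OF c] g(2)[OF c] that])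
    show "c i \<in> \<int>" if "\<And>i. g c i \<in> \<int>" for i
      by (rule pull_integral_rev[OF a b mu c g(1)[OF c] g(2)[OF c] lam that])
    fix d :: "'i \<Rightarrow> complex" and s t assume d: "(\<Sum>i\<in>UNIV. d i) = 0"
    have cd: "(\<Sum>i\<in>UNIV. s * c i + t * d i) = 0" using c d by (simp add: sum.distrib flip: sum_distrib_left)
    have gcd: "(\<Sum>i\<in>UNIV. s * g c i + t * g d i) = 0"
      using g(1)[OF c] g(1)[OF d] by (simp add: sum.distrib flip: sum_distrib_left)
    show "g (\<lambda>i. s * c i + t * d i) = (\<lambda>i. s * g c i + t * g d i)"
    proof (rule coefficients_unique[OF mu b g(1)[OF cd] gcd])
      fix x assume x: "x \<in> gwa_sub b"
      have "tau mu (g (\<lambda>i. s * c i + t * d i)) x = s * tau mu (g c) x + t * tau mu (g d) x"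
        using pull_linear[OF a c d x, of s t] by (simp only: g(2)[OF c x] g(2)[OF d x] g(2)[OF cd x])
      also have "\<dots> = tau mu (\<lambda>i. s * g c i + t * g d i) x"
      proof -
        obtain P where P: "coef x 0 = rat_of (P - pshift (-1) P)" using gwa_sub_primitive[OF x] by blast
        show ?thesis
          unfolding tau_eq[OF P g(1)[OF c]] tau_eq[OF P g(1)[OF d]] tau_eq[OF P gcd]
          by (simp add: algebra_simps sum.distrib sum_distrib_left)
      qed
      finally show "tau mu (g (\<lambda>i. s * c i + t * d i)) x = tau mu (\<lambda>i. s * g c i + t * g d i) x" .
    qed
  qed
qed

end

section \<open>Presentations by generators and relations\<close>

definition relideal :: "'g free_alg set \<Rightarrow> 'g free_alg set" where
  "relideal S = genideal free_algebra S"

definition rel_class :: "'g free_alg set \<Rightarrow> 'g free_alg \<Rightarrow> 'g free_alg set" where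
  "rel_class S f = relideal S +>\<^bsub>free_algebra\<^esub> f"

lemma ideal_relideal: "ideal (relideal S) free_algebra"
  unfolding relideal_def by (rule ring.genideal_ideal[OF ring_free_algebra]) (simp add: free_algebra_def)

lemma relideal_incl: "f \<in> S \<Longrightarrow> f \<in> relideal S"
  unfolding relideal_def genideal_def by blast

lemma relideal_add: "f \<in> relideal S \<Longrightarrow> g \<in> relideal S \<Longrightarrow> f + g \<in> relideal S"
  using additive_subgroup.a_closed[OF ideal.axioms(1)[OF ideal_relideal], of f S g] by (simp add: free_algebra_def)

lemma relideal_0: "0 \<in> relideal S"
  using additive_subgroup.zero_closed[OF ideal.axioms(1)[OF ideal_relideal], of S] by (simp add: free_algebra_def)

lemma relideal_mult_left: "f \<in> relideal S \<Longrightarrow> g * f \<in> relideal S"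
  using ideal.I_l_closed[OF ideal_relideal, of f S g] by (simp add: free_algebra_def)

lemma relideal_mult_right: "f \<in> relideal S \<Longrightarrow> f * g \<in> relideal S"
  using ideal.I_r_closed[OF ideal_relideal, of f S g] by (simp add: free_algebra_def)

lemma relideal_uminus: "f \<in> relideal S \<Longrightarrow> - f \<in> relideal S"
  using relideal_mult_left[of f S "- 1"] by simp

lemma relideal_diff: "f \<in> relideal S \<Longrightarrow> g \<in> relideal S \<Longrightarrow> f - g \<in> relideal S"
  using relideal_add[of f S "- g"] relideal_uminus[of g S] by simp

lemma relideal_least:
  assumes "S \<subseteq> J" "0 \<in> J" "\<And>f g. f \<in> J \<Longrightarrow> g \<in> J \<Longrightarrow> f + g \<in> J"
    "\<And>f g. f \<in> J \<Longrightarrow> g * f \<in> J" "\<And>f g. f \<in> J \<Longrightarrow> f * g \<in> J"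
  shows "relideal S \<subseteq> J"
proof -
  have uminus: "- f \<in> J" if "f \<in> J" for f using assms(4)[OF that, of "- 1"] by simp
  have inv: "inv\<^bsub>add_monoid free_algebra\<^esub> f = - f" for f :: "'a free_alg"
  proof -
    interpret F: ring "free_algebra :: (complex, 'a free_alg) module" by (rule ring_free_algebra)
    have "- f \<oplus>\<^bsub>free_algebra\<^esub> f = \<zero>\<^bsub>free_algebra\<^esub>" "f \<in> carrier free_algebra" "- f \<in> carrier free_algebra"
      by (simp_all add: free_algebra_def)
    then show ?thesis using F.minus_equality[of "- f" f] by (simp add: a_inv_def)
  qed
  have "ideal J free_algebra"
  proof (rule idealI[OF ring_free_algebra])
    show "subgroup J (add_monoid free_algebra)"
    proof
      show "J \<subseteq> carrier (add_monoid free_algebra)" by (simp add: free_algebra_def)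
      show "x \<otimes>\<^bsub>add_monoid free_algebra\<^esub> y \<in> J" if "x \<in> J" "y \<in> J" for x y
        using assms(3)[OF that] by (simp add: free_algebra_def)
      show "\<one>\<^bsub>add_monoid free_algebra\<^esub> \<in> J" using assms(2) by (simp add: free_algebra_def)
      show "inv\<^bsub>add_monoid free_algebra\<^esub> x \<in> J" if "x \<in> J" for x unfolding inv using uminus[OF that] .
    qed
  qed (use assms(4,5) in \<open>simp_all add: free_algebra_def\<close>)
  then show ?thesis unfolding relideal_def genideal_def using assms(1) by blast
qed

lemma rel_class_eq_iff: "rel_class S f = rel_class S g \<longleftrightarrow> f - g \<in> relideal S"
proof
  assume "rel_class S f = rel_class S g"
  moreover have "f \<in> rel_class S f"
    unfolding rel_class_def a_r_coset_def' using relideal_0 by (force simp: free_algebra_def)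
  ultimately have "f \<in> rel_class S g" by simp
  then obtain h where "h \<in> relideal S" "f = h + g" by (auto simp: rel_class_def a_r_coset_def' free_algebra_def)
  then show "f - g \<in> relideal S" by simp
next
  assume fg: "f - g \<in> relideal S"
  have *: "rel_class S f = {h + f |h. h \<in> relideal S}" for f :: "'a free_alg"
    by (auto simp: rel_class_def a_r_coset_def' free_algebra_def)
  show "rel_class S f = rel_class S g" unfolding *
  proof safe
    fix h assume "h \<in> relideal S"
    then show "\<exists>k. h + f = k + g \<and> k \<in> relideal S"
      using relideal_add[OF _ fg] by (intro exI[of _ "h + (f - g)"]) simp
  next
    fix h assume "h \<in> relideal S"
    then show "\<exists>k. h + g = k + f \<and> k \<in> relideal S"
      using relideal_diff[OF _ fg] by (intro exI[of _ "h - (f - g)"]) simp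
  qed
qed

lemma presented_algebra_ops:
  shows presented_carrier: "carrier (presented_algebra S) = range (rel_class S)"
    and presented_add: "rel_class S f \<oplus>\<^bsub>presented_algebra S\<^esub> rel_class S g = rel_class S (f + g)"
    and presented_mult: "rel_class S f \<otimes>\<^bsub>presented_algebra S\<^esub> rel_class S g = rel_class S (f * g)"
    and presented_smult: "c \<odot>\<^bsub>presented_algebra S\<^esub> rel_class S f = rel_class S (scalar c * f)"
    and presented_one: "\<one>\<^bsub>presented_algebra S\<^esub> = rel_class S 1"
    and presented_zero: "\<zero>\<^bsub>presented_algebra S\<^esub> = rel_class S 0"
proof -
  let ?F = "free_algebra :: (complex, 'a free_alg) module"
  interpret F: ring ?F by (rule ring_free_algebra)
  interpret I: ideal "relideal S" ?F by (rule ideal_relideal)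
  have carr: "x \<in> carrier ?F" for x by (simp add: free_algebra_def)
  let ?P = "presented_algebra S"
  have P: "?P = ring.extend (?F Quot relideal S)
        \<lparr>module.smult = (\<lambda>c X. \<Union>f\<in>X. rel_class S (c \<odot>\<^bsub>?F\<^esub> f))\<rparr>"
    by (simp add: presented_algebra_def relideal_def rel_class_def Let_def)
  have fields: "carrier ?P = carrier (?F Quot relideal S)" "monoid.mult ?P = monoid.mult (?F Quot relideal S)"
    "monoid.one ?P = monoid.one (?F Quot relideal S)" "ring.zero ?P = ring.zero (?F Quot relideal S)"
    "ring.add ?P = ring.add (?F Quot relideal S)"
    "\<And>c X. c \<odot>\<^bsub>?P\<^esub> X = (\<Union>f\<in>X. rel_class S (c \<odot>\<^bsub>?F\<^esub> f))"
    by (simp_all add: P ring.extend_def)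
  show "carrier ?P = range (rel_class S)"
    unfolding fields by (auto simp: FactRing_def A_RCOSETS_def' rel_class_def free_algebra_def)
  show "rel_class S f \<oplus>\<^bsub>?P\<^esub> rel_class S g = rel_class S (f + g)"
    unfolding fields rel_class_def using I.a_rcos_sum[OF carr carr] by (simp add: FactRing_def free_algebra_def)
  show "rel_class S f \<otimes>\<^bsub>?P\<^esub> rel_class S g = rel_class S (f * g)"
    unfolding fields rel_class_def using I.rcoset_mult_add[OF carr carr] by (simp add: FactRing_def free_algebra_def)
  show "\<one>\<^bsub>?P\<^esub> = rel_class S 1"
    unfolding fields rel_class_def by (simp add: FactRing_def free_algebra_def)
  have "rel_class S 0 = relideal S" by (auto simp: rel_class_def a_r_coset_def' free_algebra_def)
  then show "\<zero>\<^bsub>?P\<^esub> = rel_class S 0"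
    unfolding fields by (simp add: FactRing_def)
  have "rel_class S (c \<odot>\<^bsub>?F\<^esub> g) = rel_class S (scalar c * f)" if "g \<in> rel_class S f" for g
  proof -
    from that obtain h where h: "h \<in> relideal S" "g = h + f"
      by (auto simp: rel_class_def a_r_coset_def' free_algebra_def)
    then show ?thesis unfolding rel_class_eq_iff
      using relideal_mult_left[OF h(1), of "scalar c"] by (simp add: free_algebra_def algebra_simps)
  qed
  moreover have "f \<in> rel_class S f"
    unfolding rel_class_def a_r_coset_def' using relideal_0 by (force simp: free_algebra_def)
  ultimately show "c \<odot>\<^bsub>?P\<^esub> rel_class S f = rel_class S (scalar c * f)"
    unfolding fields by blast
qed

section \<open>Induction and evaluation in the free algebra\<close>

lemma single_Cons: "Poly_Mapping.single (Word (g # l)) c = gen g * Poly_Mapping.single (Word l) c"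
  by (simp add: gen_def mult_single plus_word_def)

lemma free_alg_induct [case_names add scalar gen]:
  fixes f :: "'g free_alg"
  assumes add: "\<And>f g. P f \<Longrightarrow> P g \<Longrightarrow> P (f + g)" and scalar: "\<And>c. P (scalar c)"
    and gen: "\<And>g f. P f \<Longrightarrow> P (gen g * f)"
  shows "P f"
proof (induction f rule: update_induct)
  case const
  show ?case using scalar[of 0] by (simp add: scalar_def)
next
  case (update f a b)
  have "P (Poly_Mapping.single (Word l) c)" for l c
  proof (induction l)
    case Nil
    show ?case using scalar[of c] by (simp add: scalar_def zero_word_def)
  next
    case (Cons g l)
    then show ?case unfolding single_Cons by (rule gen)
  qed
  then have "P (Poly_Mapping.single a b)" by (metis word.exhaust_sel)
  moreover have "Poly_Mapping.update a b f = Poly_Mapping.single a b + f"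
    using update.hyps
    by (intro poly_mapping_eqI) (auto simp: lookup_update lookup_add lookup_single in_keys_iff when_def)
  ultimately show ?case using update.IH add by simp
qed

text \<open>The universal property of the free algebra for targets with central scalars. It is used
  twice: for evaluation in the skew Laurent polynomials, and for substitutions in the free algebra
  that induce the maps of tori.\<close>

locale scalar_ring =
  fixes sc :: "complex \<Rightarrow> 'r::ring_1"
  assumes sc_add: "sc (c + d) = sc c + sc d" and sc_mult: "sc (c * d) = sc c * sc d"
    and sc_1: "sc 1 = 1" and sc_commute: "sc c * r = r * sc c"
begin

definition eval_free :: "('g \<Rightarrow> 'r) \<Rightarrow> 'g free_alg \<Rightarrow> 'r" where
  "eval_free h f = (\<Sum>w\<in>Poly_Mapping.keys f. sc (Poly_Mapping.lookup f w) * prod_list (map h (letters w)))"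

lemma sc_0: "sc 0 = 0" using sc_add[of 0 0] by simp

lemma eval_free_superset: "finite S \<Longrightarrow> Poly_Mapping.keys f \<subseteq> S \<Longrightarrow>
    eval_free h f = (\<Sum>w\<in>S. sc (Poly_Mapping.lookup f w) * prod_list (map h (letters w)))"
  unfolding eval_free_def by (rule sum.mono_neutral_left) (auto simp: in_keys_iff sc_0)

lemma eval_free_add: "eval_free h (f + g) = eval_free h f + eval_free h g"
proof -
  have *: "finite (Poly_Mapping.keys f \<union> Poly_Mapping.keys g)" "Poly_Mapping.keys f \<subseteq> Poly_Mapping.keys f \<union> Poly_Mapping.keys g" "Poly_Mapping.keys g \<subseteq> Poly_Mapping.keys f \<union> Poly_Mapping.keys g"
    "Poly_Mapping.keys (f + g) \<subseteq> Poly_Mapping.keys f \<union> Poly_Mapping.keys g" by (auto dest: subsetD[OF Poly_Mapping.keys_add])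
  show ?thesis unfolding eval_free_superset[OF *(1,2)] eval_free_superset[OF *(1,3)] eval_free_superset[OF *(1,4)]
    by (simp add: lookup_add sc_add distrib_right sum.distrib)
qed

lemma eval_free_single: "eval_free h (Poly_Mapping.single w c) = sc c * prod_list (map h (letters w))"
proof -
  have "eval_free h (Poly_Mapping.single w c) = (\<Sum>v\<in>{w}. sc (Poly_Mapping.lookup (Poly_Mapping.single w c) v) * prod_list (map h (letters v)))"
    by (rule eval_free_superset) auto
  then show ?thesis by simp
qed

lemma eval_free_scalar: "eval_free h (scalar c) = sc c"
  by (simp add: scalar_def eval_free_single zero_word_def)
lemma eval_free_gen: "eval_free h (gen g) = h g"
  by (simp add: gen_def eval_free_single sc_1)
lemma eval_free_1: "eval_free h 1 = 1"
  using eval_free_scalar[of h 1] by (simp add: scalar_one sc_1)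
lemma eval_free_0: "eval_free h 0 = 0"
  by (simp add: eval_free_def)

lemma eval_free_gen_mult: "eval_free h (gen g * f) = h g * eval_free h f"
proof (induction f rule: update_induct)
  case const
  then show ?case by (simp add: eval_free_0)
next
  case (update f a b)
  have "Poly_Mapping.update a b f = Poly_Mapping.single a b + f"
    using update.hyps
    by (intro poly_mapping_eqI) (auto simp: lookup_update lookup_add lookup_single in_keys_iff when_def)
  moreover have "eval_free h (gen g * Poly_Mapping.single a b) = h g * eval_free h (Poly_Mapping.single a b)"
    by (simp add: gen_def mult_single plus_word_def eval_free_single) (metis sc_commute mult.assoc)
  ultimately show ?case using update.IH by (simp add: distrib_left eval_free_add)
qed

lemma eval_free_scalar_mult: "eval_free h (scalar c * f) = sc c * eval_free h f"
proof (induction f rule: free_alg_induct)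
  case (add f g) then show ?case by (simp add: distrib_left eval_free_add)
next
  case (scalar d) then show ?case by (simp add: eval_free_scalar sc_mult flip: scalar_mult)
next
  case (gen g f)
  have "scalar c * (gen g * f) = gen g * (scalar c * f)" by (metis scalar_commute mult.assoc)
  then show ?case using gen by (simp add: eval_free_gen_mult) (metis sc_commute mult.assoc)
qed

lemma eval_free_mult: "eval_free h (f * g) = eval_free h f * eval_free h g"
proof (induction f rule: free_alg_induct)
  case (add f f') then show ?case by (simp add: distrib_right eval_free_add)
next
  case (scalar d) then show ?case by (simp add: eval_free_scalar_mult eval_free_scalar)
next
  case (gen x f) then show ?case by (simp add: eval_free_gen_mult mult.assoc)
qed

lemma eval_free_uminus: "eval_free h (- f) = - eval_free h f"
  using eval_free_add[of h f "- f"] by (simp add: eval_free_0 eq_neg_iff_add_eq_0 add.commute)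
lemma eval_free_diff: "eval_free h (f - g) = eval_free h f - eval_free h g"
  using eval_free_add[of h f "- g"] by (simp add: eval_free_uminus)
lemma eval_free_power: "eval_free h (f ^ n) = eval_free h f ^ n"
  by (induction n) (simp_all add: eval_free_1 eval_free_mult)
lemma eval_free_sum: "eval_free h (sum f S) = (\<Sum>i\<in>S. eval_free h (f i))"
  by (induction S rule: infinite_finite_induct) (auto simp: eval_free_0 eval_free_add)

lemma eval_free_relideal:
  assumes "\<And>r. r \<in> S \<Longrightarrow> eval_free h r = 0" shows "f \<in> relideal S \<Longrightarrow> eval_free h f = 0"
  using relideal_least[of S "{f. eval_free h f = 0}"] assms by (auto simp: eval_free_0 eval_free_add eval_free_mult)

end

section \<open>Polynomials evaluated in the free algebra\<close>

lemma eval_poly_pCons: "eval_poly (pCons c p) u = scalar c + u * eval_poly p u"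
proof (cases "p = 0")
  case True
  then show ?thesis by (simp add: eval_poly_def scalar_def)
next
  case False
  have "eval_poly (pCons c p) u = (\<Sum>i\<le>Suc (degree p). scalar (coeff (pCons c p) i) * u ^ i)"
    using False by (simp add: eval_poly_def)
  also have "\<dots> = scalar c + (\<Sum>i\<le>degree p. scalar (coeff p i) * (u * u ^ i))"
    by (subst sum.atMost_Suc_shift) simp
  also have "(\<Sum>i\<le>degree p. scalar (coeff p i) * (u * u ^ i)) = u * eval_poly p u"
    unfolding eval_poly_def sum_distrib_left
    by (intro sum.cong refl) (metis scalar_commute mult.assoc)
  finally show ?thesis .
qed

lemma eval_poly_0 [simp]: "eval_poly 0 u = 0"
  by (simp add: eval_poly_def scalar_def)

lemma scalar_add: "scalar (c + d) = scalar c + scalar d"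
  by (simp add: scalar_def single_add)

lemma minus_one_eq_scalar: "(u :: 'a free_alg) - 1 = u + scalar (of_int (- 1))"
proof -
  have "scalar (of_int (- 1)) + 1 = scalar (of_int (- 1) + 1)" unfolding scalar_add scalar_one ..
  also have "\<dots> = 0" by (simp add: scalar_def)
  finally have "scalar (of_int (- 1)) = (- 1 :: 'a free_alg)" by (simp only: eq_neg_iff_add_eq_0)
  then show ?thesis by simp
qed

lemma eval_poly_const: "eval_poly [:c:] u = scalar c"
  by (simp add: eval_poly_pCons)

lemma eval_poly_add: "eval_poly (p + q) u = eval_poly p u + eval_poly q u"
proof (induction p arbitrary: q)
  case (pCons c p)
  show ?case
  proof (cases q)
    case (pCons d q')
    then show ?thesis using pCons.IH[of q'] by (simp add: eval_poly_pCons scalar_add algebra_simps)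
  qed
qed simp

lemma eval_poly_smult: "eval_poly (smult c p) u = scalar c * eval_poly p u"
proof (induction p)
  case (pCons d p)
  have "scalar c * (u * eval_poly p u) = u * (scalar c * eval_poly p u)" by (metis scalar_commute mult.assoc)
  then show ?case using pCons.IH by (simp add: eval_poly_pCons scalar_mult distrib_left)
qed simp

lemma eval_poly_mult: "eval_poly (p * q) u = eval_poly p u * eval_poly q u"
proof (induction p)
  case (pCons c p)
  then show ?case
    by (simp add: eval_poly_pCons eval_poly_add eval_poly_smult distrib_right mult.assoc scalar_def)
qed simp

lemma eval_poly_shift: "eval_poly p (u + scalar (of_int n)) = eval_poly (pshift n p) u"
proof (induction p)
  case (pCons c p)
  have "pshift n (pCons c p) = [:c:] + [:of_int n, 1:] * pshift n p"
    by (simp add: pshift_def pcompose_pCons)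
  then show ?case
    by (simp only: eval_poly_add eval_poly_mult pCons.IH eval_poly_pCons) (simp add: eval_poly_pCons scalar_one scalar_def algebra_simps)
qed simp

definition sc_skl :: "complex \<Rightarrow> skl" where "sc_skl c = monomial (rat_of [:c:]) 0"

interpretation skl: scalar_ring sc_skl
proof
  fix c d :: complex and r
  have "[:c + d:] = [:c:] + [:d:]" by simp
  then show "sc_skl (c + d) = sc_skl c + sc_skl d" by (simp only: sc_skl_def rat_of_add monomial_add)
  have "[:c * d:] = [:c:] * [:d:]" by simp
  then show "sc_skl (c * d) = sc_skl c * sc_skl d" by (simp only: sc_skl_def rat_of_mult monomial_mult_monomial minus_zero rshift_zero add_0)
  show "sc_skl 1 = 1" unfolding sc_skl_def by (metis rat_of_1 one_pCons monomial_1_0)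
  show "sc_skl c * r = r * sc_skl c" by (rule skl_eqI) (simp add: sc_skl_def mult.commute)
qed

section \<open>Normal forms in A(a) and faithfulness of its representation\<close>

fun gwa_images :: "complex poly \<Rightarrow> gwa_gen \<Rightarrow> skl" where
  "gwa_images a gen_h = monomial (rat_of [:0, 1:]) 0"
| "gwa_images a gen_x = monomial 1 1"
| "gwa_images a gen_y = monomial (rat_of a) (-1)"

lemma eval_free_eval_poly: "skl.eval_free h u = monomial (rat_of q) 0 \<Longrightarrow> skl.eval_free h (eval_poly p u) = monomial (rat_of (pcompose p q)) 0"
proof (induction p)
  case 0
  then show ?case by (simp add: skl.eval_free_0)
next
  case (pCons c p)
  have "skl.eval_free h (eval_poly (pCons c p) u) = sc_skl c + monomial (rat_of q) 0 * monomial (rat_of (pcompose p q)) 0"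
    using pCons by (simp add: eval_poly_pCons skl.eval_free_add skl.eval_free_mult skl.eval_free_scalar)
  also have "\<dots> = monomial (rat_of ([:c:] + q * pcompose p q)) 0"
    by (simp only: sc_skl_def monomial_mult_monomial rat_of_add rat_of_mult minus_zero rshift_zero add_0 monomial_add)
  finally show ?case by (simp add: pcompose_pCons)
qed

definition gwa_rels :: "complex poly \<Rightarrow> gwa_gen free_alg set" where
  "gwa_rels a = {gen gen_x * gen gen_h - (gen gen_h - 1) * gen gen_x,
         gen gen_y * gen gen_h - (gen gen_h + 1) * gen gen_y,
         gen gen_y * gen gen_x - eval_poly a (gen gen_h),
         gen gen_x * gen gen_y - eval_poly a (gen gen_h - 1)}"

lemma gwa_presented: "gwa a = presented_algebra (gwa_rels a)"
  by (simp add: gwa_def gwa_rels_def Let_def)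

abbreviation gwa_eval :: "complex poly \<Rightarrow> gwa_gen free_alg \<Rightarrow> skl" where
  "gwa_eval a \<equiv> skl.eval_free (gwa_images a)"

lemma gwa_eval_h: "gwa_eval a (eval_poly p (gen gen_h)) = monomial (rat_of p) 0"
  using eval_free_eval_poly[of "gwa_images a" "gen gen_h" "[:0, 1:]" p] by (simp add: skl.eval_free_gen pcompose_idR)

lemma gwa_eval_rels: "r \<in> gwa_rels a \<Longrightarrow> gwa_eval a r = 0"
proof -
  assume "r \<in> gwa_rels a"
  then consider "r = gen gen_x * gen gen_h - (gen gen_h - 1) * gen gen_x"
    | "r = gen gen_y * gen gen_h - (gen gen_h + 1) * gen gen_y"
    | "r = gen gen_y * gen gen_x - eval_poly a (gen gen_h)"
    | "r = gen gen_x * gen gen_y - eval_poly a (gen gen_h - 1)"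
    unfolding gwa_rels_def by blast
  then show ?thesis
  proof cases
    case 1
    have "pshift (-1) [:0, 1:] = [:0, 1:] - 1" by (rule poly_ext) simp
    then show ?thesis unfolding 1
      by (simp add: skl.eval_free_diff skl.eval_free_mult skl.eval_free_gen skl.eval_free_1 monomial_mult_monomial left_diff_distrib monomial_diff del: pshift_def)
  next
    case 2
    have "pshift 1 [:0, 1:] = [:0, 1:] + 1" by (rule poly_ext) simp
    then show ?thesis unfolding 2
      by (simp add: skl.eval_free_diff skl.eval_free_add skl.eval_free_mult skl.eval_free_gen skl.eval_free_1 monomial_mult_monomial distrib_right distrib_left monomial_add mult.commute)
  next
    case 3
    then show ?thesis by (simp add: skl.eval_free_diff skl.eval_free_mult skl.eval_free_gen gwa_eval_h monomial_mult_monomial)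
  next
    case 4
    have "gen gen_h - 1 = gen gen_h + scalar (of_int (- 1))"
      by (rule minus_one_eq_scalar)
    then have "gwa_eval a (eval_poly a (gen gen_h - 1)) = monomial (rat_of (pshift (-1) a)) 0"
      by (simp only: eval_poly_shift gwa_eval_h)
    then show ?thesis by (simp add: 4 skl.eval_free_diff skl.eval_free_mult skl.eval_free_gen monomial_mult_monomial)
  qed
qed

definition gwa_monomial :: "int \<Rightarrow> gwa_gen free_alg" where
  "gwa_monomial n = (if n \<ge> 0 then gen gen_x ^ nat n else gen gen_y ^ nat (- n))"

lemma monomial_y_power: "monomial (rat_of a) (-1) ^ n = monomial (rat_of (shifted_prod a 0 (int n))) (- int n)"
proof (induction n)
  case 0 show ?case by (simp add: monomial_1_0)
next
  case (Suc n)
  have "{0..<1 + int n} = insert 0 {1..<1 + int n}" by auto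
  then have "shifted_prod a 0 (1 + int n) = a * shifted_prod a 1 (1 + int n)" by (simp add: shifted_prod_def)
  then show ?case by (simp add: Suc monomial_mult_monomial pshift_shifted_prod)
qed

lemma monomial_x_power: "monomial 1 1 ^ n = monomial 1 (int n)"
  by (induction n) (simp_all add: monomial_1_0 monomial_mult_monomial)

lemma gwa_eval_monomial: "gwa_eval a (gwa_monomial n) = monomial (rat_of (shifted_prod a 0 (- n))) n"
  by (simp add: gwa_monomial_def skl.eval_free_power skl.eval_free_gen monomial_x_power monomial_y_power)

context
  fixes a :: "complex poly"
begin

definition gcong :: "gwa_gen free_alg \<Rightarrow> gwa_gen free_alg \<Rightarrow> bool" (infix "\<doteq>" 50) where
  "f \<doteq> g \<longleftrightarrow> f - g \<in> relideal (gwa_rels a)"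

lemma gcong_refl: "f \<doteq> f" by (simp add: gcong_def relideal_0)
lemma gcong_trans: "f \<doteq> g \<Longrightarrow> g \<doteq> k \<Longrightarrow> f \<doteq> k"
  unfolding gcong_def using relideal_add[of "f - g" _ "g - k"] by simp
lemma gcong_add: "f \<doteq> g \<Longrightarrow> f' \<doteq> g' \<Longrightarrow> f + f' \<doteq> g + g'"
  unfolding gcong_def using relideal_add[of "f - g" _ "f' - g'"] by (simp add: algebra_simps)
lemma gcong_left: "f \<doteq> g \<Longrightarrow> k * f \<doteq> k * g"
  unfolding gcong_def using relideal_mult_left[of "f - g" _ k] by (simp add: right_diff_distrib)
lemma gcong_right: "f \<doteq> g \<Longrightarrow> f * k \<doteq> g * k"
  unfolding gcong_def using relideal_mult_right[of "f - g" _ k] by (simp add: left_diff_distrib)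

abbreviation "eh p \<equiv> eval_poly p (gen gen_h)"

lemma rel_xh: "gen gen_x * gen gen_h \<doteq> (gen gen_h + scalar (of_int (-1))) * gen gen_x"
proof -
  have "gen gen_h - 1 = gen gen_h + scalar (of_int (- 1))"
    by (rule minus_one_eq_scalar)
  then show ?thesis unfolding gcong_def by (metis gwa_rels_def insertI1 relideal_incl)
qed
lemma rel_yh: "gen gen_y * gen gen_h \<doteq> (gen gen_h + scalar (of_int 1)) * gen gen_y"
  unfolding gcong_def by (rule relideal_incl) (simp add: gwa_rels_def scalar_one)
lemma rel_yx: "gen gen_y * gen gen_x \<doteq> eh a"
  unfolding gcong_def by (rule relideal_incl) (simp add: gwa_rels_def)
lemma rel_xy: "gen gen_x * gen gen_y \<doteq> eh (pshift (-1) a)"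
proof -
  have "gen gen_h - 1 = gen gen_h + scalar (of_int (- 1))"
    by (rule minus_one_eq_scalar)
  then have "eh (pshift (-1) a) = eval_poly a (gen gen_h - 1)" by (simp only: eval_poly_shift)
  then show ?thesis unfolding gcong_def by (intro relideal_incl) (simp add: gwa_rels_def)
qed

lemma move_past:
  assumes g: "gen g * gen gen_h \<doteq> (gen gen_h + scalar (of_int n)) * gen g"
  shows "gen g * eh p \<doteq> eh (pshift n p) * gen g"
proof (induction p)
  case 0 show ?case by (simp add: gcong_refl)
next
  case (pCons c p)
  let ?u = "gen gen_h + scalar (of_int n)"
  have 1: "gen g * eh (pCons c p) = scalar c * gen g + gen g * gen gen_h * eh p"
    by (simp add: eval_poly_pCons distrib_left mult.assoc scalar_commute)
  have "gen g * gen gen_h * eh p \<doteq> ?u * gen g * eh p" by (rule gcong_right[OF g])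
  moreover have "?u * gen g * eh p \<doteq> ?u * (eh (pshift n p) * gen g)"
    using gcong_left[OF pCons.IH] by (simp add: mult.assoc)
  ultimately have "gen g * eh (pCons c p) \<doteq> scalar c * gen g + ?u * (eh (pshift n p) * gen g)"
    unfolding 1 using gcong_add[OF gcong_refl gcong_trans] by blast
  also have "scalar c * gen g + ?u * (eh (pshift n p) * gen g) = eval_poly (pCons c p) ?u * gen g"
    by (simp only: eval_poly_pCons) (simp only: eval_poly_shift distrib_right mult.assoc)
  finally show ?case by (simp only: eval_poly_shift)
qed

text \<open>Sums of terms p(h) x^n and p(h) y^n, polynomials on the left. Exponents may repeat,
  which keeps closure under addition immediate; they are collected in
  \<open>normal_sum\<close>.\<close>

inductive_set normal :: "gwa_gen free_alg set" where
  base: "eh p * gwa_monomial n \<in> normal"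
| add: "f \<in> normal \<Longrightarrow> g \<in> normal \<Longrightarrow> f + g \<in> normal"

lemma x_monomial: "\<exists>q. gen gen_x * gwa_monomial n \<doteq> eh q * gwa_monomial (n + 1)"
proof (cases "n \<ge> 0")
  case True
  then have "gen gen_x * gwa_monomial n = eh 1 * gwa_monomial (n + 1)"
    by (simp add: gwa_monomial_def nat_add_distrib eval_poly_const scalar_one flip: one_pCons)
       (simp add: one_pCons eval_poly_const scalar_one)
  then show ?thesis using gcong_refl by metis
next
  case False
  then have "nat (- n) = Suc (nat (- (n + 1)))" by auto
  moreover have "gwa_monomial (n + 1) = gen gen_y ^ nat (- (n + 1))"
    using False by (cases "n = -1") (auto simp: gwa_monomial_def)
  ultimately have m: "gwa_monomial n = gen gen_y * gwa_monomial (n + 1)"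
    using False by (simp add: gwa_monomial_def)
  show ?thesis unfolding m using gcong_right[OF rel_xy] by (auto simp flip: mult.assoc)
qed

lemma y_monomial: "\<exists>q. gen gen_y * gwa_monomial n \<doteq> eh q * gwa_monomial (n - 1)"
proof (cases "n \<le> 0")
  case True
  then have "nat (- (n - 1)) = Suc (nat (- n))" by auto
  then have "gen gen_y * gwa_monomial n = eh 1 * gwa_monomial (n - 1)"
    using True by (cases "n = 0") (simp_all add: gwa_monomial_def one_pCons eval_poly_const scalar_one)
  then show ?thesis using gcong_refl by metis
next
  case False
  then have "nat n = Suc (nat (n - 1))" by auto
  then have m: "gwa_monomial n = gen gen_x * gwa_monomial (n - 1)"
    using False by (simp add: gwa_monomial_def)
  show ?thesis unfolding m using gcong_right[OF rel_yx] by (auto simp flip: mult.assoc)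
qed

text \<open>x and y pass a polynomial in h at the price of a translation, and a product of x with a
  power of y, or of y with a power of x, collapses to a polynomial times a shorter power.\<close>

lemma gen_mult_normal: "f \<in> normal \<Longrightarrow> \<exists>f'\<in>normal. gen g * f \<doteq> f'"
proof (induction f rule: normal.induct)
  case (add f f')
  then show ?case using gcong_add normal.add by (metis distrib_left)
next
  case (base p n)
  show ?case
  proof (cases g)
    case gen_h
    have "gen gen_h * (eh p * gwa_monomial n) = eh (pCons 0 p) * gwa_monomial n"
      by (simp add: eval_poly_pCons mult.assoc scalar_def)
    then show ?thesis unfolding gen_h using normal.base gcong_refl by metis
  next
    case gen_x
    obtain q where q: "gen gen_x * gwa_monomial n \<doteq> eh q * gwa_monomial (n + 1)" using x_monomial by blast
    have "gen gen_x * (eh p * gwa_monomial n) \<doteq> eh (pshift (-1) p) * (gen gen_x * gwa_monomial n)"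
      using gcong_right[OF move_past[OF rel_xh]] by (simp add: mult.assoc)
    also have "eh (pshift (-1) p) * (gen gen_x * gwa_monomial n) \<doteq> eh (pshift (-1) p) * (eh q * gwa_monomial (n + 1))"
      by (rule gcong_left[OF q])
    finally (gcong_trans) show ?thesis unfolding gen_x
      using normal.base[of "pshift (-1) p * q" "n + 1"] by (auto simp: eval_poly_mult mult.assoc)
  next
    case gen_y
    obtain q where q: "gen gen_y * gwa_monomial n \<doteq> eh q * gwa_monomial (n - 1)" using y_monomial by blast
    have "gen gen_y * (eh p * gwa_monomial n) \<doteq> eh (pshift 1 p) * (gen gen_y * gwa_monomial n)"
      using gcong_right[OF move_past[OF rel_yh]] by (simp add: mult.assoc)
    also have "eh (pshift 1 p) * (gen gen_y * gwa_monomial n) \<doteq> eh (pshift 1 p) * (eh q * gwa_monomial (n - 1))"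
      by (rule gcong_left[OF q])
    finally (gcong_trans) show ?thesis unfolding gen_y
      using normal.base[of "pshift 1 p * q" "n - 1"] by (auto simp: eval_poly_mult mult.assoc)
  qed
qed

lemma normal_form: "\<exists>f'\<in>normal. f \<doteq> f'"
proof (induction f rule: free_alg_induct)
  case (add f g)
  then show ?case using gcong_add normal.add by metis
next
  case (scalar c)
  have "scalar c = eh [:c:] * gwa_monomial 0" by (simp add: eval_poly_const gwa_monomial_def)
  then show ?case using normal.base gcong_refl by metis
next
  case (gen g f)
  then obtain f' where f': "f' \<in> normal" "f \<doteq> f'" by blast
  then obtain f'' where "f'' \<in> normal" "gen g * f' \<doteq> f''" using gen_mult_normal by blast
  then show ?case using gcong_trans[OF gcong_left[OF f'(2)]] by blast
qed

lemma normal_sum: "f \<in> normal \<Longrightarrow> \<exists>F P. finite F \<and> f = (\<Sum>n\<in>F. eh (P n) * gwa_monomial n)"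
proof (induction f rule: normal.induct)
  case (base p n)
  show ?case by (rule exI[of _ "{n}"], rule exI[of _ "\<lambda>_. p"]) simp
next
  case (add f g)
  then obtain F P G Q where *: "finite F" "f = (\<Sum>n\<in>F. eh (P n) * gwa_monomial n)"
    "finite G" "g = (\<Sum>n\<in>G. eh (Q n) * gwa_monomial n)" by blast
  define R where "R n = (if n \<in> F then P n else 0) + (if n \<in> G then Q n else 0)" for n
  have "f = (\<Sum>n\<in>F \<union> G. eh (if n \<in> F then P n else 0) * gwa_monomial n)"
    unfolding *(2) using *(1,3) by (intro sum.mono_neutral_cong_left) auto
  moreover have "g = (\<Sum>n\<in>F \<union> G. eh (if n \<in> G then Q n else 0) * gwa_monomial n)"
    unfolding *(4) using *(1,3) by (intro sum.mono_neutral_cong_left) auto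
  ultimately have "f + g = (\<Sum>n\<in>F \<union> G. eh (R n) * gwa_monomial n)"
    unfolding R_def by (simp add: eval_poly_add distrib_right sum.distrib)
  then show ?case using * by blast
qed

lemma gwa_eval_normal:
  "gwa_eval a (\<Sum>n\<in>F. eh (P n) * gwa_monomial n) = (\<Sum>n\<in>F. monomial (rat_of (P n * shifted_prod a 0 (- n))) n)"
  by (simp add: skl.eval_free_sum skl.eval_free_mult gwa_eval_h gwa_eval_monomial monomial_mult_monomial)

lemma gwa_eval_cong: "f \<doteq> g \<Longrightarrow> gwa_eval a f = gwa_eval a g"
  using skl.eval_free_relideal[OF gwa_eval_rels, of "gwa_rels a" a "f - g"] by (auto simp: gcong_def skl.eval_free_diff gwa_eval_rels)

text \<open>The terms of a normal form go to distinct degrees, each multiplied by a nonzero product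
  of translates of \<open>a\<close>; a normal form with image zero is therefore zero.\<close>

lemma gwa_eval_eq_0: assumes a: "a \<noteq> 0" and f: "gwa_eval a f = 0" shows "f \<in> relideal (gwa_rels a)"
proof -
  obtain f' where f': "f' \<in> normal" "f \<doteq> f'" using normal_form by blast
  then obtain F P where F: "finite F" "f' = (\<Sum>n\<in>F. eh (P n) * gwa_monomial n)" using normal_sum by blast
  have 0: "(\<Sum>n\<in>F. monomial (rat_of (P n * shifted_prod a 0 (- n))) n) = 0"
    using gwa_eval_cong[OF f'(2)] f gwa_eval_normal F(2) by simp
  have "P m = 0" if "m \<in> F" for m
  proof -
    have "coef (\<Sum>n\<in>F. monomial (rat_of (P n * shifted_prod a 0 (- n))) n) m = (\<Sum>n\<in>F. if n = m then rat_of (P m * shifted_prod a 0 (- m)) else 0)"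
      unfolding coef_sum by (intro sum.cong refl) auto
    then have "rat_of (P m * shifted_prod a 0 (- m)) = 0" using that F(1) unfolding 0 by simp
    then show ?thesis using shifted_prod_nonzero[OF a] by (simp del: rat_of_mult)
  qed
  then have "f' = 0" unfolding F(2) by simp
  then show ?thesis using f'(2) by (simp add: gcong_def)
qed

lemma gwa_eval_range: "range (gwa_eval a) = gwa_sub a"
proof
  show "range (gwa_eval a) \<subseteq> gwa_sub a"
  proof
    fix u assume "u \<in> range (gwa_eval a)"
    then obtain f where f: "u = gwa_eval a f" by blast
    obtain f' where f': "f' \<in> normal" "f \<doteq> f'" using normal_form by blast
    then obtain F P where F: "finite F" "f' = (\<Sum>n\<in>F. eh (P n) * gwa_monomial n)" using normal_sum by blast
    have "u = (\<Sum>n\<in>F. monomial (rat_of (P n * shifted_prod a 0 (- n))) n)"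
      using gwa_eval_cong[OF f'(2)] f gwa_eval_normal F(2) by simp
    then show "u \<in> gwa_sub a" by (simp only:) (intro gwa_sub_sum gwa_sub_monomial dvd_triv_right)
  qed
  show "gwa_sub a \<subseteq> range (gwa_eval a)"
  proof
    fix u assume u: "u \<in> gwa_sub a"
    have "\<exists>p. coef u n = rat_of (p * shifted_prod a 0 (- n))" for n
      using gwD[OF u, of n] by (auto simp: multiples_def mult.commute elim!: dvdE)
    then obtain P where P: "\<And>n. coef u n = rat_of (P n * shifted_prod a 0 (- n))" by metis
    have "u = (\<Sum>n\<in>supp u. monomial (coef u n) n)" by (rule skl_eq_sum_monomial)
    also have "\<dots> = gwa_eval a (\<Sum>n\<in>supp u. eh (P n) * gwa_monomial n)"
      unfolding gwa_eval_normal P[symmetric] ..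
    finally show "u \<in> range (gwa_eval a)" by blast
  qed
qed

end

definition gwa_map :: "complex poly \<Rightarrow> gwa_gen free_alg set \<Rightarrow> skl" where
  "gwa_map a X = gwa_eval a (SOME f. X = rel_class (gwa_rels a) f)"

lemma gwa_map_rel_class: "gwa_map a (rel_class (gwa_rels a) f) = gwa_eval a f"
proof -
  have "rel_class (gwa_rels a) f = rel_class (gwa_rels a) (SOME g. rel_class (gwa_rels a) f = rel_class (gwa_rels a) g)"
    by (rule someI) (rule refl)
  then have "f - (SOME g. rel_class (gwa_rels a) f = rel_class (gwa_rels a) g) \<in> relideal (gwa_rels a)"
    by (simp only: rel_class_eq_iff)
  then have "gwa_eval a (f - (SOME g. rel_class (gwa_rels a) f = rel_class (gwa_rels a) g)) = 0"
    by (intro skl.eval_free_relideal[OF gwa_eval_rels])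
  then show ?thesis unfolding gwa_map_def by (simp add: skl.eval_free_diff)
qed

lemma gwa_map_bij: "a \<noteq> 0 \<Longrightarrow> bij_betw (gwa_map a) (carrier (gwa a)) (gwa_sub a)"
proof -
  assume a: "a \<noteq> 0"
  have "rel_class (gwa_rels a) f = rel_class (gwa_rels a) g"
    if "gwa_map a (rel_class (gwa_rels a) f) = gwa_map a (rel_class (gwa_rels a) g)" for f g
    unfolding rel_class_eq_iff using that by (intro gwa_eval_eq_0[OF a]) (simp add: gwa_map_rel_class skl.eval_free_diff)
  then have "inj_on (gwa_map a) (range (rel_class (gwa_rels a)))" by (auto intro!: inj_onI)
  moreover have "gwa_map a ` range (rel_class (gwa_rels a)) = gwa_sub a"
    unfolding image_image gwa_map_rel_class by (rule gwa_eval_range)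
  ultimately show ?thesis by (simp add: bij_betw_def gwa_presented presented_carrier)
qed

lemma gwa_map_hom:
  assumes "X \<in> carrier (gwa a)" "Y \<in> carrier (gwa a)"
  shows "gwa_map a (X \<oplus>\<^bsub>gwa a\<^esub> Y) = gwa_map a X + gwa_map a Y"
    and "gwa_map a (X \<otimes>\<^bsub>gwa a\<^esub> Y) = gwa_map a X * gwa_map a Y"
    and "gwa_map a (c \<odot>\<^bsub>gwa a\<^esub> X) = monomial (rat_of [:c:]) 0 * gwa_map a X"
    and "gwa_map a \<one>\<^bsub>gwa a\<^esub> = 1" and "gwa_map a \<zero>\<^bsub>gwa a\<^esub> = 0"
proof -
  obtain f g where "X = rel_class (gwa_rels a) f" "Y = rel_class (gwa_rels a) g"
    using assms unfolding gwa_presented presented_carrier by blast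
  then show "gwa_map a (X \<oplus>\<^bsub>gwa a\<^esub> Y) = gwa_map a X + gwa_map a Y"
    "gwa_map a (X \<otimes>\<^bsub>gwa a\<^esub> Y) = gwa_map a X * gwa_map a Y"
    "gwa_map a (c \<odot>\<^bsub>gwa a\<^esub> X) = monomial (rat_of [:c:]) 0 * gwa_map a X"
    "gwa_map a \<one>\<^bsub>gwa a\<^esub> = 1" "gwa_map a \<zero>\<^bsub>gwa a\<^esub> = 0"
    unfolding gwa_presented by (simp_all add: presented_algebra_ops gwa_map_rel_class skl.eval_free_add skl.eval_free_mult skl.eval_free_scalar sc_skl_def skl.eval_free_1 skl.eval_free_0)
qed

section \<open>Modules and linear equivalences\<close>

lemma lmod_group: "left_module A M \<Longrightarrow> abelian_group M"
  by (simp add: left_module_def)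
lemma lmod_ring: "left_module A M \<Longrightarrow> ring A"
  by (simp add: left_module_def)

lemma lmod_hom_closed: "f \<in> lmod_hom A M N \<Longrightarrow> x \<in> carrier M \<Longrightarrow> f x \<in> carrier N"
  by (auto simp: lmod_hom_def)
lemma lmod_hom_add: "f \<in> lmod_hom A M N \<Longrightarrow> x \<in> carrier M \<Longrightarrow> y \<in> carrier M \<Longrightarrow> f (x \<oplus>\<^bsub>M\<^esub> y) = f x \<oplus>\<^bsub>N\<^esub> f y"
  by (auto simp: lmod_hom_def)
lemma lmod_hom_smult: "f \<in> lmod_hom A M N \<Longrightarrow> a \<in> carrier A \<Longrightarrow> x \<in> carrier M \<Longrightarrow> f (a \<odot>\<^bsub>M\<^esub> x) = a \<odot>\<^bsub>N\<^esub> f x"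
  by (auto simp: lmod_hom_def)
lemma lmod_hom_ext: "f \<in> lmod_hom A M N \<Longrightarrow> g \<in> lmod_hom A M N \<Longrightarrow> (\<And>x. x \<in> carrier M \<Longrightarrow> f x = g x) \<Longrightarrow> f = g"
  unfolding lmod_hom_def by (auto intro: PiE_ext)

lemma lmod_hom_zero:
  assumes "left_module A M" "left_module A N" "f \<in> lmod_hom A M N"
  shows "f \<zero>\<^bsub>M\<^esub> = \<zero>\<^bsub>N\<^esub>"
proof -
  interpret M: abelian_group M by (rule lmod_group[OF assms(1)])
  interpret N: abelian_group N by (rule lmod_group[OF assms(2)])
  have f0: "f \<zero>\<^bsub>M\<^esub> \<in> carrier N" using lmod_hom_closed[OF assms(3)] by simp
  have "f \<zero>\<^bsub>M\<^esub> \<oplus>\<^bsub>N\<^esub> f \<zero>\<^bsub>M\<^esub> = f \<zero>\<^bsub>M\<^esub>" using lmod_hom_add[OF assms(3), of "\<zero>\<^bsub>M\<^esub>" "\<zero>\<^bsub>M\<^esub>"] by simp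
  then show ?thesis using N.add.r_cancel_one'[OF f0 f0] by simp
qed

lemma lmod_homI:
  assumes "\<And>x. x \<in> carrier M \<Longrightarrow> f x \<in> carrier N"
    "\<And>x y. x \<in> carrier M \<Longrightarrow> y \<in> carrier M \<Longrightarrow> f (x \<oplus>\<^bsub>M\<^esub> y) = f x \<oplus>\<^bsub>N\<^esub> f y"
    "\<And>a x. a \<in> carrier A \<Longrightarrow> x \<in> carrier M \<Longrightarrow> f (a \<odot>\<^bsub>M\<^esub> x) = a \<odot>\<^bsub>N\<^esub> f x"
    and M: "left_module A M"
  shows "restrict f (carrier M) \<in> lmod_hom A M N"
proof -
  interpret M: abelian_group M by (rule lmod_group[OF M])
  show ?thesis using assms(1-3) left_module.smult_closed[OF M] by (auto simp: lmod_hom_def)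
qed

lemma lmod_hom_compose:
  assumes M: "left_module A L" and f: "f \<in> lmod_hom A L M" and g: "g \<in> lmod_hom A M N"
  shows "compose (carrier L) g f \<in> lmod_hom A L N"
  unfolding compose_def
  by (rule lmod_homI[OF _ _ _ M])
     (simp_all add: lmod_hom_closed[OF f] lmod_hom_closed[OF g] lmod_hom_add[OF f] lmod_hom_add[OF g]
        lmod_hom_smult[OF f] lmod_hom_smult[OF g])

lemma lmod_hom_id: "left_module A M \<Longrightarrow> hom_id M \<in> lmod_hom A M M"
  unfolding hom_id_def by (rule lmod_homI) auto

lemma lmod_hom_hom_add:
  assumes M: "left_module A M" and N: "left_module A N" and f: "f \<in> lmod_hom A M N" and g: "g \<in> lmod_hom A M N"
  shows "hom_add M N f g \<in> lmod_hom A M N"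
proof -
  interpret N: abelian_group N by (rule lmod_group[OF N])
  note c = lmod_hom_closed[OF f] lmod_hom_closed[OF g]
  show ?thesis unfolding hom_add_def
  proof (rule lmod_homI[OF _ _ _ M])
    fix x y assume xy: "x \<in> carrier M" "y \<in> carrier M"
    show "f (x \<oplus>\<^bsub>M\<^esub> y) \<oplus>\<^bsub>N\<^esub> g (x \<oplus>\<^bsub>M\<^esub> y) = f x \<oplus>\<^bsub>N\<^esub> g x \<oplus>\<^bsub>N\<^esub> (f y \<oplus>\<^bsub>N\<^esub> g y)"
      using xy c by (simp add: lmod_hom_add[OF f] lmod_hom_add[OF g] N.a_ac)
  next
    fix a x assume ax: "a \<in> carrier A" "x \<in> carrier M"
    show "f (a \<odot>\<^bsub>M\<^esub> x) \<oplus>\<^bsub>N\<^esub> g (a \<odot>\<^bsub>M\<^esub> x) = a \<odot>\<^bsub>N\<^esub> (f x \<oplus>\<^bsub>N\<^esub> g x)"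
      using ax c by (simp add: lmod_hom_smult[OF f] lmod_hom_smult[OF g] left_module.smult_r_distr[OF N])
  qed (use c in auto)
qed

text \<open>
  The regular module and its quotients are needed with elements in the universe. Both are images of the algebra under
  a map \<open>j\<close> whose fibres form a congruence: an injection for the regular module, an injection composed with a
  choice of representatives for a quotient.
\<close>

definition img_module :: "(complex, 'a) module \<Rightarrow> ('a \<Rightarrow> 'u) \<Rightarrow> ('a, 'u) module" where
  "img_module A j = \<lparr>carrier = j ` carrier A, monoid.mult = undefined, one = undefined, zero = j \<zero>\<^bsub>A\<^esub>,
     add = (\<lambda>x y. j (inv_into (carrier A) j x \<oplus>\<^bsub>A\<^esub> inv_into (carrier A) j y)),
     module.smult = (\<lambda>a x. j (a \<otimes>\<^bsub>A\<^esub> inv_into (carrier A) j x))\<rparr>"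

locale left_congruence = ring A for A :: "(complex, 'a) module" (structure) +
  fixes j :: "'a \<Rightarrow> 'u"
  assumes cong_add: "x \<in> carrier A \<Longrightarrow> x' \<in> carrier A \<Longrightarrow> y \<in> carrier A \<Longrightarrow> y' \<in> carrier A \<Longrightarrow>
      j x = j x' \<Longrightarrow> j y = j y' \<Longrightarrow> j (x \<oplus> y) = j (x' \<oplus> y')"
    and cong_mult: "a \<in> carrier A \<Longrightarrow> x \<in> carrier A \<Longrightarrow> x' \<in> carrier A \<Longrightarrow> j x = j x' \<Longrightarrow> j (a \<otimes> x) = j (a \<otimes> x')"
begin

lemma carrier_img: "carrier (img_module A j) = j ` carrier A"
  by (simp add: img_module_def)
lemma zero_img: "\<zero>\<^bsub>img_module A j\<^esub> = j \<zero>"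
  by (simp add: img_module_def)

lemma add_img: "x \<in> carrier A \<Longrightarrow> y \<in> carrier A \<Longrightarrow> j x \<oplus>\<^bsub>img_module A j\<^esub> j y = j (x \<oplus> y)"
proof -
  assume xy: "x \<in> carrier A" "y \<in> carrier A"
  show ?thesis unfolding img_module_def
    using xy cong_add[of "inv_into (carrier A) j (j x)" x "inv_into (carrier A) j (j y)" y]
    by (simp add: inv_into_into f_inv_into_f)
qed

lemma smult_img: "a \<in> carrier A \<Longrightarrow> x \<in> carrier A \<Longrightarrow> a \<odot>\<^bsub>img_module A j\<^esub> j x = j (a \<otimes> x)"
proof -
  assume xy: "a \<in> carrier A" "x \<in> carrier A"
  show ?thesis unfolding img_module_def
    using xy cong_mult[of a "inv_into (carrier A) j (j x)" x]
    by (simp add: inv_into_into f_inv_into_f)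
qed

lemma left_module_img: "left_module A (img_module A j)"
proof -
  let ?M = "img_module A j"
  have "abelian_group ?M"
  proof (rule abelian_groupI)
    fix u assume "u \<in> carrier ?M"
    then obtain x where x: "x \<in> carrier A" "u = j x" by (auto simp: carrier_img)
    show "\<exists>v\<in>carrier ?M. v \<oplus>\<^bsub>?M\<^esub> u = \<zero>\<^bsub>?M\<^esub>"
      by (rule bexI[of _ "j (\<ominus> x)"]) (use x in \<open>simp_all add: add_img zero_img carrier_img l_neg\<close>)
    show "\<zero>\<^bsub>?M\<^esub> \<oplus>\<^bsub>?M\<^esub> u = u" using x by (simp add: add_img zero_img)
    fix v assume "v \<in> carrier ?M"
    then obtain y where y: "y \<in> carrier A" "v = j y" by (auto simp: carrier_img)
    show "u \<oplus>\<^bsub>?M\<^esub> v \<in> carrier ?M" using x y by (simp add: add_img carrier_img)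
    show "u \<oplus>\<^bsub>?M\<^esub> v = v \<oplus>\<^bsub>?M\<^esub> u" using x y by (simp add: add_img a_comm)
    fix w assume "w \<in> carrier ?M"
    then obtain z where z: "z \<in> carrier A" "w = j z" by (auto simp: carrier_img)
    show "u \<oplus>\<^bsub>?M\<^esub> v \<oplus>\<^bsub>?M\<^esub> w = u \<oplus>\<^bsub>?M\<^esub> (v \<oplus>\<^bsub>?M\<^esub> w)" using x y z by (simp add: add_img a_assoc)
  qed (simp add: zero_img carrier_img)
  moreover have "left_module_axioms A ?M"
  proof
    fix a u assume a: "a \<in> carrier A" and "u \<in> carrier ?M"
    then obtain x where x: "x \<in> carrier A" "u = j x" by (auto simp: carrier_img)
    show "a \<odot>\<^bsub>?M\<^esub> u \<in> carrier ?M" using a x by (simp add: smult_img carrier_img)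
    fix b assume b: "b \<in> carrier A"
    show "(a \<oplus> b) \<odot>\<^bsub>?M\<^esub> u = a \<odot>\<^bsub>?M\<^esub> u \<oplus>\<^bsub>?M\<^esub> b \<odot>\<^bsub>?M\<^esub> u"
      using a b x by (simp add: smult_img add_img l_distr)
    show "(a \<otimes> b) \<odot>\<^bsub>?M\<^esub> u = a \<odot>\<^bsub>?M\<^esub> (b \<odot>\<^bsub>?M\<^esub> u)"
      using a b x by (simp add: smult_img m_assoc)
  next
    fix a u v assume a: "a \<in> carrier A" and "u \<in> carrier ?M" "v \<in> carrier ?M"
    then obtain x y where x: "x \<in> carrier A" "u = j x" and y: "y \<in> carrier A" "v = j y" by (auto simp: carrier_img)
    show "a \<odot>\<^bsub>?M\<^esub> (u \<oplus>\<^bsub>?M\<^esub> v) = a \<odot>\<^bsub>?M\<^esub> u \<oplus>\<^bsub>?M\<^esub> a \<odot>\<^bsub>?M\<^esub> v"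
      using a x y by (simp add: smult_img add_img r_distr)
  next
    fix u assume "u \<in> carrier ?M"
    then obtain x where x: "x \<in> carrier A" "u = j x" by (auto simp: carrier_img)
    show "\<one> \<odot>\<^bsub>?M\<^esub> u = u" using x by (simp add: smult_img)
  qed
  ultimately show ?thesis using ring_axioms by (simp add: left_module_def)
qed

end

lemma left_congruence_inj:
  assumes "ring A" "inj_on j (carrier A)" shows "left_congruence A j"
proof -
  interpret ring A by fact
  show ?thesis by unfold_locales (use assms(2) in \<open>auto dest: inj_onD\<close>)
qed

definition msum :: "('a, 'u) module \<Rightarrow> 'u list \<Rightarrow> 'u" where
  "msum M xs = foldr (add M) xs \<zero>\<^bsub>M\<^esub>"

lemma msum_Nil [simp]: "msum M [] = \<zero>\<^bsub>M\<^esub>" and msum_Cons [simp]: "msum M (x # xs) = x \<oplus>\<^bsub>M\<^esub> msum M xs"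
  by (simp_all add: msum_def)

lemma msum_closed: "abelian_group M \<Longrightarrow> set xs \<subseteq> carrier M \<Longrightarrow> msum M xs \<in> carrier M"
proof -
  assume "abelian_group M" and xs: "set xs \<subseteq> carrier M"
  then interpret abelian_group M by simp
  show ?thesis using xs by (induction xs) auto
qed

lemma msum_append:
  assumes "abelian_group M" "set xs \<subseteq> carrier M" "set ys \<subseteq> carrier M"
  shows "msum M (xs @ ys) = msum M xs \<oplus>\<^bsub>M\<^esub> msum M ys"
proof -
  interpret abelian_group M by fact
  show ?thesis using assms(2,3)
    by (induction xs) (auto simp: msum_closed[OF assms(1)] a_assoc)
qed

lemma lmod_isoD: "h \<in> lmod_iso A M N \<Longrightarrow> h \<in> lmod_hom A M N" "h \<in> lmod_iso A M N \<Longrightarrow> inj_on h (carrier M)"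
  "h \<in> lmod_iso A M N \<Longrightarrow> h ` carrier M = carrier N"
  by (auto simp: lmod_iso_def bij_betw_def)

lemma lmod_iso_inverse:
  assumes M: "left_module A M" and N: "left_module A N" and h: "h \<in> lmod_iso A M N"
  shows "restrict (inv_into (carrier M) h) (carrier N) \<in> lmod_hom A N M"
proof (rule lmod_homI[OF _ _ _ N])
  interpret M: abelian_group M by (rule lmod_group[OF M])
  note hh = lmod_isoD[OF h]
  have c: "inv_into (carrier M) h x \<in> carrier M" "h (inv_into (carrier M) h x) = x" if "x \<in> carrier N" for x
    using that hh(3) by (auto intro: inv_into_into f_inv_into_f)
  have eq: "inv_into (carrier M) h y = x" if "x \<in> carrier M" "h x = y" for x y
    using that hh(2) by (auto intro: inv_into_f_eq)
  fix x assume x: "x \<in> carrier N"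
  show "inv_into (carrier M) h x \<in> carrier M" using c x by blast
  fix y assume y: "y \<in> carrier N"
  show "inv_into (carrier M) h (x \<oplus>\<^bsub>N\<^esub> y) = inv_into (carrier M) h x \<oplus>\<^bsub>M\<^esub> inv_into (carrier M) h y"
    by (rule eq) (use c x y lmod_hom_add[OF hh(1)] in auto)
next
  note hh = lmod_isoD[OF h]
  fix a x assume ax: "a \<in> carrier A" "x \<in> carrier N"
  have c: "inv_into (carrier M) h x \<in> carrier M" "h (inv_into (carrier M) h x) = x"
    using ax hh(3) by (auto intro: inv_into_into f_inv_into_f)
  show "inv_into (carrier M) h (a \<odot>\<^bsub>N\<^esub> x) = a \<odot>\<^bsub>M\<^esub> inv_into (carrier M) h x"
    by (rule inv_into_f_eq[OF hh(2)]) (use c ax lmod_hom_smult[OF hh(1)] left_module.smult_closed[OF M] in auto)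
qed

text \<open>The homomorphism out of the regular module, realised on the image of \<open>i\<close>,
  that takes 1 to \<open>z\<close>.\<close>

definition rmul :: "(complex, 'a) module \<Rightarrow> ('a \<Rightarrow> 'u) \<Rightarrow> ('a, 'u) module \<Rightarrow> 'u \<Rightarrow> 'u \<Rightarrow> 'u" where
  "rmul A i M z = (\<lambda>u\<in>i ` carrier A. inv_into (carrier A) i u \<odot>\<^bsub>M\<^esub> z)"

text \<open>A list of pairs (f, q) encodes the sum of the f(q), which for regular \<open>N\<close>
  is an element of the trace ideal of \<open>M\<close>. The same data also serve as a dual
  basis.\<close>

definition hom_list :: "(complex, 'a) module \<Rightarrow> ('a, 'u) module \<Rightarrow> ('a, 'u) module \<Rightarrow> (('u \<Rightarrow> 'u) \<times> 'u) list \<Rightarrow> bool" where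
  "hom_list A M N ps \<longleftrightarrow> (\<forall>(f, q)\<in>set ps. f \<in> lmod_hom A M N \<and> q \<in> carrier M)"

locale linear_equivalence =
  fixes A :: "(complex, 'a) module" and B :: "(complex, 'b) module"
    and Fo :: "('a, 'u) module \<Rightarrow> ('b, 'u) module" and Fm
    and Go :: "('b, 'u) module \<Rightarrow> ('a, 'u) module" and Gm \<eta> \<epsilon>
    and i :: "'a \<Rightarrow> 'u" and j :: "'b \<Rightarrow> 'u"
  assumes algA: "complex_algebra A" and algB: "complex_algebra B"
    and F: "linear_functor A B Fo Fm" and G: "linear_functor B A Go Gm"
    and eta: "nat_iso_id A (\<lambda>M. Go (Fo M)) (\<lambda>M N f. Gm (Fo M) (Fo N) (Fm M N f)) \<eta>"
    and eps: "nat_iso_id B (\<lambda>M. Fo (Go M)) (\<lambda>M N f. Fm (Go M) (Go N) (Gm M N f)) \<epsilon>"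
    and i: "inj_on i (carrier A)" and j: "inj_on j (carrier B)"
begin

text \<open>The data are symmetric, so every result of the locale has a second reading with the two
  algebras exchanged.\<close>

lemma swap: "linear_equivalence B A Go Gm Fo Fm \<epsilon> \<eta> j i"
  unfolding linear_equivalence_def using algA algB F G eta eps i j by blast

lemma ringA: "ring A" by (rule complex_algebra.axioms(1)[OF algA])

lemma congA: "left_congruence A i" by (rule left_congruence_inj[OF ringA i])
lemma congB: "left_congruence B j"
  by (rule left_congruence_inj[OF complex_algebra.axioms(1)[OF algB] j])

abbreviation "Ar \<equiv> img_module A i"
abbreviation "Br \<equiv> img_module B j"
abbreviation "Q \<equiv> Go Br"

lemma Ar: "left_module A Ar" by (rule left_congruence.left_module_img[OF congA])
lemma Br: "left_module B Br" by (rule left_congruence.left_module_img[OF congB])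
lemma Q: "left_module A Q" by (rule linear_functor.obj[OF G Br])

lemmas F_obj = linear_functor.obj[OF F] and G_obj = linear_functor.obj[OF G]
lemmas F_hom = linear_functor.hom[OF F] and G_hom = linear_functor.hom[OF G]

lemma eta_iso: "left_module A M \<Longrightarrow> \<eta> M \<in> lmod_iso A (Go (Fo M)) M"
  using eta by (simp add: nat_iso_id_def)
lemma eps_iso: "left_module B M \<Longrightarrow> \<epsilon> M \<in> lmod_iso B (Fo (Go M)) M"
  using eps by (simp add: nat_iso_id_def)
lemma eta_nat: "left_module A M \<Longrightarrow> left_module A N \<Longrightarrow> f \<in> lmod_hom A M N \<Longrightarrow> x \<in> carrier (Go (Fo M)) \<Longrightarrow>
    \<eta> N (Gm (Fo M) (Fo N) (Fm M N f) x) = f (\<eta> M x)"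
proof -
  assume *: "left_module A M" "left_module A N" "f \<in> lmod_hom A M N" and x: "x \<in> carrier (Go (Fo M))"
  have "compose (carrier (Go (Fo M))) (\<eta> N) (Gm (Fo M) (Fo N) (Fm M N f)) = compose (carrier (Go (Fo M))) f (\<eta> M)"
    using eta * unfolding nat_iso_id_def by blast
  from fun_cong[OF this, of x] show ?thesis using x by (simp add: compose_def)
qed
lemma eps_nat: "left_module B M \<Longrightarrow> left_module B N \<Longrightarrow> f \<in> lmod_hom B M N \<Longrightarrow> x \<in> carrier (Fo (Go M)) \<Longrightarrow>
    \<epsilon> N (Fm (Go M) (Go N) (Gm M N f) x) = f (\<epsilon> M x)"
proof -
  assume *: "left_module B M" "left_module B N" "f \<in> lmod_hom B M N" and x: "x \<in> carrier (Fo (Go M))"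
  have "compose (carrier (Fo (Go M))) (\<epsilon> N) (Fm (Go M) (Go N) (Gm M N f)) = compose (carrier (Fo (Go M))) f (\<epsilon> M)"
    using eps * unfolding nat_iso_id_def by blast
  from fun_cong[OF this, of x] show ?thesis using x by (simp add: compose_def)
qed

text \<open>By naturality, conjugating the image of \<open>f\<close> under the composite functor
  with the components of \<open>\<eta>\<close> gives back \<open>f\<close>.\<close>

lemma F_faithful:
  assumes M: "left_module A M" and N: "left_module A N" and f: "f \<in> lmod_hom A M N" and g: "g \<in> lmod_hom A M N"
    and eq: "Fm M N f = Fm M N g"
  shows "f = g"
proof (rule lmod_hom_ext[OF f g])
  fix x assume "x \<in> carrier M"
  then have "x \<in> \<eta> M ` carrier (Go (Fo M))" unfolding lmod_isoD(3)[OF eta_iso[OF M]] .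
  then obtain y where y: "\<eta> M y = x" "y \<in> carrier (Go (Fo M))" by blast
  show "f x = g x" using eta_nat[OF M N f y(2)] eta_nat[OF M N g y(2)] eq y(1) by simp
qed

end

context linear_equivalence
begin

lemma G_faithful:
  assumes "left_module B M" "left_module B N" "f \<in> lmod_hom B M N" "g \<in> lmod_hom B M N" "Gm M N f = Gm M N g"
  shows "f = g"
  using linear_equivalence.F_faithful[OF swap, OF assms] .

text \<open>The preimage is \<epsilon>_N F(g) \<epsilon>_M^-1. Naturality shows that F cannot
  distinguish its image under G from \<open>g\<close>, and F is faithful.\<close>

lemma G_full:
  assumes M: "left_module B M" and N: "left_module B N" and g: "g \<in> lmod_hom A (Go M) (Go N)"
  shows "\<exists>f\<in>lmod_hom B M N. Gm M N f = g"
proof -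
  note FM = F_obj[OF G_obj[OF M]] and FN = F_obj[OF G_obj[OF N]]
  note eM = eps_iso[OF M] and eN = eps_iso[OF N]
  define e' where "e' = restrict (inv_into (carrier (Fo (Go M))) (\<epsilon> M)) (carrier M)"
  have e': "e' \<in> lmod_hom B M (Fo (Go M))" unfolding e'_def by (rule lmod_iso_inverse[OF FM M eM])
  have Fg: "Fm (Go M) (Go N) g \<in> lmod_hom B (Fo (Go M)) (Fo (Go N))" by (rule F_hom[OF G_obj[OF M] G_obj[OF N] g])
  define f where "f = compose (carrier M) (compose (carrier (Fo (Go M))) (\<epsilon> N) (Fm (Go M) (Go N) g)) e'"
  have f: "f \<in> lmod_hom B M N" unfolding f_def
    by (rule lmod_hom_compose[OF M e' lmod_hom_compose[OF FM Fg lmod_isoD(1)[OF eN]]])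
  have Gf: "Gm M N f \<in> lmod_hom A (Go M) (Go N)" by (rule G_hom[OF M N f])
  have FGf: "Fm (Go M) (Go N) (Gm M N f) \<in> lmod_hom B (Fo (Go M)) (Fo (Go N))"
    by (rule F_hom[OF G_obj[OF M] G_obj[OF N] Gf])
  have "Fm (Go M) (Go N) (Gm M N f) = Fm (Go M) (Go N) g"
  proof (rule lmod_hom_ext[OF FGf Fg])
    fix x assume x: "x \<in> carrier (Fo (Go M))"
    have ex: "\<epsilon> M x \<in> carrier M" by (rule lmod_hom_closed[OF lmod_isoD(1)[OF eM] x])
    have "e' (\<epsilon> M x) = x" using ex x lmod_isoD(2)[OF eM] by (simp add: e'_def)
    then have "f (\<epsilon> M x) = \<epsilon> N (Fm (Go M) (Go N) g x)" using ex x by (simp add: f_def compose_def)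
    then have "\<epsilon> N (Fm (Go M) (Go N) (Gm M N f) x) = \<epsilon> N (Fm (Go M) (Go N) g x)"
      using eps_nat[OF M N f x] by simp
    then show "Fm (Go M) (Go N) (Gm M N f) x = Fm (Go M) (Go N) g x"
      using inj_onD[OF lmod_isoD(2)[OF eN]] lmod_hom_closed[OF FGf x] lmod_hom_closed[OF Fg x] by blast
  qed
  then have "Gm M N f = g" by (rule F_faithful[OF G_obj[OF M] G_obj[OF N] Gf g])
  then show ?thesis using f by blast
qed

lemma i_inv: "a \<in> carrier A \<Longrightarrow> inv_into (carrier A) i (i a) = a"
  using i by simp

lemma carrier_Ar: "carrier Ar = i ` carrier A"
  by (rule left_congruence.carrier_img[OF congA])
lemma smult_Ar: "a \<in> carrier A \<Longrightarrow> x \<in> carrier A \<Longrightarrow> a \<odot>\<^bsub>Ar\<^esub> i x = i (a \<otimes>\<^bsub>A\<^esub> x)"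
  by (rule left_congruence.smult_img[OF congA])
lemma add_Ar: "x \<in> carrier A \<Longrightarrow> y \<in> carrier A \<Longrightarrow> i x \<oplus>\<^bsub>Ar\<^esub> i y = i (x \<oplus>\<^bsub>A\<^esub> y)"
  by (rule left_congruence.add_img[OF congA])
lemma zero_Ar: "\<zero>\<^bsub>Ar\<^esub> = i \<zero>\<^bsub>A\<^esub>"
  by (rule left_congruence.zero_img[OF congA])

lemma rmul_i: "a \<in> carrier A \<Longrightarrow> rmul A i M z (i a) = a \<odot>\<^bsub>M\<^esub> z"
  by (simp add: rmul_def carrier_Ar i_inv)

lemma rmul_hom:
  assumes M: "left_module A M" and z: "z \<in> carrier M"
  shows "rmul A i M z \<in> lmod_hom A Ar M"
proof -
  interpret A: ring A by (rule ringA)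
  show ?thesis unfolding rmul_def carrier_Ar[symmetric]
  proof (rule lmod_homI[OF _ _ _ Ar])
    fix u assume "u \<in> carrier Ar"
    then obtain x where x: "x \<in> carrier A" "u = i x" by (auto simp: carrier_Ar)
    show "inv_into (carrier A) i u \<odot>\<^bsub>M\<^esub> z \<in> carrier M" using x z left_module.smult_closed[OF M] by (simp add: i_inv)
    fix v assume "v \<in> carrier Ar"
    then obtain y where y: "y \<in> carrier A" "v = i y" by (auto simp: carrier_Ar)
    show "inv_into (carrier A) i (u \<oplus>\<^bsub>Ar\<^esub> v) \<odot>\<^bsub>M\<^esub> z = inv_into (carrier A) i u \<odot>\<^bsub>M\<^esub> z \<oplus>\<^bsub>M\<^esub> inv_into (carrier A) i v \<odot>\<^bsub>M\<^esub> z"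
      using x y z left_module.smult_l_distr[OF M] by (simp add: add_Ar i_inv)
  next
    fix a u assume a: "a \<in> carrier A" and "u \<in> carrier Ar"
    then obtain x where x: "x \<in> carrier A" "u = i x" by (auto simp: carrier_Ar)
    show "inv_into (carrier A) i (a \<odot>\<^bsub>Ar\<^esub> u) \<odot>\<^bsub>M\<^esub> z = a \<odot>\<^bsub>M\<^esub> (inv_into (carrier A) i u \<odot>\<^bsub>M\<^esub> z)"
      using x a z left_module.smult_assoc[OF M] by (simp add: smult_Ar i_inv)
  qed
qed

lemma hom_Ar: "f \<in> lmod_hom A Ar M \<Longrightarrow> a \<in> carrier A \<Longrightarrow> f (i a) = a \<odot>\<^bsub>M\<^esub> f (i \<one>\<^bsub>A\<^esub>)"
proof -
  assume f: "f \<in> lmod_hom A Ar M" and a: "a \<in> carrier A"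
  interpret A: ring A by (rule ringA)
  have "f (i a) = f (a \<odot>\<^bsub>Ar\<^esub> i \<one>\<^bsub>A\<^esub>)" using a by (simp add: smult_Ar)
  also have "\<dots> = a \<odot>\<^bsub>M\<^esub> f (i \<one>\<^bsub>A\<^esub>)" by (rule lmod_hom_smult[OF f a]) (simp add: carrier_Ar)
  finally show ?thesis .
qed

end

section \<open>The module Q = G(B) is a generator with a finite dual basis\<close>

context linear_equivalence
begin

lemmas carrier_Br = linear_equivalence.carrier_Ar[OF swap]
  and rmulB_j = linear_equivalence.rmul_i[OF swap]
  and rmulB_hom = linear_equivalence.rmul_hom[OF swap]
  and hom_Br = linear_equivalence.hom_Ar[OF swap]

abbreviation "combo \<equiv> hom_list A Q Ar"

abbreviation "cval ps \<equiv> msum Ar (map (\<lambda>(f, q). f q) ps)"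

lemma combo_closed: "combo ps \<Longrightarrow> set (map (\<lambda>(f, q). f q) ps) \<subseteq> carrier Ar"
  by (auto simp: hom_list_def intro: lmod_hom_closed)

text \<open>Otherwise the trace ideal T of Q is a proper left ideal, and the projection A
  \<rightarrow> A/T and the zero map agree after every homomorphism Q \<rightarrow> A. Through the
  equivalence, their images under F agree after every homomorphism from the regular B-module to
  F(A), hence everywhere. Faithfulness then makes the projection zero, which is absurd.\<close>

lemma generator: "\<exists>ps. combo ps \<and> cval ps = i \<one>\<^bsub>A\<^esub>"
proof (rule ccontr)
  assume contr: "\<not> ?thesis"
  interpret A: ring A by (rule ringA)
  define T where "T = {x \<in> carrier A. \<exists>ps. combo ps \<and> cval ps = i x}"
  have T0: "\<zero>\<^bsub>A\<^esub> \<in> T" unfolding T_def by (auto intro!: exI[of _ "[]"] simp: hom_list_def zero_Ar)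
  have T_add: "x \<oplus>\<^bsub>A\<^esub> y \<in> T" if xy: "x \<in> T" "y \<in> T" for x y
  proof -
    obtain ps qs where p: "combo ps" "cval ps = i x" and q: "combo qs" "cval qs = i y" using xy by (auto simp: T_def)
    have "combo (ps @ qs)" using p q by (auto simp: hom_list_def)
    moreover have "cval (ps @ qs) = i (x \<oplus>\<^bsub>A\<^esub> y)"
      using msum_append[OF lmod_group[OF Ar] combo_closed[OF p(1)] combo_closed[OF q(1)]] p q xy
      by (simp add: add_Ar T_def)
    ultimately show ?thesis using xy unfolding T_def by blast
  qed
  have T_mult: "a \<otimes>\<^bsub>A\<^esub> x \<in> T" if ax: "a \<in> carrier A" "x \<in> T" for a x
  proof -
    obtain ps where p: "combo ps" "cval ps = i x" using ax by (auto simp: T_def)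
    define qs where "qs = map (\<lambda>(f, q). (f, a \<odot>\<^bsub>Q\<^esub> q)) ps"
    have "combo qs" using p(1) left_module.smult_closed[OF Q ax(1)] by (auto simp: hom_list_def qs_def)
    moreover have "cval qs = a \<odot>\<^bsub>Ar\<^esub> cval ps"
      using p(1) unfolding qs_def
    proof (induction ps)
      case Nil
      show ?case using ax by (simp add: zero_Ar smult_Ar)
    next
      case (Cons fq ps)
      obtain f q where fq: "fq = (f, q)" by fastforce
      have "combo ps" and f: "f \<in> lmod_hom A Q Ar" "q \<in> carrier Q" using Cons.prems by (auto simp: hom_list_def fq)
      then have "cval ps \<in> carrier Ar" using msum_closed[OF lmod_group[OF Ar] combo_closed] by blast
      then show ?case using Cons.IH[OF \<open>combo ps\<close>] f lmod_hom_smult[OF f(1) ax(1) f(2)]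
          left_module.smult_r_distr[OF Ar ax(1) lmod_hom_closed[OF f]]
        by (simp add: fq)
    qed
    then have "cval qs = i (a \<otimes>\<^bsub>A\<^esub> x)" using p(2) ax by (simp add: smult_Ar T_def)
    ultimately show ?thesis using ax unfolding T_def by auto
  qed
  have T_carr: "T \<subseteq> carrier A" by (auto simp: T_def)
  have T_neg: "\<ominus>\<^bsub>A\<^esub> x \<in> T" if "x \<in> T" for x
    using T_mult[of "\<ominus>\<^bsub>A\<^esub> \<one>\<^bsub>A\<^esub>" x] that T_carr by (auto simp: A.l_minus)
  have one: "\<one>\<^bsub>A\<^esub> \<notin> T" using contr by (auto simp: T_def)
  \<comment> \<open>The choice depends only on the coset of \<open>x\<close>, so two representatives
    coincide exactly for elements congruent modulo \<open>T\<close>.\<close>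
  define rep where "rep x = (SOME y. y \<in> carrier A \<and> x \<ominus>\<^bsub>A\<^esub> y \<in> T)" for x
  have rep: "rep x \<in> carrier A" "x \<ominus>\<^bsub>A\<^esub> rep x \<in> T" if "x \<in> carrier A" for x
  proof -
    have "x \<in> carrier A \<and> x \<ominus>\<^bsub>A\<^esub> x \<in> T" using that T0 by (simp add: A.r_neg A.minus_eq)
    then show "rep x \<in> carrier A" "x \<ominus>\<^bsub>A\<^esub> rep x \<in> T" unfolding rep_def by (metis (mono_tags, lifting) someI)+
  qed
  have T_trans: "x \<ominus>\<^bsub>A\<^esub> z \<in> T" if "x \<ominus>\<^bsub>A\<^esub> y \<in> T" "y \<ominus>\<^bsub>A\<^esub> z \<in> T" "x \<in> carrier A" "y \<in> carrier A" "z \<in> carrier A" for x y z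
  proof -
    have "(x \<ominus>\<^bsub>A\<^esub> y) \<oplus>\<^bsub>A\<^esub> (y \<ominus>\<^bsub>A\<^esub> z) = x \<ominus>\<^bsub>A\<^esub> z"
      using that(3-5) by (simp add: A.minus_eq A.a_ac A.r_neg1 A.r_neg2)
    then show ?thesis using T_add[OF that(1,2)] by simp
  qed
  have T_sym: "y \<ominus>\<^bsub>A\<^esub> x \<in> T" if "x \<ominus>\<^bsub>A\<^esub> y \<in> T" "x \<in> carrier A" "y \<in> carrier A" for x y
  proof -
    have "\<ominus>\<^bsub>A\<^esub> (x \<ominus>\<^bsub>A\<^esub> y) = y \<ominus>\<^bsub>A\<^esub> x" using that(2,3) by (simp add: A.minus_eq A.minus_add A.a_comm)
    then show ?thesis using T_neg[OF that(1)] by simp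
  qed
  have rep_iff: "rep x = rep y \<longleftrightarrow> x \<ominus>\<^bsub>A\<^esub> y \<in> T" if xy: "x \<in> carrier A" "y \<in> carrier A" for x y
  proof
    assume "rep x = rep y"
    then show "x \<ominus>\<^bsub>A\<^esub> y \<in> T"
      using T_trans[of x "rep x" y] T_sym[of y "rep y"] rep xy by metis
  next
    assume d: "x \<ominus>\<^bsub>A\<^esub> y \<in> T"
    have "x \<ominus>\<^bsub>A\<^esub> z \<in> T \<longleftrightarrow> y \<ominus>\<^bsub>A\<^esub> z \<in> T" if "z \<in> carrier A" for z
      using T_trans[OF d _ xy that] T_trans[OF T_sym[OF d xy] _ xy(2,1) that] by blast
    then have "(\<lambda>z. z \<in> carrier A \<and> x \<ominus>\<^bsub>A\<^esub> z \<in> T) = (\<lambda>z. z \<in> carrier A \<and> y \<ominus>\<^bsub>A\<^esub> z \<in> T)" by auto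
    then show "rep x = rep y" unfolding rep_def by simp
  qed
  define p where "p x = i (rep x)" for x
  have p_iff: "p x = p y \<longleftrightarrow> x \<ominus>\<^bsub>A\<^esub> y \<in> T" if xy: "x \<in> carrier A" "y \<in> carrier A" for x y
    unfolding p_def rep_iff[OF xy, symmetric] using i rep xy by (auto dest: inj_onD)
  interpret M: left_congruence A p
  proof
    fix x x' y y' assume c: "x \<in> carrier A" "x' \<in> carrier A" "y \<in> carrier A" "y' \<in> carrier A" and e: "p x = p x'" "p y = p y'"
    have "(x \<ominus>\<^bsub>A\<^esub> x') \<oplus>\<^bsub>A\<^esub> (y \<ominus>\<^bsub>A\<^esub> y') = (x \<oplus>\<^bsub>A\<^esub> y) \<ominus>\<^bsub>A\<^esub> (x' \<oplus>\<^bsub>A\<^esub> y')"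
      using c by (simp add: A.minus_eq A.minus_add A.a_ac)
    then show "p (x \<oplus>\<^bsub>A\<^esub> y) = p (x' \<oplus>\<^bsub>A\<^esub> y')"
      using T_add[of "x \<ominus>\<^bsub>A\<^esub> x'" "y \<ominus>\<^bsub>A\<^esub> y'"] e c by (simp add: p_iff)
  next
    fix a x x' assume c: "a \<in> carrier A" "x \<in> carrier A" "x' \<in> carrier A" and e: "p x = p x'"
    have "a \<otimes>\<^bsub>A\<^esub> (x \<ominus>\<^bsub>A\<^esub> x') = a \<otimes>\<^bsub>A\<^esub> x \<ominus>\<^bsub>A\<^esub> a \<otimes>\<^bsub>A\<^esub> x'"
      using c by (simp add: A.minus_eq A.r_distr A.r_minus)
    then show "p (a \<otimes>\<^bsub>A\<^esub> x) = p (a \<otimes>\<^bsub>A\<^esub> x')" using T_mult[OF c(1), of "x \<ominus>\<^bsub>A\<^esub> x'"] e c by (simp add: p_iff)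
  qed
  let ?M = "img_module A p"
  have M: "left_module A ?M" by (rule M.left_module_img)
  define f where "f = (\<lambda>u\<in>carrier Ar. p (inv_into (carrier A) i u))"
  define z where "z = (\<lambda>u\<in>carrier Ar. p \<zero>\<^bsub>A\<^esub>)"
  have f: "f \<in> lmod_hom A Ar ?M" unfolding f_def
    by (rule lmod_homI[OF _ _ _ Ar]) (auto simp: carrier_Ar i_inv M.carrier_img add_Ar smult_Ar M.add_img M.smult_img)
  have z: "z \<in> lmod_hom A Ar ?M" unfolding z_def
    by (rule lmod_homI[OF _ _ _ Ar]) (auto simp: carrier_Ar M.carrier_img M.add_img M.smult_img)
  have fz: "f (i x) = z (i x)" if "x \<in> T" for x
  proof -
    have "x \<in> carrier A" using that T_carr by blast
    then show ?thesis using that by (simp add: f_def z_def carrier_Ar i_inv p_iff A.minus_eq)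
  qed
  have "Fm Ar ?M f = Fm Ar ?M z"
  proof (rule lmod_hom_ext[OF F_hom[OF Ar M f] F_hom[OF Ar M z]])
    fix y assume y: "y \<in> carrier (Fo Ar)"
    note FAr = F_obj[OF Ar] and FM = F_obj[OF M] and Ff = F_hom[OF Ar M f] and Fz = F_hom[OF Ar M z]
    \<comment> \<open>The homomorphism from the regular B-module with 1 \<mapsto> y; an equality of
      its two composites is evaluated at 1 in the end.\<close>
    define r where "r = rmul B j (Fo Ar) y"
    have r: "r \<in> lmod_hom B Br (Fo Ar)" unfolding r_def by (rule rmulB_hom[OF FAr y])
    have Gr: "Gm Br (Fo Ar) r \<in> lmod_hom A Q (Go (Fo Ar))" by (rule G_hom[OF Br FAr r])
    have GFf: "Gm (Fo Ar) (Fo ?M) (Fm Ar ?M f) \<in> lmod_hom A (Go (Fo Ar)) (Go (Fo ?M))" by (rule G_hom[OF FAr FM Ff])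
    have GFz: "Gm (Fo Ar) (Fo ?M) (Fm Ar ?M z) \<in> lmod_hom A (Go (Fo Ar)) (Go (Fo ?M))" by (rule G_hom[OF FAr FM Fz])
    have rf: "compose (carrier Br) (Fm Ar ?M f) r \<in> lmod_hom B Br (Fo ?M)" by (rule lmod_hom_compose[OF Br r Ff])
    have rz: "compose (carrier Br) (Fm Ar ?M z) r \<in> lmod_hom B Br (Fo ?M)" by (rule lmod_hom_compose[OF Br r Fz])
    have "Gm Br (Fo ?M) (compose (carrier Br) (Fm Ar ?M f) r) = Gm Br (Fo ?M) (compose (carrier Br) (Fm Ar ?M z) r)"
    proof (rule lmod_hom_ext[OF G_hom[OF Br FM rf] G_hom[OF Br FM rz]])
      fix q assume "q \<in> carrier (Go Br)"
      then have q: "q \<in> carrier Q" .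
      let ?y = "Gm Br (Fo Ar) r q"
      have y': "?y \<in> carrier (Go (Fo Ar))" by (rule lmod_hom_closed[OF Gr q])
      let ?b = "compose (carrier Q) (\<eta> Ar) (Gm Br (Fo Ar) r)"
      have b: "?b \<in> lmod_hom A Q Ar" by (rule lmod_hom_compose[OF Q Gr lmod_isoD(1)[OF eta_iso[OF Ar]]])
      have bq: "?b q = \<eta> Ar ?y" using q by (simp add: compose_def)
      have bqA: "?b q \<in> carrier Ar" by (rule lmod_hom_closed[OF b q])
      then obtain x where x: "x \<in> carrier A" "?b q = i x" by (auto simp: carrier_Ar)
      interpret Ar: abelian_group Ar by (rule lmod_group[OF Ar])
      have "combo [(?b, q)]" using b q by (simp add: hom_list_def)
      moreover have "cval [(?b, q)] = i x" using x bqA by simp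
      ultimately have "x \<in> T" unfolding T_def using x(1) by blast
      then have "f (\<eta> Ar ?y) = z (\<eta> Ar ?y)" using fz x(2) bq by simp
      then have "\<eta> ?M (Gm (Fo Ar) (Fo ?M) (Fm Ar ?M f) ?y) = \<eta> ?M (Gm (Fo Ar) (Fo ?M) (Fm Ar ?M z) ?y)"
        using eta_nat[OF Ar M f y'] eta_nat[OF Ar M z y'] by simp
      then have "Gm (Fo Ar) (Fo ?M) (Fm Ar ?M f) ?y = Gm (Fo Ar) (Fo ?M) (Fm Ar ?M z) ?y"
        using inj_onD[OF lmod_isoD(2)[OF eta_iso[OF M]]] lmod_hom_closed[OF GFf y'] lmod_hom_closed[OF GFz y'] by blast
      then show "Gm Br (Fo ?M) (compose (carrier Br) (Fm Ar ?M f) r) q = Gm Br (Fo ?M) (compose (carrier Br) (Fm Ar ?M z) r) q"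
        using q linear_functor.comp[OF G Br FAr FM r Ff] linear_functor.comp[OF G Br FAr FM r Fz]
        by (simp add: compose_def)
    qed
    then have e: "compose (carrier Br) (Fm Ar ?M f) r = compose (carrier Br) (Fm Ar ?M z) r"
      by (rule G_faithful[OF Br FM rf rz])
    interpret B: ring B by (rule complex_algebra.axioms(1)[OF algB])
    have 1: "j \<one>\<^bsub>B\<^esub> \<in> carrier Br" by (simp add: carrier_Br)
    have "r (j \<one>\<^bsub>B\<^esub>) = y" unfolding r_def using left_module.smult_one[OF FAr y] by (simp add: rmulB_j)
    then show "Fm Ar ?M f y = Fm Ar ?M z y" using fun_cong[OF e, of "j \<one>\<^bsub>B\<^esub>"] 1 by (simp add: compose_def)
  qed
  then have "f = z" by (rule F_faithful[OF Ar M f z])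
  then have "f (i \<one>\<^bsub>A\<^esub>) = z (i \<one>\<^bsub>A\<^esub>)" by simp
  then have "\<one>\<^bsub>A\<^esub> \<ominus>\<^bsub>A\<^esub> \<zero>\<^bsub>A\<^esub> \<in> T" by (simp add: f_def z_def carrier_Ar i_inv p_iff)
  then show False using one by (simp add: A.minus_eq)
qed

end


context linear_equivalence
begin

lemma hom_zero_sum:
  assumes M: "left_module A M" and N: "left_module A N"
  shows "restrict (\<lambda>_. \<zero>\<^bsub>N\<^esub>) (carrier M) \<in> lmod_hom A M N"
proof (rule lmod_homI[OF _ _ _ M])
  interpret N: abelian_group N by (rule lmod_group[OF N])
  show "\<zero>\<^bsub>N\<^esub> \<in> carrier N" "\<zero>\<^bsub>N\<^esub> = \<zero>\<^bsub>N\<^esub> \<oplus>\<^bsub>N\<^esub> \<zero>\<^bsub>N\<^esub>" by simp_all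
  fix a assume a: "a \<in> carrier A"
  have c: "a \<odot>\<^bsub>N\<^esub> \<zero>\<^bsub>N\<^esub> \<in> carrier N" using left_module.smult_closed[OF N a] by simp
  have "a \<odot>\<^bsub>N\<^esub> \<zero>\<^bsub>N\<^esub> \<oplus>\<^bsub>N\<^esub> a \<odot>\<^bsub>N\<^esub> \<zero>\<^bsub>N\<^esub> = a \<odot>\<^bsub>N\<^esub> \<zero>\<^bsub>N\<^esub>"
    using left_module.smult_r_distr[OF N a, of "\<zero>\<^bsub>N\<^esub>" "\<zero>\<^bsub>N\<^esub>"] by simp
  then show "\<zero>\<^bsub>N\<^esub> = a \<odot>\<^bsub>N\<^esub> \<zero>\<^bsub>N\<^esub>" using N.add.r_cancel_one'[OF c c] by simp
qed

lemma G_zero: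
  assumes M: "left_module B M" and N: "left_module B N" and x: "x \<in> carrier (Go M)"
  shows "Gm M N (restrict (\<lambda>_. \<zero>\<^bsub>N\<^esub>) (carrier M)) x = \<zero>\<^bsub>Go N\<^esub>"
proof -
  let ?z = "restrict (\<lambda>_. \<zero>\<^bsub>N\<^esub>) (carrier M)"
  interpret N: abelian_group N by (rule lmod_group[OF N])
  interpret GN: abelian_group "Go N" by (rule lmod_group[OF G_obj[OF N]])
  have z: "?z \<in> lmod_hom B M N" by (rule linear_equivalence.hom_zero_sum[OF swap, OF M N])
  have "hom_add M N ?z ?z = ?z" by (auto simp: hom_add_def restrict_def fun_eq_iff)
  then have "Gm M N ?z = hom_add (Go M) (Go N) (Gm M N ?z) (Gm M N ?z)"
    using linear_functor.add[OF G M N z z] by simp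
  from fun_cong[OF this, of x] have e: "Gm M N ?z x \<oplus>\<^bsub>Go N\<^esub> Gm M N ?z x = Gm M N ?z x"
    using x by (simp add: hom_add_def)
  have c: "Gm M N ?z x \<in> carrier (Go N)" by (rule lmod_hom_closed[OF G_hom[OF M N z] x])
  show ?thesis using GN.add.r_cancel_one'[OF c c] e by simp
qed

lemma G_comp:
  assumes "left_module B L" "left_module B M" "left_module B N" "f \<in> lmod_hom B L M" "g \<in> lmod_hom B M N"
    "x \<in> carrier (Go L)"
  shows "Gm L N (compose (carrier L) g f) x = Gm M N g (Gm L M f x)"
  using linear_functor.comp[OF G assms(1-5)] assms(6) by (simp add: compose_def)

text \<open>\<open>generator\<close> for the reverse direction writes 1 of B as a sum of values f(p)
  with f from F(A) to B. Thus the identity of B factors through a finite power of F(A), and applying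
  G, with G F(A) \<cong> A, the identity of Q factors through a finite power of A.\<close>

lemma dual_basis:
  "\<exists>ps. combo ps \<and> (\<forall>q\<in>carrier Q. q = msum Q (map (\<lambda>(f, p). inv_into (carrier A) i (f q) \<odot>\<^bsub>Q\<^esub> p) ps))"
proof -
  interpret A: ring A by (rule ringA)
  interpret B: ring B by (rule complex_algebra.axioms(1)[OF algB])
  interpret Br: abelian_group Br by (rule lmod_group[OF Br])
  note FA = F_obj[OF Ar] and GFA = G_obj[OF F_obj[OF Ar]]
  obtain ps where ps: "hom_list B (Fo Ar) Br ps" "msum Br (map (\<lambda>(f, q). f q) ps) = j \<one>\<^bsub>B\<^esub>"
    using linear_equivalence.generator[OF swap] by blast
  \<comment> \<open>\<open>S ps\<close> is the sum of the composites B \<rightarrow> F(A)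
    \<rightarrow> B and \<open>V ps\<close> is what G makes of it; the induction matches the two by
    additivity and functoriality.\<close>
  define S where "S ps = (\<lambda>u\<in>carrier Br. msum Br (map (\<lambda>(f, q). f (rmul B j (Fo Ar) q u)) ps))" for ps
  define V where "V ps q = msum Q (map (\<lambda>(f, p). Gm (Fo Ar) Br f (Gm Br (Fo Ar) (rmul B j (Fo Ar) p) q)) ps)" for ps q
  have S: "S ps \<in> lmod_hom B Br Br \<and> (\<forall>q\<in>carrier Q. Gm Br Br (S ps) q = V ps q)" if "hom_list B (Fo Ar) Br ps" for ps
    using that
  proof (induction ps)
    case Nil
    have S0: "S [] = restrict (\<lambda>_. \<zero>\<^bsub>Br\<^esub>) (carrier Br)" by (simp add: S_def)
    show ?case unfolding S0
    proof (intro conjI ballI)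
      show "restrict (\<lambda>_. \<zero>\<^bsub>Br\<^esub>) (carrier Br) \<in> lmod_hom B Br Br"
        by (rule linear_equivalence.hom_zero_sum[OF swap Br Br])
      show "Gm Br Br (restrict (\<lambda>_. \<zero>\<^bsub>Br\<^esub>) (carrier Br)) q = V [] q" if "q \<in> carrier Q" for q
        using G_zero[OF Br Br that] by (simp only: V_def list.map msum_Nil)
    qed
  next
    case (Cons fp ps)
    obtain f p where fp: "fp = (f, p)" by fastforce
    have hl: "hom_list B (Fo Ar) Br ps" and f: "f \<in> lmod_hom B (Fo Ar) Br" and p: "p \<in> carrier (Fo Ar)"
      using Cons.prems by (auto simp: hom_list_def fp)
    have r: "rmul B j (Fo Ar) p \<in> lmod_hom B Br (Fo Ar)" by (rule rmulB_hom[OF FA p])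
    let ?c = "compose (carrier Br) f (rmul B j (Fo Ar) p)"
    have c: "?c \<in> lmod_hom B Br Br" by (rule lmod_hom_compose[OF Br r f])
    have Sps: "S ps \<in> lmod_hom B Br Br" "\<And>q. q \<in> carrier Q \<Longrightarrow> Gm Br Br (S ps) q = V ps q" using Cons.IH[OF hl] by blast+
    have e: "S (fp # ps) = hom_add Br Br ?c (S ps)"
      by (auto simp: S_def hom_add_def fp compose_def restrict_def fun_eq_iff)
    have "Gm Br Br (S (fp # ps)) q = V (fp # ps) q" if q: "q \<in> carrier Q" for q
    proof -
      have "Gm Br Br (S (fp # ps)) q = Gm Br Br ?c q \<oplus>\<^bsub>Q\<^esub> V ps q"
        unfolding e linear_functor.add[OF G Br Br c Sps(1)] using q Sps(2)[OF q] by (simp add: hom_add_def)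
      then show ?thesis using G_comp[OF Br FA Br r f q] by (simp add: V_def fp)
    qed
    then show ?case using lmod_hom_hom_add[OF Br Br c Sps(1)] unfolding e by simp
  qed
  have "S ps = hom_id Br"
  proof (rule lmod_hom_ext[OF conjunct1[OF S[OF ps(1)]] lmod_hom_id[OF Br]])
    fix u assume "u \<in> carrier Br"
    then obtain b where b: "b \<in> carrier B" "u = j b" by (auto simp: carrier_Br)
    have one: "S ps (j \<one>\<^bsub>B\<^esub>) = j \<one>\<^bsub>B\<^esub>"
    proof -
      have m: "map (\<lambda>(f, q). f (rmul B j (Fo Ar) q (j \<one>\<^bsub>B\<^esub>))) ps = map (\<lambda>(f, q). f q) ps"
        using ps(1) by (auto simp: hom_list_def rmulB_j left_module.smult_one[OF FA])
      have "S ps (j \<one>\<^bsub>B\<^esub>) = msum Br (map (\<lambda>(f, q). f (rmul B j (Fo Ar) q (j \<one>\<^bsub>B\<^esub>))) ps)"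
        by (simp add: S_def carrier_Br)
      then show ?thesis unfolding m ps(2) .
    qed
    have "S ps (j b) = b \<odot>\<^bsub>Br\<^esub> j \<one>\<^bsub>B\<^esub>"
      using hom_Br[OF conjunct1[OF S[OF ps(1)]] b(1)] one by simp
    also have "\<dots> = j b" using linear_equivalence.smult_Ar[OF swap b(1) B.one_closed] b by simp
    finally show "S ps u = hom_id Br u" using b by (simp add: hom_id_def carrier_Br)
  qed
  then have V: "V ps q = q" if "q \<in> carrier Q" for q
    using conjunct2[OF S[OF ps(1)]] linear_functor.id[OF G Br] that by (auto simp: hom_id_def)
  note eta = eta_iso[OF Ar]
  have "i \<one>\<^bsub>A\<^esub> \<in> \<eta> Ar ` carrier (Go (Fo Ar))" unfolding lmod_isoD(3)[OF eta] by (simp add: carrier_Ar)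
  \<comment> \<open>The element of G F(A) corresponding to 1. Each y in G F(A) is a multiple of it,
    with the coefficient read off by \<open>\<eta>\<close>.\<close>
  then obtain e where e: "e \<in> carrier (Go (Fo Ar))" "\<eta> Ar e = i \<one>\<^bsub>A\<^esub>" by force
  define qs where "qs = map (\<lambda>(f, p). (compose (carrier Q) (\<eta> Ar) (Gm Br (Fo Ar) (rmul B j (Fo Ar) p)), Gm (Fo Ar) Br f e)) ps"
  have hom: "compose (carrier Q) (\<eta> Ar) (Gm Br (Fo Ar) (rmul B j (Fo Ar) p)) \<in> lmod_hom A Q Ar"
    "Gm (Fo Ar) Br f e \<in> carrier Q"
    "q \<in> carrier Q \<Longrightarrow> inv_into (carrier A) i (compose (carrier Q) (\<eta> Ar) (Gm Br (Fo Ar) (rmul B j (Fo Ar) p)) q) \<odot>\<^bsub>Q\<^esub> Gm (Fo Ar) Br f e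
       = Gm (Fo Ar) Br f (Gm Br (Fo Ar) (rmul B j (Fo Ar) p) q)"
    if fp: "(f, p) \<in> set ps" for f p q
  proof -
    have f: "f \<in> lmod_hom B (Fo Ar) Br" and p: "p \<in> carrier (Fo Ar)" using fp ps(1) by (auto simp: hom_list_def)
    have r: "rmul B j (Fo Ar) p \<in> lmod_hom B Br (Fo Ar)" by (rule rmulB_hom[OF FA p])
    have Gr: "Gm Br (Fo Ar) (rmul B j (Fo Ar) p) \<in> lmod_hom A Q (Go (Fo Ar))" by (rule G_hom[OF Br FA r])
    have Gf: "Gm (Fo Ar) Br f \<in> lmod_hom A (Go (Fo Ar)) Q" by (rule G_hom[OF FA Br f])
    show "compose (carrier Q) (\<eta> Ar) (Gm Br (Fo Ar) (rmul B j (Fo Ar) p)) \<in> lmod_hom A Q Ar"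
      by (rule lmod_hom_compose[OF Q Gr lmod_isoD(1)[OF eta]])
    show "Gm (Fo Ar) Br f e \<in> carrier Q" by (rule lmod_hom_closed[OF Gf e(1)])
    assume q: "q \<in> carrier Q"
    let ?y = "Gm Br (Fo Ar) (rmul B j (Fo Ar) p) q"
    have y: "?y \<in> carrier (Go (Fo Ar))" by (rule lmod_hom_closed[OF Gr q])
    have "\<eta> Ar ?y \<in> carrier Ar" by (rule lmod_hom_closed[OF lmod_isoD(1)[OF eta] y])
    then obtain a where a: "a \<in> carrier A" "\<eta> Ar ?y = i a" by (auto simp: carrier_Ar)
    have ae: "a \<odot>\<^bsub>Go (Fo Ar)\<^esub> e \<in> carrier (Go (Fo Ar))" by (rule left_module.smult_closed[OF GFA a(1) e(1)])
    have "\<eta> Ar (a \<odot>\<^bsub>Go (Fo Ar)\<^esub> e) = \<eta> Ar ?y"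
      using lmod_hom_smult[OF lmod_isoD(1)[OF eta] a(1) e(1)] a e by (simp add: smult_Ar)
    then have "a \<odot>\<^bsub>Go (Fo Ar)\<^esub> e = ?y" by (rule inj_onD[OF lmod_isoD(2)[OF eta] _ ae y])
    then have "Gm (Fo Ar) Br f ?y = a \<odot>\<^bsub>Q\<^esub> Gm (Fo Ar) Br f e"
      using lmod_hom_smult[OF Gf a(1) e(1)] by simp
    then show "inv_into (carrier A) i (compose (carrier Q) (\<eta> Ar) (Gm Br (Fo Ar) (rmul B j (Fo Ar) p)) q) \<odot>\<^bsub>Q\<^esub> Gm (Fo Ar) Br f e
       = Gm (Fo Ar) Br f ?y"
      using q a by (simp add: compose_def i_inv)
  qed
  have "combo qs" unfolding hom_list_def qs_def using hom(1,2) by auto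
  moreover have "q = msum Q (map (\<lambda>(f, p). inv_into (carrier A) i (f q) \<odot>\<^bsub>Q\<^esub> p) qs)" if q: "q \<in> carrier Q" for q
  proof -
    have "map (\<lambda>(f, p). inv_into (carrier A) i (f q) \<odot>\<^bsub>Q\<^esub> p) qs
        = map (\<lambda>(f, p). Gm (Fo Ar) Br f (Gm Br (Fo Ar) (rmul B j (Fo Ar) p) q)) ps"
      unfolding qs_def using hom(3)[OF _ q] by auto
    then show ?thesis using V[OF q] by (simp add: V_def)
  qed
  ultimately show ?thesis by blast
qed

end

section \<open>From an equivalence to a full corner\<close>

lemma complex_algebra_gwa: "complex_algebra (gwa a)"
  unfolding gwa_presented by (rule complex_algebra_presented_algebra)

locale gwa_equivalence = linear_equivalence "gwa a" "gwa b" Fo Fm Go Gm \<eta> \<epsilon> i j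
  for a b :: "complex poly" and Fo Fm Go Gm \<eta> \<epsilon> and i j :: "gwa_gen free_alg set \<Rightarrow> 'u" +
  assumes a0: "a \<noteq> 0" and b0: "b \<noteq> 0"
begin

abbreviation "Ga \<equiv> gwa a"
abbreviation "Gb \<equiv> gwa b"

definition val :: "'u \<Rightarrow> skl" where "val u = gwa_map a (inv_into (carrier Ga) i u)"

lemma gwa_map_gwa_sub: "x \<in> carrier Ga \<Longrightarrow> gwa_map a x \<in> gwa_sub a"
  using gwa_map_bij[OF a0] by (auto simp: bij_betw_def)

lemma val_i: "x \<in> carrier Ga \<Longrightarrow> val (i x) = gwa_map a x"
  by (simp add: val_def i_inv)
lemma val_gwa_sub: "u \<in> carrier Ar \<Longrightarrow> val u \<in> gwa_sub a"
  using gwa_map_gwa_sub by (auto simp: carrier_Ar val_i)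
lemma val_add: "u \<in> carrier Ar \<Longrightarrow> v \<in> carrier Ar \<Longrightarrow> val (u \<oplus>\<^bsub>Ar\<^esub> v) = val u + val v"
proof -
  interpret A: ring Ga by (rule ringA)
  show "u \<in> carrier Ar \<Longrightarrow> v \<in> carrier Ar \<Longrightarrow> val (u \<oplus>\<^bsub>Ar\<^esub> v) = val u + val v"
    by (auto simp: carrier_Ar add_Ar val_i gwa_map_hom)
qed
lemma val_smult: "x \<in> carrier Ga \<Longrightarrow> u \<in> carrier Ar \<Longrightarrow> val (x \<odot>\<^bsub>Ar\<^esub> u) = gwa_map a x * val u"
proof -
  interpret A: ring Ga by (rule ringA)
  show "x \<in> carrier Ga \<Longrightarrow> u \<in> carrier Ar \<Longrightarrow> val (x \<odot>\<^bsub>Ar\<^esub> u) = gwa_map a x * val u"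
    by (auto simp: carrier_Ar smult_Ar val_i gwa_map_hom)
qed

text \<open>Linear forms on Q, with values already taken in the skew Laurent polynomials, so that
  coordinates can serve directly as matrix entries.\<close>

definition functional :: "('u \<Rightarrow> skl) \<Rightarrow> bool" where
  "functional h \<longleftrightarrow> (\<forall>p\<in>carrier Q. h p \<in> gwa_sub a \<and> (\<forall>q\<in>carrier Q. h (p \<oplus>\<^bsub>Q\<^esub> q) = h p + h q)
     \<and> (\<forall>x\<in>carrier Ga. h (x \<odot>\<^bsub>Q\<^esub> p) = gwa_map a x * h p))"

lemma functional_hom: "f \<in> lmod_hom Ga Q Ar \<Longrightarrow> functional (\<lambda>q. val (f q))"
  unfolding functional_def
  by (simp add: lmod_hom_add lmod_hom_smult val_add val_smult val_gwa_sub lmod_hom_closed)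

lemma functional_compose: "functional h \<Longrightarrow> g \<in> lmod_hom Ga Q Q \<Longrightarrow> functional (\<lambda>q. h (g q))"
  unfolding functional_def
  by (simp add: lmod_hom_add lmod_hom_smult lmod_hom_closed)

lemma functional_zero: "functional h \<Longrightarrow> h \<zero>\<^bsub>Q\<^esub> = 0"
proof -
  assume h: "functional h"
  interpret Q: abelian_group Q by (rule lmod_group[OF Q])
  have "h (\<zero>\<^bsub>Q\<^esub> \<oplus>\<^bsub>Q\<^esub> \<zero>\<^bsub>Q\<^esub>) = h \<zero>\<^bsub>Q\<^esub> + h \<zero>\<^bsub>Q\<^esub>" using h Q.zero_closed unfolding functional_def by blast
  then show ?thesis by simp
qed

lemma functional_msum: "functional h \<Longrightarrow> set xs \<subseteq> carrier Q \<Longrightarrow> h (msum Q xs) = sum_list (map h xs)"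
proof (induction xs)
  case Nil
  then show ?case by (simp add: functional_zero)
next
  case (Cons x xs)
  then have "msum Q xs \<in> carrier Q" by (intro msum_closed[OF lmod_group[OF Q]]) simp
  then have "h (x \<oplus>\<^bsub>Q\<^esub> msum Q xs) = h x + h (msum Q xs)"
    using Cons.prems unfolding functional_def by simp
  then show ?case using Cons by simp
qed

section \<open>Coordinates with respect to the dual basis\<close>

definition "basis = (SOME ps. combo ps \<and>
  (\<forall>q\<in>carrier Q. q = msum Q (map (\<lambda>(f, p). inv_into (carrier Ga) i (f q) \<odot>\<^bsub>Q\<^esub> p) ps)))"

lemma basis: "combo basis"
  "q \<in> carrier Q \<Longrightarrow> q = msum Q (map (\<lambda>(f, p). inv_into (carrier Ga) i (f q) \<odot>\<^bsub>Q\<^esub> p) basis)"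
  using someI_ex[OF dual_basis] unfolding basis_def[symmetric] by blast+

definition "n = length basis"
definition "basis_elem r = snd (basis ! r)"
definition "crd r q = val (fst (basis ! r) q)"

lemma basis_nth: "r < n \<Longrightarrow> fst (basis ! r) \<in> lmod_hom Ga Q Ar" "r < n \<Longrightarrow> basis_elem r \<in> carrier Q"
  using basis(1) nth_mem[of r basis] unfolding hom_list_def n_def basis_elem_def by (auto simp: case_prod_beta)

lemma crd: "r < n \<Longrightarrow> functional (crd r)"
  unfolding crd_def[abs_def] by (rule functional_hom[OF basis_nth(1)])

lemma inv_i: "u \<in> carrier Ar \<Longrightarrow> inv_into (carrier Ga) i u \<in> carrier Ga"
  by (simp add: carrier_Ar inv_into_into)

lemma functional_expand:
  assumes h: "functional h" and q: "q \<in> carrier Q"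
  shows "h q = (\<Sum>r<n. crd r q * h (basis_elem r))"
proof -
  let ?g = "\<lambda>(f, p). inv_into (carrier Ga) i (f q) \<odot>\<^bsub>Q\<^esub> p"
  have c: "?g x \<in> carrier Q" "h (?g x) = val (fst x q) * h (snd x)" if x: "x \<in> set basis" for x
  proof -
    have f: "fst x \<in> lmod_hom Ga Q Ar" "snd x \<in> carrier Q" using basis(1) x by (auto simp: hom_list_def)
    have v: "inv_into (carrier Ga) i (fst x q) \<in> carrier Ga" by (rule inv_i[OF lmod_hom_closed[OF f(1) q]])
    show "?g x \<in> carrier Q" using left_module.smult_closed[OF Q v f(2)] by (simp add: case_prod_beta)
    show "h (?g x) = val (fst x q) * h (snd x)"
      using h v f(2) unfolding functional_def by (simp add: case_prod_beta val_def)
  qed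
  have "h q = h (msum Q (map ?g basis))" using basis(2)[OF q] by simp
  also have "\<dots> = sum_list (map h (map ?g basis))"
    using c(1) by (intro functional_msum[OF h]) auto
  also have "map h (map ?g basis) = map (\<lambda>x. val (fst x q) * h (snd x)) basis"
    using c(2) by simp
  also have "sum_list \<dots> = (\<Sum>r<n. crd r q * h (basis_elem r))"
    by (simp add: sum_list_sum_nth n_def crd_def basis_elem_def atLeast0LessThan)
  finally show ?thesis .
qed

lemma crd_inject:
  assumes p: "p \<in> carrier Q" and q: "q \<in> carrier Q" and eq: "\<And>r. r < n \<Longrightarrow> crd r p = crd r q"
  shows "p = q"
proof -
  have "fst x p = fst x q" if x: "x \<in> set basis" for x
  proof -
    obtain r where r: "r < n" "x = basis ! r" using x unfolding n_def by (metis in_set_conv_nth)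
    have f: "fst x \<in> lmod_hom Ga Q Ar" using basis_nth(1)[OF r(1)] r(2) by simp
    have c: "fst x p \<in> carrier Ar" "fst x q \<in> carrier Ar" using lmod_hom_closed[OF f] p q by blast+
    have "gwa_map a (inv_into (carrier Ga) i (fst x p)) = gwa_map a (inv_into (carrier Ga) i (fst x q))"
      using eq[OF r(1)] r(2) by (simp add: crd_def val_def)
    then have "inv_into (carrier Ga) i (fst x p) = inv_into (carrier Ga) i (fst x q)"
      using gwa_map_bij[OF a0] inv_i c by (auto simp: bij_betw_def dest: inj_onD)
    then show ?thesis using c by (metis carrier_Ar f_inv_into_f)
  qed
  then have m: "map (\<lambda>(f, r). inv_into (carrier Ga) i (f p) \<odot>\<^bsub>Q\<^esub> r) basis = map (\<lambda>(f, r). inv_into (carrier Ga) i (f q) \<odot>\<^bsub>Q\<^esub> r) basis"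
    by (auto simp: case_prod_beta)
  have "p = msum Q (map (\<lambda>(f, r). inv_into (carrier Ga) i (f p) \<odot>\<^bsub>Q\<^esub> r) basis)" by (rule basis(2)[OF p])
  also note m
  also have "msum Q (map (\<lambda>(f, r). inv_into (carrier Ga) i (f q) \<odot>\<^bsub>Q\<^esub> r) basis) = q" by (rule basis(2)[OF q, symmetric])
  finally show ?thesis .
qed

text \<open>G applied to right multiplication by \<open>x\<close> on the regular module: the right
  action of A(b) that makes Q a bimodule.\<close>

definition induced :: "gwa_gen free_alg set \<Rightarrow> 'u \<Rightarrow> 'u" where
  "induced x = Gm Br Br (rmul Gb j Br (j x))"

definition pre :: "skl \<Rightarrow> gwa_gen free_alg set" where
  "pre = inv_into (carrier Gb) (gwa_map b)"

lemma pre: "y \<in> gwa_sub b \<Longrightarrow> pre y \<in> carrier Gb" "y \<in> gwa_sub b \<Longrightarrow> gwa_map b (pre y) = y"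
  "x \<in> carrier Gb \<Longrightarrow> pre (gwa_map b x) = x"
  using gwa_map_bij[OF b0] unfolding pre_def by (auto simp: bij_betw_def intro: inv_into_into f_inv_into_f)

lemma ringB: "ring Gb" by (rule complex_algebra.axioms(1)[OF algB])

lemma pre_add: "x \<in> gwa_sub b \<Longrightarrow> y \<in> gwa_sub b \<Longrightarrow> pre (x + y) = pre x \<oplus>\<^bsub>Gb\<^esub> pre y"
proof -
  assume xy: "x \<in> gwa_sub b" "y \<in> gwa_sub b"
  interpret B: ring Gb by (rule ringB)
  have "gwa_map b (pre x \<oplus>\<^bsub>Gb\<^esub> pre y) = x + y" using xy by (simp add: gwa_map_hom pre)
  then show ?thesis using pre(3)[of "pre x \<oplus>\<^bsub>Gb\<^esub> pre y"] pre(1) xy by simp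
qed
lemma pre_mult: "x \<in> gwa_sub b \<Longrightarrow> y \<in> gwa_sub b \<Longrightarrow> pre (x * y) = pre x \<otimes>\<^bsub>Gb\<^esub> pre y"
proof -
  assume xy: "x \<in> gwa_sub b" "y \<in> gwa_sub b"
  interpret B: ring Gb by (rule ringB)
  have "gwa_map b (pre x \<otimes>\<^bsub>Gb\<^esub> pre y) = x * y" using xy by (simp add: gwa_map_hom pre)
  then show ?thesis using pre(3)[of "pre x \<otimes>\<^bsub>Gb\<^esub> pre y"] pre(1) xy by simp
qed
lemma pre_smult: "x \<in> gwa_sub b \<Longrightarrow> pre (monomial (rat_of [:c:]) 0 * x) = c \<odot>\<^bsub>Gb\<^esub> pre x"
proof -
  assume x: "x \<in> gwa_sub b"
  have "gwa_map b (c \<odot>\<^bsub>Gb\<^esub> pre x) = monomial (rat_of [:c:]) 0 * x"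
    using gwa_map_hom(3)[OF pre(1) pre(1), OF x x] x by (simp add: pre)
  then show ?thesis using pre(3)[of "c \<odot>\<^bsub>Gb\<^esub> pre x"] complex_algebra.smult_closed[OF algB pre(1)[OF x]] by simp
qed
lemma pre_1: "pre 1 = \<one>\<^bsub>Gb\<^esub>"
proof -
  interpret B: ring Gb by (rule ringB)
  show ?thesis using pre(3)[OF B.one_closed] by (simp add: gwa_map_hom(4)[OF B.one_closed B.one_closed])
qed

lemma rm: "x \<in> carrier Gb \<Longrightarrow> rmul Gb j Br (j x) \<in> lmod_hom Gb Br Br"
  by (rule rmulB_hom[OF Br]) (simp add: carrier_Br)

lemma induced_hom: "x \<in> carrier Gb \<Longrightarrow> induced x \<in> lmod_hom Ga Q Q"
  unfolding induced_def by (rule G_hom[OF Br Br rm])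

lemma induced_add:
  assumes x: "x \<in> carrier Gb" and y: "y \<in> carrier Gb" and q: "q \<in> carrier Q"
  shows "induced (x \<oplus>\<^bsub>Gb\<^esub> y) q = induced x q \<oplus>\<^bsub>Q\<^esub> induced y q"
proof -
  interpret B: ring Gb by (rule ringB)
  have "rmul Gb j Br (j (x \<oplus>\<^bsub>Gb\<^esub> y)) = hom_add Br Br (rmul Gb j Br (j x)) (rmul Gb j Br (j y))" (is "?l = ?r")
  proof (rule lmod_hom_ext[OF rm lmod_hom_hom_add[OF Br Br rm[OF x] rm[OF y]]])
    show "x \<oplus>\<^bsub>Gb\<^esub> y \<in> carrier Gb" using x y by simp
    fix u assume "u \<in> carrier Br"
    then obtain c where c: "c \<in> carrier Gb" "u = j c" by (auto simp: carrier_Br)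
    show "?l u = ?r u" using x y c
      by (simp add: hom_add_def carrier_Br rmulB_j linear_equivalence.smult_Ar[OF swap] linear_equivalence.add_Ar[OF swap] B.r_distr)
  qed
  then show ?thesis unfolding induced_def linear_functor.add[OF G Br Br rm[OF x] rm[OF y], symmetric]
    using linear_functor.add[OF G Br Br rm[OF x] rm[OF y]] q by (simp add: hom_add_def)
qed

text \<open>Right multiplications compose in reverse order. The matrices in \<open>corner\<close>
  act on rows of coordinates, which reverses the order once more, so \<open>corner\<close> is
  multiplicative.\<close>

lemma induced_mult:
  assumes x: "x \<in> carrier Gb" and y: "y \<in> carrier Gb" and q: "q \<in> carrier Q"
  shows "induced (x \<otimes>\<^bsub>Gb\<^esub> y) q = induced y (induced x q)"
proof -
  interpret B: ring Gb by (rule ringB)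
  have "rmul Gb j Br (j (x \<otimes>\<^bsub>Gb\<^esub> y)) = compose (carrier Br) (rmul Gb j Br (j y)) (rmul Gb j Br (j x))" (is "?l = ?r")
  proof (rule lmod_hom_ext[OF rm lmod_hom_compose[OF Br rm[OF x] rm[OF y]]])
    show "x \<otimes>\<^bsub>Gb\<^esub> y \<in> carrier Gb" using x y by simp
    fix u assume "u \<in> carrier Br"
    then obtain c where c: "c \<in> carrier Gb" "u = j c" by (auto simp: carrier_Br)
    show "?l u = ?r u" using x y c
      by (simp add: compose_def carrier_Br rmulB_j linear_equivalence.smult_Ar[OF swap] B.m_assoc)
  qed
  then show ?thesis unfolding induced_def using G_comp[OF Br Br Br rm[OF x] rm[OF y] q] by simp
qed

lemma induced_one: "q \<in> carrier Q \<Longrightarrow> induced \<one>\<^bsub>Gb\<^esub> q = q"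
proof -
  assume q: "q \<in> carrier Q"
  interpret B: ring Gb by (rule ringB)
  have "rmul Gb j Br (j \<one>\<^bsub>Gb\<^esub>) = hom_id Br"
  proof (rule lmod_hom_ext[OF rm lmod_hom_id[OF Br]])
    fix u assume "u \<in> carrier Br"
    then obtain c where c: "c \<in> carrier Gb" "u = j c" by (auto simp: carrier_Br)
    show "rmul Gb j Br (j \<one>\<^bsub>Gb\<^esub>) u = hom_id Br u" using c
      by (simp add: hom_id_def carrier_Br rmulB_j linear_equivalence.smult_Ar[OF swap])
  qed simp
  then show ?thesis using linear_functor.id[OF G Br] q by (simp add: induced_def hom_id_def)
qed

lemma induced_smult:
  assumes x: "x \<in> carrier Gb" and q: "q \<in> carrier Q"
  shows "induced (c \<odot>\<^bsub>Gb\<^esub> x) q = (c \<odot>\<^bsub>Ga\<^esub> \<one>\<^bsub>Ga\<^esub>) \<odot>\<^bsub>Q\<^esub> induced x q"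
proof -
  interpret B: complex_algebra Gb by (rule algB)
  have cx: "c \<odot>\<^bsub>Gb\<^esub> x \<in> carrier Gb" using x by (rule B.smult_closed)
  have "rmul Gb j Br (j (c \<odot>\<^bsub>Gb\<^esub> x)) = hom_smult Gb Br Br c (rmul Gb j Br (j x))"
  proof
    fix u
    show "rmul Gb j Br (j (c \<odot>\<^bsub>Gb\<^esub> x)) u = hom_smult Gb Br Br c (rmul Gb j Br (j x)) u"
    proof (cases "u \<in> carrier Br")
      case True
      then obtain d where d: "d \<in> carrier Gb" "u = j d" by (auto simp: carrier_Br)
      have "(c \<odot>\<^bsub>Gb\<^esub> \<one>\<^bsub>Gb\<^esub>) \<otimes>\<^bsub>Gb\<^esub> (d \<otimes>\<^bsub>Gb\<^esub> x) = d \<otimes>\<^bsub>Gb\<^esub> (c \<odot>\<^bsub>Gb\<^esub> x)"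
        using d x by (simp add: B.smult_mult_left B.smult_mult_right)
      then show ?thesis using d x cx B.smult_closed[OF B.one_closed, of c]
        by (simp add: hom_smult_def carrier_Br rmulB_j linear_equivalence.smult_Ar[OF swap])
    next
      case False
      then show ?thesis by (simp add: hom_smult_def rmul_def carrier_Br)
    qed
  qed
  then have "induced (c \<odot>\<^bsub>Gb\<^esub> x) = hom_smult Ga Q Q c (induced x)"
    unfolding induced_def using linear_functor.smult[OF G Br Br rm[OF x], of c] by simp
  then show ?thesis using q by (simp add: hom_smult_def)
qed

text \<open>The matrix of the induced endomorphism; row r holds the coordinates of the image of
  \<open>basis_elem r\<close>. A dual basis need not be independent, so \<open>corner 1\<close> is
  in general only an idempotent.\<close>

definition corner :: "skl \<Rightarrow> nat \<Rightarrow> nat \<Rightarrow> skl" where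
  "corner y r s = (if r < n \<and> s < n then crd s (induced (pre y) (basis_elem r)) else 0)"

lemma functional_induced: "y \<in> gwa_sub b \<Longrightarrow> s < n \<Longrightarrow> functional (\<lambda>q. crd s (induced (pre y) q))"
  by (rule functional_compose[OF crd induced_hom[OF pre(1)]])

lemma crd_induced: "y \<in> gwa_sub b \<Longrightarrow> s < n \<Longrightarrow> q \<in> carrier Q \<Longrightarrow> crd s (induced (pre y) q) = (\<Sum>r<n. crd r q * corner y r s)"
  using functional_expand[OF functional_induced] by (simp add: corner_def)

lemma induced_basis_elem: "y \<in> gwa_sub b \<Longrightarrow> r < n \<Longrightarrow> induced (pre y) (basis_elem r) \<in> carrier Q"
  by (rule lmod_hom_closed[OF induced_hom[OF pre(1)] basis_nth(2)])

lemma corner_one: "r < n \<Longrightarrow> s < n \<Longrightarrow> corner 1 r s = crd s (basis_elem r)"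
  by (simp add: corner_def pre_1 induced_one basis_nth(2))

lemma corner_Mat: "y \<in> gwa_sub b \<Longrightarrow> corner y \<in> Mat (gwa_sub a) {..<n} {..<n}"
  using crd induced_basis_elem unfolding Mat_def corner_def functional_def by auto

lemma crd_smult_one: "s < n \<Longrightarrow> q \<in> carrier Q \<Longrightarrow> crd s ((c \<odot>\<^bsub>Ga\<^esub> \<one>\<^bsub>Ga\<^esub>) \<odot>\<^bsub>Q\<^esub> q) = monomial (rat_of [:c:]) 0 * crd s q"
proof -
  assume s: "s < n" and q: "q \<in> carrier Q"
  interpret A: complex_algebra Ga by (rule algA)
  have "gwa_map a (c \<odot>\<^bsub>Ga\<^esub> \<one>\<^bsub>Ga\<^esub>) = monomial (rat_of [:c:]) 0"
    using gwa_map_hom(3,4)[OF A.one_closed A.one_closed] by simp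
  then show ?thesis using crd[OF s] q A.smult_closed[OF A.one_closed, of c] unfolding functional_def by simp
qed

lemma corner_zero_inj: assumes y: "y \<in> gwa_sub b" and z: "corner y = mzero" shows "y = 0"
proof -
  interpret B: ring Gb by (rule ringB)
  interpret Q: abelian_group Q by (rule lmod_group[OF Q])
  have p0: "pre 0 = \<zero>\<^bsub>Gb\<^esub>"
    using pre(3)[OF B.zero_closed] by (simp add: gwa_map_hom(5)[OF B.zero_closed B.zero_closed])
  have lz: "induced (pre y) q = \<zero>\<^bsub>Q\<^esub>" if q: "q \<in> carrier Q" and zz: "corner y = mzero" and yy: "y \<in> gwa_sub b" for q y
    by (rule crd_inject[OF lmod_hom_closed[OF induced_hom[OF pre(1)[OF yy]] q]])
       (simp_all add: crd_induced[OF yy _ q] zz functional_zero[OF crd])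
  have T0: "corner 0 = mzero"
  proof (intro ext)
    fix r s
    have "induced (pre 0 \<oplus>\<^bsub>Gb\<^esub> pre 0) (basis_elem r) = induced (pre 0) (basis_elem r) \<oplus>\<^bsub>Q\<^esub> induced (pre 0) (basis_elem r)" if "r < n"
      using that by (intro induced_add pre(1) basis_nth(2)) auto
    then have "crd s (induced (pre 0) (basis_elem r)) = crd s (induced (pre 0) (basis_elem r)) + crd s (induced (pre 0) (basis_elem r))" if "r < n" "s < n"
      using crd[OF that(2)] induced_basis_elem[OF gwa_sub_0 that(1)] that functional_zero[OF crd[OF that(2)]] unfolding functional_def by (simp add: p0)
    then show "corner 0 r s = 0" by (simp add: corner_def)
  qed
  have "induced (pre y) = induced (pre 0)"
    by (rule lmod_hom_ext[OF induced_hom[OF pre(1)[OF y]] induced_hom[OF pre(1)[OF gwa_sub_0]]])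
       (simp add: lz z T0 y)
  then have "rmul Gb j Br (j (pre y)) = rmul Gb j Br (j (pre 0))"
    unfolding induced_def by (rule G_faithful[OF Br Br rm[OF pre(1)[OF y]] rm[OF pre(1)[OF gwa_sub_0]]])
  from fun_cong[OF this, of "j \<one>\<^bsub>Gb\<^esub>"] have "j (pre y) = j (pre 0)"
    using pre(1)[OF y] pre(1)[OF gwa_sub_0] by (simp add: rmulB_j linear_equivalence.smult_Ar[OF swap])
  then have "pre y = pre 0" using j pre(1)[OF y] pre(1)[OF gwa_sub_0] by (auto dest: inj_onD)
  then show ?thesis using pre(2)[OF y] pre(2)[OF gwa_sub_0] by simp
qed

text \<open>A matrix in the corner defines an endomorphism of Q by multiplying rows of coordinates
  with it. By fullness of G this comes from an endomorphism of the regular module of A(b), that is,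
  from a right multiplication.\<close>

lemma corner_surjective:
  assumes m: "m \<in> Mat (gwa_sub a) {..<n} {..<n}" and l: "matmul {..<n} (corner 1) m = m" and r: "matmul {..<n} m (corner 1) = m"
  shows "\<exists>y\<in>gwa_sub b. corner y = m"
proof -
  interpret A: ring Ga by (rule ringA)
  interpret Q: abelian_group Q by (rule lmod_group[OF Q])
  define bck where "bck = inv_into (carrier Ga) (gwa_map a)"
  have bck: "bck u \<in> carrier Ga" "gwa_map a (bck u) = u" if "u \<in> gwa_sub a" for u
    using gwa_map_bij[OF a0] that unfolding bck_def by (auto simp: bij_betw_def intro: inv_into_into f_inv_into_f)
  \<comment> \<open>The row of coordinates of \<open>q\<close> times \<open>m\<close>. Passing to
    \<open>h q\<close> and back to coordinates multiplies it by \<open>corner 1\<close>, and this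
    does not change it.\<close>
  define w where "w s q = (\<Sum>t<n. crd t q * m t s)" for s q
  have w: "functional (w s)" for s
    unfolding functional_def w_def
    using crd m unfolding functional_def
    by (auto simp: Mat_def sum.distrib distrib_right sum_distrib_left mult.assoc intro!: gwa_sub_sum gwa_sub_mult)
  define h where "h q = msum Q (map (\<lambda>s. bck (w s q) \<odot>\<^bsub>Q\<^esub> basis_elem s) [0..<n])" for q
  have hc: "set (map (\<lambda>s. bck (w s q) \<odot>\<^bsub>Q\<^esub> basis_elem s) [0..<n]) \<subseteq> carrier Q" if "q \<in> carrier Q" for q
    using that w bck(1) left_module.smult_closed[OF Q] basis_nth(2) unfolding functional_def by auto
  have h_carr: "h q \<in> carrier Q" if "q \<in> carrier Q" for q
    unfolding h_def by (rule msum_closed[OF Q.abelian_group_axioms hc[OF that]])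
  have crd_h: "crd t (h q) = w t q" if q: "q \<in> carrier Q" and t: "t < n" for t q
  proof -
    have "crd t (h q) = sum_list (map (crd t) (map (\<lambda>s. bck (w s q) \<odot>\<^bsub>Q\<^esub> basis_elem s) [0..<n]))"
      unfolding h_def by (rule functional_msum[OF crd[OF t] hc[OF q]])
    also have "map (crd t) (map (\<lambda>s. bck (w s q) \<odot>\<^bsub>Q\<^esub> basis_elem s) [0..<n]) = map (\<lambda>s. w s q * corner 1 s t) [0..<n]"
      using crd[OF t] w bck basis_nth(2) q t unfolding functional_def by (simp add: corner_one)
    also have "sum_list \<dots> = (\<Sum>s<n. w s q * corner 1 s t)"
      by (simp add: sum_list_sum_nth atLeast0LessThan)
    also have "\<dots> = (\<Sum>k<n. crd k q * matmul {..<n} m (corner 1) k t)"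
      unfolding w_def matmul_def sum_distrib_left sum_distrib_right by (subst sum.swap) (simp add: mult.assoc)
    finally show ?thesis unfolding r w_def .
  qed
  have g: "restrict h (carrier Q) \<in> lmod_hom Ga Q Q"
  proof (rule lmod_homI[OF _ _ _ Q])
    show "h q \<in> carrier Q" if "q \<in> carrier Q" for q by (rule h_carr[OF that])
    fix p q assume pq: "p \<in> carrier Q" "q \<in> carrier Q"
    show "h (p \<oplus>\<^bsub>Q\<^esub> q) = h p \<oplus>\<^bsub>Q\<^esub> h q"
    proof (rule crd_inject)
      fix t assume t: "t < n"
      have "crd t (h p \<oplus>\<^bsub>Q\<^esub> h q) = crd t (h p) + crd t (h q)"
        using crd[OF t] h_carr pq unfolding functional_def by blast
      then show "crd t (h (p \<oplus>\<^bsub>Q\<^esub> q)) = crd t (h p \<oplus>\<^bsub>Q\<^esub> h q)"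
        using w[of t] pq t by (simp add: crd_h functional_def)
    qed (use pq h_carr in auto)
  next
    fix x q assume x: "x \<in> carrier Ga" and q: "q \<in> carrier Q"
    have xq: "x \<odot>\<^bsub>Q\<^esub> q \<in> carrier Q" by (rule left_module.smult_closed[OF Q x q])
    show "h (x \<odot>\<^bsub>Q\<^esub> q) = x \<odot>\<^bsub>Q\<^esub> h q"
    proof (rule crd_inject)
      show "x \<odot>\<^bsub>Q\<^esub> h q \<in> carrier Q" by (rule left_module.smult_closed[OF Q x h_carr[OF q]])
      fix t assume t: "t < n"
      have "crd t (x \<odot>\<^bsub>Q\<^esub> h q) = gwa_map a x * crd t (h q)"
        using crd[OF t] h_carr[OF q] x unfolding functional_def by blast
      then show "crd t (h (x \<odot>\<^bsub>Q\<^esub> q)) = crd t (x \<odot>\<^bsub>Q\<^esub> h q)"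
        using w[of t] q x t xq by (simp add: crd_h functional_def)
    qed (use xq h_carr in auto)
  qed
  obtain f where f: "f \<in> lmod_hom Gb Br Br" "Gm Br Br f = restrict h (carrier Q)"
    using G_full[OF Br Br g] by blast
  interpret B: ring Gb by (rule ringB)
  have "f (j \<one>\<^bsub>Gb\<^esub>) \<in> carrier Br" by (rule lmod_hom_closed[OF f(1)]) (simp add: carrier_Br)
  then obtain x where x: "x \<in> carrier Gb" "f (j \<one>\<^bsub>Gb\<^esub>) = j x" by (auto simp: carrier_Br)
  have "f = rmul Gb j Br (j x)"
  proof (rule lmod_hom_ext[OF f(1) rm[OF x(1)]])
    fix u assume "u \<in> carrier Br"
    then obtain c where c: "c \<in> carrier Gb" "u = j c" by (auto simp: carrier_Br)
    show "f u = rmul Gb j Br (j x) u"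
      using hom_Br[OF f(1) c(1)] x c by (simp add: rmulB_j)
  qed
  then have lx: "induced x q = h q" if "q \<in> carrier Q" for q
    using f(2) that by (simp add: induced_def)
  define y where "y = gwa_map b x"
  have y: "y \<in> gwa_sub b" "pre y = x" using gwa_map_bij[OF b0] x pre(3) by (auto simp: y_def bij_betw_def)
  have "corner y = m"
  proof (intro ext)
    fix t s
    show "corner y t s = m t s"
    proof (cases "t < n \<and> s < n")
      case True
      then have "corner y t s = (\<Sum>k<n. corner 1 t k * m k s)"
        by (simp add: corner_def y lx basis_nth(2) crd_h w_def pre_1 induced_one)
      then show ?thesis using fun_cong[OF fun_cong[OF l, of t], of s] by (simp add: matmul_def)
    next
      case False
      then show ?thesis using m by (auto simp: corner_def Mat_def)
    qed
  qed
  then show ?thesis using y by blast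
qed

theorem morita_matrices_exists: "\<exists>k u v. morita_matrices a b n k u v corner"
proof -
  obtain us where us: "combo us" "cval us = i \<one>\<^bsub>Ga\<^esub>" using generator by blast
  define k where "k = length us"
  \<comment> \<open>For 1 = \<Sum> f_s(q_s) as given by \<open>generator\<close>, take the
    coordinates of q_s and the values of f_s on the dual basis; expanding f_s(q_s) then gives \<Sum>
    u v = 1.\<close>
  define u where "u s r = crd r (snd (us ! s))" for s r
  define v where "v s r = val (fst (us ! s) (basis_elem r))" for s r
  interpret A: ring Ga by (rule ringA)
  have us_nth: "fst (us ! s) \<in> lmod_hom Ga Q Ar" "snd (us ! s) \<in> carrier Q" if "s < k" for s
    using us(1) nth_mem[of s us] that unfolding hom_list_def k_def by (auto simp: case_prod_beta)
  have fn: "functional (\<lambda>q. val (fst (us ! s) q))" if "s < k" for s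
    by (rule functional_hom[OF us_nth(1)[OF that]])
  have "morita_matrices a b n k u v corner"
  proof
    fix x y assume x: "x \<in> gwa_sub b"
    show "corner x \<in> Mat (gwa_sub a) {..<n} {..<n}" by (rule corner_Mat[OF x])
    show "x = 0" if "corner x = mzero" by (rule corner_zero_inj[OF x that])
    show "corner (monomial (rat_of [:c:]) 0 * x) r s = monomial (rat_of [:c:]) 0 * corner x r s" for c r s
      by (simp add: corner_def pre_smult[OF x] induced_smult[OF pre(1)[OF x]] basis_nth(2) crd_smult_one induced_basis_elem[OF x])
    assume y: "y \<in> gwa_sub b"
    show "corner (x + y) r s = corner x r s + corner y r s" for r s
      using crd[of s] induced_basis_elem[OF x, of r] induced_basis_elem[OF y, of r]
      by (auto simp: corner_def pre_add[OF x y] induced_add[OF pre(1)[OF x] pre(1)[OF y]] basis_nth(2) functional_def)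
    show "corner (x * y) = matmul {..<n} (corner x) (corner y)"
    proof (intro ext)
      fix r s
      show "corner (x * y) r s = matmul {..<n} (corner x) (corner y) r s"
      proof (cases "r < n \<and> s < n")
        case True
        then have "corner (x * y) r s = crd s (induced (pre y) (induced (pre x) (basis_elem r)))"
          by (simp add: corner_def pre_mult[OF x y] induced_mult[OF pre(1)[OF x] pre(1)[OF y]] basis_nth(2))
        also have "\<dots> = (\<Sum>t<n. crd t (induced (pre x) (basis_elem r)) * corner y t s)"
          using True by (intro crd_induced[OF y _ induced_basis_elem[OF x]]) auto
        finally show ?thesis using True by (simp add: matmul_def corner_def)
      next
        case False
        then show ?thesis by (auto simp: matmul_def corner_def)
      qed
    qed
  next
    fix m assume "m \<in> Mat (gwa_sub a) {..<n} {..<n}" "matmul {..<n} (corner 1) m = m" "matmul {..<n} m (corner 1) = m"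
    then show "\<exists>x\<in>gwa_sub b. corner x = m" by (rule corner_surjective)
  next
    fix s r assume s: "s < k" and r: "r < n"
    show "u s r \<in> gwa_sub a" using crd[OF r] us_nth(2)[OF s] by (simp add: u_def functional_def)
    show "v s r \<in> gwa_sub a" using fn[OF s] basis_nth(2)[OF r] by (simp add: v_def functional_def)
    show "(\<Sum>i<n. u s i * corner 1 i r) = u s r"
      using functional_expand[OF crd[OF r] us_nth(2)[OF s]] r by (simp add: u_def corner_one)
    show "(\<Sum>j<n. corner 1 r j * v s j) = v s r"
      using functional_expand[OF fn[OF s] basis_nth(2)[OF r]] r by (simp add: v_def corner_one)
  next
    have val_msum: "val (msum Ar xs) = sum_list (map val xs)" if "set xs \<subseteq> carrier Ar" for xs
      using that
    proof (induction xs)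
      case Nil
      show ?case using gwa_map_hom(5)[OF A.zero_closed A.zero_closed] by (simp add: zero_Ar val_i)
    next
      case (Cons z xs)
      then show ?case using msum_closed[OF lmod_group[OF Ar], of xs] by (simp add: val_add)
    qed
    have "1 = val (cval us)"
      unfolding us(2) using gwa_map_hom(4)[OF A.one_closed A.one_closed] by (simp add: val_i)
    also have "\<dots> = sum_list (map val (map (\<lambda>(f, q). f q) us))"
      by (rule val_msum[OF combo_closed[OF us(1)]])
    also have "\<dots> = (\<Sum>s<k. val (fst (us ! s) (snd (us ! s))))"
      by (simp add: sum_list_sum_nth k_def atLeast0LessThan case_prod_beta)
    also have "\<dots> = (\<Sum>s<k. \<Sum>r<n. u s r * v s r)"
      unfolding u_def v_def by (intro sum.cong refl functional_expand[OF fn us_nth(2)]) auto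
    finally show "(\<Sum>s<k. \<Sum>r<n. u s r * v s r) = 1" by simp
  qed
  then show ?thesis by blast
qed

end

lemma morita_equivalent_matrices:
  assumes "morita_equivalent TYPE('u) (gwa a) (gwa b)" "a \<noteq> 0" "b \<noteq> 0"
  shows "\<exists>n k u v corner. morita_matrices a b n k u v corner"
proof -
  obtain i j :: "gwa_gen free_alg set \<Rightarrow> 'u" where ij: "inj_on i (carrier (gwa a))" "inj_on j (carrier (gwa b))"
    using assms(1) unfolding morita_equivalent_def lepoll_def by blast
  obtain Fo :: "(_, 'u) module \<Rightarrow> (_, 'u) module" and Fm Go Gm \<eta> \<epsilon> where
    "linear_functor (gwa a) (gwa b) Fo Fm" "linear_functor (gwa b) (gwa a) Go Gm"
    "nat_iso_id (gwa a) (\<lambda>M. Go (Fo M)) (\<lambda>M N f. Gm (Fo M) (Fo N) (Fm M N f)) \<eta>"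
    "nat_iso_id (gwa b) (\<lambda>M. Fo (Go M)) (\<lambda>M N f. Fm (Go M) (Go N) (Gm M N f)) \<epsilon>"
    using assms(1) unfolding morita_equivalent_def by blast
  then have "gwa_equivalence a b Fo Fm Go Gm \<eta> \<epsilon> i j"
    using ij assms(2,3) complex_algebra_gwa
    by (intro gwa_equivalence.intro linear_equivalence.intro gwa_equivalence_axioms.intro)
  from gwa_equivalence.morita_matrices_exists[OF this] show ?thesis by blast
qed

section \<open>Isomorphisms of quantum tori\<close>

interpretation fa: scalar_ring "scalar :: complex \<Rightarrow> 'g free_alg"
  by standard (rule scalar_add, rule scalar_mult, rule scalar_one, rule scalar_commute)

definition torus_rels :: "complex ^ 'n ^ 'n \<Rightarrow> 'n::finite torus_gen free_alg set" where
  "torus_rels Q = (\<Union>i. {gen (TX i) * gen (TX_inv i) - 1, gen (TX_inv i) * gen (TX i) - 1}) \<union>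
      (\<Union>i. \<Union>j. {gen (TX i) * gen (TX j) - scalar (Q $ i $ j) * gen (TX j) * gen (TX i)})"

lemma torus_presented: "quantum_torus Q = presented_algebra (torus_rels Q)"
  by (simp add: quantum_torus_def torus_rels_def)

definition word_elem :: "'g list \<Rightarrow> 'g free_alg" where
  "word_elem w = Poly_Mapping.single (Word w) 1"

lemma word_elem_append: "word_elem (u @ v) = word_elem u * word_elem v"
  by (simp add: word_elem_def mult_single plus_word_def)
lemma word_elem_Nil: "word_elem [] = 1"
  by (simp add: word_elem_def flip: zero_word_def)
lemma word_elem_single: "word_elem [g] = gen g"
  by (simp add: word_elem_def gen_def)
lemma word_elem_Cons: "word_elem (g # w) = gen g * word_elem w"
  using word_elem_append[of "[g]" w] by (simp add: word_elem_single)

section \<open>Words, exponent vectors and their commutation rules\<close>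

fun flip_gen :: "'n torus_gen \<Rightarrow> 'n torus_gen" where
  "flip_gen (TX i) = TX_inv i" | "flip_gen (TX_inv i) = TX i"

fun gdeg :: "'n torus_gen \<Rightarrow> 'n \<Rightarrow> int" where
  "gdeg (TX i) k = (if k = i then 1 else 0)" | "gdeg (TX_inv i) k = (if k = i then - 1 else 0)"

definition wdeg :: "'n torus_gen list \<Rightarrow> 'n \<Rightarrow> int" where
  "wdeg w k = (\<Sum>g\<leftarrow>w. gdeg g k)"

lemma wdeg_simps [simp]: "wdeg [] k = 0" "wdeg (g # w) k = gdeg g k + wdeg w k" "wdeg (u @ v) k = wdeg u k + wdeg v k"
  by (simp_all add: wdeg_def)

lemma wdeg_fun: "wdeg [] = (\<lambda>_. 0)" "wdeg (g # w) = (\<lambda>k. gdeg g k + wdeg w k)"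
  by (simp_all add: fun_eq_iff)

definition inv_word :: "'n torus_gen list \<Rightarrow> 'n torus_gen list" where
  "inv_word w = rev (map flip_gen w)"

lemma inv_word_simps [simp]: "inv_word [] = []" "inv_word (g # w) = inv_word w @ [flip_gen g]"
  by (simp_all add: inv_word_def)

lemma gdeg_flip [simp]: "gdeg (flip_gen g) k = - gdeg g k"
  by (cases g) auto

lemma wdeg_inv [simp]: "wdeg (inv_word w) k = - wdeg w k"
  by (induction w) auto

lemma wdeg_surj: "\<exists>w. wdeg w = (v :: 'n::finite \<Rightarrow> int)"
proof -
  have "\<exists>w. wdeg w = (\<lambda>k. if k \<in> S then v k else 0)" if "finite S" for S
    using that
  proof induction
    case empty
    show ?case by (rule exI[of _ "[]"]) (simp add: fun_eq_iff)
  next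
    case (insert i S)
    then obtain w where w: "wdeg w = (\<lambda>k. if k \<in> S then v k else 0)" by blast
    define w' where "w' = replicate (nat \<bar>v i\<bar>) (if v i \<ge> 0 then TX i else TX_inv i) @ w"
    have r: "wdeg (replicate m g) k = int m * gdeg g k" for m g and k :: 'n
      by (induction m) (auto simp: algebra_simps)
    have "wdeg w' = (\<lambda>k. if k \<in> insert i S then v k else 0)"
      using insert(2) by (auto simp: w'_def r w fun_eq_iff)
    then show ?case by blast
  qed
  from this[of UNIV] show ?thesis by simp
qed

context
  fixes l :: "complex ^ 'n::finite"
begin

abbreviation "TR \<equiv> torus_rels (root_matrix l)"

definition tcong :: "'n torus_gen free_alg \<Rightarrow> 'n torus_gen free_alg \<Rightarrow> bool" (infix "\<doteq>" 50) where
  "f \<doteq> g \<longleftrightarrow> f - g \<in> relideal TR"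

lemma tcong_refl: "f \<doteq> f" by (simp add: tcong_def relideal_0)
lemma tcong_sym: "f \<doteq> g \<Longrightarrow> g \<doteq> f"
  unfolding tcong_def using relideal_uminus[of "f - g" TR] by simp
lemma tcong_trans [trans]: "f \<doteq> g \<Longrightarrow> g \<doteq> k \<Longrightarrow> f \<doteq> k"
  unfolding tcong_def using relideal_add[of "f - g" TR "g - k"] by simp
lemma tcong_left: "f \<doteq> g \<Longrightarrow> k * f \<doteq> k * g"
  unfolding tcong_def using relideal_mult_left[of "f - g" TR k] by (simp add: right_diff_distrib)
lemma tcong_right: "f \<doteq> g \<Longrightarrow> f * k \<doteq> g * k"
  unfolding tcong_def using relideal_mult_right[of "f - g" TR k] by (simp add: left_diff_distrib)
lemma tcong_mult: "f \<doteq> g \<Longrightarrow> f' \<doteq> g' \<Longrightarrow> f * f' \<doteq> g * g'"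
  using tcong_left tcong_right tcong_trans by blast

lemma gen_flip: "gen g * gen (flip_gen g) \<doteq> 1"
  unfolding tcong_def by (rule relideal_incl) (cases g, auto simp: torus_rels_def)

lemma flip_flip [simp]: "flip_gen (flip_gen g) = g"
  by (cases g) auto

lemma flip_gen_mult: "gen (flip_gen g) * gen g \<doteq> 1"
  using gen_flip[of "flip_gen g"] by simp

text \<open>The bilinear exponent of the scalar by which monomials with exponent vectors
  \<open>u\<close> and \<open>v\<close> commute.\<close>

definition twist_form :: "('n \<Rightarrow> int) \<Rightarrow> ('n \<Rightarrow> int) \<Rightarrow> complex" where
  "twist_form u v = (\<Sum>i\<in>UNIV. \<Sum>j\<in>UNIV. of_int (u i) * of_int (v j) * (l $ i - l $ j))"

definition twist :: "('n \<Rightarrow> int) \<Rightarrow> ('n \<Rightarrow> int) \<Rightarrow> complex" where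
  "twist u v = exp (2 * \<i> * of_real pi * twist_form u v)"

text \<open>Only coordinate sums and pairings with \<open>l\<close> enter. For two vectors of
  coordinate sum one, the form is the difference of their pairings with \<open>l\<close>.\<close>

lemma twist_form_eq: "twist_form u v = (\<Sum>i\<in>UNIV. of_int (u i) * l $ i) * of_int (\<Sum>j\<in>UNIV. v j)
    - of_int (\<Sum>i\<in>UNIV. u i) * (\<Sum>j\<in>UNIV. of_int (v j) * l $ j)"
proof -
  have "twist_form u v = (\<Sum>i\<in>UNIV. \<Sum>j\<in>UNIV. (of_int (u i) * l $ i) * of_int (v j))
      - (\<Sum>i\<in>UNIV. \<Sum>j\<in>UNIV. of_int (u i) * (of_int (v j) * l $ j))"
    unfolding twist_form_def sum_subtractf[symmetric] by (intro sum.cong refl) (simp add: algebra_simps)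
  then show ?thesis unfolding sum_product[symmetric] of_int_sum .
qed

lemma twist_form_add_left: "twist_form (\<lambda>k. u k + u' k) v = twist_form u v + twist_form u' v"
  by (simp add: twist_form_def algebra_simps sum.distrib sum_subtractf)
lemma twist_form_add_right: "twist_form u (\<lambda>k. v k + v' k) = twist_form u v + twist_form u v'"
  by (simp add: twist_form_def algebra_simps sum.distrib sum_subtractf)
lemma twist_form_minus_left: "twist_form (\<lambda>k. - u k) v = - twist_form u v"
  by (simp add: twist_form_def sum_negf)
lemma twist_form_minus_right: "twist_form u (\<lambda>k. - v k) = - twist_form u v"
  by (simp add: twist_form_def sum_negf)
lemma twist_add_left: "twist (\<lambda>k. u k + u' k) v = twist u v * twist u' v"
  by (simp add: twist_def twist_form_add_left distrib_left exp_add)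
lemma twist_add_right: "twist u (\<lambda>k. v k + v' k) = twist u v * twist u v'"
  by (simp add: twist_def twist_form_add_right distrib_left exp_add)
lemma twist_zero: "twist (\<lambda>_. 0) v = 1" "twist u (\<lambda>_. 0) = 1"
  by (simp_all add: twist_def twist_form_def)
lemma twist_nonzero: "twist u v \<noteq> 0" by (simp add: twist_def)

lemma twist_form_basis: "twist_form (gdeg (TX i)) (gdeg (TX j)) = l $ i - l $ j"
proof -
  have "(\<Sum>k\<in>UNIV. of_int (gdeg (TX i) k) * l $ k) = l $ i" for i
    by (simp add: if_distrib[of of_int] if_distrib[of "\<lambda>x. x * _"] cong: if_cong)
  moreover have "(\<Sum>k\<in>UNIV. gdeg (TX i) k) = 1" for i :: 'n by simp
  ultimately show ?thesis by (simp add: twist_form_eq)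
qed

lemma commute_inverse:
  assumes y: "y * y' \<doteq> 1" "y' * y \<doteq> 1" and c: "x * y \<doteq> scalar q * (y * x)" and q: "q \<noteq> 0"
  shows "x * y' \<doteq> scalar (1 / q) * (y' * x)"
proof -
  have "y' * x \<doteq> y' * x * (y * y')" using tcong_left[OF tcong_sym[OF y(1)], of "y' * x"] by simp
  also have "y' * x * (y * y') = y' * (x * y) * y'" by (simp add: mult.assoc)
  also have "\<dots> \<doteq> y' * (scalar q * (y * x)) * y'" by (rule tcong_right[OF tcong_left[OF c]])
  also have "y' * (scalar q * (y * x)) * y' = scalar q * (y' * y * (x * y'))"
    by (simp add: mult.assoc) (metis scalar_commute mult.assoc)
  also have "\<dots> \<doteq> scalar q * (1 * (x * y'))" by (rule tcong_left[OF tcong_right[OF y(2)]])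
  finally have "scalar (1 / q) * (y' * x) \<doteq> scalar (1 / q) * (scalar q * (x * y'))"
    using tcong_left by simp
  also have "scalar (1 / q) * (scalar q * (x * y')) = x * y'"
    using q by (simp add: scalar_one flip: mult.assoc scalar_mult)
  finally show ?thesis by (rule tcong_sym)
qed

lemma commute_swap:
  assumes c: "x * y \<doteq> scalar q * (y * x)" and q: "q \<noteq> 0"
  shows "y * x \<doteq> scalar (1 / q) * (x * y)"
proof -
  have "scalar (1 / q) * (x * y) \<doteq> scalar (1 / q) * (scalar q * (y * x))" by (rule tcong_left[OF c])
  also have "scalar (1 / q) * (scalar q * (y * x)) = y * x"
    using q by (simp add: scalar_one flip: mult.assoc scalar_mult)
  finally show ?thesis by (rule tcong_sym)
qed

lemma twist_minus: "twist (\<lambda>k. - u k) v = 1 / twist u v" "twist u (\<lambda>k. - v k) = 1 / twist u v"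
  by (simp_all add: twist_def twist_form_minus_left twist_form_minus_right exp_minus inverse_eq_divide)

lemma gen_commute: "gen g * gen h \<doteq> scalar (twist (gdeg g) (gdeg h)) * (gen h * gen g)"
proof -
  have inv: "gdeg (TX_inv i) = (\<lambda>k. - gdeg (TX i) k)" for i :: 'n by auto
  have base: "gen (TX i) * gen (TX j) \<doteq> scalar (twist (gdeg (TX i)) (gdeg (TX j))) * (gen (TX j) * gen (TX i))" for i j
  proof -
    have "twist (gdeg (TX i)) (gdeg (TX j)) = root_matrix l $ i $ j"
      by (simp only: twist_def twist_form_basis root_matrix_def vec_lambda_beta)
    then show ?thesis unfolding tcong_def by (intro relideal_incl) (auto simp: torus_rels_def mult.assoc)
  qed
  have right: "gen x * gen (TX_inv j) \<doteq> scalar (twist (gdeg x) (gdeg (TX_inv j))) * (gen (TX_inv j) * gen x)"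
    if "gen x * gen (TX j) \<doteq> scalar (twist (gdeg x) (gdeg (TX j))) * (gen (TX j) * gen x)" for x j
    unfolding inv twist_minus
    by (rule commute_inverse[OF _ _ that twist_nonzero]) (use gen_flip[of "TX j"] flip_gen_mult[of "TX j"] in simp_all)
  have left: "gen (TX_inv i) * gen y \<doteq> scalar (twist (gdeg (TX_inv i)) (gdeg y)) * (gen y * gen (TX_inv i))"
    if c: "gen (TX i) * gen y \<doteq> scalar (twist (gdeg (TX i)) (gdeg y)) * (gen y * gen (TX i))" for i y
  proof -
    have "gen y * gen (TX_inv i) \<doteq> scalar (1 / (1 / twist (gdeg (TX i)) (gdeg y))) * (gen (TX_inv i) * gen y)"
      by (rule commute_inverse[OF _ _ commute_swap[OF c twist_nonzero]])
         (use gen_flip[of "TX i"] flip_gen_mult[of "TX i"] twist_nonzero in simp_all)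
    then show ?thesis unfolding inv twist_minus using commute_swap twist_nonzero by (metis divide_divide_eq_right mult_1 div_by_1)
  qed
  show ?thesis by (cases g; cases h) (auto intro: base right left)
qed

lemma word_commute: "word_elem u * word_elem v \<doteq> scalar (twist (wdeg u) (wdeg v)) * (word_elem v * word_elem u)"
proof -
  have one: "word_elem u * gen h \<doteq> scalar (twist (wdeg u) (gdeg h)) * (gen h * word_elem u)" for u h
  proof (induction u)
    case Nil
    show ?case by (simp add: word_elem_Nil tcong_refl scalar_one wdeg_fun twist_zero)
  next
    case (Cons g u)
    let ?p = "twist (wdeg u) (gdeg h)" and ?q = "twist (gdeg g) (gdeg h)"
    have "word_elem (g # u) * gen h = gen g * (word_elem u * gen h)" by (simp add: word_elem_Cons mult.assoc)
    also have "\<dots> \<doteq> gen g * (scalar ?p * (gen h * word_elem u))" by (rule tcong_left[OF Cons.IH])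
    also have "gen g * (scalar ?p * (gen h * word_elem u)) = scalar ?p * (gen g * gen h * word_elem u)"
      by (metis scalar_commute mult.assoc)
    also have "\<dots> \<doteq> scalar ?p * (scalar ?q * (gen h * gen g) * word_elem u)"
      by (rule tcong_left[OF tcong_right[OF gen_commute]])
    also have "scalar ?p * (scalar ?q * (gen h * gen g) * word_elem u) = scalar (?p * ?q) * (gen h * word_elem (g # u))"
      by (simp add: scalar_mult word_elem_Cons mult.assoc)
    also have "?p * ?q = twist (wdeg (g # u)) (gdeg h)"
      by (simp only: wdeg_fun twist_add_left mult.commute)
    finally show ?case .
  qed
  show ?thesis
  proof (induction v)
    case Nil
    show ?case by (simp add: word_elem_Nil tcong_refl scalar_one wdeg_fun twist_zero)
  next
    case (Cons h v)
    let ?p = "twist (wdeg u) (gdeg h)" and ?q = "twist (wdeg u) (wdeg v)"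
    have "word_elem u * word_elem (h # v) = word_elem u * gen h * word_elem v" by (simp add: word_elem_Cons mult.assoc)
    also have "\<dots> \<doteq> scalar ?p * (gen h * word_elem u) * word_elem v" by (rule tcong_right[OF one])
    also have "scalar ?p * (gen h * word_elem u) * word_elem v = scalar ?p * gen h * (word_elem u * word_elem v)" by (simp add: mult.assoc)
    also have "\<dots> \<doteq> scalar ?p * gen h * (scalar ?q * (word_elem v * word_elem u))" by (rule tcong_left[OF Cons.IH])
    also have "scalar ?p * gen h * (scalar ?q * (word_elem v * word_elem u)) = scalar (?p * ?q) * (word_elem (h # v) * word_elem u)"
      by (simp add: scalar_mult word_elem_Cons mult.assoc) (metis scalar_commute mult.assoc)
    also have "?p * ?q = twist (wdeg u) (wdeg (h # v))"
      by (simp only: wdeg_fun twist_add_right)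
    finally show ?case .
  qed
qed

text \<open>Reordering letters costs a nonzero scalar depending on the order. Only its existence is
  recorded; such scalars are compensated later by rescaling generators.\<close>

definition proportional :: "'n torus_gen list \<Rightarrow> 'n torus_gen list \<Rightarrow> bool" where
  "proportional u v \<longleftrightarrow> (\<exists>c. c \<noteq> 0 \<and> word_elem u \<doteq> scalar c * word_elem v)"

lemma proportional_refl: "proportional u u"
  unfolding proportional_def by (rule exI[of _ 1]) (simp add: scalar_one tcong_refl)

lemma proportional_trans: "proportional u v \<Longrightarrow> proportional v w \<Longrightarrow> proportional u w"
proof -
  assume "proportional u v" "proportional v w"
  then obtain c d where c: "c \<noteq> 0" "word_elem u \<doteq> scalar c * word_elem v" and d: "d \<noteq> 0" "word_elem v \<doteq> scalar d * word_elem w"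
    unfolding proportional_def by blast
  have "word_elem u \<doteq> scalar c * (scalar d * word_elem w)" by (rule tcong_trans[OF c(2) tcong_left[OF d(2)]])
  then have "word_elem u \<doteq> scalar (c * d) * word_elem w" by (simp add: scalar_mult mult.assoc)
  then show ?thesis unfolding proportional_def using c d by (intro exI[of _ "c * d"]) simp
qed

lemma proportional_append: "proportional u u' \<Longrightarrow> proportional v v' \<Longrightarrow> proportional (u @ v) (u' @ v')"
proof -
  assume "proportional u u'" "proportional v v'"
  then obtain c d where c: "c \<noteq> 0" "word_elem u \<doteq> scalar c * word_elem u'" and d: "d \<noteq> 0" "word_elem v \<doteq> scalar d * word_elem v'"
    unfolding proportional_def by blast
  have "word_elem (u @ v) \<doteq> scalar c * word_elem u' * (scalar d * word_elem v')" unfolding word_elem_append by (rule tcong_mult[OF c(2) d(2)])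
  also have "scalar c * word_elem u' * (scalar d * word_elem v') = scalar (c * d) * word_elem (u' @ v')"
    by (simp add: scalar_mult word_elem_append mult.assoc) (metis scalar_commute mult.assoc)
  finally show ?thesis unfolding proportional_def using c d by (intro exI[of _ "c * d"]) simp
qed

lemma proportional_swap: "proportional (u @ v) (v @ u)"
  unfolding proportional_def word_elem_append using word_commute twist_nonzero by blast

lemma proportional_cancel: "proportional [g, flip_gen g] []"
  unfolding proportional_def
  by (rule exI[of _ 1]) (simp add: word_elem_Cons word_elem_Nil word_elem_single scalar_one gen_flip)

text \<open>Induction on the length: a nonempty word of degree zero contains the inverse of its
  first letter, which is moved next to that letter and cancelled.\<close>

lemma wdeg_zero_proportional: "wdeg w = (\<lambda>_. 0) \<Longrightarrow> proportional w []"
proof (induction "length w" arbitrary: w rule: less_induct)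
  case less
  show ?case
  proof (cases w)
    case Nil
    then show ?thesis by (simp add: proportional_refl)
  next
    case (Cons g w')
    have "flip_gen g \<in> set w'"
    proof (rule ccontr)
      assume no: "flip_gen g \<notin> set w'"
      obtain i where i: "g = TX i \<or> g = TX_inv i" by (cases g) auto
      \<comment> \<open>The sign of the first letter \<open>g\<close>. Without the inverse letter,
        no letter contributes with the opposite sign at \<open>i\<close>, so the degree there could
        not be zero.\<close>
      define s where "s = gdeg g i"
      have s: "s * s = 1" using i by (auto simp: s_def)
      have "s * wdeg x i \<ge> 0" if "flip_gen g \<notin> set x" for x
        using that
      proof (induction x)
        case (Cons h x)
        have "s * gdeg h i \<ge> 0" using Cons.prems i by (cases h) (auto simp: s_def)
        then show ?case using Cons by (simp add: distrib_left)
      qed simp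
      from this[OF no] have "s * wdeg w i > 0" using s Cons by (simp add: s_def distrib_left)
      then show False using less.prems by simp
    qed
    then obtain x y where w': "w' = x @ flip_gen g # y" by (auto dest: split_list)
    have "proportional w (g # flip_gen g # x @ y)"
    proof -
      have "proportional (x @ [flip_gen g]) ([flip_gen g] @ x)" by (rule proportional_swap)
      from proportional_append[OF proportional_refl[of "[g]"] proportional_append[OF this proportional_refl[of y]]]
      show ?thesis by (simp add: Cons w')
    qed
    moreover have "proportional (g # flip_gen g # x @ y) (x @ y)"
      using proportional_append[OF proportional_cancel[of g] proportional_refl[of "x @ y"]] by simp
    moreover have "proportional (x @ y) []"
    proof (rule less.hyps)
      show "length (x @ y) < length w" by (simp add: Cons w')
      show "wdeg (x @ y) = (\<lambda>_. 0)"
      proof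
        fix k show "wdeg (x @ y) k = 0" using fun_cong[OF less.prems, of k] by (simp add: Cons w')
      qed
    qed
    ultimately show ?thesis using proportional_trans by blast
  qed
qed

lemma wdeg_eq_proportional: assumes "wdeg u = wdeg v" shows "proportional u v"
proof -
  have 1: "proportional (u @ inv_word v) []" by (rule wdeg_zero_proportional) (simp add: assms fun_eq_iff)
  have 2: "proportional [] (inv_word v @ v)"
  proof -
    have "proportional (inv_word v @ v) []" by (rule wdeg_zero_proportional) (simp add: fun_eq_iff)
    then obtain c where c: "c \<noteq> 0" "word_elem (inv_word v @ v) \<doteq> scalar c * word_elem []" unfolding proportional_def by blast
    have "scalar (1 / c) * word_elem (inv_word v @ v) \<doteq> scalar (1 / c) * (scalar c * word_elem [])" by (rule tcong_left[OF c(2)])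
    also have "scalar (1 / c) * (scalar c * word_elem []) = (word_elem [] :: 'n torus_gen free_alg)" using c(1) by (simp add: scalar_one flip: mult.assoc scalar_mult)
    finally show ?thesis unfolding proportional_def using tcong_sym c(1) by (intro exI[of _ "1 / c"]) auto
  qed
  have "proportional u (u @ inv_word v @ v)" using proportional_append[OF proportional_refl[of u] 2] by simp
  moreover have "proportional (u @ inv_word v @ v) v" using proportional_append[OF 1 proportional_refl[of v]] by simp
  ultimately show ?thesis by (rule proportional_trans)
qed

lemma word_inverse: "word_elem w * word_elem (inv_word w) \<doteq> 1" "word_elem (inv_word w) * word_elem w \<doteq> 1"
proof -
  show "word_elem w * word_elem (inv_word w) \<doteq> 1"
  proof (induction w)
    case (Cons g w)
    have "word_elem (g # w) * word_elem (inv_word (g # w)) = gen g * (word_elem w * word_elem (inv_word w)) * gen (flip_gen g)"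
      by (simp add: word_elem_Cons word_elem_append word_elem_single word_elem_Nil mult.assoc)
    also have "\<dots> \<doteq> gen g * 1 * gen (flip_gen g)" by (rule tcong_right[OF tcong_left[OF Cons.IH]])
    also have "gen g * 1 * gen (flip_gen g) \<doteq> 1" using gen_flip by simp
    finally show ?case .
  qed (simp add: word_elem_Nil tcong_refl)
  show "word_elem (inv_word w) * word_elem w \<doteq> 1"
  proof (induction w)
    case (Cons g w)
    have "word_elem (inv_word (g # w)) * word_elem (g # w) = word_elem (inv_word w) * (gen (flip_gen g) * gen g) * word_elem w"
      by (simp add: word_elem_Cons word_elem_append word_elem_single word_elem_Nil mult.assoc)
    also have "\<dots> \<doteq> word_elem (inv_word w) * 1 * word_elem w" by (rule tcong_right[OF tcong_left[OF flip_gen_mult]])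
    also have "word_elem (inv_word w) * 1 * word_elem w \<doteq> 1" using Cons.IH by simp
    finally show ?case .
  qed (simp add: word_elem_Nil tcong_refl)
qed

end

section \<open>Monomial maps between quantum tori\<close>

fun word_image :: "('n \<Rightarrow> 'n torus_gen list) \<Rightarrow> 'n torus_gen \<Rightarrow> 'n torus_gen list" where
  "word_image W (TX i) = W i" | "word_image W (TX_inv i) = inv_word (W i)"

definition monomial_map :: "('n \<Rightarrow> 'n torus_gen list) \<Rightarrow> 'n torus_gen free_alg \<Rightarrow> 'n torus_gen free_alg" where
  "monomial_map W = fa.eval_free (\<lambda>g. word_elem (word_image W g))"

lemma monomial_map_word_elem: "monomial_map W (word_elem w) = word_elem (concat (map (word_image W) w))"
  by (induction w) (simp_all add: monomial_map_def word_elem_Nil fa.eval_free_1 word_elem_Cons fa.eval_free_gen_mult word_elem_append)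

lemma wdeg_word_image: "wdeg (word_image W g) k = (\<Sum>i\<in>UNIV. gdeg g i * wdeg (W i) k)" for k :: "'n::finite"
  by (cases g) (simp_all add: if_distrib[of "\<lambda>x. x * _"] cong: if_cong)

lemma wdeg_concat: "wdeg (concat (map (word_image W) w)) k = (\<Sum>i\<in>UNIV. wdeg w i * wdeg (W i) k)" for k :: "'n::finite"
  by (induction w) (simp_all add: wdeg_word_image distrib_right sum.distrib)

lemma monomial_map_relideal:
  fixes l m :: "complex ^ 'n::finite"
  assumes com: "\<And>i j. twist m (wdeg (W i)) (wdeg (W j)) = root_matrix l $ i $ j"
    and f: "f \<in> relideal (torus_rels (root_matrix l))"
  shows "monomial_map W f \<in> relideal (torus_rels (root_matrix m))"
proof -
  let ?J = "{f. monomial_map W f \<in> relideal (torus_rels (root_matrix m))}"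
  have "relideal (torus_rels (root_matrix l)) \<subseteq> ?J"
  proof (rule relideal_least)
    show "torus_rels (root_matrix l) \<subseteq> ?J"
    proof
      fix r assume "r \<in> torus_rels (root_matrix l)"
      then consider i where "r = gen (TX i) * gen (TX_inv i) - 1" | i where "r = gen (TX_inv i) * gen (TX i) - 1"
        | i j where "r = gen (TX i) * gen (TX j) - scalar (root_matrix l $ i $ j) * gen (TX j) * gen (TX i)"
        unfolding torus_rels_def by blast
      then show "r \<in> ?J"
      proof cases
        case (1 i)
        then show ?thesis using word_inverse(1)[of m "W i"]
          by (simp add: monomial_map_def tcong_def fa.eval_free_diff fa.eval_free_mult fa.eval_free_gen fa.eval_free_1)
      next
        case (2 i)
        then show ?thesis using word_inverse(2)[of m "W i"]
          by (simp add: monomial_map_def tcong_def fa.eval_free_diff fa.eval_free_mult fa.eval_free_gen fa.eval_free_1)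
      next
        case (3 i j)
        then show ?thesis using word_commute[of m "W i" "W j"]
          by (simp add: monomial_map_def tcong_def fa.eval_free_diff fa.eval_free_mult fa.eval_free_gen fa.eval_free_scalar com mult.assoc)
      qed
    qed
  qed (simp_all add: monomial_map_def fa.eval_free_0 relideal_0 fa.eval_free_add relideal_add fa.eval_free_mult relideal_mult_left relideal_mult_right)
  then show ?thesis using f by blast
qed

text \<open>The exponent matrices are inverse to each other, so the image of \<open>g\<close> is a
  word with the exponent vector of \<open>g\<close>, and such words are proportional.\<close>

lemma monomial_map_comp_gen:
  fixes l :: "complex ^ 'n::finite"
  assumes inv: "\<And>i k. (\<Sum>j\<in>UNIV. wdeg (W i) j * wdeg (V j) k) = (if i = k then 1 else 0)"
  shows "\<exists>c. c \<noteq> 0 \<and> tcong l (monomial_map V (monomial_map W (gen g))) (scalar c * gen g)"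
proof -
  have "monomial_map V (monomial_map W (gen g)) = word_elem (concat (map (word_image V) (word_image W g)))"
    by (simp add: monomial_map_word_elem flip: word_elem_single)
  moreover have "wdeg (concat (map (word_image V) (word_image W g))) = wdeg [g]"
  proof
    fix k
    have "wdeg (concat (map (word_image V) (word_image W g))) k = (\<Sum>i\<in>UNIV. gdeg g i * (\<Sum>j\<in>UNIV. wdeg (W i) j * wdeg (V j) k))"
      unfolding wdeg_concat wdeg_word_image sum_distrib_left sum_distrib_right by (subst sum.swap) (simp add: mult.assoc)
    then show "wdeg (concat (map (word_image V) (word_image W g))) k = wdeg [g] k" by (simp add: inv if_distrib[of "\<lambda>x. _ * x"] cong: if_cong)
  qed
  ultimately show ?thesis using wdeg_eq_proportional unfolding proportional_def by (metis word_elem_single)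
qed

text \<open>
  The composite of two inverse monomial maps fixes every generator only up to a scalar \<open>c\<close>; the map \<open>D\<close> in the proof removes
  these scalars. It respects the relations since the scalars of a generator and its inverse multiply to one in the torus.
\<close>

lemma monomial_map_inj:
  fixes l m :: "complex ^ 'n::finite"
  assumes W: "\<And>i j. twist m (wdeg (W i)) (wdeg (W j)) = root_matrix l $ i $ j"
    and V: "\<And>i j. twist l (wdeg (V i)) (wdeg (V j)) = root_matrix m $ i $ j"
    and inv: "\<And>i k. (\<Sum>j\<in>UNIV. wdeg (W i) j * wdeg (V j) k) = (if i = k then 1 else 0)"
    and f: "monomial_map W f \<in> relideal (torus_rels (root_matrix m))"
  shows "f \<in> relideal (torus_rels (root_matrix l))"
proof -
  let ?I = "relideal (torus_rels (root_matrix l))"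
  define T where "T f = monomial_map V (monomial_map W f)" for f
  have T_I: "T f \<in> ?I" if "f \<in> ?I" for f
    unfolding T_def using monomial_map_relideal[OF V monomial_map_relideal[OF W that]] .
  obtain c where c: "\<And>g. c g \<noteq> 0" "\<And>g. tcong l (T (gen g)) (scalar (c g) * gen g)"
    using monomial_map_comp_gen[OF inv, of l] unfolding T_def by metis
  have T_mult: "T (f * g) = T f * T g" and T_add: "T (f + g) = T f + T g" and T_scalar: "T (scalar z) = scalar z"
    and T_diff: "T (f - g) = T f - T g" and T_1: "T 1 = 1" for f g z
    by (simp_all add: T_def monomial_map_def fa.eval_free_mult fa.eval_free_add fa.eval_free_scalar fa.eval_free_diff fa.eval_free_1)
  \<comment> \<open>The image of the relation between \<open>g\<close> and its inverse under
    \<open>T\<close>. The identity of scalars is stated modulo the ideal, the torus not having been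
    shown to be nonzero.\<close>
  have cc: "scalar (c g * c (flip_gen g)) - 1 \<in> ?I" for g
  proof -
    have "gen g * gen (flip_gen g) - 1 \<in> ?I" using gen_flip[of l g] by (simp add: tcong_def)
    from T_I[OF this] have "tcong l (T (gen g) * T (gen (flip_gen g))) 1" by (simp add: T_diff T_mult T_1 tcong_def)
    then have "tcong l (scalar (c g) * gen g * (scalar (c (flip_gen g)) * gen (flip_gen g))) 1"
      using tcong_mult[OF c(2) c(2)] tcong_sym tcong_trans by metis
    moreover have "scalar (c g) * gen g * (scalar (c (flip_gen g)) * gen (flip_gen g))
        = scalar (c g * c (flip_gen g)) * (gen g * gen (flip_gen g))"
      by (simp add: scalar_mult mult.assoc) (metis scalar_commute mult.assoc)
    ultimately have "tcong l (scalar (c g * c (flip_gen g)) * (gen g * gen (flip_gen g))) 1" by simp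
    moreover have "tcong l (scalar (c g * c (flip_gen g)) * (gen g * gen (flip_gen g))) (scalar (c g * c (flip_gen g)) * 1)"
      by (rule tcong_left[OF gen_flip])
    ultimately have "tcong l (scalar (c g * c (flip_gen g)) * 1) 1" using tcong_sym tcong_trans by metis
    then show ?thesis by (simp add: tcong_def)
  qed
  define D where "D = fa.eval_free (\<lambda>g :: 'n torus_gen. scalar (1 / c g) * gen g)"
  have D_mult: "D (f * g) = D f * D g" and D_add: "D (f + g) = D f + D g" and D_scalar: "D (scalar z) = scalar z"
    and D_diff: "D (f - g) = D f - D g" and D_1: "D 1 = 1" and D_gen: "D (gen x) = scalar (1 / c x) * gen x" and D_0: "D 0 = 0" for f g z x
    by (simp_all add: D_def fa.eval_free_mult fa.eval_free_add fa.eval_free_scalar fa.eval_free_diff fa.eval_free_1 fa.eval_free_gen fa.eval_free_0)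
  have D_gen2: "D (gen x) * D (gen y) = scalar (1 / (c x * c y)) * (gen x * gen y)" for x y
  proof -
    have "D (gen x) * D (gen y) = scalar (1 / c x) * scalar (1 / c y) * (gen x * gen y)"
      by (simp add: D_gen mult.assoc) (metis scalar_commute mult.assoc)
    then show ?thesis by (simp flip: scalar_mult)
  qed
  have D_inv: "D (gen x) * D (gen (flip_gen x)) - 1 \<in> ?I" for x
  proof -
    let ?p = "c x * c (flip_gen x)"
    have "?p \<noteq> 0" using c(1) by simp
    have "scalar (1 / ?p) * (gen x * gen (flip_gen x)) - scalar (1 / ?p) * 1 \<in> ?I"
      using tcong_left[OF gen_flip, of l "scalar (1 / ?p)" x] by (simp add: tcong_def)
    moreover have "scalar (1 / ?p) * (scalar ?p - 1) \<in> ?I" by (rule relideal_mult_left[OF cc])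
    moreover have "scalar (1 / ?p) * (scalar ?p - 1) = 1 - scalar (1 / ?p)"
      using \<open>?p \<noteq> 0\<close> by (simp add: right_diff_distrib scalar_one flip: scalar_mult)
    ultimately have "(scalar (1 / ?p) * (gen x * gen (flip_gen x)) - scalar (1 / ?p) * 1) - (1 - scalar (1 / ?p)) \<in> ?I"
      using relideal_diff by metis
    then show ?thesis unfolding D_gen2 by simp
  qed
  have D_I: "D f \<in> ?I" if "f \<in> ?I" for f
  proof -
    have "?I \<subseteq> {f. D f \<in> ?I}"
    proof (rule relideal_least)
      show "torus_rels (root_matrix l) \<subseteq> {f. D f \<in> ?I}"
      proof
        fix r assume r: "r \<in> torus_rels (root_matrix l)"
        then consider i where "r = gen (TX i) * gen (TX_inv i) - 1" | i where "r = gen (TX_inv i) * gen (TX i) - 1"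
          | i j where "r = gen (TX i) * gen (TX j) - scalar (root_matrix l $ i $ j) * gen (TX j) * gen (TX i)"
          unfolding torus_rels_def by blast
        then show "r \<in> {f. D f \<in> ?I}"
        proof cases
          case (1 i)
          then show ?thesis using D_inv[of "TX i"] by (simp add: D_diff D_mult D_1)
        next
          case (2 i)
          then show ?thesis using D_inv[of "TX_inv i"] by (simp add: D_diff D_mult D_1)
        next
          case (3 i j)
          let ?q = "root_matrix l $ i $ j" and ?s = "1 / (c (TX i) * c (TX j))"
          have "D r = D (gen (TX i)) * D (gen (TX j)) - scalar ?q * (D (gen (TX j)) * D (gen (TX i)))"
            unfolding 3 by (simp add: D_diff D_mult D_scalar mult.assoc)
          also have "\<dots> = scalar ?s * (gen (TX i) * gen (TX j)) - scalar ?q * (scalar ?s * (gen (TX j) * gen (TX i)))"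
            unfolding D_gen2 by (simp add: mult.commute[of "c (TX j)"])
          also have "\<dots> = scalar ?s * r"
          proof -
            have "scalar ?q * (scalar ?s * (gen (TX j) * gen (TX i))) = scalar ?s * (scalar ?q * (gen (TX j) * gen (TX i)))"
              by (simp only: mult.assoc[symmetric] scalar_mult[symmetric] mult.commute)
            then show ?thesis unfolding 3 by (simp only: right_diff_distrib mult.assoc)
          qed
          finally show ?thesis using relideal_mult_left[OF relideal_incl[OF r]] by simp
        qed
      qed
    qed (simp_all add: D_0 relideal_0 D_add relideal_add D_mult relideal_mult_left relideal_mult_right)
    then show ?thesis using that by blast
  qed
  have DT: "tcong l (D (T f)) f" for f
  proof (induction f rule: free_alg_induct)
    case (add f g)
    then show ?case unfolding tcong_def T_add D_add using relideal_add by (metis add_diff_add)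
  next
    case (scalar z)
    then show ?case by (simp add: T_scalar D_scalar tcong_refl)
  next
    case (gen g f)
    have "D (T (gen g)) - D (scalar (c g) * gen g) \<in> ?I" using D_I c(2)[of g] by (simp add: tcong_def flip: D_diff)
    moreover have "D (scalar (c g) * gen g) = gen g"
      using c(1)[of g] by (simp add: D_mult D_scalar D_gen scalar_one flip: mult.assoc scalar_mult)
    ultimately have "tcong l (D (T (gen g))) (gen g)" by (simp add: tcong_def)
    then show ?case unfolding T_mult D_mult by (rule tcong_mult[OF _ gen])
  qed
  have "T f \<in> ?I" unfolding T_def by (rule monomial_map_relideal[OF V f])
  then have "D (T f) \<in> ?I" by (rule D_I)
  then show ?thesis using DT[of f] relideal_diff[of "D (T f)" _ "D (T f) - f"] by (simp add: tcong_def)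
qed

text \<open>A preimage of a generator is its image under the inverse monomial map, divided by the
  scalar from \<open>monomial_map_comp_gen\<close>.\<close>

lemma monomial_map_surj:
  fixes m :: "complex ^ 'n::finite"
  assumes inv: "\<And>i k. (\<Sum>j\<in>UNIV. wdeg (V i) j * wdeg (W j) k) = (if i = k then 1 else 0)"
  shows "\<exists>f. tcong m (monomial_map W f) h"
proof (induction h rule: free_alg_induct)
  case (add f g)
  then obtain f' g' where "tcong m (monomial_map W f') f" "tcong m (monomial_map W g') g" by blast
  then have "tcong m (monomial_map W (f' + g')) (f + g)"
    unfolding tcong_def monomial_map_def fa.eval_free_add using relideal_add by (metis add_diff_add)
  then show ?case by blast
next
  case (scalar z)
  have "monomial_map W (scalar z) = scalar z" by (simp add: monomial_map_def fa.eval_free_scalar)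
  then show ?case using tcong_refl by metis
next
  case (gen g h)
  then obtain f where f: "tcong m (monomial_map W f) h" by blast
  obtain c where c: "c \<noteq> 0" "tcong m (monomial_map W (monomial_map V (gen g))) (scalar c * gen g)"
    using monomial_map_comp_gen[OF inv] by blast
  have "monomial_map W (scalar (1 / c) * monomial_map V (gen g)) = scalar (1 / c) * monomial_map W (monomial_map V (gen g))"
    by (simp add: monomial_map_def fa.eval_free_scalar_mult)
  moreover have "tcong m (scalar (1 / c) * monomial_map W (monomial_map V (gen g))) (scalar (1 / c) * (scalar c * gen g))"
    by (rule tcong_left[OF c(2)])
  moreover have "scalar (1 / c) * (scalar c * gen g) = gen g"
    using c(1) by (simp add: scalar_one flip: mult.assoc scalar_mult)
  ultimately have "tcong m (monomial_map W (scalar (1 / c) * monomial_map V (gen g))) (gen g)" by simp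
  from tcong_mult[OF this f] show ?case unfolding monomial_map_def by (metis fa.eval_free_mult)
qed

lemma quantum_torus_isomorphic:
  fixes l m :: "complex ^ 'n::finite"
  assumes W: "\<And>i j. twist m (wdeg (W i)) (wdeg (W j)) = root_matrix l $ i $ j"
    and V: "\<And>i j. twist l (wdeg (V i)) (wdeg (V j)) = root_matrix m $ i $ j"
    and WV: "\<And>i k. (\<Sum>j\<in>UNIV. wdeg (W i) j * wdeg (V j) k) = (if i = k then 1 else 0)"
    and VW: "\<And>i k. (\<Sum>j\<in>UNIV. wdeg (V i) j * wdeg (W j) k) = (if i = k then 1 else 0)"
  shows "algebra_isomorphic (quantum_torus (root_matrix l)) (quantum_torus (root_matrix m))"
proof -
  let ?S = "torus_rels (root_matrix l)" and ?R = "torus_rels (root_matrix m)"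
  define F where "F X = rel_class ?R (monomial_map W (SOME f. X = rel_class ?S f))" for X
  have matmul_diff: "monomial_map W f - monomial_map W g = monomial_map W (f - g)" for f g
    by (simp add: monomial_map_def fa.eval_free_diff)
  have F: "F (rel_class ?S f) = rel_class ?R (monomial_map W f)" for f
  proof -
    have "rel_class ?S f = rel_class ?S (SOME g. rel_class ?S f = rel_class ?S g)" by (rule someI) (rule refl)
    then have "f - (SOME g. rel_class ?S f = rel_class ?S g) \<in> relideal ?S" by (simp only: rel_class_eq_iff)
    then have "monomial_map W (f - (SOME g. rel_class ?S f = rel_class ?S g)) \<in> relideal ?R" by (rule monomial_map_relideal[OF W])
    then have "rel_class ?R (monomial_map W f) = rel_class ?R (monomial_map W (SOME g. rel_class ?S f = rel_class ?S g))"
      unfolding rel_class_eq_iff matmul_diff .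
    then show ?thesis unfolding F_def by simp
  qed
  have "inj_on F (range (rel_class ?S))"
  proof (rule inj_onI)
    fix X Y assume "X \<in> range (rel_class ?S)" "Y \<in> range (rel_class ?S)" and eq: "F X = F Y"
    then obtain f g where XY: "X = rel_class ?S f" "Y = rel_class ?S g" by blast
    have "monomial_map W (f - g) \<in> relideal ?R" using eq unfolding XY F rel_class_eq_iff matmul_diff .
    then have "f - g \<in> relideal ?S" by (rule monomial_map_inj[OF W V WV])
    then show "X = Y" unfolding XY rel_class_eq_iff .
  qed
  moreover have "F ` range (rel_class ?S) = range (rel_class ?R)"
  proof
    show "F ` range (rel_class ?S) \<subseteq> range (rel_class ?R)" by (auto simp: F)
    show "range (rel_class ?R) \<subseteq> F ` range (rel_class ?S)"
    proof
      fix Y assume "Y \<in> range (rel_class ?R)"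
      then obtain h where h: "Y = rel_class ?R h" by blast
      obtain f where "tcong m (monomial_map W f) h" using monomial_map_surj[OF VW] by blast
      then have "F (rel_class ?S f) = Y" unfolding F h rel_class_eq_iff tcong_def .
      then show "Y \<in> F ` range (rel_class ?S)" by blast
    qed
  qed
  ultimately have "bij_betw F (carrier (quantum_torus (root_matrix l))) (carrier (quantum_torus (root_matrix m)))"
    by (simp add: bij_betw_def torus_presented presented_carrier)
  moreover have "F \<in> ring_hom (quantum_torus (root_matrix l)) (quantum_torus (root_matrix m))"
    unfolding torus_presented
    by (rule ring_hom_memI)
       (auto simp: presented_algebra_ops F monomial_map_def fa.eval_free_mult fa.eval_free_add fa.eval_free_1)
  ultimately have "F \<in> algebra_iso (quantum_torus (root_matrix l)) (quantum_torus (root_matrix m))"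
    unfolding algebra_iso_def ring_iso_def
    by (auto simp: torus_presented presented_carrier presented_smult F monomial_map_def fa.eval_free_scalar_mult)
  then show ?thesis unfolding algebra_isomorphic_def by blast
qed

text \<open>Row sums one reduce the commutation form to differences of pairings by
  \<open>twist_form_eq\<close>. The form is exponentiated, so agreement of these differences modulo
  \<int> is enough.\<close>

theorem root_torus_isomorphic:
  fixes l m :: "complex ^ 'n::finite" and M N :: "'n \<Rightarrow> 'n \<Rightarrow> int"
  assumes M1: "\<And>i. (\<Sum>k\<in>UNIV. M i k) = 1" and N1: "\<And>i. (\<Sum>k\<in>UNIV. N i k) = 1"
    and MN: "\<And>i k. (\<Sum>j\<in>UNIV. M i j * N j k) = (if i = k then 1 else 0)"
    and NM: "\<And>i k. (\<Sum>j\<in>UNIV. N i j * M j k) = (if i = k then 1 else 0)"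
    and Mm: "\<And>i j. ((\<Sum>k\<in>UNIV. of_int (M i k) * m $ k) - (\<Sum>k\<in>UNIV. of_int (M j k) * m $ k)) - (l $ i - l $ j) \<in> \<int>"
    and Nl: "\<And>i j. ((\<Sum>k\<in>UNIV. of_int (N i k) * l $ k) - (\<Sum>k\<in>UNIV. of_int (N j k) * l $ k)) - (m $ i - m $ j) \<in> \<int>"
  shows "algebra_isomorphic (quantum_torus (root_matrix l)) (quantum_torus (root_matrix m))"
proof -
  define W where "W i = (SOME w. wdeg w = M i)" for i
  define V where "V i = (SOME w. wdeg w = N i)" for i
  have W: "wdeg (W i) = M i" and V: "wdeg (V i) = N i" for i
    unfolding W_def V_def using someI_ex[OF wdeg_surj[of "M i"]] someI_ex[OF wdeg_surj[of "N i"]] by simp_all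
  have ex: "exp (2 * \<i> * of_real pi * x) = exp (2 * \<i> * of_real pi * y)" if xy: "x - y \<in> \<int>" for x y :: complex
  proof -
    obtain k where "x - y = of_int k" using xy by (auto elim: Ints_cases)
    then have "x = y + of_int k" by (simp add: diff_eq_eq add.commute)
    then have "2 * \<i> * of_real pi * x = 2 * \<i> * of_real pi * y + \<i> * of_real (2 * pi * of_int k)"
      by (simp add: algebra_simps)
    moreover have "exp (\<i> * of_real (2 * pi * of_int k)) = 1"
      unfolding cis_conv_exp[symmetric] by (rule cis_multiple_2pi) simp
    ultimately show ?thesis by (simp add: exp_add)
  qed
  show ?thesis
  proof (rule quantum_torus_isomorphic[of m W l V])
    show "twist m (wdeg (W i)) (wdeg (W j)) = root_matrix l $ i $ j" for i j
      using ex[OF Mm[of i j]] by (simp add: twist_def twist_form_eq W M1 root_matrix_def)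
    show "twist l (wdeg (V i)) (wdeg (V j)) = root_matrix m $ i $ j" for i j
      using ex[OF Nl[of i j]] by (simp add: twist_def twist_form_eq V N1 root_matrix_def)
  qed (simp_all add: W V MN NM)
qed

section \<open>Rank three\<close>

lemma half_not_integer: "(1 / 2 :: complex) \<notin> \<int>"
proof
  assume "(1 / 2 :: complex) \<in> \<int>"
  then obtain k where "(1 / 2 :: complex) = of_int k" by (elim Ints_cases)
  then have "of_int (2 * k) = (of_int 1 :: complex)" by (simp add: field_simps)
  then have "2 * k = 1" by (simp only: of_int_eq_iff)
  then show False by presburger
qed

text \<open>With z i = e_i - e_3, the vectors z 1 and z 2 are a basis of the integral vectors of sum
  zero, and z 3 = 0. \<open>P\<close> describes \<open>g\<close> in this basis and \<open>R\<close>
  its inverse; the reverse integrality of \<open>g\<close> makes \<open>R\<close> integral.\<close>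

lemma integral_inverse:
  fixes g :: "(3 \<Rightarrow> complex) \<Rightarrow> 3 \<Rightarrow> complex" and z :: "3 \<Rightarrow> 3 \<Rightarrow> complex"
  assumes z_def: "\<And>i k. z i k = (if k = i then 1 else 0) - (if k = 3 then 1 else 0)"
    and zero_sum: "\<And>c. (\<Sum>i\<in>UNIV. c i) = 0 \<Longrightarrow> (\<Sum>i\<in>UNIV. g c i) = 0"
    and linear: "\<And>c d s t. (\<Sum>i\<in>UNIV. c i) = 0 \<Longrightarrow> (\<Sum>i\<in>UNIV. d i) = 0 \<Longrightarrow>
       g (\<lambda>i. s * c i + t * d i) = (\<lambda>i. s * g c i + t * g d i)"
    and int: "\<And>c i. (\<Sum>i\<in>UNIV. c i) = 0 \<Longrightarrow> (\<And>i. c i \<in> \<int>) \<Longrightarrow> g c i \<in> \<int>"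
    and int_rev: "\<And>c i. (\<Sum>i\<in>UNIV. c i) = 0 \<Longrightarrow> (\<And>i. g c i \<in> \<int>) \<Longrightarrow> c i \<in> \<int>"
  shows "\<exists>(P :: 3 \<Rightarrow> 3 \<Rightarrow> int) R :: 3 \<Rightarrow> 3 \<Rightarrow> int.
    (\<forall>i k. g (z i) k = of_int (P i k)) \<and> (\<forall>i. g (\<lambda>k. of_int (R i k)) = z i) \<and>
    (\<forall>i. (\<Sum>k\<in>UNIV. P i k) = 0) \<and> (\<forall>i. (\<Sum>k\<in>UNIV. R i k) = 0) \<and> (\<forall>k. P 3 k = 0) \<and> (\<forall>k. R 3 k = 0) \<and>
    (\<forall>i k. of_int (P i 1 * R 1 k + P i 2 * R 2 k) = z i k) \<and> (\<forall>i k. of_int (R i 1 * P 1 k + R i 2 * P 2 k) = z i k)"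
proof -
  have zs: "(\<Sum>k\<in>UNIV. z i k) = 0" for i by (simp add: z_def sum_subtractf)
  have zi: "z i k \<in> \<int>" for i k by (simp add: z_def)
  have "\<exists>p. g (z i) k = of_int p" for i k
    using int[OF zs[of i] zi, of k] by (elim Ints_cases) blast
  then obtain P :: "3 \<Rightarrow> 3 \<Rightarrow> int" where P: "\<And>i k. g (z i) k = of_int (P i k)" by metis
  have Ps: "(\<Sum>k\<in>UNIV. P i k) = 0" for i
  proof -
    have "(of_int (\<Sum>k\<in>UNIV. P i k) :: complex) = 0" using zero_sum[OF zs[of i]] by (simp add: P)
    then show ?thesis by (simp only: of_int_eq_0_iff)
  qed
  then have P3: "P i 3 = - P i 1 - P i 2" for i by (simp add: sum_3 algebra_simps) (metis add.commute add_eq_0_iff minus_add_distrib)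
  have expand: "g c k = c 1 * of_int (P 1 k) + c 2 * of_int (P 2 k)" if c: "(\<Sum>i\<in>UNIV. c i) = 0" for c k
  proof -
    have "c 3 = - c 1 - c 2" using c by (simp add: sum_3 algebra_simps) (metis add.commute add_eq_0_iff minus_add_distrib)
    then have "c i = c 1 * z 1 i + c 2 * z 2 i" for i
      using exhaust_3[of i] by (auto simp: z_def)
    then have "c = (\<lambda>i. c 1 * z 1 i + c 2 * z 2 i)" by blast
    then have "g c = (\<lambda>i. c 1 * g (z 1) i + c 2 * g (z 2) i)" using linear[OF zs zs] by metis
    then show ?thesis by (simp add: P)
  qed
  have z3: "z 3 = (\<lambda>_. 0)" by (simp add: z_def fun_eq_iff)
  have P30: "P 3 k = 0" for k
  proof -
    have "(of_int (P 3 k) :: complex) = g (z 3) k" by (rule P[symmetric])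
    also have "\<dots> = 0" unfolding expand[OF zs] by (simp add: z3)
    finally have "(of_int (P 3 k) :: complex) = 0" .
    then show ?thesis by simp
  qed
  define p where "p i k = (of_int (P i k) :: complex)" for i k
  \<comment> \<open>A nonzero kernel vector, rescaled to have a coordinate 1/2, would still go to
    the integral vector 0, against \<open>int_rev\<close>.\<close>
  have no_kernel: "u = 0 \<and> v = 0" if uv: "u * p 1 1 + v * p 2 1 = 0" "u * p 1 2 + v * p 2 2 = 0" for u v
  proof -
    define c where "c s = (\<lambda>k::3. if k = 1 then s * u else if k = 2 then s * v else - s * u - s * v)" for s
    have cs: "(\<Sum>k\<in>UNIV. c s k) = 0" for s by (simp add: sum_3 c_def)
    have "g (c s) k = s * (u * p 1 k + v * p 2 k)" for s k
      using expand[OF cs, of s k] by (simp add: c_def p_def algebra_simps)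
    moreover have "u * p 1 3 + v * p 2 3 = - (u * p 1 1 + v * p 2 1) - (u * p 1 2 + v * p 2 2)"
      by (simp add: p_def P3 algebra_simps)
    then have "u * p 1 k + v * p 2 k = 0" for k using uv exhaust_3[of k] by auto
    ultimately have "g (c s) k = 0" for s k by simp
    then have ci: "c s k \<in> \<int>" for s k using int_rev[OF cs] by simp
    have "u = 0" using ci[of "1 / (2 * u)" 1] half_not_integer by (auto simp: c_def split: if_splits)
    moreover have "v = 0" using ci[of "1 / (2 * v)" 2] half_not_integer by (auto simp: c_def split: if_splits)
    ultimately show ?thesis by blast
  qed
  define D where "D = p 1 1 * p 2 2 - p 1 2 * p 2 1"
  have D: "D \<noteq> 0"
  proof
    assume D0: "D = 0"
    \<comment> \<open>If the determinant is zero, (p 2 1, - p 1 1) and (p 2 2, - p 1 2) are kernel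
      vectors. So all four entries are zero, and then (1, 1) is a kernel vector as well.\<close>
    have "p 2 1 = 0 \<and> - p 1 1 = 0" using D0 by (intro no_kernel) (auto simp: D_def algebra_simps)
    moreover have "p 2 2 = 0 \<and> - p 1 2 = 0" using D0 by (intro no_kernel) (auto simp: D_def algebra_simps)
    ultimately have "(1 :: complex) = 0 \<and> (1 :: complex) = 0" by (intro no_kernel) auto
    then show False by simp
  qed
  \<comment> \<open>Cramer's rule for the block with indices 1 and 2. The third column makes the row
    sums zero, and the third row is zero like z 3.\<close>
  define r where "r i k = (if i = 1 then if k = 1 then p 2 2 / D else if k = 2 then - p 1 2 / D else (p 1 2 - p 2 2) / D
     else if i = 2 then if k = 1 then - p 2 1 / D else if k = 2 then p 1 1 / D else (p 2 1 - p 1 1) / D else 0)" for i k :: 3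
  have rs: "(\<Sum>k\<in>UNIV. r i k) = 0" for i by (simp add: sum_3 r_def flip: add_divide_distrib diff_divide_distrib)
  have p3: "p i 3 = - p i 1 - p i 2" "p 3 k = 0" for i k by (simp_all add: p_def P3 P30)
  have rp: "r i 1 * p 1 k + r i 2 * p 2 k = z i k" for i k
    using exhaust_3[of i] exhaust_3[of k] D
    by (elim disjE) (simp_all add: r_def z_def p3 field_simps, simp_all add: D_def algebra_simps)
  have pr: "p i 1 * r 1 k + p i 2 * r 2 k = z i k" for i k
    using exhaust_3[of i] exhaust_3[of k] D
    by (elim disjE) (simp_all add: r_def z_def p3 field_simps, simp_all add: D_def algebra_simps)
  have gr: "g (r i) = z i" for i
    using expand[OF rs] rp by (auto simp: p_def fun_eq_iff)
  have "r i k \<in> \<int>" for i k using int_rev[OF rs] gr zi by simp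
  then have "\<exists>q. r i k = of_int q" for i k using Ints_cases by metis
  then obtain R :: "3 \<Rightarrow> 3 \<Rightarrow> int" where R: "\<And>i k. r i k = of_int (R i k)" by metis
  have Rr: "(\<lambda>k. of_int (R i k)) = r i" for i by (simp add: R fun_eq_iff)
  have "(\<Sum>k\<in>UNIV. R i k) = 0" for i
  proof -
    have "(of_int (\<Sum>k\<in>UNIV. R i k) :: complex) = 0" using rs[of i] by (simp add: R)
    then show ?thesis by (simp only: of_int_eq_0_iff)
  qed
  moreover have "R 3 k = 0" for k
  proof -
    have "(of_int (R 3 k) :: complex) = 0" unfolding R[symmetric] by (simp add: r_def)
    then show ?thesis by simp
  qed
  ultimately show ?thesis using P Ps P30 gr Rr rp pr
    by (intro exI[of _ P] exI[of _ R]) (simp add: p_def R)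
qed

theorem theorem4p4p2:
  fixes lam mu :: "complex ^ 3" and a b :: "complex poly"
  assumes "a = [:- (lam $ 1), 1:] * [:- (lam $ 2), 1:] * [:- (lam $ 3), 1:]"
    and "b = [:- (mu $ 1), 1:] * [:- (mu $ 2), 1:] * [:- (mu $ 3), 1:]"
    and "\<And>i j. i \<noteq> j \<Longrightarrow> lam $ i - lam $ j \<notin> \<int>"
    and "\<And>i j. i \<noteq> j \<Longrightarrow> mu $ i - mu $ j \<notin> \<int>"
    and "morita_equivalent TYPE('u) (gwa a) (gwa b)"
  shows "algebra_isomorphic (quantum_torus (root_matrix lam)) (quantum_torus (root_matrix mu))"
proof -
  have a: "a = root_poly (\<lambda>i. lam $ i)" and b: "b = root_poly (\<lambda>i. mu $ i)"
    unfolding assms(1,2) root_poly_def UNIV_3 by (simp_all add: mult.assoc del: mult_pCons_left mult_pCons_right)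
  have inj: "inj (\<lambda>i. lam $ i)" "inj (\<lambda>i. mu $ i)"
    using assms(3,4) by (auto intro!: injI) (metis Ints_0 diff_self)+
  obtain n k u v corner where "morita_matrices a b n k u v corner"
    using morita_equivalent_matrices[OF assms(5)] root_poly_nonzero a b by metis
  then interpret morita_matrices a b n k u v corner .
  obtain g :: "(3 \<Rightarrow> complex) \<Rightarrow> 3 \<Rightarrow> complex" where g:
    "\<And>c. (\<Sum>i\<in>UNIV. c i) = 0 \<Longrightarrow> (\<Sum>i\<in>UNIV. g c i) = 0"
    "\<And>c d s t. (\<Sum>i\<in>UNIV. c i) = 0 \<Longrightarrow> (\<Sum>i\<in>UNIV. d i) = 0 \<Longrightarrow>
       g (\<lambda>i. s * c i + t * d i) = (\<lambda>i. s * g c i + t * g d i)"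
    "\<And>c i. (\<Sum>i\<in>UNIV. c i) = 0 \<Longrightarrow> (\<And>i. c i \<in> \<int>) \<Longrightarrow> g c i \<in> \<int>"
    "\<And>c. (\<Sum>i\<in>UNIV. c i) = 0 \<Longrightarrow> (\<And>i. c i \<in> \<int>) \<Longrightarrow>
       (\<Sum>i\<in>UNIV. g c i * mu $ i) - (\<Sum>i\<in>UNIV. c i * lam $ i) \<in> \<int>"
    "\<And>c i. (\<Sum>i\<in>UNIV. c i) = 0 \<Longrightarrow> (\<And>i. g c i \<in> \<int>) \<Longrightarrow> c i \<in> \<int>"
    using lattice_map[OF a b inj] by blast
  define z where "z i k = (if k = i then 1 else 0) - (if k = 3 then 1 else (0 :: complex))" for i k :: 3
  have zs: "(\<Sum>k\<in>UNIV. z i k) = 0" and zi: "z i k \<in> \<int>" for i k by (simp_all add: z_def sum_subtractf)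
  obtain P R :: "3 \<Rightarrow> 3 \<Rightarrow> int" where P: "\<And>i k. g (z i) k = of_int (P i k)" and R: "\<And>i. g (\<lambda>k. of_int (R i k)) = z i"
    and s: "\<And>i. (\<Sum>k\<in>UNIV. P i k) = 0" "\<And>i. (\<Sum>k\<in>UNIV. R i k) = 0" and 3: "\<And>k. P 3 k = 0" "\<And>k. R 3 k = 0"
    and PR: "\<And>i k. of_int (P i 1 * R 1 k + P i 2 * R 2 k) = z i k" and RP: "\<And>i k. of_int (R i 1 * P 1 k + R i 2 * P 2 k) = z i k"
  proof -
    have "\<exists>(P :: 3 \<Rightarrow> 3 \<Rightarrow> int) R :: 3 \<Rightarrow> 3 \<Rightarrow> int.
      (\<forall>i k. g (z i) k = of_int (P i k)) \<and> (\<forall>i. g (\<lambda>k. of_int (R i k)) = z i) \<and>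
      (\<forall>i. (\<Sum>k\<in>UNIV. P i k) = 0) \<and> (\<forall>i. (\<Sum>k\<in>UNIV. R i k) = 0) \<and> (\<forall>k. P 3 k = 0) \<and> (\<forall>k. R 3 k = 0) \<and>
      (\<forall>i k. of_int (P i 1 * R 1 k + P i 2 * R 2 k) = z i k) \<and> (\<forall>i k. of_int (R i 1 * P 1 k + R i 2 * P 2 k) = z i k)"
    proof (rule integral_inverse)
      show "z i k = (if k = i then 1 else 0) - (if k = 3 then 1 else 0)" for i k by (rule z_def)
      show "(\<Sum>i\<in>UNIV. g c i) = 0" if "(\<Sum>i\<in>UNIV. c i) = 0" for c by (rule g(1)[OF that])
      show "g (\<lambda>i. s * c i + t * d i) = (\<lambda>i. s * g c i + t * g d i)"
        if "(\<Sum>i\<in>UNIV. c i) = 0" "(\<Sum>i\<in>UNIV. d i) = 0" for c d s t by (rule g(2)[OF that])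
      show "g c i \<in> \<int>" if "(\<Sum>i\<in>UNIV. c i) = 0" "\<And>i. c i \<in> \<int>" for c i by (rule g(3)[OF that])
      show "c i \<in> \<int>" if "(\<Sum>i\<in>UNIV. c i) = 0" "\<And>i. g c i \<in> \<int>" for c i by (rule g(5)[OF that])
    qed
    then show ?thesis using that by (elim exE conjE) blast
  qed
  \<comment> \<open>The coordinate vector e_3. As e_i = z i + e_3, adding it to every row of
    \<open>P\<close> gives the images of the e_i under the extension of \<open>g\<close> that fixes
    e_3.\<close>
  define d where "d k = (if k = 3 then 1 else (0::int))" for k :: 3
  have zl: "(\<Sum>k\<in>UNIV. z i k * x $ k) = x $ i - x $ 3" for i and x :: "complex ^ 3"
    by (simp add: z_def left_diff_distrib sum_subtractf if_distrib[of "\<lambda>y. y * _"] cong: if_cong)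
  have dl: "(\<Sum>k\<in>UNIV. of_int (d k) * x $ k) = x $ 3" for x :: "complex ^ 3"
    by (simp add: d_def if_distrib[of of_int] if_distrib[of "\<lambda>y. y * _"] cong: if_cong)
  have ds: "(\<Sum>k\<in>UNIV. d k) = 1" by (simp add: d_def)
  have Pz: "(\<Sum>k\<in>UNIV. of_int (P i k) * mu $ k) - (lam $ i - lam $ 3) \<in> \<int>" for i
    using g(4)[OF zs zi, of i] by (simp add: P zl)
  have Rz: "(mu $ i - mu $ 3) - (\<Sum>k\<in>UNIV. of_int (R i k) * lam $ k) \<in> \<int>" for i
  proof -
    have "(\<Sum>k\<in>UNIV. of_int (R i k) :: complex) = 0" using s(2)[of i] by (simp flip: of_int_sum)
    from g(4)[OF this] show ?thesis by (simp add: R zl)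
  qed
  \<comment> \<open>\<open>z\<close> is the unit matrix with \<open>d\<close> subtracted from every
    row, so adding \<open>d\<close> restores the unit matrix.\<close>
  have id: "x + d k = (if i = k then 1 else 0)" if "of_int x = z i k" for x i k
  proof -
    have "(of_int (x + d k) :: complex) = of_int (if i = k then 1 else 0)" using that by (auto simp: z_def d_def)
    then show ?thesis by (simp only: of_int_eq_iff)
  qed
  show ?thesis
  proof (rule root_torus_isomorphic[of "\<lambda>i k. P i k + d k" "\<lambda>i k. R i k + d k"])
    fix i k j
    show "(\<Sum>k\<in>UNIV. P i k + d k) = 1" "(\<Sum>k\<in>UNIV. R i k + d k) = 1" by (simp_all add: sum.distrib s ds)
    \<comment> \<open>Row 3 of \<open>R\<close> is zero, so the terms P i 3 * R 3 k and d 3 * R 3 k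
      drop out; the row sum of \<open>P\<close> is zero too, and exactly \<open>d k\<close> remains
      to be added.\<close>
    have "(\<Sum>j\<in>UNIV. (P i j + d j) * (R j k + d k)) = (P i 1 * R 1 k + P i 2 * R 2 k) + d k * ((\<Sum>j\<in>UNIV. P i j) + 1)"
      by (simp add: sum_3 3 d_def algebra_simps)
    then show "(\<Sum>j\<in>UNIV. (P i j + d j) * (R j k + d k)) = (if i = k then 1 else 0)"
      using id[OF PR[of i k]] by (simp add: s)
    have "(\<Sum>j\<in>UNIV. (R i j + d j) * (P j k + d k)) = (R i 1 * P 1 k + R i 2 * P 2 k) + d k * ((\<Sum>j\<in>UNIV. R i j) + 1)"
      by (simp add: sum_3 3 d_def algebra_simps)
    then show "(\<Sum>j\<in>UNIV. (R i j + d j) * (P j k + d k)) = (if i = k then 1 else 0)"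
      using id[OF RP[of i k]] by (simp add: s)
    have e: "(\<Sum>k\<in>UNIV. of_int (Q i k + d k) * x $ k) = (\<Sum>k\<in>UNIV. of_int (Q i k) * x $ k) + x $ 3"
      for Q :: "3 \<Rightarrow> 3 \<Rightarrow> int" and x :: "complex ^ 3" and i
      by (simp add: distrib_right sum.distrib dl)
    show "(\<Sum>k\<in>UNIV. of_int (P i k + d k) * mu $ k) - (\<Sum>k\<in>UNIV. of_int (P j k + d k) * mu $ k) - (lam $ i - lam $ j) \<in> \<int>"
      using Ints_diff[OF Pz[of i] Pz[of j]] unfolding e by (simp add: algebra_simps)
    show "(\<Sum>k\<in>UNIV. of_int (R i k + d k) * lam $ k) - (\<Sum>k\<in>UNIV. of_int (R j k + d k) * lam $ k) - (mu $ i - mu $ j) \<in> \<int>"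
      using Ints_diff[OF Rz[of j] Rz[of i]] unfolding e by (simp add: algebra_simps)
  qed
qed

end
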